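(* In type $C_n$, let $\lambda$ be a partition with at most $n$ parts, $\Gamma$ the $\lambda$-chain described below, $J\in\mathcal A(\lambda)$ an admissible subset, and $b=\mathrm{sfill}(J)\in B^{\otimes\lambda}$. For $i\in\{0,1,\dots,n\}$: there is a dual Demazure arrow $b\to f_i(b)$ if and only if $f_i(J)\neq\mathbf 0$, and in that case $f_i(b)=\mathrm{sfill}(f_i(J))$.
   Context: General quantum alcove model. For an irreducible finite root system with inner product $\langle\cdot,\cdot\rangle$, positive roots $\Phi^+$, simple roots $\alpha_1,\dots,\alpha_r$, Weyl group $W$ (length $\ell$), highest root $\tilde\alpha$, $\rho=\frac12\sum_{\alpha\in\Phi^+}\alpha$, $\alpha^\vee=2\alpha/\langle\alpha,\alpha\rangle$, $\alpha_0:=\theta:=-\tilde\alpha$, $\mathrm{sgn}(\gamma)=\pm1$ according as $\gamma\in\Phi^+$ or not, $|\gamma|=\mathrm{sgn}(\gamma)\gamma$. Quantum Bruhat graph: edges $w\to ws_\beta$ ($\beta\in\Phi^+$) when $\ell(ws_\beta)=\ell(w)+1$ or $\ell(ws_\beta)=\ell(w)-2\langle\rho,\beta^\vee\rangle+1$. For a $\lambda$-chain $(\beta_1,\dots,\beta_m)$: $r_i=s_{\beta_i}$, $l_i=\#\{j<i:\beta_j=\beta_i\}$, $\hat r_i=s_{\beta_i,-l_i}$ (affine reflection in $H_{\beta_i,-l_i}=\{x:\langle x,\beta_i^\vee\rangle=-l_i\}$). For $J=\{j_1<\dots<j_s\}\subseteq[m]$: $\gamma_k=r_{j_1}\cdots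 r_{j_p}(\beta_k)$ ($j_p$ the largest element of $J$ below $k$), $\gamma_\infty=r_{j_1}\cdots r_{j_s}(\rho)$, $l^\Delta_k$ defined by $H_{|\gamma_k|,-l^\Delta_k}=\hat r_{j_1}\cdots\hat r_{j_p}(H_{\beta_k,-l_k})$, $\mu(J)=-\hat r_{j_1}\cdots\hat r_{j_s}(-\lambda)$, $\varepsilon_k=1$ if $k\notin J$, $-1$ if $k\in J$. $J$ is admissible if $1\xrightarrow{\beta_{j_1}}r_{j_1}\to r_{j_1}r_{j_2}\to\cdots\to r_{j_1}\cdots r_{j_s}$ is a path in the quantum Bruhat graph; $\mathcal A(\lambda)$ is the set of admissible subsets. For a root $\alpha$: $I_\alpha=\{i:\gamma_i=\pm\alpha\}=\{i_1<\dots<i_n\}$, $\hat I_\alpha=I_\alpha\cup\{\infty\}$, $l^\Delta_\infty:=\langle\mu(J),\mathrm{sgn}(\alpha)\alpha^\vee\rangle$; for $\alpha>0$, $g_\alpha$ on $[0,n+\frac12]$ is continuous piecewise-linear, $g_\alpha(0)=-\frac12$, slope $\mathrm{sgn}(\gamma_{i_k})$ on $(k-1,k-\frac12)$, $\varepsilon_{i_k}\mathrm{sgn}(\gamma_{i_k})$ on $(k-\frac12,k)$, $\mathrm{sgn}\langle\gamma_\infty,\alpha^\vee\rangle$ on $(n,n+\frac12)$; $g_\alpha=-g_{-\alpha}$ for $\alpha<0$ (known: $\mathrm{sgn}(\alpha)l^\Delta_{i_k}=g_\alpha(k-\frac12)$). Crystal operator on admissible $J$: $M=\max g_{\alpha_p}$;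 $m$ the minimal $i\in\hat I_{\alpha_p}$ with $\mathrm{sgn}(\alpha_p)l^\Delta_i=M$; if $M>\delta_{p,0}$, $m$ has a predecessor $k$ in $\hat I_{\alpha_p}$ and $f_p(J)=(J\setminus\{m\})\cup\{k\}$ (with $J\setminus\{\infty\}=J\cup\{\infty\}=J$); otherwise $f_p(J)=\mathbf 0$. Type $C_n$: $V=\mathbb R^n$ with basis $\varepsilon_i$, roots $\pm\varepsilon_i\pm\varepsilon_j$ ($i<j$) and $\pm2\varepsilon_i$; simple roots $\alpha_i=\varepsilon_i-\varepsilon_{i+1}$ ($i<n$), $\alpha_n=2\varepsilon_n$; $\theta=-2\varepsilon_1$. $W$ is the group of signed permutations of $[\bar n]=\{1<\dots<n<\bar n<\dots<\bar1\}$ ($w(\bar\imath)=\overline{w(i)}$). Notation: $(i,j)=\varepsilon_i-\varepsilon_j$ with reflection $t_{ij}t_{\bar\jmath\bar\imath}$; $(i,\bar\jmath)=\varepsilon_i+\varepsilon_j$ ($i<j$) with reflection $t_{i\bar\jmath}t_{j\bar\imath}$; $(i,\bar\imath)=2\varepsilon_i$ with reflection $t_{i\bar\imath}$. For $1\le k\le n$: $\Gamma_i=((i,\overline{i-1}),(i,\overline{i-2}),\dots,(i,\bar1))$; $\Gamma_{ki}=((i,k+1),\dots,(i,n),(i,\bar\imath),(i,\bar n),(i,\overline{n-1}),\dots,(i,\overline{k+1}),(i,\overline{i-1}),\dots,(i,\bar1))$; $\Gamma_l(k)=\Gamma_{kk}\Gamma_{k,k-1}\cdots\Gamma_{k1}$,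 $\Gamma_r(k)=\Gamma_k\Gamma_{k-1}\cdots\Gamma_2$, $\Gamma(k)=\Gamma_l(k)\Gamma_r(k)$. With $\lambda$ a partition with at most $n$ parts and $\lambda'$ its conjugate, $\Gamma=\Gamma(\lambda'_1)\cdots\Gamma(\lambda'_{\lambda_1})$, factored into $2\lambda_1$ blocks $\Gamma_l(\lambda'_1),\Gamma_r(\lambda'_1),\Gamma_l(\lambda'_2),\dots$. For $J\subseteq[m]$, $T^q$ is the sequence of $\beta_j$, $j\in J$, in block $q$, $\pi_q$ the left-to-right product of the reflections in $T^1,\dots,T^q$ (a signed permutation), $C_q$ the column $\pi_q(1),\dots,\pi_q(\lambda'_{\lceil q/2\rceil})$, and $\mathrm{sfill}(J)$ is $C_1\cdots C_{2\lambda_1}$ with each column sorted increasingly in the order of $[\bar n]$. KN columns: a strictly increasing column $x_1<\dots<x_r$ in $[\bar n]$ is KN if there is no $z\in[n]$ with $z=x_p$, $\bar z=x_q$, $q-p\le r-z$. Split: if $I=\{z_1>\dots>z_k\}$ are the $z\in[n]$ with both $z,\bar z$ in $C$, let $t_1$ be the largest element of $[n]$ with $t_1<z_1$ and $t_1,\bar t_1\notin C$, and recursively $t_i$ the largest with $t_i<\min(t_{i-1},z_i)$ and $t_i,\bar t_i\notin C$; $lC$ (resp. $rC$) is obtained from $C$ by replacing each $z_i$ by $t_i$ (resp. each $\bar z_i$ by $\bar t_i$) and sorting. (A column is KN iff such $t_i$ exist.) $B^{\otimes\lambda}=B^{\lambda'_1,1}\otimes\cdots\otimes B^{\lambda'_{\lambda_1},1}$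 is the set of tuples $(K_1,\dots,K_{\lambda_1})$ of KN columns of heights $\lambda'_1,\dots,\lambda'_{\lambda_1}$; it is known that for $J\in\mathcal A(\lambda)$ each pair $(C_{2q-1},C_{2q})$ of columns of $\mathrm{sfill}(J)$ equals $(lK_q,rK_q)$ for a unique KN column $K_q$, and this identifies $\mathrm{sfill}$ with a bijection $\mathcal A(\lambda)\to B^{\otimes\lambda}$. Crystal operators on $b\in B^{\otimes\lambda}$: form the reading word (each column bottom to top, columns left to right); for $1\le i\le n-1$ encode $i,\overline{i+1}$ as $+$ and $i+1,\bar\imath$ as $-$; for $i=n$ encode $n$ as $+$, $\bar n$ as $-$; for $i=0$ encode $\bar1$ as $+$, $1$ as $-$; ignore other letters; cancel adjacent $-+$ pairs repeatedly to get $+^x-^y$. If $x>0$, $f_i(b)$ changes the letter of the rightmost remaining $+$ to the corresponding $-$ letter ($i\mapsto i+1$, $\overline{i+1}\mapsto\bar\imath$; $n\mapsto\bar n$ for $i=n$; $\bar1\mapsto1$ for $i=0$), re-sorting if needed; if $x=0$, $f_i(b)=\mathbf 0$. $\varphi_i(b)=x$. An arrow $b\to f_i(b)\neq\mathbf 0$ is dual Demazure if $i\neq0$ or $\varphi_0(b)\ge2$. *)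

theory Defs
  imports Complex_Main
begin

section \<open>The root system of type C\<close>

text \<open>
  The ambient space V is R^n. A vector is a function giving the coordinates 1, ..., n; it vanishes at
  all other indices. A letter of [n-bar] is a nonzero integer x with |x| at most n, where the barred
  letter of i is the integer -i. Putting e(-i) = - e(i), the root written (a,b) in the type C
  notation is e(a) - e(b) for all four kinds of pairs (i,j), (i,j-bar), (i,i-bar).
\<close>

type_synonym rvec = "nat \<Rightarrow> real"

definition space :: "nat \<Rightarrow> rvec set" where
  "space n = {x. \<forall>k. k \<notin> {1..n} \<longrightarrow> x k = 0}"

definition vadd :: "rvec \<Rightarrow> rvec \<Rightarrow> rvec" where
  "vadd x y = (\<lambda>k. x k + y k)"

definition vscale :: "real \<Rightarrow> rvec \<Rightarrow> rvec" where
  "vscale c x = (\<lambda>k. c * x k)"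

definition ip :: "nat \<Rightarrow> rvec \<Rightarrow> rvec \<Rightarrow> real" where
  "ip n x y = (\<Sum>k=1..n. x k * y k)"

definition eps :: "int \<Rightarrow> rvec" where
  "eps a = (\<lambda>k. if k = nat \<bar>a\<bar> then of_int (sgn a) else 0)"

definition root :: "int \<times> int \<Rightarrow> rvec" where
  "root ab = vadd (eps (fst ab)) (vscale (-1) (eps (snd ab)))"

definition pos_roots :: "nat \<Rightarrow> rvec set" where
  "pos_roots n =
     {root (i, j) | i j. 1 \<le> i \<and> i < j \<and> j \<le> int n}
   \<union> {root (i, - j) | i j. 1 \<le> i \<and> i < j \<and> j \<le> int n}
   \<union> {root (i, - i) | i. 1 \<le> i \<and> i \<le> int n}"

text \<open>The value at 0 is minus the highest root.\<close>

definition simple_root :: "nat \<Rightarrow> nat \<Rightarrow> rvec" where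
  "simple_root n p =
     (if p = 0 then vscale (-2) (eps 1)
      else if p < n then root (int p, int p + 1)
      else vscale 2 (eps (int n)))"

definition rho :: "nat \<Rightarrow> rvec" where
  "rho n = (\<lambda>k. (\<Sum>\<alpha>\<in>pos_roots n. \<alpha> k) / 2)"

definition coroot :: "nat \<Rightarrow> rvec \<Rightarrow> rvec" where
  "coroot n \<alpha> = vscale (2 / ip n \<alpha> \<alpha>) \<alpha>"

definition rsgn :: "nat \<Rightarrow> rvec \<Rightarrow> real" where
  "rsgn n \<gamma> = (if \<gamma> \<in> pos_roots n then 1 else -1)"

definition rabs :: "nat \<Rightarrow> rvec \<Rightarrow> rvec" where
  "rabs n \<gamma> = vscale (rsgn n \<gamma>) \<gamma>"

definition hyperplane :: "nat \<Rightarrow> rvec \<Rightarrow> real \<Rightarrow> rvec set" where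
  "hyperplane n \<beta> l = {x \<in> space n. ip n x (coroot n \<beta>) = l}"

text \<open>The reflection in \<open>hyperplane n \<beta> l\<close>.\<close>

definition aff_reflection :: "nat \<Rightarrow> rvec \<Rightarrow> real \<Rightarrow> rvec \<Rightarrow> rvec" where
  "aff_reflection n \<beta> l x = vadd x (vscale (- (ip n x (coroot n \<beta>) - l)) \<beta>)"

definition reflection :: "nat \<Rightarrow> rvec \<Rightarrow> rvec \<Rightarrow> rvec" where
  "reflection n \<beta> = aff_reflection n \<beta> 0"

text \<open>Products in the (affine) Weyl group are compositions of maps, so the last factor acts first.\<close>

definition compose_list :: "('a \<Rightarrow> 'a) list \<Rightarrow> 'a \<Rightarrow> 'a" where
  "compose_list fs = foldr (\<circ>) fs id"

definition weyl_length :: "nat \<Rightarrow> (rvec \<Rightarrow> rvec) \<Rightarrow> nat" where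
  "weyl_length n w = (LEAST k. \<exists>ps. length ps = k \<and> set ps \<subseteq> {1..n} \<and>
     w = compose_list (map (\<lambda>p. reflection n (simple_root n p)) ps))"

definition qbg_edge :: "nat \<Rightarrow> (rvec \<Rightarrow> rvec) \<Rightarrow> rvec \<Rightarrow> bool" where
  "qbg_edge n w \<beta> \<longleftrightarrow> \<beta> \<in> pos_roots n \<and>
     (real (weyl_length n (w \<circ> reflection n \<beta>)) = real (weyl_length n w) + 1 \<or>
      real (weyl_length n (w \<circ> reflection n \<beta>))
        = real (weyl_length n w) - 2 * ip n (rho n) (coroot n \<beta>) + 1)"


section \<open>Partitions and the chain of roots\<close>

definition is_partition :: "nat list \<Rightarrow> bool" where
  "is_partition lam \<longleftrightarrow> sorted_wrt (\<ge>) lam \<and> 0 \<notin> set lam"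

definition first_part :: "nat list \<Rightarrow> nat" where
  "first_part lam = (if lam = [] then 0 else hd lam)"

definition conj_part :: "nat list \<Rightarrow> nat \<Rightarrow> nat" where
  "conj_part lam j = length (filter (\<lambda>p. j \<le> p) lam)"

definition partition_vec :: "nat list \<Rightarrow> rvec" where
  "partition_vec lam = (\<lambda>k. if 1 \<le> k \<and> k \<le> length lam then real (lam ! (k - 1)) else 0)"

definition Gamma_i :: "int \<Rightarrow> (int \<times> int) list" where
  "Gamma_i i = map (\<lambda>j. (i, - j)) (rev [1..i-1])"

definition Gamma_ki :: "nat \<Rightarrow> int \<Rightarrow> int \<Rightarrow> (int \<times> int) list" where
  "Gamma_ki n k i =
     map (\<lambda>j. (i, j)) [k+1..int n] @ [(i, - i)] @
     map (\<lambda>j. (i, - j)) (rev [k+1..int n]) @ map (\<lambda>j. (i, - j)) (rev [1..i-1])"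

definition Gamma_l :: "nat \<Rightarrow> nat \<Rightarrow> (int \<times> int) list" where
  "Gamma_l n k = concat (map (Gamma_ki n (int k)) (rev [1..int k]))"

definition Gamma_r :: "nat \<Rightarrow> (int \<times> int) list" where
  "Gamma_r k = concat (map Gamma_i (rev [2..int k]))"

definition blocks :: "nat \<Rightarrow> nat list \<Rightarrow> (int \<times> int) list list" where
  "blocks n lam =
     concat (map (\<lambda>j. [Gamma_l n (conj_part lam j), Gamma_r (conj_part lam j)])
                 [1..<Suc (first_part lam)])"

definition chain :: "nat \<Rightarrow> nat list \<Rightarrow> (int \<times> int) list" where
  "chain n lam = concat (blocks n lam)"


section \<open>The quantum alcove model\<close>

text \<open>
  Positions in the chain are numbered from 0, so the subsets J are subsets of
  \<open>{..<chain_length n lam}\<close>, and the symbol \<open>\<infinity>\<close>, which is larger than all positions, is encoded as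
  \<open>chain_length n lam\<close>.
\<close>

definition chain_length :: "nat \<Rightarrow> nat list \<Rightarrow> nat" where
  "chain_length n lam = length (chain n lam)"

definition chain_root :: "nat \<Rightarrow> nat list \<Rightarrow> nat \<Rightarrow> rvec" where
  "chain_root n lam i = root (chain n lam ! i)"

text \<open>
  Roots are compared as vectors here: the pairs (i, j-bar) and (j, i-bar) denote the same root, and
  both can occur in the chain (in the parts for different column heights).
\<close>

definition chain_level :: "nat \<Rightarrow> nat list \<Rightarrow> nat \<Rightarrow> nat" where
  "chain_level n lam i = card {j. j < i \<and> chain_root n lam j = chain_root n lam i}"

text \<open>The products over the elements of J below k, in increasing order.\<close>

definition prefix_prod :: "nat \<Rightarrow> nat list \<Rightarrow> nat set \<Rightarrow> nat \<Rightarrow> rvec \<Rightarrow> rvec" where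
  "prefix_prod n lam J k =
     compose_list (map (\<lambda>j. reflection n (chain_root n lam j)) (sorted_list_of_set {j \<in> J. j < k}))"

definition aff_prefix_prod :: "nat \<Rightarrow> nat list \<Rightarrow> nat set \<Rightarrow> nat \<Rightarrow> rvec \<Rightarrow> rvec" where
  "aff_prefix_prod n lam J k =
     compose_list (map (\<lambda>j. aff_reflection n (chain_root n lam j) (- real (chain_level n lam j)))
                       (sorted_list_of_set {j \<in> J. j < k}))"

definition admissible :: "nat \<Rightarrow> nat list \<Rightarrow> nat set \<Rightarrow> bool" where
  "admissible n lam J \<longleftrightarrow> J \<subseteq> {..<chain_length n lam} \<and>
     (\<forall>j\<in>J. qbg_edge n (prefix_prod n lam J j) (chain_root n lam j))"

definition gam :: "nat \<Rightarrow> nat list \<Rightarrow> nat set \<Rightarrow> nat \<Rightarrow> rvec" where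
  "gam n lam J k = prefix_prod n lam J k (chain_root n lam k)"

definition gam_inf :: "nat \<Rightarrow> nat list \<Rightarrow> nat set \<Rightarrow> rvec" where
  "gam_inf n lam J = prefix_prod n lam J (chain_length n lam) (rho n)"

definition mu :: "nat \<Rightarrow> nat list \<Rightarrow> nat set \<Rightarrow> rvec" where
  "mu n lam J =
     vscale (-1) (aff_prefix_prod n lam J (chain_length n lam) (vscale (-1) (partition_vec lam)))"

text \<open>The level at \<open>\<infinity>\<close> depends on the root \<open>\<alpha>\<close>; the other levels do not.\<close>

definition level :: "nat \<Rightarrow> nat list \<Rightarrow> nat set \<Rightarrow> rvec \<Rightarrow> nat \<Rightarrow> real" where
  "level n lam J \<alpha> k =
     (if k = chain_length n lam
      then ip n (mu n lam J) (vscale (rsgn n \<alpha>) (coroot n \<alpha>))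
      else (THE l. hyperplane n (rabs n (gam n lam J k)) (- l)
              = aff_prefix_prod n lam J k `
                  hyperplane n (chain_root n lam k) (- real (chain_level n lam k))))"

definition I_set :: "nat \<Rightarrow> nat list \<Rightarrow> nat set \<Rightarrow> rvec \<Rightarrow> nat set" where
  "I_set n lam J \<alpha> = {i. i < chain_length n lam \<and>
     (gam n lam J i = \<alpha> \<or> gam n lam J i = vscale (-1) \<alpha>)}"

definition I_hat :: "nat \<Rightarrow> nat list \<Rightarrow> nat set \<Rightarrow> rvec \<Rightarrow> nat set" where
  "I_hat n lam J \<alpha> = insert (chain_length n lam) (I_set n lam J \<alpha>)"

text \<open>The continuous function with slope 1 on (0,1/2) that is constant elsewhere and 0 at 0.\<close>

definition ramp :: "real \<Rightarrow> real" where
  "ramp x = max 0 (min x (1/2))"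

text \<open>
  The function g for a positive root. The list \<open>is\<close> is indexed from 0, so its entry k governs the
  slopes on (k,k+1/2) and (k+1/2,k+1).
\<close>

definition g_pos :: "nat \<Rightarrow> nat list \<Rightarrow> nat set \<Rightarrow> rvec \<Rightarrow> real \<Rightarrow> real" where
  "g_pos n lam J \<alpha> x =
     (let is = sorted_list_of_set (I_set n lam J \<alpha>) in
        - 1/2
        + (\<Sum>k<length is. rsgn n (gam n lam J (is ! k)) *
             (ramp (x - real k) + (if is ! k \<in> J then -1 else 1) * ramp (x - (real k + 1/2))))
        + sgn (ip n (gam_inf n lam J) (coroot n \<alpha>)) * ramp (x - real (length is)))"

definition g_fun :: "nat \<Rightarrow> nat list \<Rightarrow> nat set \<Rightarrow> rvec \<Rightarrow> real \<Rightarrow> real" where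
  "g_fun n lam J \<alpha> x =
     (if \<alpha> \<in> pos_roots n then g_pos n lam J \<alpha> x else - g_pos n lam J (vscale (-1) \<alpha>) x)"

definition g_max :: "nat \<Rightarrow> nat list \<Rightarrow> nat set \<Rightarrow> rvec \<Rightarrow> real" where
  "g_max n lam J \<alpha> = Sup (g_fun n lam J \<alpha> ` {0..real (card (I_set n lam J \<alpha>)) + 1/2})"

definition alcove_f :: "nat \<Rightarrow> nat list \<Rightarrow> nat \<Rightarrow> nat set \<Rightarrow> nat set option" where
  "alcove_f n lam p J =
     (let \<alpha> = simple_root n p;
          M = g_max n lam J \<alpha>;
          m = Min {i \<in> I_hat n lam J \<alpha>. rsgn n \<alpha> * level n lam J \<alpha> i = M};
          k = Max {i \<in> I_hat n lam J \<alpha>. i < m}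
      in if M > (if p = 0 then 1 else 0) then Some ((J - {m}) \<union> {k}) else None)"


section \<open>Kashiwara-Nakashima columns and the filling map\<close>

text \<open>Columns are lists read from top to bottom. The position of a letter in 1 < ... < n < n-bar <
  ... < 1-bar gives the order on [n-bar].\<close>

definition letter_pos :: "nat \<Rightarrow> int \<Rightarrow> int" where
  "letter_pos n x = (if 0 < x then x else 2 * int n + 1 + x)"

definition sort_column :: "nat \<Rightarrow> int list \<Rightarrow> int list" where
  "sort_column n = sort_key (letter_pos n)"

definition is_column :: "nat \<Rightarrow> int list \<Rightarrow> bool" where
  "is_column n C \<longleftrightarrow> (\<forall>x\<in>set C. x \<noteq> 0 \<and> \<bar>x\<bar> \<le> int n) \<and>
     sorted_wrt (\<lambda>x y. letter_pos n x < letter_pos n y) C"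

definition KN_column :: "nat \<Rightarrow> int list \<Rightarrow> bool" where
  "KN_column n C \<longleftrightarrow> is_column n C \<and>
     \<not> (\<exists>z p q. 1 \<le> z \<and> z \<le> int n \<and> p < length C \<and> q < length C \<and>
          C ! p = z \<and> C ! q = - z \<and> int q - int p \<le> int (length C) - z)"

text \<open>\<open>split_ts b C zs\<close> lists the letters t for the z in \<open>zs\<close>, where b is a strict upper bound for
  the first of them.\<close>

fun split_ts :: "int \<Rightarrow> int set \<Rightarrow> int list \<Rightarrow> int list" where
  "split_ts b C [] = []"
| "split_ts b C (z # zs) =
     (let t = Max {t. 1 \<le> t \<and> t < min b z \<and> t \<notin> C \<and> - t \<notin> C} in t # split_ts t C zs)"

definition split_map :: "nat \<Rightarrow> int list \<Rightarrow> (int \<times> int) list" where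
  "split_map n C =
     (let zs = filter (\<lambda>z. z \<in> set C \<and> - z \<in> set C) (rev [1..int n])
      in zip zs (split_ts (int n + 1) (set C) zs))"

definition left_column :: "nat \<Rightarrow> int list \<Rightarrow> int list" where
  "left_column n C = sort_column n
     (map (\<lambda>x. case map_of (split_map n C) x of Some t \<Rightarrow> t | None \<Rightarrow> x) C)"

definition right_column :: "nat \<Rightarrow> int list \<Rightarrow> int list" where
  "right_column n C = sort_column n
     (map (\<lambda>x. case map_of (split_map n C) (- x) of Some t \<Rightarrow> - t | None \<Rightarrow> x) C)"

definition KN_tensor :: "nat \<Rightarrow> nat list \<Rightarrow> int list list set" where
  "KN_tensor n lam = {b. length b = first_part lam \<and>
     (\<forall>q<first_part lam. KN_column n (b ! q) \<and> length (b ! q) = conj_part lam (q + 1))}"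

definition split_tensor :: "nat \<Rightarrow> int list list \<Rightarrow> int list list" where
  "split_tensor n b = concat (map (\<lambda>C. [left_column n C, right_column n C]) b)"

definition swap_letters :: "int \<Rightarrow> int \<Rightarrow> int \<Rightarrow> int" where
  "swap_letters a b x = (if x = a then b else if x = b then a else x)"

definition signed_reflection :: "int \<times> int \<Rightarrow> int \<Rightarrow> int" where
  "signed_reflection ab =
     (case ab of (a, b) \<Rightarrow>
        if b = - a then swap_letters a b else swap_letters a b \<circ> swap_letters (- b) (- a))"

text \<open>The sequence \<open>T^q\<close> for the block number q, counted from 1.\<close>

definition T_seq :: "nat \<Rightarrow> nat list \<Rightarrow> nat set \<Rightarrow> nat \<Rightarrow> (int \<times> int) list" where
  "T_seq n lam J q =
     nths (blocks n lam ! (q - 1)) {i. length (concat (take (q - 1) (blocks n lam))) + i \<in> J}"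

definition signed_perm :: "nat \<Rightarrow> nat list \<Rightarrow> nat set \<Rightarrow> nat \<Rightarrow> int \<Rightarrow> int" where
  "signed_perm n lam J q =
     compose_list (map signed_reflection (concat (map (T_seq n lam J) [1..<Suc q])))"

definition sfill_columns :: "nat \<Rightarrow> nat list \<Rightarrow> nat set \<Rightarrow> int list list" where
  "sfill_columns n lam J =
     map (\<lambda>q. sort_column n
            (map (signed_perm n lam J q) [1..int (conj_part lam ((q + 1) div 2))]))
         [1..<Suc (2 * first_part lam)]"

text \<open>The filling viewed as an element of the tensor product, through the splitting of columns.\<close>

definition sfill :: "nat \<Rightarrow> nat list \<Rightarrow> nat set \<Rightarrow> int list list" where
  "sfill n lam J = (THE b. b \<in> KN_tensor n lam \<and> split_tensor n b = sfill_columns n lam J)"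


section \<open>Crystal operators on tensor products of columns\<close>

definition plus_letter :: "nat \<Rightarrow> nat \<Rightarrow> int \<Rightarrow> bool" where
  "plus_letter n i x \<longleftrightarrow>
     (if i = 0 then x = -1
      else if i = n then x = int n
      else x = int i \<or> x = - (int i + 1))"

definition minus_letter :: "nat \<Rightarrow> nat \<Rightarrow> int \<Rightarrow> bool" where
  "minus_letter n i x \<longleftrightarrow>
     (if i = 0 then x = 1
      else if i = n then x = - int n
      else x = int i + 1 \<or> x = - int i)"

definition lower_letter :: "nat \<Rightarrow> nat \<Rightarrow> int \<Rightarrow> int" where
  "lower_letter n i x =
     (if i = 0 then 1
      else if i = n then - int n
      else if x = int i then int i + 1 else - int i)"

text \<open>The cells (column, row) of b in reading order, both indices counted from 0.\<close>

definition reading_cells :: "int list list \<Rightarrow> (nat \<times> nat) list" where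
  "reading_cells b =
     concat (map (\<lambda>q. map (\<lambda>p. (q, p)) (rev [0..<length (b ! q)])) [0..<length b])"

text \<open>Signs are marked with their cells; \<open>True\<close> stands for plus and \<open>False\<close> for minus.\<close>

definition signature :: "nat \<Rightarrow> nat \<Rightarrow> int list list \<Rightarrow> (bool \<times> nat \<times> nat) list" where
  "signature n i b =
     map (\<lambda>(q, p). (plus_letter n i (b ! q ! p), (q, p)))
       (filter (\<lambda>(q, p). plus_letter n i (b ! q ! p) \<or> minus_letter n i (b ! q ! p))
          (reading_cells b))"

text \<open>Deletes the first adjacent pair consisting of a minus and a plus, if there is one.\<close>

fun cancel_pair :: "(bool \<times> 'a) list \<Rightarrow> (bool \<times> 'a) list" where
  "cancel_pair ((False, x) # (True, y) # w) = w"
| "cancel_pair (s # w) = s # cancel_pair w"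
| "cancel_pair [] = []"

definition cancel_pairs :: "(bool \<times> 'a) list \<Rightarrow> (bool \<times> 'a) list" where
  "cancel_pairs w = (cancel_pair ^^ length w) w"

definition plus_cells :: "nat \<Rightarrow> nat \<Rightarrow> int list list \<Rightarrow> (nat \<times> nat) list" where
  "plus_cells n i b = map snd (filter fst (cancel_pairs (signature n i b)))"

definition crystal_phi :: "nat \<Rightarrow> nat \<Rightarrow> int list list \<Rightarrow> nat" where
  "crystal_phi n i b = length (plus_cells n i b)"

definition crystal_f :: "nat \<Rightarrow> nat \<Rightarrow> int list list \<Rightarrow> int list list option" where
  "crystal_f n i b =
     (if plus_cells n i b = [] then None
      else case last (plus_cells n i b) of (q, p) \<Rightarrow>
        Some (b[q := sort_column n ((b ! q)[p := lower_letter n i (b ! q ! p)])]))"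

definition dual_demazure_arrow :: "nat \<Rightarrow> nat \<Rightarrow> int list list \<Rightarrow> bool" where
  "dual_demazure_arrow n i b \<longleftrightarrow>
     crystal_f n i b \<noteq> None \<and> (i \<noteq> 0 \<or> crystal_phi n 0 b \<ge> 2)"

end

theory Submission
  imports Defs
begin

text \<open>
  Let c be a column of the chain and \<open>\<pi>\<^sub>c\<close> the product of the folded reflections up to the end of c.
  The values of g at the ends of the columns are the partial sums of the pairings of
  \<open>\<pi>\<^sub>c(\<epsilon>\<^sub>1 + \<dots> + \<epsilon>\<^sub>k) / 2\<close> with the coroot of the simple root, hence at the ends of the blocks they are
  partial sums of the signature. Inside a part of the chain all occurrences of plus or minus the
  simple root have the same level. As the path of J in the quantum Bruhat graph
  can change the sign of the pulled back simple root only by an edge labelled with it, or in the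
  right half of a block by an edge that is excluded there, the maximum of g is attained just as the
  signature prescribes, and f replaces \<open>\<pi>\<^sub>c\<close> by \<open>s\<^sub>p \<pi>\<^sub>c\<close> exactly between the folding added and the
  one removed. This applies the simple reflection to both halves of the split column, or to one of
  them, which is what the crystal operator on KN columns does: a pair of columns (A, B) is a
  splitting if and only if its letters have the same absolute values and, for every \<open>v \<ge> 0\<close>, at most
  as many letters of A as of B exceed v, with equality if v is not an absolute value; the column
  then consists of the positive letters of B and the negative ones of A.
\<close>

section \<open>Letters and roots of type C\<close>

text \<open>In a block of height k a positive root \<beta> occurs as often as the pairing of omega_k
  with the coroot of \<beta> says: never, once, or twice, the second time in the right half. Each
  half therefore carries the weight omega_k/2, which explains the halves in all weights below and
  makes the level in a half a pairing with one vector. The obstacle is the right half, which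
  contains only the roots of pairing 2; there the sign of the pulled back simple root is replaced by
  a potential that vanishes on the roots of pairing 1 and -1. The sign is controlled only in the
  direction from plus to minus, so maxima are located by looking at the earliest position with a
  given value. The threshold 1 or 0 comes from the start of g, at 1/2 for p = 0 and at -1/2
  otherwise: a maximum without an earlier hit cannot exceed it. Nothing is taken for granted about
  the filling. For an admissible J the splitting criterion is checked fold by fold along the right
  half. For the set produced by f it follows from the computation on a single column, and so does
  not rest on the admissibility of that set.\<close>

definition letter :: "nat \<Rightarrow> int \<Rightarrow> bool" where
  "letter n a \<longleftrightarrow> a \<noteq> 0 \<and> \<bar>a\<bar> \<le> int n"

text \<open>The odd extension of the coordinates to all letters. With it the root (a,b) pairs with x
  to \<open>coord x a - coord x b\<close> for all four kinds of pairs, and no case distinction on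
  bars is needed.\<close>

definition coord :: "rvec \<Rightarrow> int \<Rightarrow> real" where
  "coord x a = of_int (sgn a) * x (nat \<bar>a\<bar>)"

lemma letter_nonzero: "letter n a \<Longrightarrow> a \<noteq> 0"
  and letter_neg [simp]: "letter n (- a) \<longleftrightarrow> letter n a"
  by (auto simp: letter_def)

lemma coord_neg [simp]: "coord x (- a) = - coord x a"
  and coord_zero [simp]: "coord x 0 = 0"
  and coord_vadd [simp]: "coord (vadd x y) a = coord x a + coord y a"
  and coord_vscale [simp]: "coord (vscale c x) a = c * coord x a"
  by (simp_all add: coord_def vadd_def vscale_def sgn_minus algebra_simps)

lemma coord_nat: "0 < k \<Longrightarrow> coord x (int k) = x k"
  by (simp add: coord_def)

lemma coord_eps: "a \<noteq> 0 \<Longrightarrow> b \<noteq> 0 \<Longrightarrow>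
    coord (eps a) b = (if b = a then 1 else if b = - a then - 1 else 0)"
  by (auto simp: coord_def eps_def sgn_if nat_eq_iff)

lemma root_eq_eps: "root (a, b) = vadd (eps a) (vscale (- 1) (eps b))"
  by (simp add: root_def)

lemma coord_root: "coord (root (a, b)) c = coord (eps a) c - coord (eps b) c"
  by (simp add: root_eq_eps)

text \<open>Vectors are functions on all naturals, and \<open>coord\<close> is 0 at the index 0, so
  the value there has to be compared separately.\<close>

lemma vec_eqI:
  assumes "x 0 = y 0" "\<And>k. 0 < k \<Longrightarrow> coord x (int k) = coord y (int k)"
  shows "x = (y :: rvec)"
proof
  fix k show "x k = y k" using assms by (cases "k = 0") (auto simp: coord_nat)
qed

lemma eps_at_0 [simp]: "a \<noteq> 0 \<Longrightarrow> eps a 0 = 0"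
  by (simp add: eps_def)

lemma root_at_0 [simp]: "a \<noteq> 0 \<Longrightarrow> b \<noteq> 0 \<Longrightarrow> root (a, b) 0 = 0"
  by (simp add: root_eq_eps vadd_def vscale_def)

lemma ip_vadd_right: "ip n x (vadd y z) = ip n x y + ip n x z"
  and ip_vadd_left: "ip n (vadd x y) z = ip n x z + ip n y z"
  and ip_vscale_right: "ip n x (vscale c y) = c * ip n x y"
  and ip_vscale_left: "ip n (vscale c x) y = c * ip n x y"
  by (simp_all add: ip_def vadd_def vscale_def algebra_simps sum.distrib sum_distrib_left)

lemma ip_eps: "letter n a \<Longrightarrow> ip n x (eps a) = coord x a"
  unfolding ip_def eps_def coord_def letter_def
  by (simp add: if_distrib sum.delta mult.commute cong: if_cong) linarith

lemma ip_root: "letter n a \<Longrightarrow> letter n b \<Longrightarrow> ip n x (root (a, b)) = coord x a - coord x b"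
  by (simp add: root_eq_eps ip_vadd_right ip_vscale_right ip_eps)

lemma ip_root_root:
  assumes "letter n a" "letter n b" "a \<noteq> b"
  shows "ip n (root (a, b)) (root (a, b)) = (if b = - a then 4 else 2)"
  using assms letter_nonzero[OF assms(1)] letter_nonzero[OF assms(2)]
  by (auto simp: ip_root coord_root coord_eps)

text \<open>The coroot of the long root 2 e(a) is e(a), so the general formula, which would give
  twice \<open>coord x a\<close>, has to be halved for \<open>b = - a\<close>.\<close>

lemma ip_coroot:
  assumes "letter n a" "letter n b" "a \<noteq> b"
  shows "ip n x (coroot n (root (a, b))) =
           (if b = - a then coord x a else coord x a - coord x b)"
  unfolding coroot_def ip_vscale_right ip_root_root[OF assms]
  unfolding ip_root[OF assms(1,2)] by auto

lemma root_swap: "vscale (- 1) (root (a, b)) = root (b, a)"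
  by (auto simp: root_eq_eps vadd_def vscale_def)

lemma eps_neg: "eps (- a) = vscale (- 1) (eps a)"
  by (auto simp: eps_def vscale_def sgn_minus)

lemma root_neg_neg: "root (- b, - a) = root (a, b)"
  by (auto simp: root_eq_eps eps_neg vadd_def vscale_def)

lemma vscale_vscale [simp]: "vscale c (vscale d x) = vscale (c * d) x"
  by (simp add: vscale_def mult.assoc)

lemma vscale_one [simp]: "vscale 1 x = x"
  by (simp add: vscale_def)

lemma root_eq_iff:
  assumes "a \<noteq> 0" "b \<noteq> 0" "c \<noteq> 0" "d \<noteq> 0" "a \<noteq> b" "c \<noteq> d"
  shows "root (a, b) = root (c, d) \<longleftrightarrow> (a = c \<and> b = d) \<or> (a = - d \<and> b = - c)"
proof
  assume eq: "root (a, b) = root (c, d)"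
  have "coord (root (a, b)) e = coord (root (c, d)) e" for e
    by (simp add: eq)
  from this[of a] this[of b] this[of c] this[of d] assms
  show "(a = c \<and> b = d) \<or> (a = - d \<and> b = - c)"
    by (auto simp: coord_root coord_eps split: if_splits)
next
  assume "(a = c \<and> b = d) \<or> (a = - d \<and> b = - c)"
  then show "root (a, b) = root (c, d)"
    by (auto simp: root_neg_neg)
qed

definition Phi :: "nat \<Rightarrow> rvec set" where
  "Phi n = {root (a, b) | a b. letter n a \<and> letter n b \<and> a \<noteq> b}"

lemma root_in_Phi: "letter n a \<Longrightarrow> letter n b \<Longrightarrow> a \<noteq> b \<Longrightarrow> root (a, b) \<in> Phi n"
  by (auto simp: Phi_def)

lemma PhiE:
  assumes "\<gamma> \<in> Phi n"
  obtains a b where "\<gamma> = root (a, b)" "letter n a" "letter n b" "a \<noteq> b"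
  using assms by (auto simp: Phi_def)

text \<open>
  A strictly decreasing odd function on the letters in the order of [n-bar]; half the difference of
  its values at a and b is the height of the root (a,b).
\<close>

definition hgt :: "nat \<Rightarrow> int \<Rightarrow> int" where
  "hgt n a = sgn a * (2 * int n + 1) - 2 * a"

lemma hgt_neg [simp]: "hgt n (- a) = - hgt n a"
  by (simp add: hgt_def sgn_minus)

lemma hgt_eq_iff: "letter n a \<Longrightarrow> letter n b \<Longrightarrow> hgt n a = hgt n b \<longleftrightarrow> a = b"
  by (auto simp: hgt_def letter_def sgn_if split: if_splits)

text \<open>A root has exactly the two names (a,b) and (-b,-a), and \<open>hgt\<close> is odd, so
  the condition does not depend on the name. If it holds, one of the two names has a positive first
  letter of smallest absolute value, which is the form required by \<open>pos_roots\<close>.\<close>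

lemma root_pos_iff:
  assumes "letter n a" "letter n b" "a \<noteq> b"
  shows "root (a, b) \<in> pos_roots n \<longleftrightarrow> hgt n b < hgt n a"
proof
  have nz: "a \<noteq> 0" "b \<noteq> 0" using assms by (auto simp: letter_def)
  { assume "root (a, b) \<in> pos_roots n"
    then obtain i j where "root (a, b) = root (i, j)" "1 \<le> i" "i \<noteq> j"
      and ij: "(i < j \<and> j \<le> int n) \<or> (i < - j \<and> - j \<le> int n) \<or> (j = - i \<and> i \<le> int n)"
      unfolding pos_roots_def by force
    then have "(a = i \<and> b = j) \<or> (a = - j \<and> b = - i)"
      using root_eq_iff[of a b i j] nz assms(3) by auto
    with ij \<open>1 \<le> i\<close> show "hgt n b < hgt n a"
      by (auto simp: hgt_def sgn_if) }
  { assume h: "hgt n b < hgt n a"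
    have "\<exists>c d. root (a, b) = root (c, d) \<and> 1 \<le> c \<and>
        ((c < d \<and> d \<le> int n) \<or> (c < - d \<and> - d \<le> int n) \<or> (d = - c \<and> c \<le> int n))"
    proof (cases "0 < a \<and> (b = - a \<or> a < \<bar>b\<bar>)")
      case True
      then show ?thesis using h assms
        by (intro exI[of _ a] exI[of _ b])
           (auto simp: hgt_def letter_def sgn_if split: if_splits)
    next
      case False
      then show ?thesis using h assms
        by (intro exI[of _ "- b"] exI[of _ "- a"])
           (auto simp: root_neg_neg hgt_def letter_def sgn_if split: if_splits)
    qed
    then obtain c d where cd: "root (a, b) = root (c, d)" "1 \<le> c"
        "(c < d \<and> d \<le> int n) \<or> (c < - d \<and> - d \<le> int n) \<or> (d = - c \<and> c \<le> int n)"
      by blast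
    show "root (a, b) \<in> pos_roots n"
      using cd(3)
    proof (elim disjE conjE)
      assume "c < - d" "- d \<le> int n"
      then have "root (c, - (- d)) \<in> pos_roots n" using cd(2) unfolding pos_roots_def by blast
      then show ?thesis by (simp add: cd(1))
    qed (use cd(1,2) in \<open>auto simp: pos_roots_def\<close>) }
qed

lemma pos_subset_Phi: "pos_roots n \<subseteq> Phi n"
proof -
  have "root (i, j) \<in> Phi n" "root (i, - j) \<in> Phi n" if "1 \<le> i" "i < j" "j \<le> int n" for i j
    using that by (auto intro!: root_in_Phi simp: letter_def)
  moreover have "root (i, - i) \<in> Phi n" if "1 \<le> i" "i \<le> int n" for i
    using that by (auto intro!: root_in_Phi simp: letter_def)
  ultimately show ?thesis unfolding pos_roots_def by blast
qed

lemma neg_root_pos_iff: "\<gamma> \<in> Phi n \<Longrightarrow> vscale (- 1) \<gamma> \<in> pos_roots n \<longleftrightarrow> \<gamma> \<notin> pos_roots n"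
  by (elim PhiE) (auto simp: root_swap root_pos_iff hgt_eq_iff not_less order.order_iff_strict)

lemma finite_pos_roots: "finite (pos_roots n)"
proof -
  have "pos_roots n \<subseteq> root ` ({- int n..int n} \<times> {- int n..int n})"
  proof
    fix \<gamma> assume "\<gamma> \<in> pos_roots n"
    then obtain a b where "\<gamma> = root (a, b)" "letter n a" "letter n b"
      using pos_subset_Phi PhiE by (metis subsetD)
    then show "\<gamma> \<in> root ` ({- int n..int n} \<times> {- int n..int n})"
      by (auto simp: letter_def intro!: imageI)
  qed
  then show ?thesis by (rule finite_subset) simp
qed


section \<open>Signed permutations and their action on vectors\<close>

definition sperm :: "nat \<Rightarrow> (int \<Rightarrow> int) \<Rightarrow> bool" where
  "sperm n \<pi> \<longleftrightarrow> bij \<pi> \<and> (\<forall>a. \<pi> (- a) = - \<pi> a) \<and> (\<forall>a. int n < \<bar>a\<bar> \<longrightarrow> \<pi> a = a)"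

lemma sperm_id: "sperm n id"
  by (simp add: sperm_def)

lemma sperm_comp: "sperm n \<pi> \<Longrightarrow> sperm n \<tau> \<Longrightarrow> sperm n (\<pi> \<circ> \<tau>)"
  by (auto simp: sperm_def intro: bij_comp)

lemma sperm_neg: "sperm n \<pi> \<Longrightarrow> \<pi> (- a) = - \<pi> a"
  and sperm_bij: "sperm n \<pi> \<Longrightarrow> bij \<pi>"
  by (auto simp: sperm_def)

lemma sperm_inv_apply [simp]: "sperm n \<pi> \<Longrightarrow> inv \<pi> (\<pi> a) = a" "sperm n \<pi> \<Longrightarrow> \<pi> (inv \<pi> a) = a"
  by (simp_all add: sperm_def bij_is_inj bij_is_surj surj_f_inv_f)

lemma sperm_eq_iff: "sperm n \<pi> \<Longrightarrow> \<pi> a = \<pi> b \<longleftrightarrow> a = b"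
  by (metis sperm_inv_apply(1))

lemma sperm_inv: "sperm n \<pi> \<Longrightarrow> sperm n (inv \<pi>)"
  unfolding sperm_def by (metis bij_imp_bij_inv bij_inv_eq_iff)

lemma sperm_zero [simp]: "sperm n \<pi> \<Longrightarrow> \<pi> 0 = 0"
  using sperm_neg[of n \<pi> 0] by simp

lemma sperm_eq_zero: "sperm n \<pi> \<Longrightarrow> \<pi> a = 0 \<longleftrightarrow> a = 0"
  by (metis sperm_eq_iff sperm_zero)

lemma sperm_letter:
  assumes "sperm n \<pi>" shows "letter n (\<pi> a) \<longleftrightarrow> letter n a"
proof -
  have "\<bar>\<pi> a\<bar> \<le> int n \<longleftrightarrow> \<bar>a\<bar> \<le> int n"
    using assms unfolding sperm_def
    by (metis bij_is_inj inj_eq linorder_not_less)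
  then show ?thesis using sperm_eq_zero[OF assms] by (simp add: letter_def)
qed

text \<open>The coordinate of \<pi> x at k is that of x at the preimage of k. The value at 0 is
  kept, so that the identity acts trivially on every function, also outside
  \<open>space n\<close>.\<close>

definition act :: "(int \<Rightarrow> int) \<Rightarrow> rvec \<Rightarrow> rvec" where
  "act \<pi> x = (\<lambda>k. if k = 0 then x 0 else coord x (inv \<pi> (int k)))"

lemma coord_act:
  assumes "sperm n \<pi>" shows "coord (act \<pi> x) a = coord x (inv \<pi> a)"
proof -
  have *: "coord (act \<pi> x) a = coord x (inv \<pi> a)" if "0 < a" for a
    using that unfolding coord_def[of "act \<pi> x"] by (simp add: act_def)
  show ?thesis
  proof (cases a "0 :: int" rule: linorder_cases)
    case less
    then show ?thesis using *[of "- a"] sperm_neg[OF sperm_inv[OF assms], of a] by simp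
  qed (use * sperm_zero[OF sperm_inv[OF assms]] in auto)
qed

lemma act_at_0 [simp]: "act \<pi> x 0 = x 0"
  by (simp add: act_def)

lemma act_id [simp]: "act id = id"
  by (rule ext, rule vec_eqI) (auto simp: coord_act[OF sperm_id])

lemma act_comp:
  assumes "sperm n \<pi>" "sperm n \<tau>" shows "act (\<pi> \<circ> \<tau>) = act \<pi> \<circ> act \<tau>"
  using assms
  by (intro ext vec_eqI)
     (auto simp: coord_act[OF sperm_comp[OF assms]] coord_act[of n] o_inv_distrib sperm_bij)

lemma act_eps: "sperm n \<pi> \<Longrightarrow> a \<noteq> 0 \<Longrightarrow> act \<pi> (eps a) = eps (\<pi> a)"
proof (rule vec_eqI)
  fix k :: nat assume a: "sperm n \<pi>" "a \<noteq> 0" "0 < k"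
  have "inv \<pi> (int k) = a \<longleftrightarrow> int k = \<pi> a" "inv \<pi> (int k) = - a \<longleftrightarrow> int k = - \<pi> a"
    using a sperm_neg[of n \<pi> a] by (metis sperm_inv_apply)+
  then show "coord (act \<pi> (eps a)) (int k) = coord (eps (\<pi> a)) (int k)"
    using a sperm_eq_zero[OF sperm_inv[OF a(1)], of "int k"] sperm_eq_zero[OF a(1), of a]
    by (auto simp: coord_act[OF a(1)] coord_eps)
qed (simp add: sperm_eq_zero)

lemma act_vadd [simp]: "act \<pi> (vadd x y) = vadd (act \<pi> x) (act \<pi> y)"
  by (auto simp: act_def fun_eq_iff) (auto simp: vadd_def coord_def algebra_simps)

lemma act_vscale [simp]: "act \<pi> (vscale c x) = vscale c (act \<pi> x)"
  by (auto simp: act_def fun_eq_iff) (auto simp: vscale_def coord_def algebra_simps)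

lemma act_root: "sperm n \<pi> \<Longrightarrow> letter n a \<Longrightarrow> letter n b \<Longrightarrow> act \<pi> (root (a, b)) = root (\<pi> a, \<pi> b)"
  by (simp add: root_eq_eps act_eps letter_nonzero)

lemma act_Phi: "sperm n \<pi> \<Longrightarrow> \<gamma> \<in> Phi n \<Longrightarrow> act \<pi> \<gamma> \<in> Phi n"
  by (elim PhiE) (auto simp: act_root sperm_letter sperm_eq_iff intro!: root_in_Phi)

lemma act_inv [simp]:
  assumes "sperm n \<pi>" shows "act (inv \<pi>) (act \<pi> x) = x" "act \<pi> (act (inv \<pi>) x) = x"
proof -
  have "inv \<pi> \<circ> \<pi> = id" "\<pi> \<circ> inv \<pi> = id" using assms by (auto simp: fun_eq_iff)
  then have "act (inv \<pi>) \<circ> act \<pi> = id" "act \<pi> \<circ> act (inv \<pi>) = id"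
    using act_comp[OF sperm_inv[OF assms] assms] act_comp[OF assms sperm_inv[OF assms]] by auto
  then show "act (inv \<pi>) (act \<pi> x) = x" "act \<pi> (act (inv \<pi>) x) = x"
    by (auto simp: fun_eq_iff dest!: fun_cong[of _ _ x])
qed

lemma ip_act_coroot:
  assumes "sperm n \<pi>" "\<gamma> \<in> Phi n"
  shows "ip n (act \<pi> x) (coroot n (act \<pi> \<gamma>)) = ip n x (coroot n \<gamma>)"
  using assms(2)
proof (elim PhiE)
  fix a b assume ab: "\<gamma> = root (a, b)" "letter n a" "letter n b" "a \<noteq> b"
  have "\<pi> b = - \<pi> a \<longleftrightarrow> b = - a"
    using sperm_neg[OF assms(1), of a] sperm_eq_iff[OF assms(1), of b "- a"] by simp
  then show ?thesis using ab assms(1)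
    by (simp add: act_root ip_coroot sperm_letter sperm_eq_iff coord_act[OF assms(1)])
qed

lemma signed_reflection_apply:
  assumes "a \<noteq> 0" "b \<noteq> 0" "a \<noteq> b"
  shows "signed_reflection (a, b) x =
     (if x = a then b else if x = b then a else if x = - a then - b else if x = - b then - a else x)"
  using assms by (auto simp: signed_reflection_def swap_letters_def)

lemma signed_reflection_invol:
  assumes "a \<noteq> 0" "b \<noteq> 0" "a \<noteq> b"
  shows "signed_reflection (a, b) (signed_reflection (a, b) x) = x"
  using assms by (auto simp: signed_reflection_apply)

lemma sperm_signed_reflection:
  assumes "letter n a" "letter n b" "a \<noteq> b"
  shows "sperm n (signed_reflection (a, b))"
proof -
  have nz: "a \<noteq> 0" "b \<noteq> 0" using assms by (auto simp: letter_def)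
  have "bij (signed_reflection (a, b))"
    using signed_reflection_invol[OF nz assms(3)] by (intro o_bij[of "signed_reflection (a, b)"]) auto
  then show ?thesis using assms nz
    by (auto simp: sperm_def signed_reflection_apply letter_def)
qed

lemma inv_signed_reflection:
  assumes "a \<noteq> 0" "b \<noteq> 0" "a \<noteq> b"
  shows "inv (signed_reflection (a, b)) = signed_reflection (a, b)"
  by (rule inv_equality) (simp_all add: signed_reflection_invol[OF assms])

lemma reflection_root:
  assumes "letter n a" "letter n b" "a \<noteq> b"
  shows "reflection n (root (a, b)) = act (signed_reflection (a, b))"
proof (rule ext, rule vec_eqI)
  fix x
  have nz: "a \<noteq> 0" "b \<noteq> 0" using assms by (auto simp: letter_def)
  show "reflection n (root (a, b)) x 0 = act (signed_reflection (a, b)) x 0"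
    using nz by (simp add: reflection_def aff_reflection_def vadd_def vscale_def)
  fix k :: nat assume "0 < k"
  then show "coord (reflection n (root (a, b)) x) (int k) = coord (act (signed_reflection (a, b)) x) (int k)"
    using nz assms
    by (auto simp: reflection_def aff_reflection_def ip_coroot coord_root coord_eps
        coord_act[OF sperm_signed_reflection[OF assms]] inv_signed_reflection signed_reflection_apply)
qed

lemma signed_reflection_swap:
  "a \<noteq> 0 \<Longrightarrow> b \<noteq> 0 \<Longrightarrow> a \<noteq> b \<Longrightarrow> signed_reflection (- b, - a) = signed_reflection (a, b)"
  by (auto simp: fun_eq_iff signed_reflection_apply)

section \<open>Lengths and inversions\<close>

lemma odd_hgt: "letter n a \<Longrightarrow> odd (hgt n a)"
  by (auto simp: hgt_def letter_def sgn_if)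

text \<open>Pairing with twice the half sum of the positive coroots, that is with (2n - 1, 2n - 3,
  ..., 1): the linear extension of twice the height of roots. Signs of reflected roots become
  inequalities between numbers.\<close>

definition height :: "nat \<Rightarrow> rvec \<Rightarrow> real" where
  "height n x = (\<Sum>k=1..n. x k * of_int (hgt n (int k)))"

lemma height_vadd: "height n (vadd x y) = height n x + height n y"
  and height_vscale: "height n (vscale c x) = c * height n x"
  by (simp_all add: height_def vadd_def vscale_def algebra_simps sum.distrib sum_distrib_left)

lemma height_eps: "letter n a \<Longrightarrow> height n (eps a) = of_int (hgt n a)"
proof -
  assume a: "letter n a"
  have "height n (eps a) = ip n (\<lambda>k. of_int (hgt n (int k))) (eps a)"
    by (simp add: height_def ip_def mult.commute)
  also have "\<dots> = of_int (hgt n a)"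
    using a by (simp add: ip_eps coord_def hgt_def letter_def sgn_if)
  finally show ?thesis .
qed

lemma height_root:
  "letter n a \<Longrightarrow> letter n b \<Longrightarrow> height n (root (a, b)) = of_int (hgt n a - hgt n b)"
  by (simp add: root_eq_eps height_vadd height_vscale height_eps)

lemma pos_iff_height: "\<gamma> \<in> Phi n \<Longrightarrow> \<gamma> \<in> pos_roots n \<longleftrightarrow> 0 < height n \<gamma>"
  by (elim PhiE) (simp add: root_pos_iff height_root)

text \<open>All values of \<open>hgt\<close> are odd, so roots have even height.\<close>

lemma height_pos_ge: assumes "\<gamma> \<in> pos_roots n" shows "2 \<le> height n \<gamma>"
proof -
  have "\<gamma> \<in> Phi n" using assms pos_subset_Phi by blast
  then show ?thesis
  proof (elim PhiE)
    fix a b assume ab: "\<gamma> = root (a, b)" "letter n a" "letter n b" "a \<noteq> b"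
    then have "hgt n b < hgt n a" "even (hgt n a - hgt n b)"
      using assms by (auto simp: root_pos_iff odd_hgt)
    then have "2 \<le> hgt n a - hgt n b" by presburger
    then show ?thesis using ab by (simp add: height_root)
  qed
qed

text \<open>The bound is the height of the simple root with index 0, minus the highest root. Nothing
  lies below it, and this does for index 0 what the minimality of the height 2 does for the other
  simple roots.\<close>

lemma height_ge_lowest: assumes "\<gamma> \<in> Phi n" shows "- (4 * real n - 2) \<le> height n \<gamma>"
  using assms
proof (elim PhiE)
  fix a b assume ab: "\<gamma> = root (a, b)" "letter n a" "letter n b" "a \<noteq> b"
  then have "- (2 * int n - 1) \<le> hgt n a" "hgt n b \<le> 2 * int n - 1"
    by (auto simp: hgt_def letter_def sgn_if split: if_splits)
  then have "- (4 * int n - 2) \<le> hgt n a - hgt n b" by linarith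
  then have "- (4 * real n - 2) \<le> of_int (hgt n a - hgt n b)"
    by linarith
  then show ?thesis using ab by (simp add: height_root)
qed

lemma reflection_eq: "reflection n \<beta> x = vadd x (vscale (- ip n x (coroot n \<beta>)) \<beta>)"
  by (simp add: reflection_def aff_reflection_def)

lemma reflection_act:
  assumes "\<beta> \<in> Phi n" obtains \<sigma> where "sperm n \<sigma>" "reflection n \<beta> = act \<sigma>" "\<sigma> \<circ> \<sigma> = id"
  using assms
proof (elim PhiE)
  fix a b assume ab: "\<beta> = root (a, b)" "letter n a" "letter n b" "a \<noteq> b"
  show thesis
    by (rule that[of "signed_reflection (a, b)"])
       (use ab in \<open>auto simp: reflection_root o_def id_def signed_reflection_invol letter_nonzero
          intro: sperm_signed_reflection\<close>)
qed

lemma reflection_invol: "\<beta> \<in> Phi n \<Longrightarrow> reflection n \<beta> (reflection n \<beta> x) = x"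
  by (metis reflection_act act_comp act_id comp_apply id_apply)

lemma reflection_Phi: "\<beta> \<in> Phi n \<Longrightarrow> \<gamma> \<in> Phi n \<Longrightarrow> reflection n \<beta> \<gamma> \<in> Phi n"
  by (metis reflection_act act_Phi)

lemma reflection_vscale: "reflection n \<beta> (vscale c x) = vscale c (reflection n \<beta> x)"
  unfolding reflection_eq ip_vscale_left by (auto simp: vadd_def vscale_def algebra_simps)

lemma ip_coroot_self: "\<beta> \<in> Phi n \<Longrightarrow> ip n \<beta> (coroot n \<beta>) = 2"
  by (elim PhiE) (auto simp: coroot_def ip_vscale_right ip_root_root)

lemma reflection_self: "\<beta> \<in> Phi n \<Longrightarrow> reflection n \<beta> \<beta> = vscale (- 1) \<beta>"
  by (auto simp: reflection_eq ip_coroot_self vadd_def vscale_def)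

lemma ip_coroot_int:
  assumes "\<beta> \<in> Phi n" "\<gamma> \<in> Phi n" shows "ip n \<gamma> (coroot n \<beta>) \<in> \<int>"
proof -
  obtain a b where ab: "\<beta> = root (a, b)" "letter n a" "letter n b" "a \<noteq> b" using assms PhiE by metis
  obtain c d where cd: "\<gamma> = root (c, d)" "letter n c" "letter n d" "c \<noteq> d" using assms PhiE by metis
  have "coord \<gamma> e \<in> \<int>" if "e \<noteq> 0" for e
    using that cd by (auto simp: coord_root coord_eps letter_nonzero)
  then show ?thesis using ab by (auto simp: ip_coroot letter_nonzero)
qed

section \<open>Inversion sets of reflections\<close>

definition invs :: "nat \<Rightarrow> rvec \<Rightarrow> rvec set" where
  "invs n \<beta> = {\<gamma> \<in> pos_roots n. reflection n \<beta> \<gamma> \<notin> pos_roots n}"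

lemma finite_invs: "finite (invs n \<beta>)"
  using finite_pos_roots by (auto simp: invs_def)

text \<open>The reflection subtracts the pairing times the positive height of \<beta> and turns a
  positive height into one that is not positive. The pairing is thus positive, and it is an
  integer.\<close>

lemma ip_coroot_ge_1:
  assumes "\<beta> \<in> pos_roots n" "\<gamma> \<in> invs n \<beta>" shows "1 \<le> ip n \<gamma> (coroot n \<beta>)"
proof -
  let ?c = "ip n \<gamma> (coroot n \<beta>)"
  have P: "\<beta> \<in> Phi n" "\<gamma> \<in> Phi n" "\<gamma> \<in> pos_roots n" "reflection n \<beta> \<gamma> \<notin> pos_roots n"
    using assms pos_subset_Phi by (auto simp: invs_def)
  then have "height n (reflection n \<beta> \<gamma>) \<le> 0" "0 < height n \<gamma>" "0 < height n \<beta>"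
    using pos_iff_height reflection_Phi assms(1) by fastforce+
  moreover have "height n (reflection n \<beta> \<gamma>) = height n \<gamma> - ?c * height n \<beta>"
    by (simp add: reflection_eq height_vadd height_vscale)
  ultimately have "0 < ?c * height n \<beta>" by linarith
  then have "0 < ?c" using \<open>0 < height n \<beta>\<close> zero_less_mult_pos2 by blast
  moreover have "?c \<in> \<int>" using P ip_coroot_int by blast
  ultimately show ?thesis by (auto elim!: Ints_cases)
qed

text \<open>The involution \<open>\<gamma> \<mapsto> - s\<^sub>\<beta> \<gamma>\<close> of the inversion set of \<open>s\<^sub>\<beta>\<close>.\<close>

definition flip :: "nat \<Rightarrow> rvec \<Rightarrow> rvec \<Rightarrow> rvec" where
  "flip n \<beta> \<gamma> = vscale (- 1) (reflection n \<beta> \<gamma>)"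

lemma flip_flip: "\<beta> \<in> Phi n \<Longrightarrow> flip n \<beta> (flip n \<beta> \<gamma>) = \<gamma>"
  by (simp add: flip_def reflection_vscale reflection_invol)

lemma flip_eq: "flip n \<beta> \<gamma> = vadd (vscale (ip n \<gamma> (coroot n \<beta>)) \<beta>) (vscale (- 1) \<gamma>)"
  by (auto simp: flip_def reflection_eq vadd_def vscale_def)

lemma flip_invs:
  assumes "\<beta> \<in> pos_roots n" "\<gamma> \<in> invs n \<beta>" shows "flip n \<beta> \<gamma> \<in> invs n \<beta>"
proof -
  have P: "\<beta> \<in> Phi n" "\<gamma> \<in> Phi n" "\<gamma> \<in> pos_roots n" "reflection n \<beta> \<gamma> \<notin> pos_roots n"
    using assms pos_subset_Phi by (auto simp: invs_def)
  then have "flip n \<beta> \<gamma> \<in> pos_roots n"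
    by (simp add: flip_def neg_root_pos_iff reflection_Phi)
  moreover have "reflection n \<beta> (flip n \<beta> \<gamma>) \<notin> pos_roots n"
    using P by (simp add: flip_def reflection_vscale reflection_invol neg_root_pos_iff)
  ultimately show ?thesis by (simp add: invs_def)
qed

lemma act_flip_pos_iff:
  assumes "sperm n \<pi>" "\<beta> \<in> Phi n" "\<gamma> \<in> Phi n"
  shows "act \<pi> (flip n \<beta> \<gamma>) \<in> pos_roots n \<longleftrightarrow> act \<pi> (reflection n \<beta> \<gamma>) \<notin> pos_roots n"
  using assms by (simp add: flip_def neg_root_pos_iff act_Phi reflection_Phi)

definition ninv :: "nat \<Rightarrow> (rvec \<Rightarrow> rvec) \<Rightarrow> nat" where
  "ninv n f = card {\<gamma> \<in> pos_roots n. f \<gamma> \<notin> pos_roots n}"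

text \<open>Outside the inversion set, the reflection permutes the positive roots and matches the
  inversions of both sides. Inside it, \<open>flip\<close> matches the inversions of the product
  with the non-inversions of \<pi>. So the number grows by the size of the inversion set minus twice
  the number of its roots inverted by \<pi>.\<close>

lemma ninv_reflection:
  assumes \<pi>: "sperm n \<pi>" and \<beta>: "\<beta> \<in> pos_roots n"
  shows "int (ninv n (act \<pi> \<circ> reflection n \<beta>)) =
    int (ninv n (act \<pi>)) + int (card (invs n \<beta>)) - 2 * int (card {\<gamma> \<in> invs n \<beta>. act \<pi> \<gamma> \<notin> pos_roots n})"
proof -
  let ?s = "reflection n \<beta>" and ?I = "invs n \<beta>" and ?P = "pos_roots n"
  let ?R = "?P - ?I"
  have \<beta>': "\<beta> \<in> Phi n" using \<beta> pos_subset_Phi by blast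
  have split: "card {\<gamma> \<in> ?P. f \<gamma> \<notin> ?P} = card {\<gamma> \<in> ?I. f \<gamma> \<notin> ?P} + card {\<gamma> \<in> ?R. f \<gamma> \<notin> ?P}"
    for f :: "rvec \<Rightarrow> rvec"
  proof -
    have "{\<gamma> \<in> ?P. f \<gamma> \<notin> ?P} = {\<gamma> \<in> ?I. f \<gamma> \<notin> ?P} \<union> {\<gamma> \<in> ?R. f \<gamma> \<notin> ?P}"
      by (auto simp: invs_def)
    then show ?thesis
      using finite_pos_roots finite_invs by (simp add: card_Un_disjoint disjoint_iff)
  qed
  have "bij_betw ?s {\<gamma> \<in> ?R. (act \<pi> \<circ> ?s) \<gamma> \<notin> ?P} {\<gamma> \<in> ?R. act \<pi> \<gamma> \<notin> ?P}"
    by (rule bij_betw_byWitness[where f' = ?s])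
       (auto simp: reflection_invol[OF \<beta>'] invs_def)
  then have R: "card {\<gamma> \<in> ?R. (act \<pi> \<circ> ?s) \<gamma> \<notin> ?P} = card {\<gamma> \<in> ?R. act \<pi> \<gamma> \<notin> ?P}"
    by (rule bij_betw_same_card)
  have IP: "\<gamma> \<in> Phi n" if "\<gamma> \<in> ?I" for \<gamma> using that pos_subset_Phi by (auto simp: invs_def)
  have "bij_betw (flip n \<beta>) {\<gamma> \<in> ?I. (act \<pi> \<circ> ?s) \<gamma> \<notin> ?P} {\<gamma> \<in> ?I. act \<pi> \<gamma> \<in> ?P}"
  proof (rule bij_betw_byWitness[where f' = "flip n \<beta>"])
    show "flip n \<beta> ` {\<gamma> \<in> ?I. (act \<pi> \<circ> ?s) \<gamma> \<notin> ?P} \<subseteq> {\<gamma> \<in> ?I. act \<pi> \<gamma> \<in> ?P}"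
      using act_flip_pos_iff[OF \<pi> \<beta>'] flip_invs[OF \<beta>] IP by auto
    show "flip n \<beta> ` {\<gamma> \<in> ?I. act \<pi> \<gamma> \<in> ?P} \<subseteq> {\<gamma> \<in> ?I. (act \<pi> \<circ> ?s) \<gamma> \<notin> ?P}"
    proof safe
      fix \<gamma> assume g: "\<gamma> \<in> ?I" "act \<pi> \<gamma> \<in> ?P"
      show "flip n \<beta> \<gamma> \<in> ?I" using flip_invs[OF \<beta> g(1)] .
      assume "(act \<pi> \<circ> ?s) (flip n \<beta> \<gamma>) \<in> ?P"
      then show False
        using g act_flip_pos_iff[OF \<pi> \<beta>', of "flip n \<beta> \<gamma>"] flip_invs[OF \<beta> g(1)] IP
        by (simp add: flip_flip[OF \<beta>'])
    qed
  qed (simp_all add: flip_flip[OF \<beta>'])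
  then have "card {\<gamma> \<in> ?I. (act \<pi> \<circ> ?s) \<gamma> \<notin> ?P} = card {\<gamma> \<in> ?I. act \<pi> \<gamma> \<in> ?P}"
    by (rule bij_betw_same_card)
  moreover have "card ?I = card {\<gamma> \<in> ?I. act \<pi> \<gamma> \<in> ?P} + card {\<gamma> \<in> ?I. act \<pi> \<gamma> \<notin> ?P}"
  proof -
    have "?I = {\<gamma> \<in> ?I. act \<pi> \<gamma> \<in> ?P} \<union> {\<gamma> \<in> ?I. act \<pi> \<gamma> \<notin> ?P}" by auto
    then show ?thesis using finite_invs card_Un_disjoint[of "{\<gamma> \<in> ?I. act \<pi> \<gamma> \<in> ?P}" "{\<gamma> \<in> ?I. act \<pi> \<gamma> \<notin> ?P}"]
      by (simp add: disjoint_iff)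
  qed
  ultimately show ?thesis
    using R split[of "act \<pi>"] split[of "act \<pi> \<circ> ?s"] by (simp add: ninv_def)
qed

section \<open>Simple reflections and the length function\<close>

definition simple_letters :: "nat \<Rightarrow> nat \<Rightarrow> int \<times> int" where
  "simple_letters n p = (if p = 0 then (- 1, 1) else if p < n then (int p, int p + 1) else (int n, - int n))"

lemma simple_root_eq: "p \<le> n \<Longrightarrow> simple_root n p = root (simple_letters n p)"
  by (auto simp: simple_root_def simple_letters_def root_eq_eps eps_neg)
     (auto simp: vadd_def vscale_def eps_def)

lemma simple_lettersE:
  assumes "1 \<le> n" "p \<le> n"
  obtains u v where "simple_letters n p = (u, v)" "letter n u" "letter n v" "u \<noteq> v"
    "hgt n u - hgt n v = (if p = 0 then - (4 * int n - 2) else 2)"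
proof -
  consider "p = 0" | "0 < p" "p < n" | "p = n" "0 < p" using assms by linarith
  then show thesis
    by cases (use assms that in \<open>auto simp: simple_letters_def letter_def hgt_def\<close>)
qed

lemma simple_root_Phi: "1 \<le> n \<Longrightarrow> p \<le> n \<Longrightarrow> simple_root n p \<in> Phi n"
  by (metis simple_lettersE simple_root_eq root_in_Phi)

lemma height_simple: "1 \<le> n \<Longrightarrow> p \<le> n \<Longrightarrow>
    height n (simple_root n p) = (if p = 0 then - (4 * real n - 2) else 2)"
  by (erule (1) simple_lettersE) (simp add: simple_root_eq height_root)

lemma simple_root_pos_iff: "1 \<le> n \<Longrightarrow> p \<le> n \<Longrightarrow> simple_root n p \<in> pos_roots n \<longleftrightarrow> 0 < p"
  by (simp add: pos_iff_height simple_root_Phi height_simple)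

text \<open>The simple reflection lowers \<open>hgt\<close> by 2 at u and -v, raises it by 2 at v
  and -u, and fixes it elsewhere. A positive root (a,b) that becomes negative therefore has
  difference 2 or 4, and at least one of its letters moves.\<close>

lemma invs_simple:
  assumes "1 \<le> p" "p \<le> n"
  shows "invs n (simple_root n p) = {simple_root n p}"
proof -
  obtain u v where uv: "simple_letters n p = (u, v)" "letter n u" "letter n v" "u \<noteq> v" "hgt n u - hgt n v = 2"
    using simple_lettersE[of n p] assms by (metis le_trans not_one_le_zero)
  have up: "0 < u" "p < n \<Longrightarrow> 0 < v" "p < n \<Longrightarrow> 1 < hgt n u" "p = n \<Longrightarrow> v = - u"
    using uv(1) assms by (auto simp: simple_letters_def hgt_def split: if_splits)
  let ?s = "signed_reflection (u, v)"
  have nz: "u \<noteq> 0" "v \<noteq> 0" using uv letter_nonzero by auto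
  have hs: "hgt n (?s c) = (if c = u \<or> c = - v then hgt n c - 2 else if c = v \<or> c = - u then hgt n c + 2 else hgt n c)" for c
    using uv nz by (auto simp: signed_reflection_apply)
  have refl: "reflection n (simple_root n p) = act ?s" "simple_root n p = root (u, v)"
    using uv assms by (simp_all add: simple_root_eq reflection_root)
  have s: "sperm n ?s" using uv sperm_signed_reflection by simp
  have "\<gamma> = root (u, v)" if "\<gamma> \<in> invs n (simple_root n p)" for \<gamma>
  proof -
    from that have "\<gamma> \<in> Phi n" using pos_subset_Phi by (auto simp: invs_def)
    then show ?thesis
    proof (elim PhiE)
      fix a b assume ab: "\<gamma> = root (a, b)" "letter n a" "letter n b" "a \<noteq> b"
      have 1: "hgt n b < hgt n a" using that ab by (auto simp: invs_def root_pos_iff)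
      have 2: "hgt n (?s a) \<le> hgt n (?s b)"
        using that ab s by (auto simp: invs_def refl(2) refl(1)[unfolded refl(2)] act_root root_pos_iff sperm_letter sperm_eq_iff)
      have "even (hgt n a - hgt n b)" using ab odd_hgt by simp
      with 1 have 3: "2 \<le> hgt n a - hgt n b" by presburger
      have "(a = u \<and> b = v) \<or> (a = - v \<and> b = - u)"
      proof (cases "hgt n a - hgt n b = 2")
        case True
        then have *: "a = u \<or> a = - v \<or> b = v \<or> b = - u" using 2 hs by (auto split: if_splits)
        show ?thesis
        proof (cases "a = u \<or> b = v")
          case True
          then have "hgt n a = hgt n u \<or> hgt n b = hgt n v" by auto
          then have "hgt n a = hgt n u" "hgt n b = hgt n v"
            using \<open>hgt n a - hgt n b = 2\<close> uv(5) by auto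
          then show ?thesis using hgt_eq_iff[of n a u] hgt_eq_iff[of n b v] ab uv by auto
        next
          case False
          then have "hgt n a = hgt n (- v) \<or> hgt n b = hgt n (- u)" using * by auto
          then have "hgt n a = hgt n (- v)" "hgt n b = hgt n (- u)"
            using \<open>hgt n a - hgt n b = 2\<close> uv(5) by auto
          then show ?thesis using hgt_eq_iff[of n a "- v"] hgt_eq_iff[of n b "- u"] ab uv by auto
        qed
      next
        case False
        \<comment> \<open>Both letters move. The only candidates besides the two names of the simple
          root are (u,-u) and (-v,v). If p < n, the first has difference at least 6 and the second
          is negative; for p = n they are the simple root itself.\<close>
        with 2 3 hs have *: "a = u \<or> a = - v" "b = v \<or> b = - u" "hgt n a - hgt n b \<le> 4"
          by (auto split: if_splits)
        show ?thesis using * up 1 assms uv(5) False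
          by (cases "p = n") (auto simp: hgt_def sgn_if split: if_splits)
      qed
      then show ?thesis using ab by (auto simp: root_neg_neg)
    qed
  qed
  moreover have "simple_root n p \<in> invs n (simple_root n p)"
    using assms simple_root_pos_iff[of n p] simple_root_Phi[of n p]
    by (simp add: invs_def reflection_self neg_root_pos_iff)
  ultimately show ?thesis using refl(2) by auto
qed

lemma ninv_comp_simple:
  assumes "sperm n \<pi>" "1 \<le> p" "p \<le> n"
  shows "int (ninv n (act \<pi> \<circ> reflection n (simple_root n p))) =
    int (ninv n (act \<pi>)) + (if act \<pi> (simple_root n p) \<in> pos_roots n then 1 else - 1)"
proof -
  have "{\<gamma>. \<gamma> = simple_root n p \<and> act \<pi> \<gamma> \<notin> pos_roots n} =
     (if act \<pi> (simple_root n p) \<in> pos_roots n then {} else {simple_root n p})" by auto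
  then show ?thesis
    using ninv_reflection[OF assms(1), of "simple_root n p"] assms simple_root_pos_iff[of n p]
    by (simp add: invs_simple)
qed

text \<open>Without descents the odd numbers \<open>hgt n (\<pi> k)\<close> drop by at least 2 from
  each k to the next and are still at least 1 at k = n. Since none exceeds 2n - 1, they are squeezed
  to 2n - 1, ..., 3, 1: from below starting at n, from above starting at 1.\<close>

lemma sperm_no_descent:
  assumes \<pi>: "sperm n \<pi>" and pos: "\<And>p. 1 \<le> p \<Longrightarrow> p \<le> n \<Longrightarrow> act \<pi> (simple_root n p) \<in> pos_roots n"
  shows "\<pi> = id"
proof -
  have step: "hgt n (\<pi> (int p + 1)) + 2 \<le> hgt n (\<pi> (int p))" if "1 \<le> p" "p < n" for p
  proof -
    have l: "letter n (int p)" "letter n (int p + 1)" using that by (auto simp: letter_def)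
    have "root (\<pi> (int p), \<pi> (int p + 1)) \<in> pos_roots n"
      using pos[of p] that l act_root[OF \<pi> l] by (simp add: simple_root_def)
    then have "hgt n (\<pi> (int p + 1)) < hgt n (\<pi> (int p))"
      using l \<pi> by (simp add: root_pos_iff sperm_letter sperm_eq_iff)
    moreover have "even (hgt n (\<pi> (int p)) - hgt n (\<pi> (int p + 1)))"
      using l \<pi> by (simp add: odd_hgt sperm_letter)
    ultimately show ?thesis by presburger
  qed
  have last: "1 \<le> hgt n (\<pi> (int n))" if "1 \<le> n"
  proof -
    have l: "letter n (int n)" using that by (auto simp: letter_def)
    have "simple_root n n = root (int n, - int n)"
      using that by (simp add: simple_root_eq simple_letters_def)
    then have "root (\<pi> (int n), - \<pi> (int n)) \<in> pos_roots n"
      using pos[of n] that l act_root[OF \<pi>, of "int n" "- int n"] sperm_neg[OF \<pi>] by simp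
    then show ?thesis
      using l root_pos_iff[of n "\<pi> (int n)" "- \<pi> (int n)"] sperm_letter[OF \<pi>, of "int n"] letter_nonzero
      by fastforce
  qed
  have low: "hgt n (int p) \<le> hgt n (\<pi> (int p))" if "1 \<le> p" "p \<le> n" for p
    using that(2,1)
  proof (induction p rule: inc_induct)
    case base
    then show ?case using last by (simp add: hgt_def)
  next
    case (step p)
    then show ?case using \<open>1 \<le> p\<close> step.hyps assms step(3) \<open>p < n\<close>
      using \<open>\<And>p. 1 \<le> p \<Longrightarrow> p < n \<Longrightarrow> hgt n (\<pi> (int p + 1)) + 2 \<le> hgt n (\<pi> (int p))\<close>[of p]
      by (simp add: hgt_def add.commute)
  qed
  have high: "hgt n (\<pi> (int p)) \<le> hgt n (int p)" if "1 \<le> p" "p \<le> n" for p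
    using that
  proof (induction p rule: dec_induct)
    case base
    have "letter n (\<pi> 1)" using base sperm_letter[OF \<pi>, of 1] by (simp add: letter_def)
    then show ?case using base by (auto simp: hgt_def letter_def sgn_if)
  next
    case (step p)
    then show ?case
      using \<open>\<And>p. 1 \<le> p \<Longrightarrow> p < n \<Longrightarrow> hgt n (\<pi> (int p + 1)) + 2 \<le> hgt n (\<pi> (int p))\<close>[of p]
      by (simp add: hgt_def add.commute)
  qed
  have fix_pos: "\<pi> a = a" if "1 \<le> a" "a \<le> int n" for a
  proof -
    have "hgt n (\<pi> a) = hgt n a" using low[of "nat a"] high[of "nat a"] that by (simp add: nat_le_iff Suc_le_eq)
    moreover have "letter n a" using that by (simp add: letter_def)
    ultimately show ?thesis using hgt_eq_iff sperm_letter[OF \<pi>] by blast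
  qed
  have "\<pi> a = a" for a
  proof -
    consider "a = 0" | "int n < \<bar>a\<bar>" | "1 \<le> a" "a \<le> int n" | "1 \<le> - a" "- a \<le> int n" by linarith
    then show ?thesis
    proof cases
      case 4
      then show ?thesis using fix_pos[of "- a"] sperm_neg[OF \<pi>, of a] by simp
    qed (use \<pi> fix_pos in \<open>auto simp: sperm_def\<close>)
  qed
  then show ?thesis by auto
qed

lemma compose_list_append: "compose_list (xs @ ys) = compose_list xs \<circ> compose_list ys"
  by (induction xs) (auto simp: compose_list_def)

lemma compose_list_snoc: "compose_list (xs @ [f]) = compose_list xs \<circ> f"
  by (simp add: compose_list_append) (simp add: compose_list_def)

lemma compose_list_Nil [simp]: "compose_list [] = id"
  by (simp add: compose_list_def)

lemma simple_word_ninv: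
  assumes "set ps \<subseteq> {1..n}"
  shows "\<exists>\<pi>. sperm n \<pi> \<and> compose_list (map (\<lambda>p. reflection n (simple_root n p)) ps) = act \<pi> \<and>
     ninv n (act \<pi>) \<le> length ps"
  using assms
proof (induction ps rule: rev_induct)
  case Nil
  show ?case
  proof (intro exI conjI)
    show "sperm n id" by (rule sperm_id)
    show "compose_list (map (\<lambda>p. reflection n (simple_root n p)) []) = act id"
      unfolding list.map compose_list_Nil act_id ..
    show "ninv n (act id) \<le> length []"
      unfolding act_id by (simp add: ninv_def)
  qed
next
  case (snoc p ps)
  then obtain \<pi> where \<pi>: "sperm n \<pi>"
      "compose_list (map (\<lambda>p. reflection n (simple_root n p)) ps) = act \<pi>" "ninv n (act \<pi>) \<le> length ps"
    by auto
  have p: "1 \<le> p" "p \<le> n" using snoc.prems by auto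
  then obtain \<sigma> where \<sigma>: "sperm n \<sigma>" "reflection n (simple_root n p) = act \<sigma>"
    using reflection_act[OF simple_root_Phi[of n p]] by auto
  then have "act \<pi> \<circ> reflection n (simple_root n p) = act (\<pi> \<circ> \<sigma>)"
    using \<pi> by (simp add: act_comp)
  moreover have "ninv n (act (\<pi> \<circ> \<sigma>)) \<le> Suc (length ps)"
    using \<pi>(3) ninv_comp_simple[OF \<pi>(1) p] calculation by (auto split: if_splits)
  ultimately show ?case
  proof (intro exI conjI)
    assume eq: "act \<pi> \<circ> reflection n (simple_root n p) = act (\<pi> \<circ> \<sigma>)"
    show "sperm n (\<pi> \<circ> \<sigma>)" using sperm_comp[OF \<pi>(1) \<sigma>(1)] .
    show "compose_list (map (\<lambda>p. reflection n (simple_root n p)) (ps @ [p])) = act (\<pi> \<circ> \<sigma>)"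
      using eq \<pi>(2) by (simp add: compose_list_snoc)
    assume "ninv n (act (\<pi> \<circ> \<sigma>)) \<le> Suc (length ps)"
    then show "ninv n (act (\<pi> \<circ> \<sigma>)) \<le> length (ps @ [p])"
      unfolding length_append by simp
  qed
qed

text \<open>A signed permutation other than the identity has a descent, and multiplying by that
  simple reflection removes one inversion. With \<open>simple_word_ninv\<close> this identifies the
  length with the number of inversions.\<close>

lemma simple_word_exists:
  assumes "sperm n \<pi>"
  shows "\<exists>ps. length ps = ninv n (act \<pi>) \<and> set ps \<subseteq> {1..n} \<and>
     act \<pi> = compose_list (map (\<lambda>p. reflection n (simple_root n p)) ps)"
  using assms
proof (induction "ninv n (act \<pi>)" arbitrary: \<pi> rule: less_induct)
  case less
  show ?case
  proof (cases "\<pi> = id")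
    case True
    then show ?thesis by (intro exI[of _ "[]"]) (simp add: ninv_def)
  next
    case False
    then obtain p where p: "1 \<le> p" "p \<le> n" "act \<pi> (simple_root n p) \<notin> pos_roots n"
      using sperm_no_descent less.prems by blast
    then obtain \<sigma> where \<sigma>: "sperm n \<sigma>" "reflection n (simple_root n p) = act \<sigma>"
      using reflection_act[OF simple_root_Phi[of n p]] by auto
    then have eq: "act \<pi> \<circ> reflection n (simple_root n p) = act (\<pi> \<circ> \<sigma>)"
      using less.prems by (simp add: act_comp)
    then have n: "int (ninv n (act (\<pi> \<circ> \<sigma>))) = int (ninv n (act \<pi>)) - 1"
      using ninv_comp_simple[OF less.prems p(1,2)] p(3) by simp
    then obtain ps where ps: "length ps = ninv n (act (\<pi> \<circ> \<sigma>))" "set ps \<subseteq> {1..n}"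
       "act (\<pi> \<circ> \<sigma>) = compose_list (map (\<lambda>p. reflection n (simple_root n p)) ps)"
      using less.hyps[OF _ sperm_comp[OF less.prems \<sigma>(1)]] by auto
    have "act \<pi> = act (\<pi> \<circ> \<sigma>) \<circ> reflection n (simple_root n p)"
      using reflection_invol[OF simple_root_Phi[of n p]] p by (intro ext) (simp add: eq[symmetric])
    then show ?thesis using ps n p
      by (intro exI[of _ "ps @ [p]"]) (auto simp: compose_list_snoc)
  qed
qed

lemma weyl_length_act: "sperm n \<pi> \<Longrightarrow> weyl_length n (act \<pi>) = ninv n (act \<pi>)"
  unfolding weyl_length_def
proof (rule Least_equality)
  assume \<pi>: "sperm n \<pi>"
  show "\<exists>ps. length ps = ninv n (act \<pi>) \<and> set ps \<subseteq> {1..n} \<and>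
     act \<pi> = compose_list (map (\<lambda>p. reflection n (simple_root n p)) ps)"
    using simple_word_exists[OF \<pi>] .
  show "ninv n (act \<pi>) \<le> k" if "\<exists>ps. length ps = k \<and> set ps \<subseteq> {1..n} \<and>
     act \<pi> = compose_list (map (\<lambda>p. reflection n (simple_root n p)) ps)" for k
    using that simple_word_ninv by fastforce
qed

section \<open>Edges of the quantum Bruhat graph\<close>

lemma ip_rho: "ip n (rho n) v = (\<Sum>\<gamma>\<in>pos_roots n. ip n \<gamma> v) / 2"
proof -
  have "ip n (rho n) v = (\<Sum>k=1..n. \<Sum>\<gamma>\<in>pos_roots n. \<gamma> k * v k) / 2"
    by (simp add: ip_def rho_def sum_divide_distrib sum_distrib_right)
  also have "(\<Sum>k=1..n. \<Sum>\<gamma>\<in>pos_roots n. \<gamma> k * v k) = (\<Sum>\<gamma>\<in>pos_roots n. ip n \<gamma> v)"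
    unfolding ip_def by (rule sum.swap)
  finally show ?thesis .
qed

text \<open>The reflection permutes the positive roots that it does not invert and negates their
  pairings, so these cancel in the sum for 2 \<rho>.\<close>

lemma rho_coroot:
  assumes \<beta>: "\<beta> \<in> pos_roots n"
  shows "2 * ip n (rho n) (coroot n \<beta>) = (\<Sum>\<gamma>\<in>invs n \<beta>. ip n \<gamma> (coroot n \<beta>))"
proof -
  let ?R = "pos_roots n - invs n \<beta>" and ?s = "reflection n \<beta>" and ?c = "\<lambda>\<gamma>. ip n \<gamma> (coroot n \<beta>)"
  have \<beta>': "\<beta> \<in> Phi n" using \<beta> pos_subset_Phi by blast
  have s: "?c (?s \<gamma>) = - ?c \<gamma>" for \<gamma>
    using ip_coroot_self[OF \<beta>'] by (simp add: reflection_eq ip_vadd_left ip_vscale_left)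
  have "bij_betw ?s ?R ?R"
    by (rule bij_betw_byWitness[where f' = ?s]) (auto simp: reflection_invol[OF \<beta>'] invs_def)
  then have "sum ?c ?R = (\<Sum>\<gamma>\<in>?R. ?c (?s \<gamma>))"
    using sum.reindex_bij_betw[of ?s ?R ?R ?c] by simp
  also have "\<dots> = - sum ?c ?R" by (simp add: s sum_negf)
  finally have "sum ?c ?R = 0" by simp
  moreover have "sum ?c (pos_roots n) = sum ?c ?R + sum ?c (invs n \<beta>)"
    by (rule sum.subset_diff) (auto simp: finite_pos_roots invs_def)
  ultimately show ?thesis by (simp add: ip_rho)
qed

lemma self_in_invs: "\<beta> \<in> pos_roots n \<Longrightarrow> \<beta> \<in> invs n \<beta>"
  using subsetD[OF pos_subset_Phi, of \<beta> n] by (simp add: invs_def reflection_self neg_root_pos_iff)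

lemma rho_coroot_pos:
  assumes "\<beta> \<in> pos_roots n" shows "0 < ip n (rho n) (coroot n \<beta>)"
proof -
  have "0 < (\<Sum>\<gamma>\<in>invs n \<beta>. ip n \<gamma> (coroot n \<beta>))"
    using ip_coroot_ge_1[OF assms] self_in_invs[OF assms]
    by (intro sum_pos2[OF finite_invs, of \<beta>]) (fastforce simp: zero_less_one_class.zero_le_one)+
  then show ?thesis using rho_coroot[OF assms] by simp
qed

text \<open>A description of the edges by signs. Let I be the inversion set of the reflection and N
  the part inverted by \<pi>; the length changes by |I| - 2|N|. The roots \<gamma> and
  \<open>flip n \<beta> \<gamma>\<close> add up to a positive multiple of \<beta>, so their images
  cannot both have the sign opposite to that of \<pi> \<beta>. For an increase by 1 this leaves
  exactly one inverted root in each such pair. A quantum drop is the extreme value: all of I is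
  inverted, and all pairings except that of \<beta> are 1.\<close>

lemma qbg_edge_cases [consumes 2, case_names bruhat quantum]:
  assumes \<pi>: "sperm n \<pi>" and edge: "qbg_edge n (act \<pi>) \<beta>"
  obtains (bruhat) "\<beta> \<in> pos_roots n" "act \<pi> \<beta> \<in> pos_roots n"
      "\<And>\<gamma>. \<gamma> \<in> invs n \<beta> \<Longrightarrow> \<gamma> \<noteq> \<beta> \<Longrightarrow>
         act \<pi> \<gamma> \<in> pos_roots n \<longleftrightarrow> act \<pi> (reflection n \<beta> \<gamma>) \<in> pos_roots n"
    | (quantum) "\<beta> \<in> pos_roots n" "\<And>\<gamma>. \<gamma> \<in> invs n \<beta> \<Longrightarrow> act \<pi> \<gamma> \<notin> pos_roots n"
      "\<And>\<gamma>. \<gamma> \<in> invs n \<beta> \<Longrightarrow> \<gamma> \<noteq> \<beta> \<Longrightarrow> ip n \<gamma> (coroot n \<beta>) = 1"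
proof -
  let ?I = "invs n \<beta>" and ?P = "pos_roots n" and ?c = "\<lambda>\<gamma>. ip n \<gamma> (coroot n \<beta>)"
  let ?N = "{\<gamma> \<in> ?I. act \<pi> \<gamma> \<notin> ?P}" and ?U = "{\<gamma> \<in> ?I - {\<beta>}. act \<pi> \<gamma> \<in> ?P}"
    and ?T = "{\<gamma> \<in> ?I - {\<beta>}. act \<pi> \<gamma> \<notin> ?P}"
  have \<beta>: "\<beta> \<in> ?P" using edge by (simp add: qbg_edge_def)
  have \<beta>': "\<beta> \<in> Phi n" using \<beta> pos_subset_Phi by blast
  obtain \<sigma> where \<sigma>: "sperm n \<sigma>" "reflection n \<beta> = act \<sigma>" using reflection_act[OF \<beta>'] .
  have len: "weyl_length n (act \<pi> \<circ> reflection n \<beta>) = ninv n (act \<pi> \<circ> reflection n \<beta>)"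
    using weyl_length_act[OF sperm_comp[OF \<pi> \<sigma>(1)]] act_comp[OF \<pi> \<sigma>(1)] \<sigma>(2) by simp
  have diff: "real (weyl_length n (act \<pi> \<circ> reflection n \<beta>)) =
      real (weyl_length n (act \<pi>)) + real (card ?I) - 2 * real (card ?N)"
    using ninv_reflection[OF \<pi> \<beta>] len weyl_length_act[OF \<pi>] by linarith
  have I: "?I = insert \<beta> (?U \<union> ?T)" using self_in_invs[OF \<beta>] by auto
  have fin: "finite ?U" "finite ?T" using finite_invs by auto
  have cardI: "card ?I = Suc (card ?U + card ?T)"
    by (subst I, subst card_insert_disjoint) (use fin in \<open>auto simp: card_Un_disjoint disjoint_iff\<close>)
  have Phi: "\<gamma> \<in> Phi n" if "\<gamma> \<in> ?I" for \<gamma> using that pos_subset_Phi by (auto simp: invs_def)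
  have flip_ne: "flip n \<beta> \<gamma> \<noteq> \<beta>" if "\<gamma> \<noteq> \<beta>" for \<gamma>
  proof
    assume "flip n \<beta> \<gamma> = \<beta>"
    then have "\<gamma> = flip n \<beta> \<beta>" using flip_flip[OF \<beta>', of \<gamma>] by simp
    also have "\<dots> = \<beta>" by (simp add: flip_def reflection_self[OF \<beta>'])
    finally show False using that by simp
  qed
  have inj: "inj_on (flip n \<beta>) A" for A
    by (rule inj_on_inverseI[where g = "flip n \<beta>"]) (simp add: flip_flip[OF \<beta>'])
  have sum_flip: "height n (act \<pi> \<gamma>) + height n (act \<pi> (flip n \<beta> \<gamma>)) = ?c \<gamma> * height n (act \<pi> \<beta>)" for \<gamma>
    by (simp add: flip_eq height_vadd height_vscale)
  from edge consider "real (card ?I) - 2 * real (card ?N) = 1"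
    | "real (card ?I) - 2 * real (card ?N) = 1 - 2 * ip n (rho n) (coroot n \<beta>)"
    unfolding qbg_edge_def diff by linarith
  then show thesis
  proof cases
    case 1
    have pos: "act \<pi> \<beta> \<in> ?P"
    proof (rule ccontr)
      \<comment> \<open>Here |I| - 2|N| is |U| - |T| - 1, while \<open>flip\<close> embeds U into T;
        so the change would be negative.\<close>
      assume neg: "act \<pi> \<beta> \<notin> ?P"
      have "flip n \<beta> ` ?U \<subseteq> ?T"
      proof safe
        fix \<gamma> assume g: "\<gamma> \<in> ?I" "act \<pi> \<gamma> \<in> ?P" "\<gamma> \<noteq> \<beta>"
        show "flip n \<beta> \<gamma> \<in> ?I" using flip_invs[OF \<beta> g(1)] .
        show "flip n \<beta> \<gamma> = \<beta> \<Longrightarrow> False" using flip_ne g by blast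
        assume "act \<pi> (flip n \<beta> \<gamma>) \<in> ?P"
        then have "0 < ?c \<gamma> * height n (act \<pi> \<beta>)"
          using sum_flip[of \<gamma>] height_pos_ge[of "act \<pi> (flip n \<beta> \<gamma>)" n] height_pos_ge[OF g(2)] by simp
        moreover have "height n (act \<pi> \<beta>) \<le> 0"
          using neg pos_iff_height act_Phi[OF \<pi> \<beta>'] by fastforce
        moreover have "0 \<le> ?c \<gamma>" using ip_coroot_ge_1[OF \<beta> g(1)] by linarith
        ultimately show False using mult_nonneg_nonpos[of "?c \<gamma>" "height n (act \<pi> \<beta>)"] by linarith
      qed
      then have "card ?U \<le> card ?T" using card_inj_on_le[OF inj _ fin(2)] by blast
      moreover have "?N = insert \<beta> ?T" using self_in_invs[OF \<beta>] neg by auto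
      then have "card ?N = Suc (card ?T)" using fin by simp
      ultimately show False using 1 cardI by linarith
    qed
    have "?N = ?T" using pos by auto
    then have UT: "card ?U = card ?T" using 1 cardI by simp
    have sub: "flip n \<beta> ` ?T \<subseteq> ?U"
    proof safe
      fix \<gamma> assume g: "\<gamma> \<in> ?I" "act \<pi> \<gamma> \<notin> ?P" "\<gamma> \<noteq> \<beta>"
      show "flip n \<beta> \<gamma> \<in> ?I" using flip_invs[OF \<beta> g(1)] .
      show "flip n \<beta> \<gamma> = \<beta> \<Longrightarrow> False" using flip_ne g by blast
      have "0 < ?c \<gamma> * height n (act \<pi> \<beta>)"
        using ip_coroot_ge_1[OF \<beta> g(1)] pos height_pos_ge[OF pos] by (intro mult_pos_pos) auto
      moreover have "height n (act \<pi> \<gamma>) \<le> 0"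
        using g Phi pos_iff_height act_Phi[OF \<pi>] by fastforce
      ultimately have "0 < height n (act \<pi> (flip n \<beta> \<gamma>))" using sum_flip[of \<gamma>] by linarith
      then show "act \<pi> (flip n \<beta> \<gamma>) \<in> ?P"
        using flip_invs[OF \<beta> g(1)] Phi act_Phi[OF \<pi>] pos_iff_height by blast
    qed
    have surj: "flip n \<beta> ` ?T = ?U"
      by (rule card_subset_eq[OF fin(1) sub]) (simp only: card_image[OF inj] UT)
    show thesis
    proof (rule bruhat[OF \<beta> pos])
      fix \<gamma> assume g: "\<gamma> \<in> ?I" "\<gamma> \<noteq> \<beta>"
      have "act \<pi> \<gamma> \<in> ?P \<longleftrightarrow> act \<pi> (flip n \<beta> \<gamma>) \<notin> ?P"
      proof
        assume "act \<pi> \<gamma> \<in> ?P"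
        then have "\<gamma> \<in> flip n \<beta> ` ?T" using surj g by auto
        then obtain \<gamma>' where "\<gamma>' \<in> ?T" "\<gamma> = flip n \<beta> \<gamma>'" by blast
        then show "act \<pi> (flip n \<beta> \<gamma>) \<notin> ?P" by (simp add: flip_flip[OF \<beta>'])
      next
        assume "act \<pi> (flip n \<beta> \<gamma>) \<notin> ?P"
        then show "act \<pi> \<gamma> \<in> ?P" using sub g by blast
      qed
      then show "act \<pi> \<gamma> \<in> ?P \<longleftrightarrow> act \<pi> (reflection n \<beta> \<gamma>) \<in> ?P"
        using act_flip_pos_iff[OF \<pi> \<beta>' Phi[OF g(1)]] by simp
    qed
  next
    case 2
    have N: "card ?N \<le> card ?I" by (rule card_mono) (auto simp: finite_invs)
    have "(\<Sum>\<gamma>\<in>?I. ?c \<gamma>) = 2 + (\<Sum>\<gamma>\<in>?I - {\<beta>}. ?c \<gamma>)"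
      using sum.remove[OF finite_invs self_in_invs[OF \<beta>], of ?c] ip_coroot_self[OF \<beta>'] by simp
    moreover have "(\<Sum>\<gamma>\<in>?I - {\<beta>}. ?c \<gamma>) = (\<Sum>\<gamma>\<in>?I - {\<beta>}. ?c \<gamma> - 1) + (real (card ?I) - 1)"
      using self_in_invs[OF \<beta>] finite_invs[of n \<beta>] cardI by (simp add: sum_subtractf)
    \<comment> \<open>Both summands are nonnegative, as |N| is at most |I| and every pairing is at
      least 1; hence both vanish.\<close>
    ultimately have eq: "2 * (real (card ?I) - real (card ?N)) + (\<Sum>\<gamma>\<in>?I - {\<beta>}. ?c \<gamma> - 1) = 0"
      using 2 rho_coroot[OF \<beta>] by algebra
    have nonneg: "0 \<le> ?c \<gamma> - 1" if "\<gamma> \<in> ?I - {\<beta>}" for \<gamma>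
      using ip_coroot_ge_1[OF \<beta>, of \<gamma>] that by simp
    define S where "S = (\<Sum>\<gamma>\<in>?I - {\<beta>}. ?c \<gamma> - 1)"
    have "0 \<le> S" unfolding S_def using nonneg by (rule sum_nonneg)
    moreover have "real (card ?N) \<le> real (card ?I)" using N by simp
    moreover have "a = b \<and> s = 0" if "0 \<le> s" "a \<le> b" "2 * (b - a) + s = 0" for a b s :: real
      using that by auto
    ultimately have "real (card ?N) = real (card ?I) \<and> S = 0" using eq[folded S_def] by blast
    then have "card ?N = card ?I" "S = 0" by simp_all
    then have "?N = ?I" "\<forall>\<gamma>\<in>?I - {\<beta>}. ?c \<gamma> - 1 = 0"
      using card_subset_eq[of ?I ?N] finite_invs sum_nonneg_eq_0_iff[of "?I - {\<beta>}" "\<lambda>\<gamma>. ?c \<gamma> - 1"] nonneg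
      unfolding S_def
      by auto
    then show thesis by (intro quantum[OF \<beta>]) auto
  qed
qed

text \<open>If \<delta> were another root inverted by the reflection, the image of its reflection
  would be the simple root minus c times \<pi> \<beta> with c at least 1. The heights exclude this:
  positive simple roots have the least positive height, and the root with index 0 has the least
  height of all.\<close>

lemma qbg_edge_simple:
  assumes \<pi>: "sperm n \<pi>" and edge: "qbg_edge n (act \<pi>) \<beta>" and p: "1 \<le> n" "p \<le> n"
    and \<delta>: "\<delta> \<in> pos_roots n" "act \<pi> \<delta> = simple_root n p" and neg: "reflection n \<beta> \<delta> \<notin> pos_roots n"
  shows "\<delta> = \<beta>"
proof (rule ccontr)
  assume ne: "\<delta> \<noteq> \<beta>"
  have inv: "\<delta> \<in> invs n \<beta>" using \<delta> neg by (simp add: invs_def)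
  let ?c = "ip n \<delta> (coroot n \<beta>)"
  have Phi: "\<beta> \<in> Phi n" "\<delta> \<in> Phi n" using edge \<delta> pos_subset_Phi by (auto simp: qbg_edge_def)
  have c: "1 \<le> ?c" using ip_coroot_ge_1 inv edge by (auto simp: qbg_edge_def)
  have h: "height n (act \<pi> (reflection n \<beta> \<delta>)) = height n (simple_root n p) - ?c * height n (act \<pi> \<beta>)"
    by (simp add: reflection_eq height_vadd height_vscale \<delta>(2))
  have Phi': "act \<pi> (reflection n \<beta> \<delta>) \<in> Phi n" "act \<pi> \<beta> \<in> Phi n"
    using \<pi> Phi act_Phi reflection_Phi by auto
  from \<pi> edge show False
  proof (cases rule: qbg_edge_cases)
    case bruhat
    \<comment> \<open>In the Bruhat case the new root has the sign of the simple root but a height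
      smaller by at least 2: not positive for p > 0, and below the lowest root for p = 0.\<close>
    have "2 \<le> height n (act \<pi> \<beta>)" using bruhat height_pos_ge by blast
    then have "2 \<le> ?c * height n (act \<pi> \<beta>)"
      using c mult_mono[of 1 ?c 2 "height n (act \<pi> \<beta>)"] by simp
    then show False
      using bruhat(3)[OF inv ne] h height_ge_lowest[OF Phi'(1)] pos_iff_height[OF Phi'(1)]
        simple_root_pos_iff[OF p] height_simple[OF p] \<delta>(2) by (auto split: if_splits)
  next
    case quantum
    \<comment> \<open>In the quantum case \<pi> inverts \<delta>, so the simple root is negative,
      and c = 1. The new root is positive, yet its height is that of the lowest root minus that of
      \<pi> \<beta>, hence at most 0.\<close>
    have "p = 0" using quantum(2)[OF inv] \<delta>(2) simple_root_pos_iff[OF p] by simp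
    moreover have "act \<pi> (reflection n \<beta> \<delta>) \<in> pos_roots n"
      using quantum(2)[OF flip_invs[OF quantum(1) inv]] act_flip_pos_iff[OF \<pi> Phi] by simp
    moreover have "?c = 1" using quantum(3)[OF inv ne] .
    ultimately show False
      using h height_ge_lowest[OF Phi'(2)] pos_iff_height[OF Phi'(1)] height_simple[OF p]
      by auto
  qed
qed

text \<open>These are the edges of the right halves. They are never quantum, since the reflection
  inverts 2 e(i), whose pairing with the coroot of e(i) + e(j) is 2. In the Bruhat case the sign
  condition at 2 e(i) makes the images of i and j have opposite signs, and the condition at the
  roots (i,d) with |d| > i keeps all letters at later positions out of the gap.\<close>

lemma qbg_edge_sum_root:
  assumes \<pi>: "sperm n \<pi>" and edge: "qbg_edge n (act \<pi>) (root (i, - j))"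
    and ij: "1 \<le> j" "j < i" "i \<le> int n"
  shows "\<exists>t z. 0 < t \<and> t < z \<and> ((\<pi> i = t \<and> \<pi> j = - z) \<or> (\<pi> j = t \<and> \<pi> i = - z)) \<and>
     (\<forall>y. i < y \<and> y \<le> int n \<longrightarrow> \<not> (t < \<bar>\<pi> y\<bar> \<and> \<bar>\<pi> y\<bar> < z))"
proof -
  let ?\<beta> = "root (i, - j)"
  have l: "letter n i" "letter n j" "letter n (- j)" using ij by (auto simp: letter_def)
  have lp: "letter n (\<pi> i)" "letter n (\<pi> j)" using l sperm_letter[OF \<pi>] by auto
  have \<beta>: "?\<beta> \<in> pos_roots n" using edge by (simp add: qbg_edge_def)
  have neg: "\<pi> (- a) = - \<pi> a" for a using sperm_neg[OF \<pi>] .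
  have refl: "reflection n ?\<beta> = act (signed_reflection (i, - j))" "sperm n (signed_reflection (i, - j))"
    using l ij by (auto intro!: reflection_root sperm_signed_reflection)
  have sr: "signed_reflection (i, - j) i = - j" "signed_reflection (i, - j) (- i) = j"
      "\<And>d. i < \<bar>d\<bar> \<Longrightarrow> signed_reflection (i, - j) d = d"
    using ij by (auto simp: signed_reflection_apply)
  have hg: "hgt n i = 2 * int n + 1 - 2 * i" "hgt n j = 2 * int n + 1 - 2 * j"
    using ij by (auto simp: hgt_def)
  have r2: "reflection n ?\<beta> (root (i, - i)) = root (- j, j)"
    using l by (simp add: refl(1) act_root[OF refl(2)] sr)
  have two: "root (i, - i) \<in> invs n ?\<beta>" "root (i, - i) \<noteq> ?\<beta>"
    using l ij hg unfolding invs_def mem_Collect_eq r2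
    by (simp_all add: root_pos_iff root_eq_iff)
  have hpos: "0 < hgt n a \<longleftrightarrow> 0 < a" "hgt n a < 0 \<longleftrightarrow> a < 0" if "letter n a" for a
    using that by (auto simp: hgt_def letter_def sgn_if)
  have *: "\<pi> i \<noteq> - \<pi> j" using neg[of j] sperm_eq_iff[OF \<pi>, of i "- j"] ij by auto
  from \<pi> edge show ?thesis
  proof (cases rule: qbg_edge_cases)
    case quantum
    have "ip n (root (i, - i)) (coroot n ?\<beta>) = 2"
      using l ij by (simp add: ip_coroot coord_root coord_eps)
    then show ?thesis using quantum(3)[OF two(1,2)] by simp
  next
    case bruhat
    have sgn: "0 < \<pi> i \<longleftrightarrow> \<pi> j < 0"
      using bruhat(3)[OF two(1,2)] lp l letter_nonzero[OF lp(1)] letter_nonzero[OF lp(2)] hpos[OF lp(1)] hpos[OF lp(2)] unfolding r2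
      by (simp add: act_root[OF \<pi>] neg root_pos_iff)
    have pos: "0 < hgt n (\<pi> i) + hgt n (\<pi> j)"
      using bruhat(2) lp l * by (simp add: act_root[OF \<pi>] neg root_pos_iff)
    \<comment> \<open>The reflection takes (i,d) to (-j,d). Equal signs of their images say that
      \<open>\<pi> d\<close> does not separate \<open>\<pi> i\<close> from
      \<open>\<pi> (- j)\<close> in the order of letters.\<close>
    have free: "\<not> (hgt n (\<pi> i) \<le> hgt n (\<pi> d) \<and> hgt n (\<pi> d) < - hgt n (\<pi> j))"
        "\<not> (- hgt n (\<pi> j) \<le> hgt n (\<pi> d) \<and> hgt n (\<pi> d) < hgt n (\<pi> i))"
      if "i < \<bar>d\<bar>" "\<bar>d\<bar> \<le> int n" for d
    proof -
      have d: "letter n d" using that ij by (auto simp: letter_def)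
      have rd: "reflection n ?\<beta> (root (i, d)) = root (- j, d)"
        using l d that by (simp add: refl(1) act_root[OF refl(2)] sr)
      have "hgt n d < hgt n i" "- hgt n j < hgt n d"
        using hg that ij by (auto simp: hgt_def sgn_if)
      then have "root (i, d) \<in> invs n ?\<beta>" "root (i, d) \<noteq> ?\<beta>"
        using l d ij that unfolding invs_def mem_Collect_eq rd
        by (auto simp: root_pos_iff root_eq_iff)
      note bruhat(3)[OF this(1,2)] rd
      moreover have "\<pi> i \<noteq> \<pi> d" "- \<pi> j \<noteq> \<pi> d"
        using that ij sperm_eq_iff[OF \<pi>, of i d] sperm_eq_iff[OF \<pi>, of "- j" d] neg by auto
      ultimately have "hgt n (\<pi> d) < hgt n (\<pi> i) \<longleftrightarrow> hgt n (\<pi> d) < - hgt n (\<pi> j)"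
        using lp l d sperm_letter[OF \<pi>, of d]
        by (simp add: act_root[OF \<pi>] neg root_pos_iff)
      then show "\<not> (hgt n (\<pi> i) \<le> hgt n (\<pi> d) \<and> hgt n (\<pi> d) < - hgt n (\<pi> j))"
        "\<not> (- hgt n (\<pi> j) \<le> hgt n (\<pi> d) \<and> hgt n (\<pi> d) < hgt n (\<pi> i))" by auto
    qed
    show ?thesis
    proof (cases "0 < \<pi> i")
      case True
      show ?thesis
      proof (intro exI conjI allI impI)
        show "0 < \<pi> i" "\<pi> i < - \<pi> j" using True sgn pos by (auto simp: hgt_def)
        show "(\<pi> i = \<pi> i \<and> \<pi> j = - (- \<pi> j)) \<or> (\<pi> j = \<pi> i \<and> \<pi> i = - (- \<pi> j))" by simp
        fix y assume y: "i < y \<and> y \<le> int n"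
        show "\<not> (\<pi> i < \<bar>\<pi> y\<bar> \<and> \<bar>\<pi> y\<bar> < - \<pi> j)"
        proof (cases "0 < \<pi> y")
          case y0: True
          then show ?thesis using free(2)[of y] y True sgn ij by (auto simp: hgt_def)
        next
          case False
          then show ?thesis using free(2)[of "- y"] y True sgn ij by (auto simp: hgt_def neg sgn_if split: if_splits)
        qed
      qed
    next
      case False
      then have "\<pi> i < 0" "0 < \<pi> j" using sgn lp letter_nonzero[of n "\<pi> i"] letter_nonzero[of n "\<pi> j"] by auto
      show ?thesis
      proof (intro exI conjI allI impI)
        show "0 < \<pi> j" "\<pi> j < - \<pi> i" using \<open>\<pi> i < 0\<close> \<open>0 < \<pi> j\<close> pos by (auto simp: hgt_def)
        show "(\<pi> i = \<pi> j \<and> \<pi> j = - (- \<pi> i)) \<or> (\<pi> j = \<pi> j \<and> \<pi> i = - (- \<pi> i))" by simp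
        fix y assume y: "i < y \<and> y \<le> int n"
        show "\<not> (\<pi> j < \<bar>\<pi> y\<bar> \<and> \<bar>\<pi> y\<bar> < - \<pi> i)"
        proof (cases "0 < \<pi> y")
          case True
          then show ?thesis using free(2)[of "- y"] y \<open>\<pi> i < 0\<close> \<open>0 < \<pi> j\<close> ij
            by (auto simp: hgt_def neg)
        next
          case False
          then show ?thesis using free(2)[of y] y \<open>\<pi> i < 0\<close> \<open>0 < \<pi> j\<close> ij
            by (auto simp: hgt_def sgn_if split: if_splits)
        qed
      qed
    qed
  qed
qed

section \<open>The order of the roots in a block\<close>

text \<open>The place of the second letter in a row with first letter i: positive letters take the
  values up to n, the letter -i takes n + 1, and the other barred letters follow from n + 2 on by
  decreasing absolute value.\<close>

definition chain_rank :: "nat \<Rightarrow> int \<Rightarrow> int \<Rightarrow> int" where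
  "chain_rank n i x = (if 0 < x then x else if x = - i then int n + 1 else 2 * int n + 2 + x)"

definition before :: "nat \<Rightarrow> int \<times> int \<Rightarrow> int \<times> int \<Rightarrow> bool" where
  "before n e f \<longleftrightarrow> fst f < fst e \<or>
     (fst e = fst f \<and> chain_rank n (fst e) (snd e) < chain_rank n (fst e) (snd f))"

lemma before_irrefl: "\<not> before n e e"
  and before_asym: "before n e f \<Longrightarrow> \<not> before n f e"
  by (auto simp: before_def)

lemma before_Pair: "before n (i, x) (j, y) \<longleftrightarrow> j < i \<or> (i = j \<and> chain_rank n i x < chain_rank n i y)"
  by (auto simp: before_def)

lemma set_take_sorted_wrt:
  assumes "sorted_wrt R xs" "\<And>x. \<not> R x x" "\<And>x y. R x y \<Longrightarrow> \<not> R y x" "k < length xs"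
  shows "set (take k xs) = {x \<in> set xs. R x (xs ! k)}"
proof (intro equalityI subsetI)
  fix x assume "x \<in> set (take k xs)"
  then obtain i where "i < k" "x = xs ! i" using assms(4) by (auto simp: in_set_conv_nth)
  then show "x \<in> {x \<in> set xs. R x (xs ! k)}"
    using assms(1,4) by (auto simp: sorted_wrt_iff_nth_less)
next
  fix x assume "x \<in> {x \<in> set xs. R x (xs ! k)}"
  then obtain i where i: "i < length xs" "x = xs ! i" "R (xs ! i) (xs ! k)" by (auto simp: in_set_conv_nth)
  then have "i < k"
    using assms by (metis linorder_neqE_nat sorted_wrt_iff_nth_less)
  then show "x \<in> set (take k xs)" using i by (auto simp: in_set_conv_nth intro!: exI[of _ i])
qed

lemma distinct_sorted_wrt:
  assumes "sorted_wrt R xs" "\<And>x. \<not> R x x" shows "distinct xs"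
  using assms unfolding distinct_conv_nth sorted_wrt_iff_nth_less by (metis linorder_neqE_nat)

lemma sorted_wrt_concat_map:
  assumes "sorted_wrt Q is" "\<And>i. i \<in> set is \<Longrightarrow> sorted_wrt R (f i)"
    "\<And>i j x y. i \<in> set is \<Longrightarrow> j \<in> set is \<Longrightarrow> Q i j \<Longrightarrow> x \<in> set (f i) \<Longrightarrow> y \<in> set (f j) \<Longrightarrow> R x y"
  shows "sorted_wrt R (concat (map f is))"
  using assms
proof (induction "is")
  case (Cons i "is")
  have "R x y" if x: "x \<in> set (f i)" and y: "y \<in> set (concat (map f is))" for x y
  proof -
    obtain j where "j \<in> set is" "y \<in> set (f j)" using y by auto
    then show ?thesis using Cons.prems(1) Cons.prems(3)[of i j x y] x by simp
  qed
  moreover have "sorted_wrt R (concat (map f is))"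
  proof (rule Cons.IH)
    show "sorted_wrt Q is" using Cons.prems(1) by simp
    show "sorted_wrt R (f j)" if "j \<in> set is" for j using Cons.prems(2) that by simp
    show "R x y" if "j \<in> set is" "l \<in> set is" "Q j l" "x \<in> set (f j)" "y \<in> set (f l)" for j l x y
      using Cons.prems(3)[of j l x y] that by simp
  qed
  ultimately show ?case using Cons.prems(2) by (simp add: sorted_wrt_append)
qed simp

lemma sorted_wrt_rev_upto: "sorted_wrt (\<lambda>i j. j < i) (rev [a..b :: int])"
  by (simp add: sorted_wrt_rev)

lemma image_Pair_neg: "(a, b) \<in> (\<lambda>j :: int. (i, - j)) ` S \<longleftrightarrow> a = i \<and> - b \<in> S"
  by (auto intro!: image_eqI[where x = "- b"])

lemma set_Gamma_l:
  "set (Gamma_l n k) = {(i, x). 1 \<le> i \<and> i \<le> int k \<and>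
     ((int k < x \<and> x \<le> int n) \<or> x = - i \<or> (int k < - x \<and> - x \<le> int n) \<or> (1 \<le> - x \<and> - x < i))}"
proof -
  have "e \<in> set (Gamma_l n k) \<longleftrightarrow> 1 \<le> fst e \<and> fst e \<le> int k \<and> e \<in> set (Gamma_ki n (int k) (fst e))" for e
    unfolding Gamma_l_def Gamma_ki_def by auto
  then show ?thesis unfolding Gamma_ki_def by (auto simp: image_Pair_neg)
qed

lemma set_Gamma_r: "set (Gamma_r k) = {(i, x). i \<le> int k \<and> 1 \<le> - x \<and> - x < i}"
  unfolding Gamma_r_def Gamma_i_def by (auto simp: image_Pair_neg)

lemma sorted_Gamma_l: "k \<le> n \<Longrightarrow> sorted_wrt (before n) (Gamma_l n k)"
  unfolding Gamma_l_def
proof (rule sorted_wrt_concat_map[OF sorted_wrt_rev_upto])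
  fix i assume k: "k \<le> n" and i: "i \<in> set (rev [1..int k])"
  show "sorted_wrt (before n) (Gamma_ki n (int k) i)"
    unfolding Gamma_ki_def sorted_wrt_append sorted_wrt_map
  proof (intro conjI)
    show "sorted_wrt (\<lambda>x y. before n (i, x) (i, y)) [int k + 1..int n]"
      by (rule sorted_wrt_mono_rel[OF _ sorted_wrt_upto]) (auto simp: before_Pair chain_rank_def)
    show "sorted_wrt (\<lambda>x y. before n (i, - x) (i, - y)) (rev [int k + 1..int n])"
      by (rule sorted_wrt_mono_rel[OF _ sorted_wrt_rev_upto])
         (use i in \<open>auto simp: before_Pair chain_rank_def\<close>)
    show "sorted_wrt (\<lambda>x y. before n (i, - x) (i, - y)) (rev [1..i - 1])"
      by (rule sorted_wrt_mono_rel[OF _ sorted_wrt_rev_upto]) (auto simp: before_Pair chain_rank_def)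
  qed (use i k in \<open>auto simp: before_Pair chain_rank_def\<close>)
next
  fix i j :: int and e f assume "j < i" "e \<in> set (Gamma_ki n (int k) i)" "f \<in> set (Gamma_ki n (int k) j)"
  moreover from this have "fst e = i" "fst f = j" by (auto simp: Gamma_ki_def)
  ultimately show "before n e f" by (simp add: before_def)
qed

lemma sorted_Gamma_r: "sorted_wrt (before n) (Gamma_r k)"
  unfolding Gamma_r_def
proof (rule sorted_wrt_concat_map[OF sorted_wrt_rev_upto])
  fix i :: int
  show "sorted_wrt (before n) (Gamma_i i)"
    unfolding Gamma_i_def sorted_wrt_map
    by (rule sorted_wrt_mono_rel[OF _ sorted_wrt_rev_upto]) (auto simp: before_Pair chain_rank_def)
next
  fix i j :: int and e f assume "j < i" "e \<in> set (Gamma_i i)" "f \<in> set (Gamma_i j)"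
  moreover from this have "fst e = i" "fst f = j" by (auto simp: Gamma_i_def)
  ultimately show "before n e f" by (simp add: before_def)
qed

section \<open>Fundamental weights and the multiplicity of roots in a block\<close>

definition omega :: "nat \<Rightarrow> rvec" where
  "omega k = (\<lambda>i. if 1 \<le> i \<and> i \<le> k then 1 else 0)"

lemma coord_omega: "coord (omega k) a = (if \<bar>a\<bar> \<le> int k then of_int (sgn a) else 0)"
  by (auto simp: coord_def omega_def sgn_if)

lemma Gamma_l_letters:
  "k \<le> n \<Longrightarrow> (i, x) \<in> set (Gamma_l n k) \<Longrightarrow> letter n i \<and> letter n x \<and> i \<noteq> x \<and> hgt n x < hgt n i"
  by (auto simp: set_Gamma_l letter_def hgt_def sgn_if)

lemma Gamma_r_subset_l: "set (Gamma_r k) \<subseteq> set (Gamma_l n k)"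
  by (auto simp: set_Gamma_l set_Gamma_r)

lemma pos_rootE:
  assumes "\<beta> \<in> pos_roots n"
  obtains a b where "\<beta> = root (a, b)" "1 \<le> a" "a \<le> int n" "letter n b"
    "(a < b \<and> b \<le> int n) \<or> (1 \<le> - b \<and> - b \<le> a)"
proof -
  have "\<beta> \<in> Phi n" using assms pos_subset_Phi by blast
  then obtain a b where ab: "\<beta> = root (a, b)" "letter n a" "letter n b" "a \<noteq> b" by (elim PhiE)
  then have h: "hgt n b < hgt n a" using assms root_pos_iff by auto
  show thesis
  proof (cases "0 < a \<and> (a < b \<or> (b < 0 \<and> - b \<le> a))")
    case True
    then show thesis using ab that[of a b] by (auto simp: letter_def)
  next
    case False
    then show thesis using ab h that[of "- b" "- a"]
      by (auto simp: letter_def root_neg_neg hgt_def sgn_if split: if_splits)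
  qed
qed

text \<open>The block of height k is a chain for \<open>omega k\<close>: a root occurs as often as
  its pairing says. Pairing 1 or 2 puts it into the left half, pairing 2 into the right half as
  well.\<close>

lemma pos_root_omega:
  assumes k: "k \<le> n" and \<beta>: "\<beta> \<in> pos_roots n"
  shows "ip n (omega k) (coroot n \<beta>) \<in> {0, 1, 2}"
    and "\<beta> \<in> root ` set (Gamma_l n k) \<longleftrightarrow> 0 < ip n (omega k) (coroot n \<beta>)"
    and "\<beta> \<in> root ` set (Gamma_r k) \<longleftrightarrow> ip n (omega k) (coroot n \<beta>) = 2"
proof -
  obtain a b where ab: "\<beta> = root (a, b)" "1 \<le> a" "a \<le> int n" "letter n b"
    "(a < b \<and> b \<le> int n) \<or> (1 \<le> - b \<and> - b \<le> a)" using pos_rootE[OF \<beta>] .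
  have l: "letter n a" "a \<noteq> b" using ab by (auto simp: letter_def)
  have ip: "ip n (omega k) (coroot n \<beta>) =
     (if b = - a then (if a \<le> int k then 1 else 0)
      else (if a \<le> int k then 1 else 0) - (if \<bar>b\<bar> \<le> int k then of_int (sgn b) else 0))"
    using ab l by (auto simp: ip_coroot coord_omega)
  show "ip n (omega k) (coroot n \<beta>) \<in> {0, 1, 2}"
    unfolding ip using ab by (auto simp: sgn_if)
  have mem: "\<beta> \<in> root ` S \<longleftrightarrow> (a, b) \<in> S \<or> (- b, - a) \<in> S"
    if "\<And>i x. (i, x) \<in> S \<Longrightarrow> i \<noteq> 0 \<and> x \<noteq> 0 \<and> i \<noteq> x" for S
  proof
    assume "\<beta> \<in> root ` S"
    then obtain i x where "(i, x) \<in> S" "root (a, b) = root (i, x)" using ab by auto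
    then show "(a, b) \<in> S \<or> (- b, - a) \<in> S"
      using root_eq_iff[of a b i x] that l ab letter_nonzero by fastforce
  next
    assume "(a, b) \<in> S \<or> (- b, - a) \<in> S"
    then show "\<beta> \<in> root ` S" using ab(1) root_neg_neg[of b a] by (metis imageI)
  qed
  have nz: "(i, x) \<in> set (Gamma_l n k) \<Longrightarrow> i \<noteq> 0 \<and> x \<noteq> 0 \<and> i \<noteq> x" for i x
    using Gamma_l_letters[OF k] by (auto simp: letter_def)
  then have nz': "(i, x) \<in> set (Gamma_r k) \<Longrightarrow> i \<noteq> 0 \<and> x \<noteq> 0 \<and> i \<noteq> x" for i x
    using Gamma_r_subset_l by blast
  have mem_l: "\<beta> \<in> root ` set (Gamma_l n k) \<longleftrightarrow> (a, b) \<in> set (Gamma_l n k) \<or> (- b, - a) \<in> set (Gamma_l n k)"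
    by (rule mem) (use nz in blast)
  have mem_r: "\<beta> \<in> root ` set (Gamma_r k) \<longleftrightarrow> (a, b) \<in> set (Gamma_r k) \<or> (- b, - a) \<in> set (Gamma_r k)"
    by (rule mem) (use nz' in blast)
  show "\<beta> \<in> root ` set (Gamma_l n k) \<longleftrightarrow> 0 < ip n (omega k) (coroot n \<beta>)"
    unfolding mem_l ip using ab(2-) k
    by (auto simp: set_Gamma_l letter_def sgn_if)
  show "\<beta> \<in> root ` set (Gamma_r k) \<longleftrightarrow> ip n (omega k) (coroot n \<beta>) = 2"
    unfolding mem_r ip using ab(2-) k
    by (auto simp: set_Gamma_r letter_def sgn_if)
qed

lemma inj_on_root_Gamma_l: "k \<le> n \<Longrightarrow> inj_on root (set (Gamma_l n k))"
proof (rule inj_onI)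
  fix e f assume k: "k \<le> n" and e: "e \<in> set (Gamma_l n k)" and f: "f \<in> set (Gamma_l n k)" and eq: "root e = root f"
  obtain i x i' x' where [simp]: "e = (i, x)" "f = (i', x')" by fastforce
  have "(i = i' \<and> x = x') \<or> (i = - x' \<and> x = - i')"
    using root_eq_iff[of i x i' x'] eq Gamma_l_letters[OF k, of i x] Gamma_l_letters[OF k, of i' x'] e f
    by (auto simp: letter_def)
  then show "e = f" using e f by (auto simp: set_Gamma_l)
qed

lemma inj_on_root_Gamma_r: "k \<le> n \<Longrightarrow> inj_on root (set (Gamma_r k))"
  by (rule inj_on_subset[OF inj_on_root_Gamma_l Gamma_r_subset_l])

lemma root_mem_take_iff:
  assumes "sorted_wrt (before n) xs" "m < length xs" "xs ! m = (i, x)"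
    and nz: "\<And>i x. (i, x) \<in> set xs \<Longrightarrow> i \<noteq> 0 \<and> x \<noteq> 0 \<and> i \<noteq> x"
    and ab: "a \<noteq> 0" "b \<noteq> 0" "a \<noteq> b"
  shows "root (a, b) \<in> root ` set (take m xs) \<longleftrightarrow>
    ((a, b) \<in> set xs \<and> before n (a, b) (i, x)) \<or> ((- b, - a) \<in> set xs \<and> before n (- b, - a) (i, x))"
proof -
  have take: "set (take m xs) = {e \<in> set xs. before n e (i, x)}"
    using set_take_sorted_wrt[OF assms(1) before_irrefl before_asym assms(2)] assms(3) by simp
  show ?thesis
  proof
    assume "root (a, b) \<in> root ` set (take m xs)"
    then obtain i' x' where *: "(i', x') \<in> set xs" "before n (i', x') (i, x)" "root (a, b) = root (i', x')"
      using take by auto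
    then show "((a, b) \<in> set xs \<and> before n (a, b) (i, x)) \<or> ((- b, - a) \<in> set xs \<and> before n (- b, - a) (i, x))"
      using root_eq_iff[of a b i' x'] nz[OF *(1)] ab by auto
  next
    assume "((a, b) \<in> set xs \<and> before n (a, b) (i, x)) \<or> ((- b, - a) \<in> set xs \<and> before n (- b, - a) (i, x))"
    then have "(a, b) \<in> set (take m xs) \<or> (- b, - a) \<in> set (take m xs)" using take by simp
    then show "root (a, b) \<in> root ` set (take m xs)" using root_neg_neg[of b a] by (metis imageI)
  qed
qed

text \<open>
  A point in general position on the hyperplane of the root (i,x) of the chain. In the l-part, its
  sign on another positive root tells whether that root occurs before (i,x). In the r-part this is
  true of the roots on which \<open>omega k\<close> is 0 or 2.
\<close>

definition wall_coord :: "nat \<Rightarrow> nat \<Rightarrow> int \<Rightarrow> int \<Rightarrow> int \<Rightarrow> int" where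
  "wall_coord n k i x a =
     (let Y = (\<lambda>a. if a \<le> int k \<and> i < a then int n + 1 + a else a - int n - 1) in
      if a = i then (if x = - i then 0 else if 0 < x then Y x else - Y (- x)) else Y a)"

definition wall_vec :: "nat \<Rightarrow> nat \<Rightarrow> int \<Rightarrow> int \<Rightarrow> rvec" where
  "wall_vec n k i x = (\<lambda>a. of_int (wall_coord n k i x (int a)))"

lemma ip_wall_vec:
  assumes "letter n a" "letter n b"
  shows "ip n (wall_vec n k i x) (root (a, b)) =
    of_int (sgn a * wall_coord n k i x \<bar>a\<bar> - sgn b * wall_coord n k i x \<bar>b\<bar>)"
  using assms by (simp add: ip_root coord_def wall_vec_def)

text \<open>Rows between i and k, which are exhausted, get coordinates above n + 1, and the other
  rows get values from -n to -1, so that sums with a finished row are positive and sums of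
  unfinished rows negative. The coordinate at i is chosen to make (i,x) vanish. As x runs through
  its row, this coordinate passes the values of the letters already treated.\<close>

lemma wall_vec_l:
  assumes k: "k \<le> n" and m: "m < length (Gamma_l n k)" and ix: "Gamma_l n k ! m = (i, x)"
  shows "ip n (wall_vec n k i x) (root (i, x)) = 0"
    and "\<gamma> \<in> pos_roots n \<Longrightarrow> \<gamma> \<noteq> root (i, x) \<Longrightarrow> ip n (wall_vec n k i x) \<gamma> \<noteq> 0 \<and>
        (0 < ip n (wall_vec n k i x) \<gamma> \<longleftrightarrow> \<gamma> \<in> root ` set (take m (Gamma_l n k)))"
proof -
  have mem: "(i, x) \<in> set (Gamma_l n k)" using m ix by (metis nth_mem)
  have l: "letter n i" "letter n x" "i \<noteq> x" "1 \<le> i" "i \<le> int k"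
    using Gamma_l_letters[OF k mem] mem by (auto simp: set_Gamma_l)
  have x: "(int k < x \<and> x \<le> int n) \<or> x = - i \<or> (int k < - x \<and> - x \<le> int n) \<or> (1 \<le> - x \<and> - x < i)"
    using mem by (simp add: set_Gamma_l)
  show "ip n (wall_vec n k i x) (root (i, x)) = 0"
  proof -
    have "wall_coord n k i x i = sgn x * wall_coord n k i x \<bar>x\<bar>"
      using x l(3-5) by (elim disjE conjE) (simp_all add: wall_coord_def Let_def sgn_if)
    then show ?thesis using l(4) by (simp add: ip_wall_vec[OF l(1,2)])
  qed
  assume \<gamma>: "\<gamma> \<in> pos_roots n" "\<gamma> \<noteq> root (i, x)"
  obtain a b where ab: "\<gamma> = root (a, b)" "1 \<le> a" "a \<le> int n" "letter n b"
    "(a < b \<and> b \<le> int n) \<or> (1 \<le> - b \<and> - b \<le> a)" using pos_rootE[OF \<gamma>(1)] .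
  have nab: "letter n a" "a \<noteq> 0" "b \<noteq> 0" "a \<noteq> b" using ab by (auto simp: letter_def)
  have ne: "\<not> (a = i \<and> b = x)" "\<not> (a = - x \<and> b = - i)"
    using \<gamma>(2) ab(1) root_neg_neg[of x i] by auto
  have nz: "(i, x) \<in> set (Gamma_l n k) \<Longrightarrow> i \<noteq> 0 \<and> x \<noteq> 0 \<and> i \<noteq> x" for i x
    using Gamma_l_letters[OF k] by (auto simp: letter_def)
  have memg: "\<gamma> \<in> root ` set (take m (Gamma_l n k)) \<longleftrightarrow>
     ((a, b) \<in> set (Gamma_l n k) \<and> before n (a, b) (i, x)) \<or> ((- b, - a) \<in> set (Gamma_l n k) \<and> before n (- b, - a) (i, x))"
    unfolding ab(1) by (rule root_mem_take_iff[OF sorted_Gamma_l[OF k] m ix _ nab(2-4)]) (rule nz)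
  define A B where "A = wall_coord n k i x a" and "B = wall_coord n k i x \<bar>b\<bar>"
  have ipg: "ip n (wall_vec n k i x) \<gamma> = of_int (A - sgn b * B)"
    unfolding ab(1) ip_wall_vec[OF nab(1) ab(4)] A_def B_def using ab(2) by simp
  consider (pos) "a < b" "b \<le> int n" | (long) "b = - a" | (neg) "1 \<le> - b" "- b < a" using ab(5) by linarith
  then have "A - sgn b * B \<noteq> 0 \<and> (0 < A - sgn b * B \<longleftrightarrow>
     ((a, b) \<in> set (Gamma_l n k) \<and> before n (a, b) (i, x)) \<or> ((- b, - a) \<in> set (Gamma_l n k) \<and> before n (- b, - a) (i, x)))"
  proof cases
    case pos
    have 1: "(a, b) \<in> set (Gamma_l n k) \<longleftrightarrow> a \<le> int k \<and> int k < b" "(- b, - a) \<notin> set (Gamma_l n k)" "sgn b = 1"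
      using pos ab by (auto simp: set_Gamma_l)
    show ?thesis unfolding 1 before_Pair chain_rank_def A_def B_def wall_coord_def Let_def
      using x l pos ab ne k by (elim disjE) (auto split: if_splits)
  next
    case long
    have 1: "(a, b) \<in> set (Gamma_l n k) \<longleftrightarrow> a \<le> int k" "- b = a" "- a = b" "sgn b = - 1" "B = A"
      using long ab by (auto simp: set_Gamma_l A_def B_def)
    show ?thesis unfolding 1 before_Pair chain_rank_def A_def wall_coord_def Let_def
      using x l long ab ne k by (elim disjE) (auto split: if_splits)
  next
    case neg
    have 1: "(a, b) \<in> set (Gamma_l n k) \<longleftrightarrow> a \<le> int k"
        "(- b, - a) \<in> set (Gamma_l n k) \<longleftrightarrow> - b \<le> int k \<and> int k < a" "sgn b = - 1" "\<bar>b\<bar> = - b"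
      using neg ab by (auto simp: set_Gamma_l)
    show ?thesis unfolding 1 before_Pair chain_rank_def A_def B_def wall_coord_def Let_def
      using x l neg ab ne k by (elim disjE) (auto split: if_splits)
  qed
  then show "ip n (wall_vec n k i x) \<gamma> \<noteq> 0 \<and>
        (0 < ip n (wall_vec n k i x) \<gamma> \<longleftrightarrow> \<gamma> \<in> root ` set (take m (Gamma_l n k)))"
    unfolding memg ipg of_int_eq_0_iff of_int_0_less_iff .
qed

text \<open>The same point serves the right half. A root of pairing 1 may be positive on it without
  occurring in that half, hence the restriction to the other roots.\<close>

lemma wall_vec_r:
  assumes k: "k \<le> n" and m: "m < length (Gamma_r k)" and ix: "Gamma_r k ! m = (i, x)"
  shows "ip n (wall_vec n k i x) (root (i, x)) = 0"
    and "\<gamma> \<in> pos_roots n \<Longrightarrow> \<gamma> \<noteq> root (i, x) \<Longrightarrow> ip n (omega k) (coroot n \<gamma>) \<noteq> 1 \<Longrightarrow>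
        ip n (wall_vec n k i x) \<gamma> \<noteq> 0 \<and>
        (0 < ip n (wall_vec n k i x) \<gamma> \<longleftrightarrow> \<gamma> \<in> root ` set (take m (Gamma_r k)))"
proof -
  have mem: "(i, x) \<in> set (Gamma_r k)" using m ix by (metis nth_mem)
  have x: "i \<le> int k" "1 \<le> - x" "- x < i" using mem by (auto simp: set_Gamma_r)
  have l: "letter n i" "letter n x" "i \<noteq> x" using x k by (auto simp: letter_def)
  show "ip n (wall_vec n k i x) (root (i, x)) = 0"
  proof -
    have "wall_coord n k i x i = sgn x * wall_coord n k i x \<bar>x\<bar>"
      using x by (simp add: wall_coord_def Let_def sgn_if)
    then show ?thesis using x by (simp add: ip_wall_vec[OF l(1,2)])
  qed
  assume \<gamma>: "\<gamma> \<in> pos_roots n" "\<gamma> \<noteq> root (i, x)" "ip n (omega k) (coroot n \<gamma>) \<noteq> 1"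
  obtain a b where ab: "\<gamma> = root (a, b)" "1 \<le> a" "a \<le> int n" "letter n b"
    "(a < b \<and> b \<le> int n) \<or> (1 \<le> - b \<and> - b \<le> a)" using pos_rootE[OF \<gamma>(1)] .
  have nab: "letter n a" "a \<noteq> 0" "b \<noteq> 0" "a \<noteq> b" using ab by (auto simp: letter_def)
  have ne: "\<not> (a = i \<and> b = x)" "\<not> (a = - x \<and> b = - i)"
    using \<gamma>(2) ab(1) root_neg_neg[of x i] by auto
  have nz: "(i, x) \<in> set (Gamma_r k) \<Longrightarrow> i \<noteq> 0 \<and> x \<noteq> 0 \<and> i \<noteq> x" for i x
    by (auto simp: set_Gamma_r)
  have memg: "\<gamma> \<in> root ` set (take m (Gamma_r k)) \<longleftrightarrow>
     ((a, b) \<in> set (Gamma_r k) \<and> before n (a, b) (i, x)) \<or> ((- b, - a) \<in> set (Gamma_r k) \<and> before n (- b, - a) (i, x))"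
    unfolding ab(1) by (rule root_mem_take_iff[OF sorted_Gamma_r m ix _ nab(2-4)]) (rule nz)
  have om: "(if b = - a then if a \<le> int k then 1 else 0
      else (if a \<le> int k then 1 else 0) - (if \<bar>b\<bar> \<le> int k then sgn b else 0)) \<noteq> 1"
    using \<gamma>(3) ab nab by (auto simp: ip_coroot coord_omega split: if_splits)
  define A B where "A = wall_coord n k i x a" and "B = wall_coord n k i x \<bar>b\<bar>"
  have ipg: "ip n (wall_vec n k i x) \<gamma> = of_int (A - sgn b * B)"
    unfolding ab(1) ip_wall_vec[OF nab(1) ab(4)] A_def B_def using ab(2) by simp
  consider (pos) "a < b" "b \<le> int n" | (long) "b = - a" | (neg) "1 \<le> - b" "- b < a" using ab(5) by linarith
  then have "A - sgn b * B \<noteq> 0 \<and> (0 < A - sgn b * B \<longleftrightarrow>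
     ((a, b) \<in> set (Gamma_r k) \<and> before n (a, b) (i, x)) \<or> ((- b, - a) \<in> set (Gamma_r k) \<and> before n (- b, - a) (i, x)))"
  proof cases
    case pos
    have 1: "(a, b) \<notin> set (Gamma_r k)" "(- b, - a) \<notin> set (Gamma_r k)" "sgn b = 1" "\<bar>b\<bar> = b" "b \<noteq> - a"
      using pos ab by (auto simp: set_Gamma_r)
    have "A - B < 0" using om x pos ab(2,3) ne(1) k unfolding 1(3-5) A_def B_def wall_coord_def Let_def
      by (auto split: if_splits)
    then show ?thesis using 1(1-3) by simp
  next
    case long
    have 1: "(a, b) \<notin> set (Gamma_r k)" "(- b, - a) \<notin> set (Gamma_r k)" "sgn b = - 1" "B = A"
      using long ab by (auto simp: set_Gamma_r A_def B_def)
    have "A < 0" using om x long ab(2,3) k unfolding A_def wall_coord_def Let_def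
      by (auto split: if_splits)
    then show ?thesis using 1 by simp
  next
    case neg
    have 1: "(a, b) \<in> set (Gamma_r k) \<longleftrightarrow> a \<le> int k" "(- b, - a) \<notin> set (Gamma_r k)" "sgn b = - 1" "\<bar>b\<bar> = - b" "b \<noteq> - a"
      using neg ab by (auto simp: set_Gamma_r)
    have om': "a \<le> int k \<longleftrightarrow> - b \<le> int k" using om neg unfolding 1(3-5) by (auto split: if_splits)
    have "A + B \<noteq> 0 \<and> (0 < A + B \<longleftrightarrow> a \<le> int k \<and> before n (a, b) (i, x))"
      using om' x neg ab(2,3) ne k unfolding 1(4) before_Pair chain_rank_def A_def B_def wall_coord_def Let_def
      by (auto split: if_splits)
    then show ?thesis using 1(1-3) by simp
  qed
  then show "ip n (wall_vec n k i x) \<gamma> \<noteq> 0 \<and>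
        (0 < ip n (wall_vec n k i x) \<gamma> \<longleftrightarrow> \<gamma> \<in> root ` set (take m (Gamma_r k)))"
    unfolding memg ipg of_int_eq_0_iff of_int_0_less_iff .
qed

section \<open>The chain and its prefix products\<close>

lemma sorted_list_of_set_less_Suc:
  "sorted_list_of_set {i \<in> A. i < Suc j} = sorted_list_of_set {i \<in> A. i < j} @ (if j \<in> A then [j] else [])"
proof -
  have eq: "sorted_list_of_set {i \<in> A. i < j} = filter (\<lambda>i. i \<in> A) [0..<j]" for j
  proof -
    have "{i \<in> A. i < j} = set (filter (\<lambda>i. i \<in> A) [0..<j])" by auto
    then show ?thesis
      by (simp only:) (rule sorted_list_of_set.idem_if_sorted_distinct; simp add: sorted_wrt_filter)
  qed
  show ?thesis unfolding eq by simp
qed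

locale lambda_chain =
  fixes n :: nat and lam :: "nat list"
  assumes n_pos: "1 \<le> n" and partition: "is_partition lam" and length_le: "length lam \<le> n"
begin

abbreviation num_parts :: nat where "num_parts \<equiv> 2 * first_part lam"

text \<open>Parts are counted from 0: the parts 2q and 2q + 1 are the left and right half of the
  block for the column q + 1 of the partition and share its height.\<close>

definition col_height :: "nat \<Rightarrow> nat" where
  "col_height c = conj_part lam (c div 2 + 1)"

definition part :: "nat \<Rightarrow> (int \<times> int) list" where
  "part c = (if even c then Gamma_l n (col_height c) else Gamma_r (col_height c))"

definition start :: "nat \<Rightarrow> nat" where
  "start c = length (concat (map part [0..<c]))"

lemma blocks_eq: "blocks n lam = map part [0..<num_parts]"
proof -
  have "concat (map (\<lambda>j. [Gamma_l n (conj_part lam j), Gamma_r (conj_part lam j)]) [1..<Suc N]) =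
     map part [0..<2 * N]" for N
    by (induction N) (simp_all add: part_def col_height_def)
  then show ?thesis by (simp add: blocks_def)
qed

lemma col_height_le: "col_height c \<le> n"
  unfolding col_height_def conj_part_def using length_filter_le length_le le_trans by blast

lemma start_0 [simp]: "start 0 = 0"
  and start_Suc: "start (Suc c) = start c + length (part c)"
  by (simp_all add: start_def)

lemma start_num_parts: "start num_parts = chain_length n lam"
  by (simp add: start_def chain_length_def chain_def blocks_eq)

lemma start_mono: "c \<le> d \<Longrightarrow> start c \<le> start d"
  by (rule lift_Suc_mono_le[of start]) (simp_all add: start_Suc)

lemma chain_split:
  assumes "c \<le> num_parts"
  shows "chain n lam = concat (map part [0..<c]) @ concat (map part [c..<num_parts])"
proof -
  have "[0..<num_parts] = [0..<c] @ [c..<num_parts]" using assms by (metis le_add_diff_inverse upt_add_eq_append zero_le)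
  then show ?thesis by (simp add: chain_def blocks_eq)
qed

lemma take_start: "c \<le> num_parts \<Longrightarrow> take (start c) (chain n lam) = concat (map part [0..<c])"
  by (subst chain_split[of c]) (simp_all add: start_def)

lemma chain_nth: "c < num_parts \<Longrightarrow> m < length (part c) \<Longrightarrow> chain n lam ! (start c + m) = part c ! m"
  by (subst chain_split[of "Suc c"]) (auto simp: start_def nth_append)

lemma start_add_less: "c < num_parts \<Longrightarrow> m < length (part c) \<Longrightarrow> start c + m < chain_length n lam"
  using start_mono[of "Suc c" num_parts] by (simp add: start_Suc start_num_parts)

lemma chain_positionE:
  assumes "j < chain_length n lam"
  obtains c m where "c < num_parts" "m < length (part c)" "j = start c + m"
proof -
  have "\<exists>c' m. c' < c \<and> m < length (part c') \<and> j = start c' + m" if "j < start c" for c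
    using that
  proof (induction c)
    case (Suc c)
    show ?case
    proof (cases "j < start c")
      case True
      then show ?thesis using Suc.IH less_SucI by blast
    next
      case False
      then show ?thesis using Suc.prems by (intro exI[of _ c] exI[of _ "j - start c"]) (auto simp: start_Suc)
    qed
  qed simp
  then show thesis using assms that by (metis start_num_parts)
qed

lemma part_subset: "set (part c) \<subseteq> set (Gamma_l n (col_height c))"
  using Gamma_r_subset_l by (auto simp: part_def)

lemma chain_letters:
  assumes "j < chain_length n lam" "chain n lam ! j = (a, b)"
  shows "letter n a" "letter n b" "a \<noteq> b" "root (a, b) \<in> pos_roots n"
proof -
  obtain c m where "c < num_parts" "m < length (part c)" "j = start c + m"
    using assms by (elim chain_positionE)
  then have "(a, b) \<in> set (Gamma_l n (col_height c))"
    using chain_nth part_subset assms by (metis nth_mem subsetD)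
  then have "letter n a \<and> letter n b \<and> a \<noteq> b \<and> hgt n b < hgt n a"
    using Gamma_l_letters col_height_le by blast
  then show "letter n a" "letter n b" "a \<noteq> b" "root (a, b) \<in> pos_roots n"
    by (auto simp: root_pos_iff)
qed

lemma chain_root_pos: "j < chain_length n lam \<Longrightarrow> chain_root n lam j \<in> pos_roots n"
  using chain_letters[of j] by (metis chain_root_def surj_pair)

lemma chain_root_Phi: "j < chain_length n lam \<Longrightarrow> chain_root n lam j \<in> Phi n"
  using chain_root_pos pos_subset_Phi by blast

lemma chain_reflection:
  assumes "j < chain_length n lam"
  shows "sperm n (signed_reflection (chain n lam ! j))"
    "reflection n (chain_root n lam j) = act (signed_reflection (chain n lam ! j))"
    "inv (signed_reflection (chain n lam ! j)) = signed_reflection (chain n lam ! j)"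
proof -
  obtain a b where ab: "chain n lam ! j = (a, b)" by fastforce
  note l = chain_letters[OF assms ab]
  show "sperm n (signed_reflection (chain n lam ! j))"
    "reflection n (chain_root n lam j) = act (signed_reflection (chain n lam ! j))"
    "inv (signed_reflection (chain n lam ! j)) = signed_reflection (chain n lam ! j)"
    using l letter_nonzero
    by (auto simp: ab chain_root_def reflection_root inv_signed_reflection intro: sperm_signed_reflection)
qed

text \<open>The product of the folded reflections before position j as a signed permutation: its
  action is \<open>prefix_prod\<close>, and its values at the ends of the parts are
  \<open>signed_perm\<close>.\<close>

definition W :: "nat set \<Rightarrow> nat \<Rightarrow> int \<Rightarrow> int" where
  "W J j = compose_list (map signed_reflection (nths (take j (chain n lam)) J))"

lemma W_0 [simp]: "W J 0 = id"
  by (simp add: W_def)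

lemma W_Suc:
  assumes "j < chain_length n lam"
  shows "W J (Suc j) = (if j \<in> J then W J j \<circ> signed_reflection (chain n lam ! j) else W J j)"
  using assms
  by (simp add: W_def chain_length_def take_Suc_conv_app_nth nths_append compose_list_snoc)

lemma sperm_W: "j \<le> chain_length n lam \<Longrightarrow> sperm n (W J j)"
  by (induction j) (auto simp: W_Suc sperm_id intro!: sperm_comp chain_reflection)

lemma signed_perm_eq: "q \<le> num_parts \<Longrightarrow> signed_perm n lam J q = W J (start q)"
proof -
  assume q: "q \<le> num_parts"
  have "concat (map (T_seq n lam J) [1..<Suc q]) = nths (concat (map part [0..<q])) J"
    using q
  proof (induction q)
    case (Suc q)
    then have "T_seq n lam J (Suc q) = nths (part q) {i. i + start q \<in> J}"
      by (simp add: T_seq_def blocks_eq take_map start_def add.commute)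
    then show ?case using Suc by (simp add: nths_append start_def)
  qed simp
  then show ?thesis using q by (simp add: signed_perm_def W_def take_start)
qed

lemma prefix_prod_eq: "j \<le> chain_length n lam \<Longrightarrow> prefix_prod n lam J j = act (W J j)"
proof (induction j)
  case (Suc j)
  then have j: "j < chain_length n lam" by simp
  have "prefix_prod n lam J (Suc j) =
      (if j \<in> J then prefix_prod n lam J j \<circ> reflection n (chain_root n lam j) else prefix_prod n lam J j)"
    by (simp add: prefix_prod_def sorted_list_of_set_less_Suc[of J j] compose_list_snoc)
  then show ?case
    using Suc j act_comp[OF sperm_W chain_reflection(1)[OF j], of j J]
    by (simp only: W_Suc[OF j] chain_reflection(2)[OF j]) simp
qed (simp add: prefix_prod_def)

definition part_count :: "rvec \<Rightarrow> nat \<Rightarrow> nat" where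
  "part_count \<beta> c = (if \<beta> \<in> root ` set (part c) then 1 else 0)"

lemma distinct_part: "distinct (map root (part c))"
  using distinct_sorted_wrt[OF sorted_Gamma_l[OF col_height_le, of c] before_irrefl]
    distinct_sorted_wrt[OF sorted_Gamma_r[of n "col_height c"] before_irrefl]
    inj_on_root_Gamma_l[OF col_height_le, of c] inj_on_root_Gamma_r[OF col_height_le, of c]
  by (auto simp: part_def distinct_map)

lemma count_before_start:
  "c \<le> num_parts \<Longrightarrow> card {j. j < start c \<and> chain_root n lam j = \<beta>} = (\<Sum>d<c. part_count \<beta> d)"
proof (induction c)
  case (Suc c)
  have "{j. j < start (Suc c) \<and> chain_root n lam j = \<beta>} =
      {j. j < start c \<and> chain_root n lam j = \<beta>} \<union>
      (+) (start c) ` {m. m < length (part c) \<and> root (part c ! m) = \<beta>}" (is "_ = ?A \<union> ?f ` ?B")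
  proof (intro equalityI subsetI)
    fix j assume j: "j \<in> {j. j < start (Suc c) \<and> chain_root n lam j = \<beta>}"
    show "j \<in> ?A \<union> ?f ` ?B"
    proof (cases "j < start c")
      case False
      then obtain m where "j = start c + m" using le_Suc_ex by (metis not_less)
      then show ?thesis using j Suc.prems by (auto simp: start_Suc chain_root_def chain_nth)
    qed (use j in auto)
  next
    fix j assume "j \<in> ?A \<union> ?f ` ?B"
    then show "j \<in> {j. j < start (Suc c) \<and> chain_root n lam j = \<beta>}"
      using Suc.prems by (auto simp: start_Suc chain_root_def chain_nth)
  qed
  moreover have "card (?f ` ?B) = card ?B" by (rule card_image) simp
  moreover have "card ?B = part_count \<beta> c"
  proof (cases "\<beta> \<in> root ` set (part c)")
    case True
    then obtain m where m: "m < length (part c)" "root (part c ! m) = \<beta>" by (auto simp: in_set_conv_nth)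
    then have "?B = {m}"
      using distinct_part[of c] by (auto simp: distinct_conv_nth)
    then show ?thesis using True by (simp add: part_count_def)
  next
    case False
    then have "?B = {}" by auto
    then show ?thesis using False by (simp add: part_count_def)
  qed
  moreover have "card (?A \<union> ?f ` ?B) = card ?A + card (?f ` ?B)"
    by (rule card_Un_disjoint) auto
  ultimately show ?case using Suc by simp
qed simp

text \<open>The sum of \<open>omega k / 2\<close> over the columns of height k before part c of the chain.\<close>

definition weight_before :: "nat \<Rightarrow> rvec" where
  "weight_before c = (\<lambda>i. (\<Sum>d<c. omega (col_height d) i) / 2)"

lemma weight_before_Suc: "weight_before (Suc c) = vadd (weight_before c) (vscale (1 / 2) (omega (col_height c)))"
  by (auto simp: weight_before_def vadd_def vscale_def field_simps)

lemma weight_before_0: "weight_before 0 = (\<lambda>_. 0)"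
  by (simp add: weight_before_def)

lemma part_count_pair:
  assumes "\<beta> \<in> pos_roots n"
  shows "real (part_count \<beta> (2 * q) + part_count \<beta> (Suc (2 * q))) = ip n (omega (col_height (2 * q))) (coroot n \<beta>)"
  using pos_root_omega[OF col_height_le[of "2 * q"] assms]
  by (auto simp: part_count_def part_def col_height_def)

text \<open>The two halves of a block contribute half of \<open>omega\<close> each, and the pairing
  with the whole of it is the number of occurrences in the block.\<close>

lemma ip_weight_before:
  assumes "\<beta> \<in> pos_roots n"
  shows "ip n (weight_before (2 * q)) (coroot n \<beta>) = (\<Sum>d<2 * q. real (part_count \<beta> d))"
proof (induction q)
  case 0
  then show ?case by (simp add: weight_before_0 ip_def)
next
  case (Suc q)
  have "col_height (Suc (2 * q)) = col_height (2 * q)" by (simp add: col_height_def)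
  then show ?case using Suc part_count_pair[OF assms, of q]
    by (simp add: weight_before_Suc ip_vadd_left ip_vscale_left)
qed

text \<open>At the start of a block this is the count of earlier occurrences. In a right half every
  root has pairing 2 and has occurred once in the left half of the same block, which is what half of
  \<open>omega\<close> accounts for.\<close>

lemma chain_level_eq:
  assumes c: "c < num_parts" and m: "m < length (part c)"
  shows "real (chain_level n lam (start c + m)) =
    ip n (weight_before c) (coroot n (chain_root n lam (start c + m)))"
proof -
  let ?\<beta> = "chain_root n lam (start c + m)"
  have pos: "?\<beta> \<in> pos_roots n" using chain_root_pos start_add_less[OF c m] .
  have "{j. j < start c + m \<and> chain_root n lam j = ?\<beta>} = {j. j < start c \<and> chain_root n lam j = ?\<beta>}"
  proof -
    have "chain_root n lam (start c + m') \<noteq> ?\<beta>" if "m' < m" for m'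
      using distinct_part[of c] that m c by (auto simp: chain_root_def chain_nth distinct_conv_nth)
    then show ?thesis by (auto, metis le_Suc_ex nat_add_left_cancel_less not_less)
  qed
  then have level: "real (chain_level n lam (start c + m)) = (\<Sum>d<c. real (part_count ?\<beta> d))"
    using count_before_start[of c ?\<beta>] c by (simp add: chain_level_def)
  have mem: "?\<beta> \<in> root ` set (part c)" using c m by (simp add: chain_root_def chain_nth)
  show ?thesis
  proof (cases "even c")
    case True
    then obtain q where "c = 2 * q" by blast
    then show ?thesis using level ip_weight_before[OF pos, of q] by simp
  next
    case False
    then obtain q where q: "c = Suc (2 * q)" by (metis oddE Suc_eq_plus1)
    have "col_height c = col_height (2 * q)" by (simp add: q col_height_def)
    moreover have "ip n (omega (col_height c)) (coroot n ?\<beta>) = 2"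
      using pos_root_omega(3)[OF col_height_le pos, of c] mem False by (simp add: part_def)
    moreover have "part_count ?\<beta> (2 * q) = 1"
      using pos_root_omega(2)[OF col_height_le pos, of c] calculation
      by (simp add: part_count_def part_def col_height_def q)
    ultimately show ?thesis using level ip_weight_before[OF pos, of q]
      by (simp add: q weight_before_Suc ip_vadd_left ip_vscale_left)
  qed
qed

lemma col_height_ge_iff: "1 \<le> i \<Longrightarrow> i \<le> conj_part lam j \<longleftrightarrow> i \<le> length lam \<and> j \<le> lam ! (i - 1)"
proof -
  assume i: "1 \<le> i"
  have "sorted_wrt (\<ge>) xs \<Longrightarrow> i \<le> length (filter (\<lambda>p. j \<le> p) xs) \<longleftrightarrow> i \<le> length xs \<and> j \<le> xs ! (i - 1)" for xs
    using i
  proof (induction xs arbitrary: i)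
    case (Cons x xs)
    show ?case
    proof (cases "j \<le> x")
      case True
      show ?thesis
      proof (cases "i = 1")
        case False
        then obtain i' where "i = Suc i'" "1 \<le> i'" using Cons.prems by (metis Suc_le_D One_nat_def le_neq_implies_less less_eq_Suc_le Suc_le_mono)
        then show ?thesis using True Cons.IH[of i'] Cons.prems by (auto simp: nth_Cons')
      qed (use True in auto)
    next
      case False
      then have "filter (\<lambda>p. j \<le> p) xs = []" using Cons.prems by (auto simp: filter_empty_conv)
      moreover have "\<not> j \<le> (x # xs) ! (i - 1)" if "i \<le> Suc (length xs)"
      proof (cases "i - 1")
        case (Suc l)
        then have "xs ! l \<in> set xs" using that by auto
        then show ?thesis using False Cons.prems(1) Suc by auto
      qed (use False in simp)
      ultimately show ?thesis using False Cons.prems by auto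
    qed
  qed simp
  then show ?thesis using partition unfolding conj_part_def is_partition_def by blast
qed

lemma weight_before_end: "weight_before num_parts = partition_vec lam"
proof
  fix i
  have "(\<Sum>d<2 * N. omega (col_height d) i) / 2 = (\<Sum>q<N. omega (conj_part lam (Suc q)) i)" for N
    by (induction N) (simp_all add: col_height_def)
  then have "weight_before num_parts i = (\<Sum>q<first_part lam. omega (conj_part lam (Suc q)) i)"
    by (simp add: weight_before_def)
  also have "\<dots> = real (card {q. q < first_part lam \<and> 1 \<le> i \<and> i \<le> conj_part lam (Suc q)})"
    by (simp add: omega_def sum.If_cases card_eq_sum[symmetric] Int_def flip: of_nat_sum)
  also have "{q. q < first_part lam \<and> 1 \<le> i \<and> i \<le> conj_part lam (Suc q)} =
      (if 1 \<le> i \<and> i \<le> length lam then {..<lam ! (i - 1)} else {})"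
  proof -
    have "lam ! (i - 1) \<le> first_part lam" if "1 \<le> i" "i \<le> length lam"
    proof -
      have "lam \<noteq> []" using that by auto
      moreover have "lam ! (i - 1) \<le> lam ! 0"
        using partition that by (cases "i = 1") (auto simp: is_partition_def sorted_wrt_iff_nth_less)
      ultimately show ?thesis by (simp add: first_part_def hd_conv_nth)
    qed
    then show ?thesis using col_height_ge_iff[of i] by (auto simp: Suc_le_eq)
  qed
  finally show "weight_before num_parts i = partition_vec lam i"
    by (simp add: partition_vec_def)
qed

end

section \<open>Affine reflections\<close>

lemma vadd_assoc: "vadd (vadd x y) z = vadd x (vadd y z)"
  and vadd_commute: "vadd x y = vadd y x"
  and vadd_vscale_distrib: "vscale c (vadd x y) = vadd (vscale c x) (vscale c y)"
  by (auto simp: vadd_def vscale_def algebra_simps)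

lemma aff_reflection_eq: "aff_reflection n \<beta> l x = vadd (reflection n \<beta> x) (vscale l \<beta>)"
  by (auto simp: reflection_def aff_reflection_def vadd_def vscale_def algebra_simps)

lemma reflection_vadd: "reflection n \<beta> (vadd x y) = vadd (reflection n \<beta> x) (reflection n \<beta> y)"
  unfolding reflection_eq ip_vadd_left by (auto simp: vadd_def vscale_def algebra_simps)

lemma aff_reflection_fixed: "ip n x (coroot n \<beta>) = l \<Longrightarrow> aff_reflection n \<beta> l x = x"
  by (auto simp: aff_reflection_def vadd_def vscale_def)

lemma coroot_neg: "coroot n (vscale (- 1) \<gamma>) = vscale (- 1) (coroot n \<gamma>)"
  by (simp add: coroot_def ip_vscale_left ip_vscale_right)

lemma vadd_in_space: "x \<in> space n \<Longrightarrow> y \<in> space n \<Longrightarrow> vadd x y \<in> space n"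
  and vscale_in_space: "x \<in> space n \<Longrightarrow> vscale c x \<in> space n"
  by (auto simp: space_def vadd_def vscale_def)

lemma Phi_in_space: "\<gamma> \<in> Phi n \<Longrightarrow> \<gamma> \<in> space n"
  by (elim PhiE) (auto simp: space_def root_eq_eps eps_def vadd_def vscale_def letter_def)

lemma act_in_space:
  assumes "sperm n \<pi>" "x \<in> space n" shows "act \<pi> x \<in> space n"
proof -
  have "inv \<pi> (int k) = int k" if "n < k" for k
    using sperm_inv[OF assms(1)] that by (auto simp: sperm_def)
  then show ?thesis using assms(2) by (auto simp: space_def act_def coord_def)
qed

lemma rabs_cases: "rabs n \<gamma> = (if \<gamma> \<in> pos_roots n then \<gamma> else vscale (- 1) \<gamma>)"
  by (simp add: rabs_def rsgn_def)

lemma rabs_neg: "\<gamma> \<in> Phi n \<Longrightarrow> rabs n (vscale (- 1) \<gamma>) = rabs n \<gamma>"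
  by (simp add: rabs_cases neg_root_pos_iff)

lemma coroot_rabs: "coroot n (rabs n \<gamma>) = vscale (rsgn n \<gamma>) (coroot n \<gamma>)"
  by (simp add: rabs_cases rsgn_def coroot_neg)

lemma rsgn_rsgn [simp]: "rsgn n \<gamma> * (rsgn n \<gamma> * c) = c"
  by (simp add: rsgn_def)

lemma hyperplane_rabs: "hyperplane n (rabs n \<gamma>) l = hyperplane n \<gamma> (rsgn n \<gamma> * l)"
  by (auto simp: hyperplane_def coroot_rabs ip_vscale_right rsgn_def)

lemma hyperplane_eq_iff:
  assumes "\<gamma> \<in> Phi n" shows "hyperplane n \<gamma> l = hyperplane n \<gamma> l' \<longleftrightarrow> l = l'"
proof
  have "vscale (l / 2) \<gamma> \<in> hyperplane n \<gamma> l" for l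
    using assms by (simp add: hyperplane_def vscale_in_space Phi_in_space ip_vscale_left ip_coroot_self)
  moreover assume "hyperplane n \<gamma> l = hyperplane n \<gamma> l'"
  ultimately have "vscale (l / 2) \<gamma> \<in> hyperplane n \<gamma> l'" by blast
  then show "l = l'" using assms by (simp add: hyperplane_def ip_vscale_left ip_coroot_self)
qed simp

context lambda_chain
begin

definition aff :: "nat set \<Rightarrow> nat \<Rightarrow> rvec \<Rightarrow> rvec" where
  "aff J j = aff_prefix_prod n lam J j"

lemma aff_Suc: "aff J (Suc j) =
   (if j \<in> J then aff J j \<circ> aff_reflection n (chain_root n lam j) (- real (chain_level n lam j)) else aff J j)"
  by (simp add: aff_def aff_prefix_prod_def sorted_list_of_set_less_Suc[of J j] compose_list_snoc)

lemma aff_vadd: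
  assumes "j \<le> chain_length n lam" shows "aff J j (vadd x y) = vadd (aff J j x) (act (W J j) y)"
  using assms
proof (induction j arbitrary: x y)
  case 0
  have "act (W J 0) y = y" by (simp only: W_0 act_id id_apply)
  then show ?case by (simp add: aff_def aff_prefix_prod_def del: W_0)
next
  case (Suc j)
  then have j: "j < chain_length n lam" by simp
  have "act (W J j \<circ> signed_reflection (chain n lam ! j)) y = act (W J j) (reflection n (chain_root n lam j) y)"
    using act_comp[OF sperm_W chain_reflection(1)[OF j], of j J] j by (simp add: chain_reflection(2)[OF j])
  moreover have "aff_reflection n (chain_root n lam j) l (vadd x y) =
      vadd (aff_reflection n (chain_root n lam j) l x) (reflection n (chain_root n lam j) y)" for l
    unfolding aff_reflection_eq reflection_vadd by (simp add: vadd_assoc vadd_commute[of _ "vscale _ _"])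
  ultimately show ?case using Suc j by (simp add: aff_Suc W_Suc[OF j])
qed

text \<open>The weight of J for the chain cut off before part c; at the last part it is
  \<open>mu\<close>.\<close>

definition partial_weight :: "nat set \<Rightarrow> nat \<Rightarrow> rvec" where
  "partial_weight J c = vscale (- 1) (aff J (start c) (vscale (- 1) (weight_before c)))"

text \<open>By \<open>chain_level_eq\<close> all hyperplanes of part c contain the point
  \<open>- weight_before c\<close>. The affine reflections folded inside the part fix it, and its
  image changes only between parts.\<close>

lemma aff_weight_before:
  assumes c: "c < num_parts" and m: "m \<le> length (part c)"
  shows "aff J (start c + m) (vscale (- 1) (weight_before c)) = vscale (- 1) (partial_weight J c)"
  using m
proof (induction m)
  case 0
  then show ?case by (simp add: partial_weight_def)
next
  case (Suc m)
  then have "ip n (vscale (- 1) (weight_before c)) (coroot n (chain_root n lam (start c + m))) =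
      - real (chain_level n lam (start c + m))"
    using chain_level_eq[OF c] by (simp add: ip_vscale_left)
  then have "aff_reflection n (chain_root n lam (start c + m)) (- real (chain_level n lam (start c + m)))
      (vscale (- 1) (weight_before c)) = vscale (- 1) (weight_before c)"
    by (rule aff_reflection_fixed)
  then show ?case using Suc by (simp add: aff_Suc)
qed

lemma partial_weight_Suc:
  assumes c: "c < num_parts"
  shows "partial_weight J (Suc c) =
    vadd (partial_weight J c) (vscale (1 / 2) (act (W J (start (Suc c))) (omega (col_height c))))"
proof -
  have s: "start (Suc c) \<le> chain_length n lam" using start_mono[of "Suc c" num_parts] c by (simp add: start_num_parts)
  have "aff J (start (Suc c)) (vscale (- 1) (weight_before (Suc c))) =
      vadd (vscale (- 1) (partial_weight J c)) (vscale (- 1 / 2) (act (W J (start (Suc c))) (omega (col_height c))))"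
    unfolding weight_before_Suc vadd_vscale_distrib aff_vadd[OF s]
    using aff_weight_before[OF c, of "length (part c)" J] by (simp add: start_Suc)
  then show ?thesis by (simp add: partial_weight_def[of J "Suc c"] vadd_vscale_distrib)
qed

lemma partial_weight_0: "partial_weight J 0 = (\<lambda>_. 0)"
  by (simp add: partial_weight_def aff_def aff_prefix_prod_def weight_before_0 vscale_def)

lemma partial_weight_in_space: "c \<le> num_parts \<Longrightarrow> partial_weight J c \<in> space n"
proof (induction c)
  case 0
  then show ?case by (simp add: partial_weight_0 space_def)
next
  case (Suc c)
  have "omega (col_height c) \<in> space n" using col_height_le[of c] by (auto simp: space_def omega_def)
  moreover have "start (Suc c) \<le> chain_length n lam"
    using start_mono[OF Suc.prems] by (simp add: start_num_parts)
  ultimately show ?case using Suc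
    by (simp add: partial_weight_Suc vadd_in_space vscale_in_space act_in_space[OF sperm_W])
qed

lemma weight_before_in_space: "c \<le> num_parts \<Longrightarrow> weight_before c \<in> space n"
proof (induction c)
  case (Suc c)
  have "omega (col_height c) \<in> space n" using col_height_le[of c] by (auto simp: space_def omega_def)
  then show ?case using Suc by (simp add: weight_before_Suc vadd_in_space vscale_in_space)
qed (simp add: weight_before_0 space_def)

lemma mu_eq: "mu n lam J = partial_weight J num_parts"
  by (simp add: mu_def partial_weight_def start_num_parts weight_before_end aff_def)

lemma gam_eq: "j < chain_length n lam \<Longrightarrow> gam n lam J j = act (W J j) (chain_root n lam j)"
  by (simp add: gam_def prefix_prod_eq)

lemma gam_Phi: "j < chain_length n lam \<Longrightarrow> gam n lam J j \<in> Phi n"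
  by (simp add: gam_eq act_Phi sperm_W chain_root_Phi)

text \<open>With the common point of the hyperplanes of the part as origin, the affine product is
  its linear part followed by the translation by minus \<open>partial_weight\<close>. The level of
  the image is therefore the pairing with a vector that depends on the part alone.\<close>

lemma image_hyperplane:
  assumes c: "c < num_parts" and m: "m < length (part c)"
  defines "j \<equiv> start c + m"
  shows "aff_prefix_prod n lam J j ` hyperplane n (chain_root n lam j) (- real (chain_level n lam j)) =
    hyperplane n (gam n lam J j) (- ip n (partial_weight J c) (coroot n (gam n lam J j)))"
proof -
  have j: "j < chain_length n lam" using start_add_less[OF c m] by (simp add: j_def)
  note sp = sperm_W[OF less_imp_le[OF j], of J]
  let ?\<beta> = "chain_root n lam j" and ?w = "weight_before c" and ?V = "partial_weight J c" and ?\<gamma> = "gam n lam J j"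
  have \<beta>: "?\<beta> \<in> Phi n" using chain_root_Phi[OF j] .
  have level: "ip n ?w (coroot n ?\<beta>) = real (chain_level n lam j)"
    using chain_level_eq[OF c m] by (simp add: j_def)
  have aff: "aff J j x = vadd (vscale (- 1) ?V) (act (W J j) (vadd x ?w))" for x
  proof -
    have "x = vadd (vscale (- 1) ?w) (vadd x ?w)" by (auto simp: vadd_def vscale_def)
    then show ?thesis
      using aff_vadd[of j J "vscale (- 1) ?w" "vadd x ?w"] aff_weight_before[OF c, of m J] j m
      by (simp add: j_def)
  qed
  have ip: "ip n (aff J j x) (coroot n ?\<gamma>) = - ip n ?V (coroot n ?\<gamma>) + ip n x (coroot n ?\<beta>) + real (chain_level n lam j)" for x
    unfolding aff using j \<beta> sp level
    by (simp add: gam_eq ip_vadd_left ip_vscale_left ip_act_coroot del: act_vadd)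
  have V: "?V \<in> space n" and w: "?w \<in> space n"
    using c partial_weight_in_space weight_before_in_space by simp_all
  show ?thesis
  proof (intro equalityI subsetI)
    fix y assume "y \<in> aff_prefix_prod n lam J j ` hyperplane n ?\<beta> (- real (chain_level n lam j))"
    then obtain x where x: "x \<in> space n" "ip n x (coroot n ?\<beta>) = - real (chain_level n lam j)" "y = aff J j x"
      by (auto simp: hyperplane_def aff_def)
    moreover have "aff J j x \<in> space n" unfolding aff
      using x V w sp by (simp add: vadd_in_space vscale_in_space act_in_space del: act_vadd)
    ultimately show "y \<in> hyperplane n ?\<gamma> (- ip n ?V (coroot n ?\<gamma>))"
      using ip by (simp add: hyperplane_def)
  next
    fix y assume "y \<in> hyperplane n ?\<gamma> (- ip n ?V (coroot n ?\<gamma>))"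
    then have y: "y \<in> space n" "ip n y (coroot n ?\<gamma>) = - ip n ?V (coroot n ?\<gamma>)"
      by (auto simp: hyperplane_def)
    define x where "x = vadd (vscale (- 1) ?w) (act (inv (W J j)) (vadd y ?V))"
    have x: "x \<in> space n" unfolding x_def
      using y V w sp by (simp add: vadd_in_space vscale_in_space act_in_space sperm_inv del: act_vadd)
    have "vadd x ?w = act (inv (W J j)) (vadd y ?V)" by (auto simp: x_def vadd_def vscale_def)
    then have aff_x: "aff J j x = y" unfolding aff using sp by (simp del: act_vadd) (auto simp: vadd_def vscale_def)
    then have "x \<in> hyperplane n ?\<beta> (- real (chain_level n lam j))"
      using ip[of x] x y by (simp add: hyperplane_def)
    then show "y \<in> aff_prefix_prod n lam J j ` hyperplane n ?\<beta> (- real (chain_level n lam j))"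
      using aff_x unfolding aff_def by blast
  qed
qed

lemma level_eq:
  assumes c: "c < num_parts" and m: "m < length (part c)"
    and \<alpha>: "\<alpha> \<in> Phi n" "gam n lam J (start c + m) = \<alpha> \<or> gam n lam J (start c + m) = vscale (- 1) \<alpha>"
  shows "rsgn n \<alpha> * level n lam J \<alpha> (start c + m) = ip n (partial_weight J c) (coroot n \<alpha>)"
proof -
  let ?j = "start c + m" and ?V = "partial_weight J c"
  have j: "?j < chain_length n lam" using start_add_less[OF c m] .
  let ?\<gamma> = "gam n lam J ?j"
  have \<gamma>: "?\<gamma> \<in> Phi n" using gam_Phi[OF j] .
  have "hyperplane n (rabs n ?\<gamma>) (- l) = aff_prefix_prod n lam J ?j ` hyperplane n (chain_root n lam ?j) (- real (chain_level n lam ?j))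
      \<longleftrightarrow> l = rsgn n ?\<gamma> * ip n ?V (coroot n ?\<gamma>)" for l
    unfolding image_hyperplane[OF c m] hyperplane_rabs hyperplane_eq_iff[OF \<gamma>]
    by (auto simp: rsgn_def)
  then have "level n lam J \<alpha> ?j = ip n ?V (coroot n (rabs n ?\<gamma>))"
    using j by (simp add: level_def coroot_rabs ip_vscale_right)
  moreover have "rabs n ?\<gamma> = rabs n \<alpha>" using \<alpha> rabs_neg by auto
  ultimately show ?thesis by (simp add: coroot_rabs ip_vscale_right)
qed

lemma level_infinity:
  "rsgn n \<alpha> * level n lam J \<alpha> (chain_length n lam) = ip n (partial_weight J num_parts) (coroot n \<alpha>)"
  by (simp add: level_def ip_vscale_right mu_eq)

end

section \<open>The function g along the chain\<close>

lemma ip_coroot_reflection: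
  assumes "\<beta> \<in> Phi n" "\<gamma> \<in> Phi n"
  shows "ip n x (coroot n (reflection n \<beta> \<gamma>)) =
    ip n x (coroot n \<gamma>) - ip n x (coroot n \<beta>) * ip n \<beta> (coroot n \<gamma>)"
proof -
  obtain \<sigma> where \<sigma>: "sperm n \<sigma>" "reflection n \<beta> = act \<sigma>" using reflection_act[OF assms(1)] .
  have "x = act \<sigma> (reflection n \<beta> x)" using reflection_invol[OF assms(1)] \<sigma>(2) by metis
  then have "ip n x (coroot n (reflection n \<beta> \<gamma>)) = ip n (reflection n \<beta> x) (coroot n \<gamma>)"
    using ip_act_coroot[OF \<sigma>(1) assms(2), of "reflection n \<beta> x"] \<sigma>(2) by simp
  then show ?thesis by (simp add: reflection_eq ip_vadd_left ip_vscale_left)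
qed

text \<open>
  The sign of a root with respect to the positive system obtained from the negative roots by moving
  the roots of R, the ones already crossed, to the positive side.
\<close>

definition side :: "nat \<Rightarrow> rvec set \<Rightarrow> rvec \<Rightarrow> real" where
  "side n R \<delta> = (if \<delta> \<in> pos_roots n then (if \<delta> \<in> R then 1 else - 1)
     else (if vscale (- 1) \<delta> \<in> R then - 1 else 1))"

lemma side_insert:
  "\<delta> \<noteq> \<beta> \<Longrightarrow> \<delta> \<noteq> vscale (- 1) \<beta> \<Longrightarrow> side n (insert \<beta> R) \<delta> = side n R \<delta>"
  by (auto simp: side_def)

text \<open>The vector y lies on the wall of \<beta> and realises the crossed roots R by signs. The
  reflection fixes y, so \<delta> and its reflection have the same sign on y, and whether \<beta>
  itself counts as crossed affects neither.\<close>

lemma side_wall: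
  assumes \<beta>: "\<beta> \<in> pos_roots n" and \<delta>: "\<delta> \<in> Phi n" "\<delta> \<noteq> \<beta>" "\<delta> \<noteq> vscale (- 1) \<beta>" and y: "ip n y \<beta> = 0"
    and "\<And>\<gamma>. \<gamma> \<in> {\<delta>, reflection n \<beta> \<delta>, vscale (- 1) \<delta>, vscale (- 1) (reflection n \<beta> \<delta>)} \<Longrightarrow>
      \<gamma> \<in> pos_roots n \<Longrightarrow> \<gamma> \<noteq> \<beta> \<Longrightarrow> ip n y \<gamma> \<noteq> 0 \<and> (0 < ip n y \<gamma> \<longleftrightarrow> \<gamma> \<in> R)"
  shows "side n (insert \<beta> R) (reflection n \<beta> \<delta>) = side n R \<delta>"
proof -
  let ?s = "reflection n \<beta> \<delta>"
  have \<beta>': "\<beta> \<in> Phi n" using \<beta> pos_subset_Phi by blast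
  have s: "?s \<in> Phi n" "?s \<noteq> \<beta>" "?s \<noteq> vscale (- 1) \<beta>"
  proof -
    show "?s \<in> Phi n" using reflection_Phi[OF \<beta>' \<delta>(1)] .
    have "\<delta> = reflection n \<beta> ?s" using reflection_invol[OF \<beta>'] by simp
    then show "?s \<noteq> \<beta>" "?s \<noteq> vscale (- 1) \<beta>"
      using \<delta>(2,3) reflection_self[OF \<beta>'] reflection_vscale[of n \<beta> "- 1" \<beta>] by auto
  qed
  have ip: "ip n y ?s = ip n y \<delta>" by (simp add: reflection_eq ip_vadd_right ip_vscale_right y)
  have side: "side n R \<gamma> = (if 0 < ip n y \<gamma> then 1 else - 1)"
    if "\<gamma> \<in> {\<delta>, ?s}" "\<gamma> \<in> Phi n" "\<gamma> \<noteq> \<beta>" "\<gamma> \<noteq> vscale (- 1) \<beta>" for \<gamma>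
  proof (cases "\<gamma> \<in> pos_roots n")
    case True
    then show ?thesis using assms(6)[of \<gamma>] that by (auto simp: side_def)
  next
    case False
    then have "vscale (- 1) \<gamma> \<in> pos_roots n" using that neg_root_pos_iff by blast
    moreover have "vscale (- 1) \<gamma> \<noteq> \<beta>" using that(4) by auto
    ultimately have "ip n y (vscale (- 1) \<gamma>) \<noteq> 0 \<and> (0 < ip n y (vscale (- 1) \<gamma>) \<longleftrightarrow> vscale (- 1) \<gamma> \<in> R)"
      using assms(6)[of "vscale (- 1) \<gamma>"] that(1) by blast
    then show ?thesis using False by (auto simp: side_def ip_vscale_right)
  qed
  show ?thesis using side[of \<delta>] side[of ?s] \<delta> s by (simp add: ip side_insert)
qed

context lambda_chain
begin

text \<open>The simple root seen from position j. It stays put at unfolded positions, and \<gamma>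
  at j is plus or minus the simple root just when the pulled back root is plus or minus the root of
  the chain at j.\<close>

definition pulled :: "nat set \<Rightarrow> nat \<Rightarrow> nat \<Rightarrow> rvec" where
  "pulled J p j = act (inv (W J j)) (simple_root n p)"

definition sgn_at :: "nat set \<Rightarrow> nat \<Rightarrow> nat \<Rightarrow> real" where
  "sgn_at J p j = (if pulled J p j \<in> pos_roots n then 1 else - 1)"

definition hit :: "nat set \<Rightarrow> nat \<Rightarrow> nat \<Rightarrow> bool" where
  "hit J p j \<longleftrightarrow> pulled J p j = chain_root n lam j \<or> pulled J p j = vscale (- 1) (chain_root n lam j)"

text \<open>The value of g at the point between the roots before position j and those from j on.\<close>

definition g_at :: "nat set \<Rightarrow> nat \<Rightarrow> nat \<Rightarrow> real" where
  "g_at J p j = - sgn_at J p 0 / 2 + (\<Sum>i<j. if hit J p i \<and> i \<notin> J then sgn_at J p i else 0)"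

lemma g_at_Suc: "g_at J p (Suc j) = g_at J p j + (if hit J p j \<and> j \<notin> J then sgn_at J p j else 0)"
  by (simp add: g_at_def)

lemma simple_Phi: "p \<le> n \<Longrightarrow> simple_root n p \<in> Phi n"
  using simple_root_Phi n_pos by blast

lemma pulled_Phi: "p \<le> n \<Longrightarrow> j \<le> chain_length n lam \<Longrightarrow> pulled J p j \<in> Phi n"
  by (simp add: pulled_def act_Phi sperm_inv sperm_W simple_Phi)

lemma act_pulled: "j \<le> chain_length n lam \<Longrightarrow> act (W J j) (pulled J p j) = simple_root n p"
  by (simp add: pulled_def act_inv(2)[OF sperm_W])

lemma pulled_Suc:
  assumes j: "j < chain_length n lam"
  shows "pulled J p (Suc j) =
    (if j \<in> J then reflection n (chain_root n lam j) (pulled J p j) else pulled J p j)"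
proof -
  let ?s = "signed_reflection (chain n lam ! j)"
  have "inv (W J j \<circ> ?s) = ?s \<circ> inv (W J j)"
    using o_inv_distrib[OF sperm_bij[OF sperm_W] sperm_bij[OF chain_reflection(1)[OF j]], of j J] j
    by (simp add: chain_reflection(3))
  moreover have "act (?s \<circ> inv (W J j)) = act ?s \<circ> act (inv (W J j))"
    using j by (intro act_comp[of n] chain_reflection(1) sperm_inv sperm_W) auto
  ultimately show ?thesis
    using j by (simp add: pulled_def W_Suc chain_reflection(2))
qed

lemma sgn_at_cases: "sgn_at J p j = 1 \<or> sgn_at J p j = - 1"
  by (simp add: sgn_at_def)

definition level_at :: "nat set \<Rightarrow> nat \<Rightarrow> nat \<Rightarrow> real" where
  "level_at J p c = ip n (partial_weight J c) (coroot n (simple_root n p))"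

text \<open>The pairing of the content of column c + 1 with the coroot of the simple root.\<close>

definition col_weight :: "nat set \<Rightarrow> nat \<Rightarrow> nat \<Rightarrow> real" where
  "col_weight J p c = ip n (omega (col_height c)) (coroot n (pulled J p (start (Suc c))))"

lemma start_le: "c \<le> num_parts \<Longrightarrow> start c \<le> chain_length n lam"
  using start_mono[of c num_parts] by (simp add: start_num_parts)

lemma level_at_Suc:
  assumes "p \<le> n" "c < num_parts"
  shows "level_at J p (Suc c) = level_at J p c + col_weight J p c / 2"
proof -
  have s: "start (Suc c) \<le> chain_length n lam" using start_le[of "Suc c"] assms(2) by simp
  have "ip n (act (W J (start (Suc c))) (omega (col_height c))) (coroot n (simple_root n p)) = col_weight J p c"
    using ip_act_coroot[OF sperm_W[OF s, of J] pulled_Phi[OF assms(1) s, of J], of "omega (col_height c)"]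
    by (simp add: col_weight_def act_pulled[OF s])
  then show ?thesis using assms(2)
    by (simp add: level_at_def partial_weight_Suc ip_vadd_left ip_vscale_left)
qed

lemma level_at_0: "level_at J p 0 = 0"
  by (simp add: level_at_def partial_weight_0 ip_def)

text \<open>
  In the r-part of a block, the potential vanishes on the roots occurring once in the block; there
  the remaining roots form the root system for which the r-part is a chain.
\<close>

definition potential :: "nat \<Rightarrow> nat \<Rightarrow> rvec \<Rightarrow> real" where
  "potential c m \<delta> = (if odd c \<and> \<bar>ip n (omega (col_height c)) (coroot n \<delta>)\<bar> = 1 then 0
     else side n (root ` set (take m (part c))) \<delta>)"

lemma omega_pairing:
  assumes "\<delta> \<in> Phi n"
  shows "ip n (omega (col_height c)) (coroot n \<delta>) \<in> {- 2, - 1, 0, 1, 2}"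
    and "0 < ip n (omega (col_height c)) (coroot n \<delta>) \<Longrightarrow> \<delta> \<in> pos_roots n"
    and "ip n (omega (col_height c)) (coroot n \<delta>) < 0 \<Longrightarrow> \<delta> \<notin> pos_roots n"
proof -
  let ?w = "omega (col_height c)"
  have neg: "ip n ?w (coroot n (vscale (- 1) \<delta>)) = - ip n ?w (coroot n \<delta>)"
    by (simp add: coroot_neg ip_vscale_right)
  show "ip n ?w (coroot n \<delta>) \<in> {- 2, - 1, 0, 1, 2}"
    "0 < ip n ?w (coroot n \<delta>) \<Longrightarrow> \<delta> \<in> pos_roots n"
    "ip n ?w (coroot n \<delta>) < 0 \<Longrightarrow> \<delta> \<notin> pos_roots n"
    using pos_root_omega(1)[OF col_height_le, of \<delta> c] pos_root_omega(1)[OF col_height_le, of "vscale (- 1) \<delta>" c]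
      neg_root_pos_iff[OF assms] neg by (cases "\<delta> \<in> pos_roots n"; auto)+
qed

lemma part_root_not_before: "m < length (part c) \<Longrightarrow> root (part c ! m) \<notin> root ` set (take m (part c))"
proof
  assume m: "m < length (part c)" and "root (part c ! m) \<in> root ` set (take m (part c))"
  then obtain e where "e \<in> set (take m (part c))" "root (part c ! m) = root e" by blast
  moreover from this(1) obtain i where "i < m" "e = part c ! i" using m by (auto simp: in_set_conv_nth)
  ultimately show False using m distinct_part[of c] by (simp add: distinct_conv_nth)
qed

lemma potential_self:
  assumes c: "c < num_parts" and m: "m < length (part c)"
  defines "\<beta> \<equiv> root (part c ! m)"
  shows "potential c m \<beta> = - 1" "potential c m (vscale (- 1) \<beta>) = 1"
    "potential c (Suc m) \<beta> = 1" "potential c (Suc m) (vscale (- 1) \<beta>) = - 1"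
proof -
  have pos: "\<beta> \<in> pos_roots n"
    using chain_root_pos[OF start_add_less[OF c m]] chain_nth[OF c m] by (simp add: chain_root_def \<beta>_def)
  then have neg: "vscale (- 1) \<beta> \<notin> pos_roots n" using neg_root_pos_iff pos_subset_Phi by blast
  have "\<bar>ip n (omega (col_height c)) (coroot n \<beta>)\<bar> \<noteq> 1" if "odd c"
    using pos_root_omega(3)[OF col_height_le pos, of c] m that by (auto simp: part_def \<beta>_def)
  then show "potential c m \<beta> = - 1" "potential c m (vscale (- 1) \<beta>) = 1"
    "potential c (Suc m) \<beta> = 1" "potential c (Suc m) (vscale (- 1) \<beta>) = - 1"
    using pos neg part_root_not_before[OF m] m
    by (auto simp: potential_def side_def coroot_neg ip_vscale_right \<beta>_def take_Suc_conv_app_nth)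
qed

lemma potential_Suc_other:
  assumes m: "m < length (part c)"
    and "\<delta> \<noteq> root (part c ! m)" "\<delta> \<noteq> vscale (- 1) (root (part c ! m))"
  shows "potential c (Suc m) \<delta> = potential c m \<delta>"
  using assms side_insert by (simp add: potential_def take_Suc_conv_app_nth)

text \<open>Folding replaces the pulled back root by its reflection at the moment the wall is
  crossed, and the potential does not notice. In the left half this is \<open>side_wall\<close> for
  the point in general position; in the right half it must also be seen that the roots on which the
  potential is 0 are preserved.\<close>

lemma potential_reflection:
  assumes c: "c < num_parts" and m: "m < length (part c)" and \<delta>: "\<delta> \<in> Phi n"
  defines "\<beta> \<equiv> root (part c ! m)"
  shows "potential c (Suc m) (reflection n \<beta> \<delta>) = potential c m \<delta>"
proof -
  have pos: "\<beta> \<in> pos_roots n"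
    using chain_root_pos[OF start_add_less[OF c m]] chain_nth[OF c m] by (simp add: chain_root_def \<beta>_def)
  then have \<beta>': "\<beta> \<in> Phi n" using pos_subset_Phi by blast
  let ?w = "omega (col_height c)" and ?s = "reflection n \<beta> \<delta>" and ?R = "root ` set (take m (part c))"
  consider "\<delta> = \<beta>" | "\<delta> = vscale (- 1) \<beta>" | "\<delta> \<noteq> \<beta>" "\<delta> \<noteq> vscale (- 1) \<beta>" by blast
  then show ?thesis
  proof cases
    case 1
    then show ?thesis using potential_self[OF c m] reflection_self[OF \<beta>'] by (simp add: \<beta>_def)
  next
    case 2
    then show ?thesis using potential_self[OF c m] reflection_self[OF \<beta>']
      by (simp add: \<beta>_def reflection_vscale)
  next
    case 3
    obtain i x where ix: "part c ! m = (i, x)" by fastforce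
    have ins: "root ` set (take (Suc m) (part c)) = insert \<beta> ?R"
      using m by (simp add: take_Suc_conv_app_nth \<beta>_def)
    show ?thesis
    proof (cases "even c")
      case True
      then have p: "part c = Gamma_l n (col_height c)" by (simp add: part_def)
      have "side n (insert \<beta> ?R) ?s = side n ?R \<delta>"
        using wall_vec_l[OF col_height_le, of m c i x] m ix p
        by (intro side_wall[OF pos \<delta> 3]) (auto simp: \<beta>_def)
      then show ?thesis using True by (simp add: potential_def ins)
    next
      case False
      then have p: "part c = Gamma_r (col_height c)" by (simp add: part_def)
      have two: "ip n ?w (coroot n \<beta>) = 2"
        using pos_root_omega(3)[OF col_height_le pos, of c] m p by (auto simp: \<beta>_def)
      have "ip n \<beta> (coroot n \<delta>) \<in> \<int>" using ip_coroot_int[OF \<delta> \<beta>'] .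
      then obtain z where "ip n \<beta> (coroot n \<delta>) = of_int z" by (elim Ints_cases)
      \<comment> \<open>The root reflected in has pairing 2 with \<open>omega\<close>, so the
        pairing of \<delta> changes by an even number. Being 1 or -1 means being odd here, as only
        -2, ..., 2 occur.\<close>
      then have s: "ip n ?w (coroot n ?s) = ip n ?w (coroot n \<delta>) - of_int (2 * z)"
        using ip_coroot_reflection[OF \<beta>' \<delta>, of ?w] two by simp
      have odd_iff: "\<bar>of_int i :: real\<bar> = 1 \<longleftrightarrow> odd i" if "of_int i \<in> {- 2, - 1, 0, 1, 2 :: real}" for i
      proof -
        have "i = - 2 \<or> i = - 1 \<or> i = 0 \<or> i = 1 \<or> i = 2"
          using that by (elim insertE emptyE) linarith+
        then show ?thesis by auto
      qed
      obtain i1 where i1: "ip n ?w (coroot n \<delta>) = of_int i1"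
        using omega_pairing(1)[OF \<delta>, of c] by (auto intro: that[of "- 2"] that[of "- 1"] that[of 0] that[of 1] that[of 2])
      have iff: "\<bar>ip n ?w (coroot n ?s)\<bar> = 1 \<longleftrightarrow> \<bar>ip n ?w (coroot n \<delta>)\<bar> = 1"
        using odd_iff[of i1] odd_iff[of "i1 - 2 * z"] s i1 omega_pairing(1)[OF \<delta>, of c]
          omega_pairing(1)[OF reflection_Phi[OF \<beta>' \<delta>], of c] by simp
      show ?thesis
      proof (cases "\<bar>ip n ?w (coroot n \<delta>)\<bar> = 1")
        case True
        then show ?thesis using iff False by (simp add: potential_def)
      next
        case no: False
        have "side n (insert \<beta> ?R) ?s = side n ?R \<delta>"
        proof (rule side_wall[OF pos \<delta> 3, where y = "wall_vec n (col_height c) i x"])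
          show "ip n (wall_vec n (col_height c) i x) \<beta> = 0"
            using wall_vec_r[OF col_height_le, of m c i x] m ix p by (simp add: \<beta>_def)
          fix \<gamma> assume g: "\<gamma> \<in> {\<delta>, ?s, vscale (- 1) \<delta>, vscale (- 1) ?s}" "\<gamma> \<in> pos_roots n" "\<gamma> \<noteq> \<beta>"
          then have "ip n ?w (coroot n \<gamma>) \<noteq> 1" using no iff by (auto simp: coroot_neg ip_vscale_right)
          then show "ip n (wall_vec n (col_height c) i x) \<gamma> \<noteq> 0 \<and> (0 < ip n (wall_vec n (col_height c) i x) \<gamma> \<longleftrightarrow> \<gamma> \<in> ?R)"
            using wall_vec_r(2)[OF col_height_le, of m c i x \<gamma>] m ix p g by (simp add: \<beta>_def)
        qed
        then show ?thesis using no iff False by (simp add: potential_def ins)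
      qed
    qed
  qed
qed

text \<open>Half the potential and g change in step, so that their difference is constant in a part:
  an unfolded hit moves the potential between -1 and 1 and g by the same sign, a fold moves neither,
  and a position without a hit moves neither.\<close>

lemma g_at_part_step:
  assumes p: "p \<le> n" and c: "c < num_parts" and m: "m \<le> length (part c)"
    and 0: "g_at J p (start c) = level_at J p c + potential c 0 (pulled J p (start c)) / 2"
  shows "g_at J p (start c + m) = level_at J p c + potential c m (pulled J p (start c + m)) / 2"
  using m
proof (induction m)
  case 0
  then show ?case using assms(4) by simp
next
  case (Suc m)
  then have m: "m < length (part c)" by simp
  let ?j = "start c + m" and ?\<beta> = "root (part c ! m)"
  have j: "?j < chain_length n lam" using start_add_less[OF c m] .
  have \<beta>: "chain_root n lam ?j = ?\<beta>" by (simp add: chain_root_def chain_nth[OF c m])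
  then have pos: "?\<beta> \<in> pos_roots n" using chain_root_pos[OF j] by simp
  then have neg: "vscale (- 1) ?\<beta> \<notin> pos_roots n" using neg_root_pos_iff pos_subset_Phi by blast
  have IH: "g_at J p ?j = level_at J p c + potential c m (pulled J p ?j) / 2" using Suc by simp
  show ?case
  proof (cases "?j \<in> J")
    case True
    then show ?thesis
      using IH pulled_Suc[OF j, of J p] potential_reflection[OF c m pulled_Phi[OF p less_imp_le[OF j]], of J]
      by (simp add: g_at_Suc \<beta>)
  next
    case False
    consider "pulled J p ?j = ?\<beta>" | "pulled J p ?j = vscale (- 1) ?\<beta>"
      | "pulled J p ?j \<noteq> ?\<beta>" "pulled J p ?j \<noteq> vscale (- 1) ?\<beta>" by blast
    then show ?thesis
    proof cases
      case 1
      then show ?thesis using IH False pos potential_self[OF c m]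
        by (simp add: g_at_Suc pulled_Suc[OF j] hit_def sgn_at_def \<beta>)
    next
      case 2
      then show ?thesis using IH False neg potential_self[OF c m]
        by (simp add: g_at_Suc pulled_Suc[OF j] hit_def sgn_at_def \<beta>)
    next
      case 3
      then show ?thesis using IH False potential_Suc_other[OF m 3]
        by (simp add: g_at_Suc pulled_Suc[OF j] hit_def \<beta>)
    qed
  qed
qed

text \<open>The potential drops by the pairing with \<open>omega\<close> between the end of a part
  and the start of the next. Half of that is the rise of the level in \<open>level_at_Suc\<close>,
  so the formula for g carries over.\<close>

lemma potential_next:
  assumes "\<delta> \<in> Phi n"
  shows "potential c (length (part c)) \<delta> = ip n (omega (col_height c)) (coroot n \<delta>) + potential (Suc c) 0 \<delta>"
proof -
  let ?q = "ip n (omega (col_height c)) (coroot n \<delta>)"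
  have h: "even c \<Longrightarrow> col_height (Suc c) = col_height c" by (auto simp: col_height_def elim!: evenE)
  have q: "?q \<in> {- 2, - 1, 0, 1, 2}" "0 < ?q \<Longrightarrow> \<delta> \<in> pos_roots n" "?q < 0 \<Longrightarrow> \<delta> \<notin> pos_roots n"
    using omega_pairing[OF assms] by auto
  have n: "ip n (omega (col_height c)) (coroot n (vscale (- 1) \<delta>)) = - ?q"
    by (simp add: coroot_neg ip_vscale_right)
  show ?thesis
  proof (cases "\<delta> \<in> pos_roots n")
    case True
    note om = pos_root_omega(2,3)[OF col_height_le True, of c]
    show ?thesis
      using True q om h by (cases "even c") (auto simp: potential_def side_def part_def)
  next
    case False
    then have "vscale (- 1) \<delta> \<in> pos_roots n" using neg_root_pos_iff[OF assms] by simp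
    note om = pos_root_omega(2,3)[OF col_height_le this, of c, unfolded n]
    show ?thesis
      using False q om h by (cases "even c") (auto simp: potential_def side_def part_def)
  qed
qed

lemma g_at_start:
  assumes "p \<le> n" "c \<le> num_parts"
  shows "g_at J p (start c) = level_at J p c + potential c 0 (pulled J p (start c)) / 2"
  using assms(2)
proof (induction c)
  case 0
  then show ?case by (simp add: g_at_def level_at_0 potential_def side_def sgn_at_def)
next
  case (Suc c)
  then have c: "c < num_parts" by simp
  then show ?case
    using g_at_part_step[OF assms(1) c _ Suc.IH, of "length (part c)"] level_at_Suc[OF assms(1) c, of J]
      potential_next[OF pulled_Phi[OF assms(1) start_le[OF Suc.prems]], of c J]
    by (simp add: start_Suc col_weight_def field_simps)
qed

lemma g_at_part:
  assumes "p \<le> n" "c < num_parts" "m \<le> length (part c)"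
  shows "g_at J p (start c + m) = level_at J p c + potential c m (pulled J p (start c + m)) / 2"
  using g_at_part_step[OF assms g_at_start[OF assms(1)]] assms(2) by simp

text \<open>The value of g half a unit after the point of position j: the middle of the k-th unit
  interval if j is the k-th hit, and the right end of the domain if j is the chain length.\<close>

definition peak :: "nat set \<Rightarrow> nat \<Rightarrow> nat \<Rightarrow> real" where
  "peak J p j = g_at J p j + sgn_at J p j / 2"

lemma peak_even: "p \<le> n \<Longrightarrow> 2 * q \<le> num_parts \<Longrightarrow> peak J p (start (2 * q)) = level_at J p (2 * q)"
  by (simp add: peak_def g_at_start potential_def side_def sgn_at_def)

text \<open>Let w be the weight of the left column. For w = 1 or -1 the potential is 0, and half of
  w and half of the sign add up to w. For w = 0, 2 or -2 the potential is minus the sign and cancels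
  it, and half of w remains.\<close>

lemma peak_odd:
  assumes p: "p \<le> n" and q: "Suc (2 * q) \<le> num_parts"
  shows "peak J p (start (Suc (2 * q))) = level_at J p (2 * q) + sgn (col_weight J p (2 * q))"
proof -
  let ?\<delta> = "pulled J p (start (Suc (2 * q)))"
  have h: "col_height (Suc (2 * q)) = col_height (2 * q)" by (simp add: col_height_def)
  have c: "2 * q < num_parts" using q by simp
  note om = omega_pairing[OF pulled_Phi[OF p start_le[OF q]], of "2 * q" J, folded col_weight_def]
  show ?thesis
    using om level_at_Suc[OF p c, of J] g_at_start[OF p q, of J]
    by (auto simp: peak_def potential_def side_def sgn_at_def h col_weight_def[symmetric])
qed

lemma peak_hit:
  assumes p: "p \<le> n" and c: "c < num_parts" and m: "m < length (part c)" and hit: "hit J p (start c + m)"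
  shows "peak J p (start c + m) = level_at J p c"
proof -
  let ?\<beta> = "root (part c ! m)"
  have \<beta>: "chain_root n lam (start c + m) = ?\<beta>" by (simp add: chain_root_def chain_nth[OF c m])
  then have pos: "?\<beta> \<in> pos_roots n" using chain_root_pos[OF start_add_less[OF c m]] by simp
  then have neg: "vscale (- 1) ?\<beta> \<notin> pos_roots n" using neg_root_pos_iff pos_subset_Phi by blast
  show ?thesis
    using hit potential_self[OF c m] pos neg g_at_part[OF p c, of m J] m
    by (auto simp: peak_def hit_def \<beta> sgn_at_def)
qed

lemma I_set_iff:
  assumes "p \<le> n"
  shows "j \<in> I_set n lam J (simple_root n p) \<longleftrightarrow> j < chain_length n lam \<and> hit J p j"
proof (cases "j < chain_length n lam")
  case True
  note sp = sperm_W[OF less_imp_le[OF True], of J]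
  have "gam n lam J j = x \<longleftrightarrow> act (inv (W J j)) x = chain_root n lam j" for x
    using sp unfolding gam_eq[OF True] by (metis act_inv)
  moreover have "vscale (- 1) x = y \<longleftrightarrow> x = vscale (- 1) y" for x y by auto
  ultimately show ?thesis using True by (auto simp: I_set_def hit_def pulled_def)
qed (simp add: I_set_def)

lemma level_hit:
  assumes "p \<le> n" "c < num_parts" "m < length (part c)" "hit J p (start c + m)"
  shows "rsgn n (simple_root n p) * level n lam J (simple_root n p) (start c + m) = level_at J p c"
proof -
  have "start c + m \<in> I_set n lam J (simple_root n p)"
    using assms I_set_iff start_add_less by simp
  then have "gam n lam J (start c + m) = simple_root n p \<or> gam n lam J (start c + m) = vscale (- 1) (simple_root n p)"
    by (simp add: I_set_def)
  then show ?thesis using level_eq[OF assms(2,3) simple_Phi[OF assms(1)]] by (simp add: level_at_def)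
qed

lemma sgn_at_keep: "j < chain_length n lam \<Longrightarrow> j \<notin> J \<Longrightarrow> sgn_at J p (Suc j) = sgn_at J p j"
  by (simp add: sgn_at_def pulled_Suc)

lemma admissible_edge:
  assumes "admissible n lam J" "j \<in> J"
  shows "j < chain_length n lam" "qbg_edge n (act (W J j)) (chain_root n lam j)"
proof -
  show j: "j < chain_length n lam" using assms by (auto simp: admissible_def)
  show "qbg_edge n (act (W J j)) (chain_root n lam j)"
    unfolding prefix_prod_eq[OF less_imp_le[OF j], symmetric] using assms by (simp add: admissible_def)
qed

text \<open>This is \<open>qbg_edge_simple\<close> along the path. It is one-sided: a change from
  minus to plus at a fold that is not a hit remains possible as far as this statement goes, and the
  later arguments allow for it.\<close>

lemma sgn_at_stays:
  assumes "admissible n lam J" "p \<le> n" "j < chain_length n lam" "\<not> (hit J p j \<and> j \<in> J)" "sgn_at J p j = 1"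
  shows "sgn_at J p (Suc j) = 1"
proof (cases "j \<in> J")
  case True
  then have "pulled J p j \<noteq> chain_root n lam j" using assms(4) by (auto simp: hit_def)
  moreover have "pulled J p j \<in> pos_roots n" using assms(5) by (auto simp: sgn_at_def split: if_splits)
  ultimately have "reflection n (chain_root n lam j) (pulled J p j) \<in> pos_roots n"
    using qbg_edge_simple[OF sperm_W admissible_edge(2)[OF assms(1) True] n_pos assms(2), of "pulled J p j"]
      act_pulled[of j J p] assms(3) by fastforce
  then show ?thesis using True assms(3) by (simp add: sgn_at_def pulled_Suc)
qed (use assms sgn_at_keep in auto)

end

section \<open>The maximum of g\<close>

lemma Sup_piecewise_linear:
  fixes s :: "nat \<Rightarrow> real" and a :: real
  defines "v \<equiv> \<lambda>i. a + (\<Sum>j<i. s j) / 2"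
  shows "Sup ((\<lambda>x. a + (\<Sum>i<K. s i * ramp (x - real i / 2))) ` {0..real K / 2}) = Max (v ` {..K})"
proof -
  let ?h = "\<lambda>x. a + (\<Sum>i<K. s i * ramp (x - real i / 2))"
  have h: "?h (real i / 2 + t / 2) = v i + t * (s i / 2)" if i: "i < K" and t: "0 \<le> t" "t \<le> 1" for i t
  proof -
    have "(\<Sum>j<K. s j * ramp (real i / 2 + t / 2 - real j / 2)) =
        (\<Sum>j<K. if j < i then s j / 2 else if j = i then s i * t / 2 else 0)"
    proof (rule sum.cong)
      fix j
      consider "j < i" | "j = i" | "i < j" by linarith
      then show "s j * ramp (real i / 2 + t / 2 - real j / 2) =
          (if j < i then s j / 2 else if j = i then s i * t / 2 else 0)"
      proof cases
        case 1
        then have "real j + 1 \<le> real i" by linarith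
        then show ?thesis using 1 t by (simp add: ramp_def)
      next
        case 3
        then have "real i + 1 \<le> real j" by linarith
        then have "ramp (real i / 2 + t / 2 - real j / 2) = 0" using t by (simp add: ramp_def)
        then show ?thesis using 3 by simp
      qed (use t in \<open>auto simp: ramp_def\<close>)
    qed simp
    also have "\<dots> = (\<Sum>j\<in>{..<K} \<inter> {j. j < i}. s j / 2) + (\<Sum>j\<in>{..<K} \<inter> - {j. j < i}. if j = i then s i * t / 2 else 0)"
      by (rule sum.If_cases) simp
    also have "{..<K} \<inter> {j. j < i} = {..<i}" using i by auto
    also have "(\<Sum>j\<in>{..<K} \<inter> - {j. j < i}. if j = i then s i * t / 2 else 0) = s i * t / 2"
      using i by (subst sum.delta) auto
    finally show ?thesis by (simp add: v_def sum_divide_distrib)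
  qed
  have v_Suc: "v (Suc i) = v i + s i / 2" for i by (simp add: v_def add_divide_distrib)
  have node: "?h (real i / 2) = v i" if "i \<le> K" for i
  proof (cases "i < K")
    case True
    then show ?thesis using h[of i 0] by simp
  next
    case False
    show ?thesis
    proof (cases i)
      case 0
      then show ?thesis using False by (simp add: v_def)
    next
      case (Suc i')
      then have e: "real i' / 2 + 1 / 2 = real i / 2" by (simp add: add_divide_distrib)
      show ?thesis using Suc False that h[of i' 1, unfolded e] v_Suc[of i'] by simp
    qed
  qed
  show ?thesis
  proof (rule cSup_eq_maximum)
    have "Max (v ` {..K}) \<in> v ` {..K}" by (rule Max_in) auto
    then obtain i where "Max (v ` {..K}) = v i" "i \<in> {..K}" by (rule imageE)
    then show "Max (v ` {..K}) \<in> ?h ` {0..real K / 2}"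
      using node[of i] by (intro image_eqI[of _ _ "real i / 2"]) auto
    fix y assume "y \<in> ?h ` {0..real K / 2}"
    then obtain x where x: "0 \<le> x" "x \<le> real K / 2" "y = ?h x" by auto
    have le: "v i \<le> Max (v ` {..K})" if "i \<le> K" for i using that by (intro Max_ge) auto
    show "y \<le> Max (v ` {..K})"
    proof (cases "x = real K / 2")
      case True
      have "y = v K" unfolding x(3) True using node[of K] by blast
      then show ?thesis using le[of K] by simp
    next
      case False
      define i where "i = nat \<lfloor>2 * x\<rfloor>"
      define t where "t = 2 * x - real i"
      have i: "real i \<le> 2 * x" "2 * x < real i + 1" using x(1) by (auto simp: i_def)
      then have t: "0 \<le> t" "t \<le> 1" by (auto simp: t_def)
      have "i < K" using i x False by linarith
      moreover have "x = real i / 2 + t / 2" by (simp add: t_def field_simps)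
      ultimately have "y = v i + t * (s i / 2)" using h[OF _ t] x(3) by metis
      \<comment> \<open>Between neighbouring nodes the function is a convex combination of their
        values, so the supremum is attained at a node.\<close>
      also have "\<dots> = (1 - t) * v i + t * v (Suc i)" by (simp add: v_Suc algebra_simps)
      also have "\<dots> \<le> (1 - t) * Max (v ` {..K}) + t * Max (v ` {..K})"
        using t \<open>i < K\<close> le by (intro add_mono mult_left_mono) auto
      finally show ?thesis by (simp add: algebra_simps)
    qed
  qed
qed

lemma sum_sorted_list_nth:
  fixes f :: "nat \<Rightarrow> real"
  assumes "finite A" "k < card A"
  shows "(\<Sum>i<k. f (sorted_list_of_set A ! i)) = sum f {a \<in> A. a < sorted_list_of_set A ! k}"
proof -
  let ?xs = "sorted_list_of_set A"
  have "(\<Sum>i<k. f (?xs ! i)) = sum_list (map f (take k ?xs))"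
    using assms by (simp add: sum_list_sum_nth atLeast0LessThan)
  also have "\<dots> = sum f (set (take k ?xs))"
    by (simp add: sum_list_distinct_conv_sum_set)
  also have "set (take k ?xs) = {a \<in> A. a < ?xs ! k}"
    using set_take_sorted_wrt[of "(<)" ?xs k] assms by simp
  finally show ?thesis .
qed

lemma sum_sorted_list_all:
  fixes f :: "nat \<Rightarrow> real"
  shows "finite A \<Longrightarrow> (\<Sum>i<card A. f (sorted_list_of_set A ! i)) = sum f A"
  using sum_list_distinct_conv_sum_set[of "sorted_list_of_set A" f]
  by (simp add: sum_list_sum_nth atLeast0LessThan)

context lambda_chain
begin

definition hits :: "nat set \<Rightarrow> nat \<Rightarrow> nat set" where
  "hits J p = {j. j < chain_length n lam \<and> hit J p j}"

definition hits_inf :: "nat set \<Rightarrow> nat \<Rightarrow> nat set" where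
  "hits_inf J p = insert (chain_length n lam) (hits J p)"

lemma finite_hits: "finite (hits J p)" "finite (hits_inf J p)"
  by (auto simp: hits_def hits_inf_def)

lemma I_set_eq: "p \<le> n \<Longrightarrow> I_set n lam J (simple_root n p) = hits J p"
  using I_set_iff by (auto simp: hits_def)

lemma I_hat_eq: "p \<le> n \<Longrightarrow> I_hat n lam J (simple_root n p) = hits_inf J p"
  by (simp add: I_hat_def hits_inf_def I_set_eq)

lemma I_set_neg: "I_set n lam J (vscale (- 1) \<alpha>) = I_set n lam J \<alpha>"
  by (auto simp: I_set_def)

lemma sgn_at_0: "p \<le> n \<Longrightarrow> sgn_at J p 0 = (if p = 0 then - 1 else 1)"
proof -
  assume "p \<le> n"
  moreover have "pulled J p 0 = simple_root n p"
    unfolding pulled_def W_0 inv_id act_id id_apply ..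
  ultimately show ?thesis using simple_root_pos_iff[OF n_pos] by (simp add: sgn_at_def)
qed

lemma rsgn_neg: "\<gamma> \<in> Phi n \<Longrightarrow> rsgn n (vscale (- 1) \<gamma>) = - rsgn n \<gamma>"
  by (simp add: rsgn_def neg_root_pos_iff)

lemma rsgn_gam:
  assumes p: "p \<le> n" and j: "j \<in> hits J p"
  shows "rsgn n (gam n lam J j) * rsgn n (simple_root n p) = sgn_at J p j"
proof -
  have j': "j < chain_length n lam" "hit J p j" using j by (auto simp: hits_def)
  note \<beta> = chain_root_pos[OF j'(1)] chain_root_Phi[OF j'(1)]
  have "gam n lam J j = act (W J j) (chain_root n lam j)" using gam_eq[OF j'(1)] .
  moreover have "act (W J j) (pulled J p j) = simple_root n p" using j' by (simp add: act_pulled)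
  moreover have "vscale (- 1) (vscale (- 1) (gam n lam J j)) = gam n lam J j" by simp
  ultimately consider "pulled J p j = chain_root n lam j" "gam n lam J j = simple_root n p" |
      "pulled J p j = vscale (- 1) (chain_root n lam j)" "gam n lam J j = vscale (- 1) (simple_root n p)"
    using j'(2) by (metis hit_def act_vscale)
  then show ?thesis
  proof cases
    case 1
    then show ?thesis using \<beta> by (simp add: sgn_at_def rsgn_def)
  next
    case 2
    then show ?thesis using \<beta> rsgn_neg[OF simple_Phi[OF p]]
      by (simp add: sgn_at_def neg_root_pos_iff) (simp add: rsgn_def)
  qed
qed

text \<open>By invariance the last slope is the sign of the pairing of \<rho> with the coroot of the
  pulled back root, and \<rho> is strictly dominant.\<close>

lemma sgn_gam_inf:
  assumes p: "p \<le> n"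
  shows "sgn (ip n (gam_inf n lam J) (coroot n (simple_root n p))) = sgn_at J p (chain_length n lam)"
proof -
  let ?L = "chain_length n lam"
  let ?\<delta> = "pulled J p ?L"
  have \<delta>: "?\<delta> \<in> Phi n" using pulled_Phi[OF p] by simp
  have "ip n (gam_inf n lam J) (coroot n (simple_root n p)) = ip n (rho n) (coroot n ?\<delta>)"
    using ip_act_coroot[OF sperm_W \<delta>, of ?L J "rho n"] by (simp add: gam_inf_def prefix_prod_eq act_pulled)
  moreover have "ip n (rho n) (coroot n ?\<delta>) < 0" if "?\<delta> \<notin> pos_roots n"
    using rho_coroot_pos[of "vscale (- 1) ?\<delta>" n] neg_root_pos_iff[OF \<delta>] that
    by (simp add: coroot_neg ip_vscale_right)
  ultimately show ?thesis using rho_coroot_pos[of ?\<delta> n] by (simp add: sgn_at_def)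
qed

text \<open>The slope on the i-th interval of length 1/2, with the sign of the simple root built in.
  Two intervals belong to each hit, the second reversed if the hit is folded; the last one, at twice
  the number of hits, belongs to infinity.\<close>

definition half_slope :: "nat set \<Rightarrow> nat \<Rightarrow> nat \<Rightarrow> real" where
  "half_slope J p i = (let hs = sorted_list_of_set (hits J p) in
     if i < 2 * card (hits J p) then sgn_at J p (hs ! (i div 2)) * (if odd i \<and> hs ! (i div 2) \<in> J then - 1 else 1)
     else sgn_at J p (chain_length n lam))"

lemma sum_double: "(\<Sum>i<2 * (N :: nat). f i) = (\<Sum>k<N. f (2 * k) + f (2 * k + 1) :: real)"
  by (induction N) simp_all

lemma g_fun_eq:
  assumes p: "p \<le> n"
  shows "g_fun n lam J (simple_root n p) x =
    - sgn_at J p 0 / 2 + (\<Sum>i<2 * card (hits J p) + 1. half_slope J p i * ramp (x - real i / 2))"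
proof -
  let ?hs = "sorted_list_of_set (hits J p)" and ?N = "card (hits J p)" and ?\<alpha> = "simple_root n p"
  have S: "(\<Sum>i<2 * ?N + 1. half_slope J p i * ramp (x - real i / 2)) =
      (\<Sum>k<?N. sgn_at J p (?hs ! k) * (ramp (x - real k) + (if ?hs ! k \<in> J then - 1 else 1) * ramp (x - (real k + 1 / 2))))
      + sgn_at J p (chain_length n lam) * ramp (x - real ?N)"
    by (simp add: sum_double half_slope_def Let_def algebra_simps add_divide_distrib)
  have hs: "?hs ! k \<in> hits J p" if "k < ?N" for k
  proof -
    have "?hs ! k \<in> set ?hs" using that by (intro nth_mem) simp
    then show ?thesis using finite_hits(1) by simp
  qed
  show ?thesis
  proof (cases "?\<alpha> \<in> pos_roots n")
    case True
    then have "p \<noteq> 0" using simple_root_pos_iff[OF n_pos p] by simp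
    moreover have "rsgn n (gam n lam J (?hs ! k)) = sgn_at J p (?hs ! k)" if "k < ?N" for k
      using rsgn_gam[OF p hs[OF that]] True by (simp add: rsgn_def)
    ultimately show ?thesis unfolding S
      using True by (simp add: g_fun_def g_pos_def Let_def I_set_eq[OF p] sgn_at_0[OF p] sgn_gam_inf[OF p])
  next
    case False
    then have "sgn_at J p 0 = - 1" using simple_root_pos_iff[OF n_pos p] sgn_at_0[OF p] by simp
    moreover have "rsgn n (gam n lam J (?hs ! k)) = - sgn_at J p (?hs ! k)" if "k < ?N" for k
      using rsgn_gam[OF p hs[OF that]] False by (simp add: rsgn_def)
    moreover have "ip n (gam_inf n lam J) (coroot n (vscale (- 1) ?\<alpha>)) = - ip n (gam_inf n lam J) (coroot n ?\<alpha>)"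
      by (simp add: coroot_neg ip_vscale_right)
    ultimately show ?thesis unfolding S
      using False sgn_gam_inf[OF p, of J]
      by (simp add: g_fun_def g_pos_def Let_def I_set_neg I_set_eq[OF p] sgn_minus sum_negf)
  qed
qed

lemma g_at_hits: "j \<le> chain_length n lam \<Longrightarrow>
    g_at J p j = - sgn_at J p 0 / 2 + (\<Sum>i\<in>{i \<in> hits J p. i < j}. if i \<in> J then 0 else sgn_at J p i)"
proof -
  assume j: "j \<le> chain_length n lam"
  have "(\<Sum>i<j. if hit J p i \<and> i \<notin> J then sgn_at J p i else 0) =
      (\<Sum>i<j. if hit J p i then if i \<in> J then 0 else sgn_at J p i else 0)"
    by (rule sum.cong) auto
  also have "\<dots> = (\<Sum>i\<in>{i \<in> {..<j}. hit J p i}. if i \<in> J then 0 else sgn_at J p i)"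
    by (rule sum.inter_filter[symmetric]) simp
  also have "{i \<in> {..<j}. hit J p i} = {i \<in> hits J p. i < j}" using j by (auto simp: hits_def)
  finally show ?thesis by (simp add: g_at_def)
qed

text \<open>The node 2k of g carries \<open>g_at\<close> and the node 2k + 1 carries
  \<open>peak\<close> at the k-th element of \<open>hits_inf\<close>, so the supremum is a maximum
  over these positions.\<close>

lemma g_max_cases:
  fixes J :: "nat set"
  assumes p: "p \<le> n"
  defines "M \<equiv> g_max n lam J (simple_root n p)"
  shows "\<And>j. j \<in> hits_inf J p \<Longrightarrow> g_at J p j \<le> M" "\<And>j. j \<in> hits_inf J p \<Longrightarrow> peak J p j \<le> M"
    "\<exists>j\<in>hits_inf J p. M = g_at J p j \<or> M = peak J p j"
proof -
  let ?hs = "sorted_list_of_set (hits J p)" and ?N = "card (hits J p)" and ?L = "chain_length n lam"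
  define v where "v i = - sgn_at J p 0 / 2 + (\<Sum>j<i. half_slope J p j) / 2" for i
  have "real (2 * ?N + 1) / 2 = real ?N + 1 / 2" by simp
  then have M: "M = Max (v ` {..2 * ?N + 1})"
    unfolding M_def g_max_def I_set_eq[OF p] g_fun_eq[OF p] v_def
    using Sup_piecewise_linear[where a = "- sgn_at J p 0 / 2" and K = "2 * ?N + 1" and s = "half_slope J p"]
    by (simp only:)
  define pos where "pos k = (if k < ?N then ?hs ! k else ?L)" for k
  have pos_in: "pos k \<in> hits_inf J p" for k
  proof (cases "k < ?N")
    case True
    then have "?hs ! k \<in> set ?hs" by (intro nth_mem) simp
    then show ?thesis using True finite_hits(1) by (simp add: pos_def hits_inf_def)
  qed (simp add: pos_def hits_inf_def)
  have pos_le: "pos k \<le> ?L" for k using pos_in[of k] by (auto simp: hits_inf_def hits_def)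
  have v_even: "v (2 * k) = g_at J p (pos k)" if "k \<le> ?N" for k
  proof -
    let ?f = "\<lambda>i. if i \<in> J then 0 else sgn_at J p i"
    have "(\<Sum>j<2 * k. half_slope J p j) / 2 = (\<Sum>i<k. ?f (?hs ! i))"
      unfolding sum_double sum_divide_distrib using that
      by (intro sum.cong) (auto simp: half_slope_def Let_def)
    also have "\<dots> = sum ?f {i \<in> hits J p. i < pos k}"
    proof (cases "k < ?N")
      case True
      then show ?thesis using sum_sorted_list_nth[OF finite_hits(1) True, of ?f] by (simp add: pos_def)
    next
      case False
      moreover have "{i \<in> hits J p. i < ?L} = hits J p" by (auto simp: hits_def)
      ultimately show ?thesis using that sum_sorted_list_all[OF finite_hits(1), of ?f] by (simp add: pos_def)
    qed
    finally show ?thesis using g_at_hits[OF pos_le, of J p k] by (simp add: v_def)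
  qed
  have v_odd: "v (2 * k + 1) = peak J p (pos k)" if "k \<le> ?N" for k
  proof -
    have "v (2 * k + 1) = v (2 * k) + half_slope J p (2 * k) / 2"
      by (simp add: v_def add_divide_distrib)
    moreover have "half_slope J p (2 * k) = sgn_at J p (pos k)"
      using that by (simp add: half_slope_def Let_def pos_def)
    ultimately show ?thesis using v_even[OF that] by (simp add: peak_def)
  qed
  have v_le: "v i \<le> M" if "i \<le> 2 * ?N + 1" for i
    unfolding M using that by (intro Max_ge) auto
  have pos_surj: "\<exists>k\<le>?N. j = pos k" if "j \<in> hits_inf J p" for j
  proof (cases "j \<in> hits J p")
    case True
    then have "j \<in> set ?hs" using finite_hits(1) by simp
    then obtain k where "k < ?N" "j = ?hs ! k" by (auto simp: in_set_conv_nth)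
    then show ?thesis by (intro exI[of _ k]) (simp add: pos_def)
  next
    case False
    then show ?thesis using that by (intro exI[of _ ?N]) (simp add: pos_def hits_inf_def)
  qed
  show "g_at J p j \<le> M" if j: "j \<in> hits_inf J p" for j
  proof -
    obtain k where "k \<le> ?N" "j = pos k" using pos_surj[OF j] by blast
    then show ?thesis using v_even[of k] v_le[of "2 * k"] by simp
  qed
  show "peak J p j \<le> M" if j: "j \<in> hits_inf J p" for j
  proof -
    obtain k where "k \<le> ?N" "j = pos k" using pos_surj[OF j] by blast
    then show ?thesis using v_odd[of k] v_le[of "2 * k + 1"] by simp
  qed
  have "M \<in> v ` {..2 * ?N + 1}" unfolding M by (rule Max_in) auto
  then obtain i where i: "i \<le> 2 * ?N + 1" "M = v i" by auto
  show "\<exists>j\<in>hits_inf J p. M = g_at J p j \<or> M = peak J p j"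
  proof (cases "even i")
    case True
    then obtain k where "i = 2 * k" by blast
    then show ?thesis using i v_even[of k] pos_in[of k] by auto
  next
    case False
    then obtain k where "i = 2 * k + 1" by (elim oddE)
    then show ?thesis using i v_odd[of k] pos_in[of k] by auto
  qed
qed

lemma no_hits_between:
  assumes adm: "admissible n lam J" and p: "p \<le> n" and ab: "a \<le> b" "b \<le> chain_length n lam"
    and no: "\<And>j. a \<le> j \<Longrightarrow> j < b \<Longrightarrow> \<not> hit J p j"
  shows "g_at J p b = g_at J p a" "sgn_at J p a = 1 \<Longrightarrow> sgn_at J p b = 1"
proof -
  have "g_at J p b = g_at J p a \<and> (sgn_at J p a = 1 \<longrightarrow> sgn_at J p b = 1)"
    using ab no
  proof (induction b rule: dec_induct)
    case (step b)
    then show ?case using sgn_at_stays[OF adm p, of b] by (auto simp: g_at_Suc)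
  qed simp
  then show "g_at J p b = g_at J p a" "sgn_at J p a = 1 \<Longrightarrow> sgn_at J p b = 1" by auto
qed

text \<open>The maximum bounds g only at hits and at infinity. Going on to the next of these leaves
  g unchanged and keeps a positive sign, which transports the bounds to all positions, in particular
  to the ends of parts.\<close>

lemma next_hit:
  assumes adm: "admissible n lam J" and p: "p \<le> n" and j: "j \<le> chain_length n lam"
  obtains i where "i \<in> hits_inf J p" "j \<le> i" "g_at J p i = g_at J p j" "sgn_at J p j = 1 \<Longrightarrow> sgn_at J p i = 1"
    "\<And>h. h \<in> hits_inf J p \<Longrightarrow> j \<le> h \<Longrightarrow> i \<le> h"
proof -
  let ?A = "{i \<in> hits_inf J p. j \<le> i}"
  have A: "finite ?A" "?A \<noteq> {}" using finite_hits j by (auto simp: hits_inf_def)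
  have i: "Min ?A \<in> hits_inf J p" "j \<le> Min ?A" using Min_in[OF A] by auto
  have least: "Min ?A \<le> h" if "h \<in> hits_inf J p" "j \<le> h" for h using that A by simp
  have le: "Min ?A \<le> chain_length n lam" using least[of "chain_length n lam"] j by (simp add: hits_inf_def)
  have "\<not> hit J p h" if "j \<le> h" "h < Min ?A" for h
  proof
    assume "hit J p h"
    then have "h \<in> hits_inf J p" using that le by (simp add: hits_inf_def hits_def)
    then show False using least[of h] that by simp
  qed
  note * = no_hits_between[OF adm p i(2) le this]
  show thesis by (rule that[of "Min ?A"]) (use i least * in blast)+
qed

text \<open>The two halves, from the starting value and from the last slope, add up to an
  integer.\<close>

lemma peak_int: "\<exists>z. peak J p j = of_int z"
proof -
  have "\<exists>z. (\<Sum>i<j. if hit J p i \<and> i \<notin> J then sgn_at J p i else 0) = of_int z"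
  proof (induction j)
    case (Suc j)
    then obtain z where "(\<Sum>i<j. if hit J p i \<and> i \<notin> J then sgn_at J p i else 0) = of_int z" by blast
    then show ?case using sgn_at_cases[of J p j]
      by (auto intro: exI[of _ "z + 1"] exI[of _ "z - 1"] exI[of _ z])
  qed (auto intro: exI[of _ 0])
  then obtain z where z: "(\<Sum>i<j. if hit J p i \<and> i \<notin> J then sgn_at J p i else 0) = of_int z" by blast
  show ?thesis using sgn_at_cases[of J p j] sgn_at_cases[of J p 0]
    by (auto simp: peak_def g_at_def z intro: exI[of _ "z + 1"] exI[of _ "z - 1"] exI[of _ z])
qed

lemma g_at_le_max:
  assumes adm: "admissible n lam J" and p: "p \<le> n" and j: "j \<le> chain_length n lam"
  shows "g_at J p j \<le> g_max n lam J (simple_root n p)"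
proof -
  obtain i where "i \<in> hits_inf J p" "g_at J p i = g_at J p j" using next_hit[OF adm p j] by metis
  then show ?thesis using g_max_cases(1)[OF p] by metis
qed

text \<open>With a negative sign the peak lies below g; a positive sign survives up to the next hit
  or infinity.\<close>

lemma peak_le_max:
  assumes adm: "admissible n lam J" and p: "p \<le> n" and j: "j \<le> chain_length n lam"
  shows "peak J p j \<le> g_max n lam J (simple_root n p)"
proof (cases "sgn_at J p j = 1")
  case True
  obtain i where "i \<in> hits_inf J p" "g_at J p i = g_at J p j" "sgn_at J p i = 1"
    using next_hit[OF adm p j] True by metis
  then show ?thesis using g_max_cases(2)[OF p, of i J] True by (simp add: peak_def)
next
  case False
  then show ?thesis using g_at_le_max[OF assms] sgn_at_cases[of J p j] by (simp add: peak_def)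
qed

end

section \<open>The crystal operator on admissible subsets\<close>

lemma signed_reflection_conj:
  assumes \<pi>: "sperm n \<pi>" and ab: "letter n a" "letter n b" "a \<noteq> b" and uv: "letter n u" "letter n v" "u \<noteq> v"
    and eq: "root (\<pi> a, \<pi> b) = root (u, v) \<or> root (\<pi> a, \<pi> b) = vscale (- 1) (root (u, v))"
  shows "\<pi> \<circ> signed_reflection (a, b) = signed_reflection (u, v) \<circ> \<pi>"
proof
  fix x
  have nz: "a \<noteq> 0" "b \<noteq> 0" "u \<noteq> 0" "v \<noteq> 0" using ab uv letter_nonzero by auto
  have p: "\<pi> a \<noteq> 0" "\<pi> b \<noteq> 0" "\<pi> a \<noteq> \<pi> b" using \<pi> nz ab by (auto simp: sperm_eq_zero sperm_eq_iff)
  have neg: "\<pi> (- y) = - \<pi> y" for y using sperm_neg[OF \<pi>] .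
  have "\<pi> (signed_reflection (a, b) x) = signed_reflection (\<pi> a, \<pi> b) (\<pi> x)"
  proof -
    have "\<pi> x = \<pi> a \<longleftrightarrow> x = a" "\<pi> x = \<pi> b \<longleftrightarrow> x = b" "\<pi> x = - \<pi> a \<longleftrightarrow> x = - a" "\<pi> x = - \<pi> b \<longleftrightarrow> x = - b"
      using sperm_eq_iff[OF \<pi>] neg by metis+
    then show ?thesis
      unfolding signed_reflection_apply[OF nz(1,2) ab(3)] signed_reflection_apply[OF p] by (simp add: neg)
  qed
  also have "signed_reflection (\<pi> a, \<pi> b) = signed_reflection (u, v)"
  proof -
    have "root (\<pi> a, \<pi> b) = root (u, v) \<or> root (\<pi> a, \<pi> b) = root (v, u)" using eq by (simp add: root_swap)
    then have "(\<pi> a = u \<and> \<pi> b = v) \<or> (\<pi> a = - v \<and> \<pi> b = - u) \<or> (\<pi> a = v \<and> \<pi> b = u) \<or> (\<pi> a = - u \<and> \<pi> b = - v)"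
      using root_eq_iff[OF p(1,2) nz(3,4) p(3) uv(3)] root_eq_iff[OF p(1,2) nz(4,3) p(3)] uv(3) by auto
    moreover have com: "signed_reflection (v, u) = signed_reflection (u, v)"
      using nz uv(3) by (intro ext) (simp add: signed_reflection_apply)
    ultimately show ?thesis
      using signed_reflection_swap[OF nz(3,4) uv(3)] signed_reflection_swap[OF nz(4,3) uv(3)[symmetric]]
      by metis
  qed
  finally show "(\<pi> \<circ> signed_reflection (a, b)) x = (signed_reflection (u, v) \<circ> \<pi>) x" by simp
qed

context lambda_chain
begin

text \<open>Conjugating by the product so far turns the reflection of a hit into the simple
  reflection: a fold on the right is multiplication by the simple reflection on the left.\<close>

lemma hit_W:
  assumes p: "p \<le> n" and j: "j < chain_length n lam" "hit J p j"
  shows "W J j \<circ> signed_reflection (chain n lam ! j) = signed_reflection (simple_letters n p) \<circ> W J j"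
proof -
  obtain a b where ab: "chain n lam ! j = (a, b)" by fastforce
  obtain u v where uv: "simple_letters n p = (u, v)" "letter n u" "letter n v" "u \<noteq> v"
    using simple_lettersE[OF n_pos p] by metis
  have sp: "sperm n (W J j)" using sperm_W[of j] j by simp
  note l = chain_letters[OF j(1) ab]
  have "act (W J j) (pulled J p j) = root (u, v)"
    using act_pulled[of j J p] j uv p by (simp add: simple_root_eq)
  moreover have "pulled J p j = root (a, b) \<or> pulled J p j = vscale (- 1) (root (a, b))"
    using j(2) by (simp add: hit_def chain_root_def ab)
  ultimately have "root (u, v) = root (W J j a, W J j b) \<or> root (u, v) = vscale (- 1) (root (W J j a, W J j b))"
    using l by (auto simp: act_root[OF sp])
  moreover have "vscale (- 1) (vscale (- 1) (root (W J j a, W J j b))) = root (W J j a, W J j b)" by simp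
  ultimately have "root (W J j a, W J j b) = root (u, v) \<or> root (W J j a, W J j b) = vscale (- 1) (root (u, v))"
    by metis
  then show ?thesis unfolding ab uv(1) using l uv by (intro signed_reflection_conj[OF sp]) auto
qed

text \<open>Otherwise the maximum would be a value of g. At its earliest position it is either the
  starting value, which the threshold forbids, or g has just risen at an unfolded positive hit. The
  sign is then still positive, and the peak there exceeds the maximum by 1/2.\<close>

lemma max_is_peak:
  assumes adm: "admissible n lam J" and p: "p \<le> n"
    and M: "(if p = 0 then 1 else 0) < g_max n lam J (simple_root n p)"
  shows "\<exists>j\<in>hits_inf J p. peak J p j = g_max n lam J (simple_root n p)"
proof (rule ccontr)
  let ?M = "g_max n lam J (simple_root n p)"
  assume none: "\<not> ?thesis"
  then obtain j0 where j0: "j0 \<in> hits_inf J p" "?M = g_at J p j0" using g_max_cases(3)[OF p, of J] by metis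
  define j where "j = (LEAST j. j \<le> chain_length n lam \<and> g_at J p j = ?M)"
  have "j0 \<le> chain_length n lam" using j0 by (auto simp: hits_inf_def hits_def)
  then have j: "j \<le> chain_length n lam \<and> g_at J p j = ?M"
    unfolding j_def using j0(2) LeastI[of "\<lambda>j. j \<le> chain_length n lam \<and> g_at J p j = ?M" j0] by simp
  have least: "\<not> (i \<le> chain_length n lam \<and> g_at J p i = ?M)" if "i < j" for i
    using not_less_Least[of i "\<lambda>j. j \<le> chain_length n lam \<and> g_at J p j = ?M"] that j_def by simp
  show False
  proof (cases j)
    case 0
    then have "?M = - sgn_at J p 0 / 2" using j by (simp add: g_at_def)
    then show False using M sgn_at_0[OF p, of J] by (auto split: if_splits)
  next
    case (Suc i)
    then have i: "i < chain_length n lam" "g_at J p i \<noteq> ?M" using j least[of i] by auto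
    have "g_at J p i \<le> ?M" using g_at_le_max[OF adm p] i(1) by simp
    then have s: "i \<notin> J" "sgn_at J p i = 1"
      using i Suc j sgn_at_cases[of J p i] by (auto simp: g_at_Suc split: if_splits)
    then have "sgn_at J p j = 1" using Suc i sgn_at_keep by simp
    then have "peak J p j = ?M + 1 / 2" using j by (simp add: peak_def)
    then show False using peak_le_max[OF adm p, of j] j by simp
  qed
qed

text \<open>
  Where g attains its maximum, a positive hit is folded; the hit before it is unfolded and positive,
  and the sign of the simple root stays positive in between.
\<close>

lemma crystal_step:
  assumes adm: "admissible n lam J" and p: "p \<le> n"
  defines "M \<equiv> g_max n lam J (simple_root n p)"
  assumes M: "(if p = 0 then 1 else 0) < M"
  defines "m \<equiv> Min {i \<in> hits_inf J p. peak J p i = M}"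
  defines "k \<equiv> Max {i \<in> hits_inf J p. i < m}"
  shows "k < m" "m \<le> chain_length n lam" "k \<in> hits J p" "k \<notin> J"
    "m \<in> hits J p \<inter> J \<or> m = chain_length n lam"
    "peak J p k = M - 1" "\<And>j. k < j \<Longrightarrow> j \<le> m \<Longrightarrow> peak J p j = M"
    "\<And>j. k < j \<Longrightarrow> j < m \<Longrightarrow> j \<notin> hits J p" "\<And>j. j \<le> k \<Longrightarrow> peak J p j < M"
proof -
  let ?L = "chain_length n lam" and ?A = "{i \<in> hits_inf J p. peak J p i = M}" and ?B = "{i \<in> hits_inf J p. i < m}"
  have fin: "finite ?A" "finite ?B" using finite_hits by auto
  have "?A \<noteq> {}" using max_is_peak[OF adm p] M unfolding M_def by blast
  then have m: "m \<in> hits_inf J p" "peak J p m = M" using Min_in[OF fin(1)] unfolding m_def by blast+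
  have first: "peak J p i \<noteq> M" if "i \<in> hits_inf J p" "i < m" for i
    using Min_le[OF fin(1), of i] that unfolding m_def[symmetric] by force
  show mL: "m \<le> ?L" using m by (auto simp: hits_inf_def hits_def)
  have le: "g_at J p j \<le> M" "peak J p j \<le> M" if "j \<le> ?L" for j
    using g_at_le_max[OF adm p that] peak_le_max[OF adm p that] by (simp_all add: M_def)
  have hl: "i < ?L" "hit J p i" if "i \<in> hits J p" for i using that by (auto simp: hits_def)
  have s0: "sgn_at J p 0 = (if p = 0 then - 1 else 1)" using sgn_at_0[OF p] .
  \<comment> \<open>Without a hit before m the peak at m is at most the starting value plus 1/2,
    that is 1 for p = 0 and 0 otherwise. This is where the threshold makes the predecessor
    exist.\<close>
  have "?B \<noteq> {}"
  proof
    assume "?B = {}"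
    have "\<not> hit J p j" if "j < m" for j
    proof
      assume "hit J p j"
      then have "j \<in> ?B" using that mL by (simp add: hits_inf_def hits_def)
      then show False using \<open>?B = {}\<close> by blast
    qed
    then have "g_at J p m = g_at J p 0" using no_hits_between(1)[OF adm p _ mL, of 0] by simp
    moreover have "g_at J p 0 = - sgn_at J p 0 / 2" by (simp add: g_at_def)
    moreover have "M = g_at J p m + sgn_at J p m / 2" using m(2) by (simp add: peak_def)
    moreover have "sgn_at J p m \<le> 1" using sgn_at_cases[of J p m] by auto
    ultimately have "M \<le> (1 - sgn_at J p 0) / 2" by (simp add: field_simps)
    then show False using M s0 by (cases "p = 0") simp_all
  qed
  then have k: "k \<in> hits_inf J p" "k < m" using Max_in[OF fin(2)] unfolding k_def by blast+
  then show "k < m" by simp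
  show kh: "k \<in> hits J p" using k mL by (auto simp: hits_inf_def)
  show no: "j \<notin> hits J p" if "k < j" "j < m" for j
    using Max_ge[OF fin(2), of j] that unfolding k_def[symmetric] by (auto simp: hits_inf_def)
  have sm: "sgn_at J p m = 1" "g_at J p m = M - 1 / 2"
    using m(2) le(1)[OF mL] sgn_at_cases[of J p m] by (auto simp: peak_def)
  have nohit: "\<not> hit J p j" if "Suc k \<le> j" "j < m" for j
    using no[of j] that mL by (auto simp: hits_def)
  have gk: "g_at J p j = M - 1 / 2" if "k < j" "j \<le> m" for j
    using no_hits_between(1)[OF adm p that(2) mL] nohit that sm by simp
  show kJ: "k \<notin> J"
  proof
    assume kJ: "k \<in> J"
    then have "g_at J p k = M - 1 / 2" using gk[of "Suc k"] k by (simp add: g_at_Suc)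
    moreover have "sgn_at J p k = - 1"
      using first[OF k] sgn_at_cases[of J p k] calculation by (auto simp: peak_def)
    ultimately have ex: "k \<le> k \<and> g_at J p k = M - 1 / 2 \<and> sgn_at J p k = - 1" by simp
    \<comment> \<open>If k were folded, g would be M - 1/2 at k with negative sign. At the earliest
      such position j, the step into j is impossible: an unfolded hit would have come down from M +
      1/2, and a change of sign from plus is a folded hit with peak M before m. The case j = 0
      contradicts the threshold.\<close>
    define j where "j = (LEAST j. j \<le> k \<and> g_at J p j = M - 1 / 2 \<and> sgn_at J p j = - 1)"
    have j: "j \<le> k" "g_at J p j = M - 1 / 2" "sgn_at J p j = - 1"
      using LeastI[of "\<lambda>j. j \<le> k \<and> g_at J p j = M - 1 / 2 \<and> sgn_at J p j = - 1", OF ex] unfolding j_def by auto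
    show False
    proof (cases j)
      case 0
      then show False using j M s0 by (cases "p = 0") (simp_all add: g_at_def)
    next
      case (Suc i)
      then have "\<not> (i \<le> k \<and> g_at J p i = M - 1 / 2 \<and> sgn_at J p i = - 1)"
        using not_less_Least[of i "\<lambda>j. j \<le> k \<and> g_at J p j = M - 1 / 2 \<and> sgn_at J p j = - 1"] j_def by simp
      then have i: "i < k" "\<not> (g_at J p i = M - 1 / 2 \<and> sgn_at J p i = - 1)" using Suc j(1) by auto
      then have iL: "i < ?L" using k mL by simp
      show False
      proof (cases "hit J p i \<and> i \<notin> J")
        case True
        then have "sgn_at J p i = - 1" using j(3) sgn_at_keep[OF iL] Suc by metis
        then have "g_at J p i = M + 1 / 2" using True j(2) Suc by (simp add: g_at_Suc)
        then show False using le(1)[of i] iL by simp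
      next
        case False
        then have g: "g_at J p i = M - 1 / 2" using j(2) Suc by (auto simp: g_at_Suc)
        then have s: "sgn_at J p i = 1" using i sgn_at_cases[of J p i] by auto
        then have "hit J p i \<and> i \<in> J" using sgn_at_stays[OF adm p iL] j(3) Suc by fastforce
        then have "i \<in> hits_inf J p" using iL by (simp add: hits_inf_def hits_def)
        then show False using first[of i] g s i k by (simp add: peak_def)
      qed
    qed
  qed
  have "g_at J p (Suc k) = g_at J p k + sgn_at J p k" using kJ hl[OF kh] by (simp add: g_at_Suc)
  then have sk: "sgn_at J p k = 1" "g_at J p k = M - 3 / 2"
    using gk[of "Suc k"] k le(1)[of k] mL sgn_at_cases[of J p k] by auto
  then show "peak J p k = M - 1" by (simp add: peak_def)
  have sSuc: "sgn_at J p (Suc k) = 1" using sgn_at_keep[OF hl(1)[OF kh] kJ] sk by simp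
  show "peak J p j = M" if "k < j" "j \<le> m" for j
  proof -
    have "sgn_at J p j = 1" using no_hits_between(2)[OF adm p, of "Suc k" j] that mL nohit sSuc by simp
    then show ?thesis using gk[OF that] by (simp add: peak_def)
  qed
  show "m \<in> hits J p \<inter> J \<or> m = ?L"
  proof (cases "m = ?L")
    case False
    then have mh: "m \<in> hits J p" using m by (simp add: hits_inf_def)
    have "m \<in> J"
    proof (rule ccontr)
      assume "m \<notin> J"
      then have "g_at J p (Suc m) = M + 1 / 2" using hl[OF mh] sm by (simp add: g_at_Suc)
      then show False using le(1)[of "Suc m"] hl[OF mh] by simp
    qed
    then show ?thesis using mh by simp
  qed simp
  \<comment> \<open>Positions up to k need not be hits; a peak M there would persist up to the next
    hit, which comes no later than k.\<close>
  show "peak J p j < M" if j: "j \<le> k" for j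
  proof (rule ccontr)
    assume "\<not> peak J p j < M"
    moreover have jL: "j \<le> ?L" using j k mL by simp
    ultimately have "peak J p j = M" using le(2)[of j] by simp
    then have s: "sgn_at J p j = 1" "g_at J p j = M - 1 / 2"
      using le(1)[OF jL] sgn_at_cases[of J p j] by (auto simp: peak_def)
    show False
    proof (rule next_hit[OF adm p jL])
      fix i assume i: "i \<in> hits_inf J p" "g_at J p i = g_at J p j" "sgn_at J p j = 1 \<Longrightarrow> sgn_at J p i = 1"
        "\<And>h. h \<in> hits_inf J p \<Longrightarrow> j \<le> h \<Longrightarrow> i \<le> h"
      have "peak J p i = M" using s i(2,3) by (simp add: peak_def)
      then show False using first[OF i(1)] i(4)[OF k(1) j] k(2) by simp
    qed
  qed
qed

text \<open>The fold added at k creates a left factor, the simple reflection. The fold removed at m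
  was a left factor of the same kind, so from there on the two products agree.\<close>

lemma W_crystal:
  assumes p: "p \<le> n" and k: "k \<in> hits J p" "k \<notin> J" "k < m"
    and m: "m \<in> hits J p \<inter> J \<or> m = chain_length n lam" and j: "j \<le> chain_length n lam"
  shows "W ((J - {m}) \<union> {k}) j =
    (if k < j \<and> j \<le> m then signed_reflection (simple_letters n p) \<circ> W J j else W J j)"
  using j
proof (induction j)
  case (Suc j)
  then have j: "j < chain_length n lam" by simp
  let ?s = "signed_reflection (simple_letters n p)"
  consider "j = k" | "j = m" "j \<noteq> k" | "j \<noteq> m" "j \<noteq> k" by blast
  then show ?case
  proof cases
    case 1
    then have "hit J p k" "\<not> j = m" using k by (auto simp: hits_def)
    then show ?thesis using Suc 1 k hit_W[OF p j, of J] by (simp add: W_Suc)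
  next
    case 2
    then have h: "hit J p m" "m \<in> J" using m j by (auto simp: hits_def)
    then have "W J (Suc j) = ?s \<circ> W J j" using 2 hit_W[OF p j, of J] j by (simp add: W_Suc)
    then show ?thesis using Suc 2 k by (simp add: W_Suc)
  next
    case 3
    have "(k < Suc j \<and> Suc j \<le> m) = (k < j \<and> j \<le> m)" using 3 by auto
    then show ?thesis using Suc 3 by (auto simp: W_Suc fun_eq_iff)
  qed
qed simp

end

section \<open>KN columns and their splittings\<close>

abbreviation letters :: "nat \<Rightarrow> int set" where
  "letters n \<equiv> {x. letter n x}"

lemma finite_letters: "S \<subseteq> letters n \<Longrightarrow> finite S"
proof -
  have "finite (letters n)"
    by (rule finite_subset[of _ "{- int n..int n}"]) (auto simp: letter_def)
  then show "S \<subseteq> letters n \<Longrightarrow> finite S" by (rule finite_subset[rotated])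
qed

lemma letter_pos_inj: "inj_on (letter_pos n) (letters n)"
  by (rule inj_onI) (auto simp: letter_pos_def letter_def split: if_splits)

definition column_of :: "nat \<Rightarrow> int set \<Rightarrow> int list" where
  "column_of n S = sort_column n (sorted_list_of_set S)"

lemma sort_column_eq:
  assumes "distinct xs" "set xs \<subseteq> letters n"
  shows "sort_column n xs = column_of n (set xs)"
proof -
  let ?ys = "sort_column n xs" and ?zs = "column_of n (set xs)"
  have sets: "set ?ys = set xs" "set ?zs = set xs" "distinct ?ys" "distinct ?zs"
    using assms(1) by (simp_all add: column_of_def sort_column_def)
  have inj: "inj_on (letter_pos n) (set xs)" using letter_pos_inj assms(2) inj_on_subset by blast
  have "map (letter_pos n) ?ys = map (letter_pos n) ?zs"
  proof (rule sorted_distinct_set_unique)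
    show "distinct (map (letter_pos n) ?ys)" "distinct (map (letter_pos n) ?zs)"
      using sets inj by (simp_all add: distinct_map)
    show "set (map (letter_pos n) ?ys) = set (map (letter_pos n) ?zs)" using sets by simp
  qed (simp_all add: column_of_def sort_column_def)
  then show ?thesis using inj sets by (simp add: inj_on_map_eq_map)
qed

lemma column_of_props:
  assumes "S \<subseteq> letters n"
  shows "set (column_of n S) = S" "distinct (column_of n S)" "length (column_of n S) = card S"
    "sorted_wrt (\<lambda>x y. letter_pos n x < letter_pos n y) (column_of n S)"
    "is_column n (column_of n S)"
proof -
  have fin: "finite S" using assms finite_letters by blast
  show set: "set (column_of n S) = S" and dist: "distinct (column_of n S)" and "length (column_of n S) = card S"
    using fin by (simp_all add: column_of_def sort_column_def)
  have "sorted (map (letter_pos n) (column_of n S))" by (simp add: column_of_def sort_column_def)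
  moreover have "distinct (map (letter_pos n) (column_of n S))"
    using dist set inj_on_subset[OF letter_pos_inj assms] by (simp add: distinct_map)
  ultimately have "sorted_wrt (<) (map (letter_pos n) (column_of n S))"
    using strict_sorted_iff by blast
  then show sorted: "sorted_wrt (\<lambda>x y. letter_pos n x < letter_pos n y) (column_of n S)"
    by (simp add: sorted_wrt_map)
  then show "is_column n (column_of n S)" using set assms by (auto simp: is_column_def letter_def)
qed

lemma is_column_eq: "is_column n C \<Longrightarrow> set C \<subseteq> letters n \<and> C = column_of n (set C) \<and> distinct C"
proof -
  assume C: "is_column n C"
  then have l: "set C \<subseteq> letters n" by (auto simp: is_column_def letter_def)
  have s: "sorted_wrt (\<lambda>x y. letter_pos n x < letter_pos n y) C" using C by (simp add: is_column_def)
  then have d: "distinct C" by (rule distinct_sorted_wrt) simp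
  have "sorted_wrt (\<lambda>x y. letter_pos n x \<le> letter_pos n y) C"
    by (rule sorted_wrt_mono_rel[OF _ s]) simp
  then have "sort_column n C = C"
    unfolding sort_column_def by (intro sort_key_id_if_sorted) (simp add: sorted_wrt_map)
  then show ?thesis using sort_column_eq[OF d l] l d by simp
qed

lemma index_sorted_wrt:
  assumes "sorted_wrt (\<lambda>x y. f x < (f y :: int)) xs" "k < length xs"
  shows "card {x \<in> set xs. f x < f (xs ! k)} = k"
proof -
  have "set (take k xs) = {x \<in> set xs. f x < f (xs ! k)}"
    by (rule set_take_sorted_wrt[OF assms(1) _ _ assms(2)]) auto
  moreover have "distinct xs" by (rule distinct_sorted_wrt[OF assms(1)]) simp
  then have "card (set (take k xs)) = k" using assms(2) by (subst distinct_card) auto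
  ultimately show ?thesis by simp
qed

text \<open>The letters outside the stretch from z to -z are those of absolute value below z, so q -
  p is the height minus 1 minus their number. The KN condition says that for each pair z, -z at most
  z letters have absolute value at most z.\<close>

lemma KN_column_of_iff:
  assumes S: "S \<subseteq> letters n"
  shows "KN_column n (column_of n S) \<longleftrightarrow>
    (\<forall>z. 0 < z \<and> z \<in> S \<and> - z \<in> S \<longrightarrow> int (card {x \<in> S. \<bar>x\<bar> < z}) + 2 \<le> z)"
proof -
  let ?C = "column_of n S" and ?l = "letter_pos n"
  note props = column_of_props[OF S]
  have fin: "finite S" using S finite_letters by blast
  have gap: "int q - int p = int (card S) - 1 - int (card {x \<in> S. \<bar>x\<bar> < z})"
    if "0 < z" "p < length ?C" "q < length ?C" "?C ! p = z" "?C ! q = - z" for z p q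
  proof -
    have mem: "z \<in> S" "- z \<in> S" using that props(1) nth_mem by metis+
    have zn: "z \<le> int n" using mem S by (auto simp: letter_def)
    have p: "p = card {x \<in> S. ?l x < ?l z}" and q: "q = card {x \<in> S. ?l x < ?l (- z)}"
      using index_sorted_wrt[OF props(4)] that props(1) by metis+
    let ?L = "{x \<in> S. ?l x < ?l z}" and ?R = "{x \<in> S. ?l (- z) < ?l x}" and ?M = "{x \<in> S. ?l x < ?l (- z)}"
    have lt: "?l x < ?l y \<or> x = y \<or> ?l y < ?l x" if "x \<in> S" "y \<in> S" for x y
      using that S letter_pos_inj[of n] by (metis inj_on_eq_iff linorder_neqE subsetD)
    have "S = ?M \<union> ({- z} \<union> ?R)" using mem lt by auto
    moreover have "card (?M \<union> ({- z} \<union> ?R)) = card ?M + card ({- z} \<union> ?R)"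
      using fin by (intro card_Un_disjoint) auto
    ultimately have "card S = card ?M + card ({- z} \<union> ?R)" by simp
    also have "card ({- z} \<union> ?R) = 1 + card ?R"
      using fin by (subst card_Un_disjoint) auto
    finally have 1: "card S = q + 1 + card ?R" using q by simp
    have "{x \<in> S. \<bar>x\<bar> < z} = ?L \<union> ?R"
      using S that(1) zn by (auto simp: letter_pos_def letter_def split: if_splits)
    moreover have "?L \<inter> ?R = {}" using that(1) zn by (auto simp: letter_pos_def split: if_splits)
    ultimately have "card {x \<in> S. \<bar>x\<bar> < z} = p + card ?R" using fin p by (simp add: card_Un_disjoint)
    then show ?thesis using 1 by simp
  qed
  show ?thesis
  proof
    assume KN: "KN_column n ?C"
    show "\<forall>z. 0 < z \<and> z \<in> S \<and> - z \<in> S \<longrightarrow> int (card {x \<in> S. \<bar>x\<bar> < z}) + 2 \<le> z"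
    proof (intro allI impI, elim conjE)
      fix z :: int assume z: "0 < z" "z \<in> S" "- z \<in> S"
      then obtain p q where pq: "p < length ?C" "?C ! p = z" "q < length ?C" "?C ! q = - z"
        using props(1) by (metis in_set_conv_nth)
      have "z \<le> int n" using z S by (auto simp: letter_def)
      then have "\<not> int q - int p \<le> int (card S) - z"
        using KN pq z(1) unfolding KN_column_def props(3) by (metis int_one_le_iff_zero_less)
      then show "int (card {x \<in> S. \<bar>x\<bar> < z}) + 2 \<le> z"
        using gap[OF z(1) pq(1,3,2,4)] by linarith
    qed
  next
    assume *: "\<forall>z. 0 < z \<and> z \<in> S \<and> - z \<in> S \<longrightarrow> int (card {x \<in> S. \<bar>x\<bar> < z}) + 2 \<le> z"
    have False if "1 \<le> z" "p < length ?C" "q < length ?C" "?C ! p = z" "?C ! q = - z"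
      "int q - int p \<le> int (length ?C) - z" for z p q
    proof -
      have "z \<in> S" "- z \<in> S" using that props(1) nth_mem by metis+
      then have "int (card {x \<in> S. \<bar>x\<bar> < z}) + 2 \<le> z" using * that by simp
      then show False using gap[of z p q] that props(3) by simp
    qed
    then show "KN_column n ?C" using props(5) unfolding KN_column_def by blast
  qed
qed

section \<open>Existence of the splitting\<close>

definition free_letters :: "int set \<Rightarrow> int set" where
  "free_letters S = {f. 1 \<le> f \<and> f \<notin> S \<and> - f \<notin> S}"

definition pairs_desc :: "nat \<Rightarrow> int set \<Rightarrow> int list" where
  "pairs_desc n S = filter (\<lambda>z. z \<in> S \<and> - z \<in> S) (rev [1..int n])"

lemma split_map_eq:
  "split_map n C = zip (pairs_desc n (set C)) (split_ts (int n + 1) (set C) (pairs_desc n (set C)))"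
  by (simp add: split_map_def pairs_desc_def Let_def)

lemma pairs_desc_props: "sorted_wrt (>) (pairs_desc n S)" "distinct (pairs_desc n S)"
    "S \<subseteq> letters n \<Longrightarrow> set (pairs_desc n S) = {z. 0 < z \<and> z \<in> S \<and> - z \<in> S}"
proof -
  show "sorted_wrt (>) (pairs_desc n S)"
    unfolding pairs_desc_def by (rule sorted_wrt_filter[OF sorted_wrt_rev_upto])
  then show "distinct (pairs_desc n S)" by (rule distinct_sorted_wrt) simp
  show "S \<subseteq> letters n \<Longrightarrow> set (pairs_desc n S) = {z. 0 < z \<and> z \<in> S \<and> - z \<in> S}"
  proof (intro equalityI subsetI)
    fix z assume "S \<subseteq> letters n" "z \<in> {z. 0 < z \<and> z \<in> S \<and> - z \<in> S}"
    then have "letter n z" "0 < z" "z \<in> S" "- z \<in> S" by blast+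
    then show "z \<in> set (pairs_desc n S)" by (simp add: pairs_desc_def letter_def)
  qed (simp add: pairs_desc_def)
qed

lemma split_ts_step: "split_ts b S (z # zs) =
    (let t = Max {f \<in> free_letters S. f < b \<and> f < z} in t # split_ts t S zs)"
proof -
  have "{t. 1 \<le> t \<and> t < min b z \<and> t \<notin> S \<and> - t \<notin> S} = {f \<in> free_letters S. f < b \<and> f < z}"
    by (auto simp: free_letters_def)
  then show ?thesis unfolding split_ts.simps(2) by (simp only:)
qed

lemma finite_free_below: "finite {f \<in> free_letters S. f < b}" "finite {f \<in> free_letters S. f < b \<and> f < z}"
  by (rule finite_subset[of _ "{1..b}"]; auto simp: free_letters_def)+

text \<open>A counting condition of Hall type for the greedy choice: the choice of the largest
  available letter leaves all smaller ones, so the count goes down by at most one at each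
  step.\<close>

lemma split_ts_exist:
  assumes "length zs \<le> card {f \<in> free_letters S. f < b}"
    "\<And>i. i < length zs \<Longrightarrow> length zs - i \<le> card {f \<in> free_letters S. f < zs ! i}"
  shows "length (split_ts b S zs) = length zs" "set (split_ts b S zs) \<subseteq> free_letters S"
proof -
  have "length (split_ts b S zs) = length zs \<and> set (split_ts b S zs) \<subseteq> free_letters S"
    using assms
  proof (induction zs arbitrary: b)
    case (Cons z zs)
    let ?X = "{f \<in> free_letters S. f < b \<and> f < z}"
    have card: "Suc (length zs) \<le> card ?X"
    proof (cases "b \<le> z")
      case True
      then have "?X = {f \<in> free_letters S. f < b}" by auto
      then show ?thesis using Cons.prems(1) by (simp only: list.size)
    next
      case False
      then have "?X = {f \<in> free_letters S. f < z}" by auto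
      then show ?thesis using Cons.prems(2)[of 0] by simp
    qed
    have "?X \<noteq> {}"
    proof
      assume "?X = {}"
      then have "card ?X = 0" by (simp only: card.empty)
      then show False using card by simp
    qed
    define t where "t = Max ?X"
    have t: "t \<in> ?X" unfolding t_def using \<open>?X \<noteq> {}\<close> finite_free_below(2) by (rule Max_in[rotated])
    have tmax: "f \<le> t" if "f \<in> ?X" for f unfolding t_def using that finite_free_below(2) by (intro Max_ge)
    have X: "?X \<subseteq> insert t {f \<in> free_letters S. f < t}"
    proof
      fix f assume f: "f \<in> ?X"
      then show "f \<in> insert t {f \<in> free_letters S. f < t}" using tmax[OF f] by auto
    qed
    have "card ?X \<le> card (insert t {f \<in> free_letters S. f < t})"
      by (rule card_mono[OF _ X]) (simp add: finite_free_below(1))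
    also have "\<dots> \<le> Suc (card {f \<in> free_letters S. f < t})"
      by (simp add: card_insert_if finite_free_below(1))
    finally have 1: "length zs \<le> card {f \<in> free_letters S. f < t}" using card by simp
    have 2: "length zs - i \<le> card {f \<in> free_letters S. f < zs ! i}" if "i < length zs" for i
      using Cons.prems(2)[of "Suc i"] that by simp
    have "length (split_ts t S zs) = length zs \<and> set (split_ts t S zs) \<subseteq> free_letters S"
      by (rule Cons.IH[OF 1 2])
    then show ?case using t unfolding split_ts_step Let_def t_def[symmetric] by simp
  qed simp
  then show "length (split_ts b S zs) = length zs" "set (split_ts b S zs) \<subseteq> free_letters S" by auto
qed

text \<open>Let N letters have absolute value below z and let them form P pairs. Then N - P values
  below z are taken, and the KN condition N + 2 \<le> z leaves at least P + 1 free ones: one for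
  each pair up to and including z.\<close>

lemma card_free_below:
  assumes S: "S \<subseteq> letters n" and z: "0 < z" "z \<in> S" "- z \<in> S" and KN: "int (card {x \<in> S. \<bar>x\<bar> < z}) + 2 \<le> z"
  shows "card {y. 0 < y \<and> y \<le> z \<and> y \<in> S \<and> - y \<in> S} \<le> card {f \<in> free_letters S. f < z}"
proof -
  let ?P = "{x \<in> S. 0 < x \<and> x < z}" and ?Q = "uminus ` {x \<in> S. x < 0 \<and> - z < x}" and ?F = "{f \<in> free_letters S. f < z}"
  have fin: "finite S" using S finite_letters by blast
  have "{x \<in> S. \<bar>x\<bar> < z} = ?P \<union> {x \<in> S. x < 0 \<and> - z < x}" using S by (auto simp: letter_def abs_if split: if_splits)
  moreover have "card {x \<in> S. x < 0 \<and> - z < x} = card ?Q" by (simp add: card_image)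
  ultimately have N: "card {x \<in> S. \<bar>x\<bar> < z} = card ?P + card ?Q"
    using fin card_Un_disjoint[of ?P "{x \<in> S. x < 0 \<and> - z < x}"] by fastforce
  have "card ?P + card ?Q = card (?P \<union> ?Q) + card (?P \<inter> ?Q)" using fin by (intro card_Un_Int) auto
  moreover have Q: "y \<in> ?Q \<longleftrightarrow> - y \<in> S \<and> 0 < y \<and> y < z" for y
    by (auto intro!: image_eqI[of _ _ "- y"])
  have "?P \<inter> ?Q = {y. 0 < y \<and> y < z \<and> y \<in> S \<and> - y \<in> S}" using Q by blast
  moreover have "{1..<z} = ?F \<union> (?P \<union> ?Q)"
    unfolding set_eq_iff Un_iff Q by (auto simp: free_letters_def)
  moreover have "card (?F \<union> (?P \<union> ?Q)) = card ?F + card (?P \<union> ?Q)"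
    using fin finite_free_below(1)[of S z] by (intro card_Un_disjoint) (auto simp: free_letters_def)
  moreover have "card {1..<z} = nat (z - 1)" by simp
  moreover have "{y. 0 < y \<and> y \<le> z \<and> y \<in> S \<and> - y \<in> S} = insert z {y. 0 < y \<and> y < z \<and> y \<in> S \<and> - y \<in> S}"
    using z by auto
  moreover have "finite {y. 0 < y \<and> y < z \<and> y \<in> S \<and> - y \<in> S}" by (rule finite_subset[OF _ fin]) auto
  ultimately show ?thesis using N KN by simp
qed

text \<open>For a KN column each \<open>Max\<close> in \<open>split_ts\<close> is taken over a
  nonempty set, so the letters of the splitting are genuine.\<close>

lemma KN_split_exist:
  assumes S: "S \<subseteq> letters n" and KN: "KN_column n (column_of n S)"
  defines "zs \<equiv> pairs_desc n S"
  shows "length (split_ts (int n + 1) S zs) = length zs" "set (split_ts (int n + 1) S zs) \<subseteq> free_letters S"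
proof -
  have KN': "int (card {x \<in> S. \<bar>x\<bar> < z}) + 2 \<le> z" if "0 < z" "z \<in> S" "- z \<in> S" for z
    using KN that KN_column_of_iff[OF S] by blast
  note props = pairs_desc_props[where n = n and S = S, folded zs_def]
  have b: "length zs - i \<le> card {f \<in> free_letters S. f < zs ! i}" if i: "i < length zs" for i
  proof -
    have mem: "zs ! i \<in> {z. 0 < z \<and> z \<in> S \<and> - z \<in> S}" using i props(3)[OF S] nth_mem by blast
    have "set (drop i zs) \<subseteq> {y. 0 < y \<and> y \<le> zs ! i \<and> y \<in> S \<and> - y \<in> S}"
    proof
      fix y assume "y \<in> set (drop i zs)"
      then obtain j where "j < length (drop i zs)" "y = drop i zs ! j" by (metis in_set_conv_nth)
      then have j: "i + j < length zs" "y = zs ! (i + j)" by auto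
      then have "y \<le> zs ! i"
        using props(1) by (cases "j = 0") (auto simp: sorted_wrt_iff_nth_less less_imp_le)
      moreover have "y \<in> set zs" using j by simp
      ultimately show "y \<in> {y. 0 < y \<and> y \<le> zs ! i \<and> y \<in> S \<and> - y \<in> S}" using props(3)[OF S] by auto
    qed
    moreover have "finite {y. 0 < y \<and> y \<le> zs ! i \<and> y \<in> S \<and> - y \<in> S}"
      by (rule finite_subset[of _ "{0..zs ! i}"]) auto
    ultimately have "card (set (drop i zs)) \<le> card {y. 0 < y \<and> y \<le> zs ! i \<and> y \<in> S \<and> - y \<in> S}"
      by (rule card_mono[rotated])
    moreover have "card (set (drop i zs)) = length zs - i" using props(2) by (simp add: distinct_card)
    ultimately show ?thesis using card_free_below[OF S, of "zs ! i"] KN' mem by simp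
  qed
  have a: "length zs \<le> card {f \<in> free_letters S. f < int n + 1}"
  proof (cases "zs = []")
    case False
    then have "zs ! 0 \<in> S" using props(3)[OF S] nth_mem[of 0 zs] by auto
    then have "zs ! 0 \<le> int n" using S by (auto simp: letter_def)
    then have "card {f \<in> free_letters S. f < zs ! 0} \<le> card {f \<in> free_letters S. f < int n + 1}"
      by (intro card_mono finite_free_below) auto
    then show ?thesis using b[of 0] False by simp
  qed simp
  show "length (split_ts (int n + 1) S zs) = length zs" "set (split_ts (int n + 1) S zs) \<subseteq> free_letters S"
    using split_ts_exist[OF a b] by blast+
qed

section \<open>Recognising splittings by counting letters\<close>

definition count_above :: "int set \<Rightarrow> int \<Rightarrow> nat" where
  "count_above A v = card {x \<in> A. v < x}"

text \<open>The pairs of sets that arise from the two columns of the splitting of a KN column.\<close>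

definition split_pair :: "nat \<Rightarrow> int set \<Rightarrow> int set \<Rightarrow> bool" where
  "split_pair n A B \<longleftrightarrow> A \<subseteq> letters n \<and> (\<forall>x\<in>A. - x \<notin> A) \<and> (\<forall>x\<in>B. - x \<notin> B) \<and> abs ` A = abs ` B \<and>
     (\<forall>v\<ge>0. count_above A v \<le> count_above B v \<and> (v \<notin> abs ` A \<longrightarrow> count_above A v = count_above B v))"

definition joined :: "int set \<Rightarrow> int set \<Rightarrow> int set" where
  "joined A B = {x \<in> B. 0 < x} \<union> {x \<in> A. x < 0}"

text \<open>Characterises the greedy choice. The domination puts the largest element t of D below
  the largest pair z. A free letter between t and z, and below b, would lie outside D with no
  element of D above it but with z above it, against the equality of counts. So t is the first
  choice, and both conditions pass on to the rest.\<close>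

lemma split_ts_eq:
  assumes "set zs = E" "sorted_wrt (>) zs" "finite D" "card D = length zs" "D \<subseteq> free_letters S" "\<And>d. d \<in> D \<Longrightarrow> d < b"
    "E \<subseteq> S" "\<And>v. count_above D v \<le> count_above E v"
    "\<And>f. f \<in> free_letters S \<Longrightarrow> f < b \<Longrightarrow> f \<notin> D \<Longrightarrow> count_above D f = count_above E f"
  shows "set (split_ts b S zs) = D \<and> length (split_ts b S zs) = length zs"
  using assms
proof (induction zs arbitrary: b D E)
  case (Cons z zs)
  have E: "finite E" "E = insert z (set zs)" "z \<notin> set zs" using Cons.prems(1,2) by auto
  have zmax: "y < z" if "y \<in> set zs" for y using Cons.prems(2) that by simp
  have "D \<noteq> {}" using Cons.prems(4) by auto
  define t where "t = Max D"
  have tD: "t \<in> D" and tmax: "\<And>d. d \<in> D \<Longrightarrow> d \<le> t"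
    using Cons.prems(3) \<open>D \<noteq> {}\<close> by (auto simp: t_def)
  have tf: "t \<in> free_letters S" "t < b" using tD Cons.prems(5,6) by auto
  have "0 < count_above D (t - 1)" using tD Cons.prems(3) by (auto simp: count_above_def card_gt_0_iff)
  then have "0 < count_above E (t - 1)" using Cons.prems(8)[of "t - 1"] by linarith
  then have "{x \<in> E. t - 1 < x} \<noteq> {}" by (simp only: count_above_def card_gt_0_iff) simp
  then obtain y where y: "y \<in> E" "t - 1 < y" by blast
  then have "y = z \<or> y < z" using E(2) zmax[of y] by blast
  then have "t \<le> z" using y by linarith
  moreover have "t \<noteq> z" using tf(1) E(2) Cons.prems(7) by (auto simp: free_letters_def)
  ultimately have tz: "t < z" by simp
  have "Max {f \<in> free_letters S. f < b \<and> f < z} = t"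
  proof (rule Max_eqI)
    fix f assume f: "f \<in> {f \<in> free_letters S. f < b \<and> f < z}"
    show "f \<le> t"
    proof (rule ccontr)
      assume "\<not> f \<le> t"
      then have "\<not> f < d \<and> d \<noteq> f" if "d \<in> D" for d using tmax[OF that] by auto
      then have "{x \<in> D. f < x} = {}" "f \<notin> D" by blast+
      then have "count_above D f = 0" unfolding count_above_def by (simp only: card.empty)
      then have "count_above E f = 0" using Cons.prems(9)[of f] f \<open>f \<notin> D\<close> by simp
      moreover have "z \<in> {x \<in> E. f < x}" "finite {x \<in> E. f < x}" using f E by simp_all
      ultimately show False unfolding count_above_def card_eq_0_iff by blast
    qed
  qed (use tf tz finite_free_below in auto)
  then have step: "split_ts b S (z # zs) = t # split_ts t S zs" unfolding split_ts_step Let_def by simp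
  have cD: "count_above D v = (if v < t then Suc (count_above (D - {t}) v) else 0)" for v
  proof (cases "v < t")
    case True
    have "{x \<in> D. v < x} = insert t {x \<in> D - {t}. v < x}" using tD True by auto
    then show ?thesis using True Cons.prems(3) by (simp add: count_above_def)
  next
    case False
    then have "\<not> v < d" if "d \<in> D" for d using tmax[OF that] by linarith
    then have "{x \<in> D. v < x} = {}" by blast
    then have "count_above D v = 0" unfolding count_above_def by (simp only: card.empty)
    then show ?thesis using False by simp
  qed
  have cE: "count_above E v = (if v < z then Suc (count_above (set zs) v) else 0)" for v
  proof (cases "v < z")
    case True
    have "{x \<in> E. v < x} = insert z {x \<in> set zs. v < x}" using E True by auto
    then show ?thesis using True E by (simp add: count_above_def)
  next
    case False
    then have "\<not> v < y" if "y \<in> E" for y using zmax[of y] E(2) that by fastforce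
    then have "{x \<in> E. v < x} = {}" by blast
    then have "count_above E v = 0" unfolding count_above_def by (simp only: card.empty)
    then show ?thesis using False by simp
  qed
  have c0: "count_above (D - {t}) v = 0" if "t \<le> v" for v
  proof -
    have "\<not> v < d" if "d \<in> D" for d using tmax[OF that] \<open>t \<le> v\<close> by linarith
    then have "{x \<in> D - {t}. v < x} = {}" by blast
    then show ?thesis unfolding count_above_def by (simp only: card.empty)
  qed
  have "set (split_ts t S zs) = D - {t} \<and> length (split_ts t S zs) = length zs"
  proof (rule Cons.IH[of "set zs"])
    show "card (D - {t}) = length zs" using Cons.prems(3,4) tD by simp
    show "d < t" if "d \<in> D - {t}" for d using tmax[of d] that by auto
    show "count_above (D - {t}) v \<le> count_above (set zs) v" for v
      using Cons.prems(8)[of v] cD[of v] cE[of v] tz c0[of v] by (cases "v < t") auto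
    show "count_above (D - {t}) f = count_above (set zs) f" if "f \<in> free_letters S" "f < t" "f \<notin> D - {t}" for f
      using Cons.prems(9)[of f] that cD[of f] cE[of f] tz tf(2) by auto
  qed (use Cons.prems E in auto)
  then show ?case unfolding step using tD by auto
qed simp

lemma split_pair_finite: "split_pair n A B \<Longrightarrow> finite A \<and> finite B \<and> B \<subseteq> letters n"
proof -
  assume sp: "split_pair n A B"
  have "B \<subseteq> letters n"
  proof
    fix x assume "x \<in> B"
    then have "\<bar>x\<bar> \<in> abs ` A" using sp by (auto simp: split_pair_def)
    then obtain y where "y \<in> A" "\<bar>x\<bar> = \<bar>y\<bar>" by auto
    then show "x \<in> letters n" using sp by (auto simp: split_pair_def letter_def)
  qed
  then show ?thesis using sp finite_letters by (auto simp: split_pair_def)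
qed

lemma joined_subset:
  assumes "split_pair n A B"
  shows "joined A B \<subseteq> letters n"
proof -
  have "A \<subseteq> letters n" using assms unfolding split_pair_def by (rule conjunct1)
  then show ?thesis using split_pair_finite[OF assms] unfolding joined_def by blast
qed

text \<open>Serves both columns of a splitting: g is the identity for the left one and negation for
  the right one.\<close>

lemma image_map_of_zip:
  assumes "distinct zs" "length ts = length zs" "set zs \<subseteq> g ` S" "\<And>x. g (g x) = x"
  shows "(\<lambda>x. case map_of (zip zs ts) (g x) of Some t \<Rightarrow> g t | None \<Rightarrow> x) ` S = (S - g ` set zs) \<union> g ` set ts"
proof -
  define h where "h x = (case map_of (zip zs ts) (g x) of Some t \<Rightarrow> g t | None \<Rightarrow> x)" for x
  have h_in: "h (g (zs ! i)) = g (ts ! i)" if "i < length zs" for i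
    using map_of_zip_nth[of zs ts i] assms that by (simp add: h_def)
  have h_out: "h x = x" if "g x \<notin> set zs" for x
  proof -
    have "map_of (zip zs ts) (g x) = None" using assms(2) that by simp
    then show ?thesis by (simp add: h_def)
  qed
  have mem: "x \<in> g ` X \<longleftrightarrow> g x \<in> X" for x X using assms(4) by (metis imageE imageI)
  have "h ` S = (S - g ` set zs) \<union> g ` set ts"
  proof (intro equalityI subsetI)
    fix y assume "y \<in> h ` S"
    then obtain x where x: "x \<in> S" "y = h x" by blast
    show "y \<in> (S - g ` set zs) \<union> g ` set ts"
    proof (cases "g x \<in> set zs")
      case True
      then obtain i where i: "i < length zs" "zs ! i = g x" by (metis in_set_conv_nth)
      then have "y = g (ts ! i)" using h_in[OF i(1)] x(2) assms(4) by metis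
      then show ?thesis using i(1) assms(2) by simp
    next
      case False
      then show ?thesis using h_out[OF False] x mem by simp
    qed
  next
    fix y assume "y \<in> (S - g ` set zs) \<union> g ` set ts"
    then consider "y \<in> S" "g y \<notin> set zs" | "y \<in> g ` set ts" using mem by blast
    then show "y \<in> h ` S"
    proof cases
      case 1
      then show ?thesis using h_out[OF 1(2)] by (metis imageI)
    next
      case 2
      then obtain t where "t \<in> set ts" "y = g t" by blast
      then obtain i where i: "i < length zs" "y = g (ts ! i)" using assms(2) by (metis in_set_conv_nth)
      then have "g (zs ! i) \<in> S" using assms(3) mem by (metis nth_mem subsetD)
      then show ?thesis using h_in[OF i(1)] i(2) by (metis imageI)
    qed
  qed
  then show ?thesis unfolding h_def .
qed

lemma map_split_letters:
  assumes S: "S \<subseteq> letters n"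
    and ts: "length (split_ts (int n + 1) S (pairs_desc n S)) = length (pairs_desc n S)"
  defines "E \<equiv> {z. 0 < z \<and> z \<in> S \<and> - z \<in> S}" and "T \<equiv> set (split_ts (int n + 1) S (pairs_desc n S))"
  shows "set (left_column n (column_of n S)) = (S - E) \<union> T"
    "set (right_column n (column_of n S)) = (S - uminus ` E) \<union> uminus ` T"
proof -
  note C = column_of_props[OF S] and zs = pairs_desc_props[where n = n and S = S]
  have E: "set (pairs_desc n S) = E" using zs(3)[OF S] by (simp add: E_def)
  show "set (left_column n (column_of n S)) = (S - E) \<union> T"
  proof -
    have "E \<subseteq> S" by (auto simp: E_def)
    then show ?thesis using image_map_of_zip[OF zs(2) ts, of "\<lambda>x. x" S] C(1) E
      by (simp add: left_column_def sort_column_def split_map_eq T_def)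
  qed
  have "set (pairs_desc n S) \<subseteq> uminus ` S"
  proof
    fix z assume "z \<in> set (pairs_desc n S)"
    then have "- z \<in> S" using E by (simp add: E_def)
    then show "z \<in> uminus ` S" by (metis imageI minus_minus)
  qed
  then show "set (right_column n (column_of n S)) = (S - uminus ` E) \<union> uminus ` T"
    using image_map_of_zip[OF zs(2) ts, of uminus S] C(1) E
    by (simp add: right_column_def sort_column_def split_map_eq T_def)
qed

lemma KN_joined:
  assumes KN: "KN_column n C"
  shows "set C = joined (set (left_column n C)) (set (right_column n C))"
proof -
  let ?S = "set C" and ?T = "set (split_ts (int n + 1) (set C) (pairs_desc n (set C)))"
  have S: "?S \<subseteq> letters n" and C: "C = column_of n ?S" using KN is_column_eq by (auto simp: KN_column_def)
  have "KN_column n (column_of n ?S)" using KN C by simp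
  note ts = KN_split_exist[OF S this]
  have T: "0 < t" if "t \<in> ?T" for t using ts(2) that by (auto simp: free_letters_def)
  have nz: "x \<noteq> 0" if "x \<in> ?S" for x using S that by (auto simp: letter_def)
  have um: "x \<in> uminus ` X \<longleftrightarrow> - x \<in> X" for x :: int and X by (metis imageE imageI minus_minus)
  have right: "x \<in> set (right_column n C) \<longleftrightarrow> x \<in> ?S" if "0 < x" for x
    unfolding map_split_letters(2)[OF S ts(1), folded C] Un_iff Diff_iff um mem_Collect_eq
    using T[of "- x"] that by auto
  have left: "x \<in> set (left_column n C) \<longleftrightarrow> x \<in> ?S" if "x < 0" for x
    unfolding map_split_letters(1)[OF S ts(1), folded C] Un_iff Diff_iff mem_Collect_eq
    using T[of x] that by auto
  show ?thesis
  proof (rule set_eqI)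
    fix x
    show "x \<in> ?S \<longleftrightarrow> x \<in> joined (set (left_column n C)) (set (right_column n C))"
      using nz[of x] left[of x] right[of x] by (cases x "0 :: int" rule: linorder_cases) (auto simp: joined_def)
  qed
qed

lemma KN_split_inj:
  assumes "KN_column n C" "KN_column n C'" "left_column n C = left_column n C'" "right_column n C = right_column n C'"
  shows "C = C'"
proof -
  have "set C = set C'" using KN_joined[OF assms(1)] KN_joined[OF assms(2)] assms(3,4) by simp
  then show ?thesis using is_column_eq assms(1,2) unfolding KN_column_def by metis
qed

lemma count_above_split:
  assumes "finite A" "\<And>x. v < x \<Longrightarrow> x \<in> A \<longleftrightarrow> x \<in> P \<or> x \<in> Q" "\<And>x. v < x \<Longrightarrow> \<not> (x \<in> P \<and> x \<in> Q)"
  shows "count_above A v = count_above P v + count_above Q v"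
proof -
  have "{x \<in> A. v < x} = {x \<in> P. v < x} \<union> {x \<in> Q. v < x}" using assms(2) by blast
  moreover have "finite {x \<in> A. v < x}" using assms(1) by simp
  ultimately show ?thesis unfolding count_above_def using assms(3)
    by (metis (no_types, lifting) card_Un_disjoint disjoint_iff finite_Un mem_Collect_eq)
qed

text \<open>In the joined column the pairs are the set E of positive z with z in B and -z in A, and
  the candidates for their replacements are the set D of positive t with t in A and -t in B. The
  difference of the counts of B and A is that of E and D, so the condition on A and B says precisely
  that D is the greedy choice for E.\<close>

lemma split_of_joined:
  assumes sp: "split_pair n A B"
  defines "C \<equiv> column_of n (joined A B)"
  shows "KN_column n C" "left_column n C = column_of n A" "right_column n C = column_of n B" "length C = card A"
proof -
  let ?S = "joined A B"
  define E where "E = {z. 0 < z \<and> z \<in> B \<and> - z \<in> A}"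
  define D where "D = {t. 0 < t \<and> t \<in> A \<and> - t \<in> B}"
  have A: "A \<subseteq> letters n" "\<And>x. x \<in> A \<Longrightarrow> - x \<notin> A" and B: "\<And>x. x \<in> B \<Longrightarrow> - x \<notin> B"
    and absAB: "abs ` A = abs ` B"
    and count: "\<And>v. 0 \<le> v \<Longrightarrow> count_above A v \<le> count_above B v"
      "\<And>v. 0 \<le> v \<Longrightarrow> v \<notin> abs ` A \<Longrightarrow> count_above A v = count_above B v"
    using sp unfolding split_pair_def by (elim conjE, simp)+
  have fin: "finite A" "finite B" and Bl: "B \<subseteq> letters n" using split_pair_finite[OF sp] by auto
  have Sl: "?S \<subseteq> letters n" using A(1) Bl by (auto simp: joined_def)
  have finS: "finite ?S" using finite_letters[OF Sl] .
  have abs_mem: "x \<in> A \<or> - x \<in> A \<longleftrightarrow> x \<in> B \<or> - x \<in> B" for x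
  proof -
    have mem: "x \<in> X \<or> - x \<in> X \<longleftrightarrow> \<bar>x\<bar> \<in> abs ` X" for X :: "int set"
    proof
      assume "x \<in> X \<or> - x \<in> X"
      then show "\<bar>x\<bar> \<in> abs ` X" by (metis abs_minus imageI)
    next
      assume "\<bar>x\<bar> \<in> abs ` X"
      then obtain y where "y \<in> X" "\<bar>x\<bar> = \<bar>y\<bar>" by blast
      then show "x \<in> X \<or> - x \<in> X" by (metis abs_eq_iff)
    qed
    show ?thesis unfolding mem absAB ..
  qed
  have nz: "0 \<notin> A" "0 \<notin> B" using A(1) Bl by (auto simp: letter_def)
  have S_mem: "x \<in> ?S \<longleftrightarrow> (if 0 < x then x \<in> B else x \<in> A)" for x
    using nz by (cases x "0 :: int" rule: linorder_cases) (auto simp: joined_def)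
  have SE: "{z. 0 < z \<and> z \<in> ?S \<and> - z \<in> ?S} = E" by (auto simp: E_def S_mem)
  have finDE: "finite D" "finite E" using fin by (auto simp: D_def E_def)
  have cnt: "count_above B v + count_above D v = count_above A v + count_above E v" if "0 \<le> v" for v
  proof -
    have "count_above A v = count_above (A \<inter> B) v + count_above D v"
      by (rule count_above_split[OF fin(1)]) (use that abs_mem A(2) B in \<open>auto simp: D_def\<close>)
    moreover have "count_above B v = count_above (A \<inter> B) v + count_above E v"
      by (rule count_above_split[OF fin(2)]) (use that abs_mem A(2) B in \<open>auto simp: E_def\<close>)
    ultimately show ?thesis by simp
  qed
  have pos: "count_above X v = count_above X 0" if "\<And>x. x \<in> X \<Longrightarrow> 0 < x" "v < 0" for X v
  proof -
    have "{x \<in> X. v < x} = {x \<in> X. 0 < x}" using that by fastforce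
    then show ?thesis by (simp add: count_above_def)
  qed
  have total: "count_above X 0 = card X" if "\<And>x. x \<in> X \<Longrightarrow> 0 < x" for X
  proof -
    have "{x \<in> X. 0 < x} = X" using that by blast
    then show ?thesis by (simp add: count_above_def)
  qed
  have posDE: "\<And>x. x \<in> D \<Longrightarrow> 0 < x" "\<And>x. x \<in> E \<Longrightarrow> 0 < x" by (auto simp: D_def E_def)
  have le: "count_above D v \<le> count_above E v" for v
  proof (cases "0 \<le> v")
    case True
    then show ?thesis using cnt[OF True] count(1)[OF True] by linarith
  next
    case False
    then have "count_above D v = count_above D 0" "count_above E v = count_above E 0"
      using posDE by (auto intro: pos)
    then show ?thesis using cnt[of 0] count(1)[of 0] by simp
  qed
  have "0 \<notin> abs ` A" using nz by auto
  moreover have "count_above D 0 = card D" "count_above E 0 = card E" using posDE by (auto intro: total)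
  ultimately have DE: "card D = card E" using cnt[of 0] count(2)[of 0] by simp
  let ?zs = "pairs_desc n ?S"
  note zs = pairs_desc_props[where n = n and S = ?S]
  have E: "set ?zs = E" using zs(3)[OF Sl] SE by simp
  have Dfree: "D \<subseteq> free_letters ?S"
  proof
    fix t assume "t \<in> D"
    then show "t \<in> free_letters ?S" using A(2)[of t] B[of "- t"] by (simp add: D_def free_letters_def S_mem)
  qed
  have ts: "set (split_ts (int n + 1) ?S ?zs) = D \<and> length (split_ts (int n + 1) ?S ?zs) = length ?zs"
  proof (rule split_ts_eq[OF E zs(1) finDE(1) _ Dfree])
    show "card D = length ?zs" using DE E zs(2) by (metis distinct_card)
    show "d < int n + 1" if "d \<in> D" for d
    proof -
      have "letter n d" using that A(1) by (auto simp: D_def)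
      then show ?thesis by (auto simp: letter_def)
    qed
    show "E \<subseteq> ?S" using SE by blast
    show "count_above D v \<le> count_above E v" for v by (rule le)
    show "count_above D f = count_above E f" if "f \<in> free_letters ?S" "f < int n + 1" "f \<notin> D" for f
    proof -
      have f: "1 \<le> f" "f \<notin> B" "- f \<notin> A" using that(1) by (auto simp: free_letters_def S_mem)
      have "f \<notin> A" using abs_mem[of f] f that(3) by (auto simp: D_def)
      then have "f \<notin> abs ` A" using f by (auto simp: abs_if split: if_splits)
      then show ?thesis using cnt[of f] count(2)[of f] f by simp
    qed
  qed
  have left: "set (left_column n C) = A"
  proof -
    have "(?S - E) \<union> D = A"
    proof (intro equalityI subsetI)
      fix x assume "x \<in> (?S - E) \<union> D"
      then show "x \<in> A" using abs_mem[of x] by (auto simp: S_mem D_def E_def split: if_splits)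
    next
      fix x assume x: "x \<in> A"
      then show "x \<in> (?S - E) \<union> D" using abs_mem[of x] A(2)[OF x] nz by (auto simp: S_mem D_def E_def)
    qed
    then show ?thesis using map_split_letters(1)[OF Sl] ts SE unfolding C_def by simp
  qed
  have right: "set (right_column n C) = B"
  proof -
    have um: "x \<in> uminus ` X \<longleftrightarrow> - x \<in> X" for x :: int and X by (metis imageE imageI minus_minus)
    have "x \<in> (?S - uminus ` E) \<union> uminus ` D \<longleftrightarrow> x \<in> B" for x
      unfolding Un_iff Diff_iff um S_mem D_def E_def mem_Collect_eq
      using abs_mem[of x] A(2)[of x] A(2)[of "- x"] B[of x] nz by (cases x "0 :: int" rule: linorder_cases) auto
    then have "(?S - uminus ` E) \<union> uminus ` D = B" by blast
    then show ?thesis using map_split_letters(2)[OF Sl] ts SE unfolding C_def by simp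
  qed
  have DS: "D \<inter> ?S = {}" using Dfree by (auto simp: free_letters_def)
  have ES: "E \<subseteq> ?S" using SE by blast
  have "card ((?S - E) \<union> D) = card ?S"
  proof -
    have "card ((?S - E) \<union> D) = card (?S - E) + card D"
      using finS finDE DS by (intro card_Un_disjoint) auto
    also have "card (?S - E) = card ?S - card E" using ES finDE by (intro card_Diff_subset) auto
    finally show ?thesis using DE card_mono[OF finS ES] by simp
  qed
  moreover have "(?S - E) \<union> D = A" using left map_split_letters(1)[OF Sl] ts SE unfolding C_def by simp
  ultimately have cardA: "card A = card ?S" by simp
  have inj: "inj_on abs A" "inj_on abs B"
    using A(2) B by (auto intro!: inj_onI simp: abs_if split: if_splits)
  have cardB: "card B = card ?S"
    using cardA absAB card_image[OF inj(1)] card_image[OF inj(2)] by simp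
  show len: "length C = card A" using column_of_props(3)[OF Sl] cardA by (simp add: C_def)
  have "distinct (left_column n C)"
    by (rule card_distinct) (simp add: left len, simp add: left_column_def sort_column_def len)
  moreover have "distinct (right_column n C)"
    by (rule card_distinct) (simp add: right cardB cardA[symmetric], simp add: right_column_def sort_column_def len)
  moreover have "sort_column n (left_column n C) = left_column n C" "sort_column n (right_column n C) = right_column n C"
    by (simp_all add: left_column_def right_column_def sort_column_def sort_key_id_if_sorted)
  ultimately show "left_column n C = column_of n A" "right_column n C = column_of n B"
    using sort_column_eq left right A(1) Bl by metis+
  show "KN_column n C"
    unfolding C_def KN_column_of_iff[OF Sl]
  proof (intro allI impI, elim conjE)
    fix z :: int assume z: "0 < z" "z \<in> ?S" "- z \<in> ?S"
    let ?le = "\<lambda>X. {x \<in> X. 0 < x \<and> x \<le> z}"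
    have split0: "count_above X 0 = card (?le X) + count_above X z" if "finite X" for X
    proof -
      have "{x \<in> X. 0 < x} = ?le X \<union> {x \<in> X. z < x}" using z(1) by auto
      moreover have "card (?le X \<union> {x \<in> X. z < x}) = card (?le X) + card {x \<in> X. z < x}"
        using that by (intro card_Un_disjoint) auto
      ultimately show ?thesis by (simp add: count_above_def)
    qed
    \<comment> \<open>The counts agree above 0 and A is dominated above z, so between 1 and z the
      inequality is reversed. As the absolute values in A are distinct, the joined column then has
      at most z letters of absolute value at most z.\<close>
    have leAB: "card (?le B) \<le> card (?le A)"
      using split0[OF fin(1)] split0[OF fin(2)] count(1)[of z] count(2)[of 0] nz z(1) \<open>0 \<notin> abs ` A\<close> by simp
    let ?N = "{x \<in> A. x < 0 \<and> - z \<le> x}"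
    have "{x \<in> ?S. \<bar>x\<bar> \<le> z} = ?le B \<union> ?N" using nz by (auto simp: joined_def)
    then have "card {x \<in> ?S. \<bar>x\<bar> \<le> z} \<le> card (?le B) + card ?N" by (simp add: card_Un_le)
    also have "\<dots> \<le> card (?le A) + card ?N" using leAB by simp
    also have "\<dots> = card (?le A \<union> ?N)" using fin by (intro card_Un_disjoint[symmetric]) auto
    also have "\<dots> = card (abs ` (?le A \<union> ?N))"
      by (rule card_image[symmetric], rule inj_on_subset[OF inj(1)]) auto
    also have "\<dots> \<le> card {1..z}" by (rule card_mono) auto
    finally have 1: "int (card {x \<in> ?S. \<bar>x\<bar> \<le> z}) \<le> z" using z(1) by simp
    have "{x \<in> ?S. \<bar>x\<bar> \<le> z} = {x \<in> ?S. \<bar>x\<bar> < z} \<union> {z, - z}" using z by auto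
    moreover have "card ({x \<in> ?S. \<bar>x\<bar> < z} \<union> {z, - z}) = card {x \<in> ?S. \<bar>x\<bar> < z} + card {z, - z}"
      using finS by (intro card_Un_disjoint) auto
    ultimately show "int (card {x \<in> ?S. \<bar>x\<bar> < z}) + 2 \<le> z" using 1 z(1) by simp
  qed
qed

section \<open>Signatures and prefix sums\<close>

definition sign_sum :: "(bool \<times> 'a) list \<Rightarrow> int" where
  "sign_sum w = (\<Sum>s\<leftarrow>w. if fst s then 1 else - 1)"

text \<open>The empty prefix is included. This number is the count of plus signs that survive the
  cancellation.\<close>

fun max_prefix :: "(bool \<times> 'a) list \<Rightarrow> int" where
  "max_prefix [] = 0"
| "max_prefix (s # w) = max 0 ((if fst s then 1 else - 1) + max_prefix w)"

text \<open>The letter at which the prefix sums first reach their maximum, if that is positive.\<close>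

fun first_peak :: "(bool \<times> 'a) list \<Rightarrow> 'a option" where
  "first_peak [] = None"
| "first_peak (s # w) = (if max_prefix (s # w) = 0 then None
     else if max_prefix w = 0 then Some (snd s) else first_peak w)"

lemma max_prefix_nonneg: "0 \<le> max_prefix w"
  by (cases w) auto

lemma sign_sum_simps [simp]: "sign_sum [] = 0" "sign_sum (s # w) = (if fst s then 1 else - 1) + sign_sum w"
    "sign_sum (u @ w) = sign_sum u + sign_sum w"
  by (simp_all add: sign_sum_def)

lemma sign_sum_le_max_prefix: "sign_sum w \<le> max_prefix w"
  by (induction w) auto

lemma max_prefix_append: "max_prefix (u @ w) = max (max_prefix u) (sign_sum u + max_prefix w)"
  using max_prefix_nonneg[of w] by (induction u) (auto simp: max_def)

lemma first_peak_None_iff: "first_peak w = None \<longleftrightarrow> max_prefix w = 0"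
  by (induction w) auto

lemma first_peak_append:
  "first_peak (u @ w) = (if max_prefix u < sign_sum u + max_prefix w then first_peak w else first_peak u)"
proof (induction u)
  case Nil
  show ?case using max_prefix_nonneg[of w] first_peak_None_iff[of w] by auto
next
  case (Cons s u)
  have app: "max_prefix (u @ w) = max (max_prefix u) (sign_sum u + max_prefix w)" by (rule max_prefix_append)
  have nn: "0 \<le> max_prefix u" "0 \<le> max_prefix w" "sign_sum u \<le> max_prefix u"
    using max_prefix_nonneg sign_sum_le_max_prefix by auto
  show ?case
  proof (cases "max_prefix u < sign_sum u + max_prefix w")
    case True
    then have *: "first_peak (u @ w) = first_peak w" "max_prefix (u @ w) = sign_sum u + max_prefix w" "0 < max_prefix (u @ w)"
      using Cons app nn by auto
    have None: "first_peak w = None" if "max_prefix w = 0" using that first_peak_None_iff by blast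
    show ?thesis using * True nn first_peak_None_iff[of u] by (auto simp: max_def)
  next
    case False
    then have *: "first_peak (u @ w) = first_peak u" "max_prefix (u @ w) = max_prefix u" using Cons app by auto
    show ?thesis using * False by (auto simp: max_def)
  qed
qed

lemma max_prefix_map: "max_prefix (map (apsnd f) w) = max_prefix w"
  and sign_sum_map: "sign_sum (map (apsnd f) w) = sign_sum w"
  by (induction w) auto

lemma first_peak_map: "first_peak (map (apsnd f) w) = map_option f (first_peak w)"
  by (induction w) (auto simp: max_prefix_map)

lemma first_peak_mem: "first_peak w = Some x \<Longrightarrow> (True, x) \<in> set w"
proof (induction w)
  case (Cons s w)
  show ?case
  proof (cases "max_prefix w = 0")
    case True
    then have "fst s" "snd s = x" using Cons.prems by (auto simp: max_def split: if_splits)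
    then have "s = (True, x)" by (cases s) simp
    then show ?thesis by simp
  next
    case False
    then show ?thesis using Cons by (auto split: if_splits)
  qed
qed simp

text \<open>A minus followed by a plus goes down and returns, so removing the two loses no maximum,
  and the maximum is never first reached at that plus.\<close>

lemma cancel_pair_invariant: "max_prefix (cancel_pair w) = max_prefix w \<and> first_peak (cancel_pair w) = first_peak w"
proof (induction w rule: cancel_pair.induct)
  case (1 x y w)
  show ?case using max_prefix_nonneg[of w] first_peak_None_iff[of w] by (auto simp: max_def)
qed auto

lemma length_cancel_pair: "cancel_pair w = w \<or> length (cancel_pair w) < length w"
  by (induction w rule: cancel_pair.induct) auto

lemma cancel_pair_funpow_fixed: "length w \<le> k \<Longrightarrow> cancel_pair ((cancel_pair ^^ k) w) = (cancel_pair ^^ k) w"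
proof (induction k arbitrary: w)
  case (Suc k)
  show ?case
  proof (cases "cancel_pair w = w")
    case True
    then have "(cancel_pair ^^ m) w = w" for m by (induction m) auto
    then show ?thesis using True by simp
  next
    case False
    then have "length (cancel_pair w) \<le> k" using length_cancel_pair[of w] Suc.prems by auto
    then show ?thesis using Suc.IH by (simp add: funpow_swap1)
  qed
qed simp

lemma cancel_pair_fixed_False: "cancel_pair ((False, x) # w) = (False, x) # w \<Longrightarrow> filter fst w = []"
proof (induction w arbitrary: x)
  case (Cons s w)
  obtain b y where s: "s = (b, y)" by fastforce
  have "length w \<noteq> Suc (Suc (length w))" by simp
  then have "\<not> b" using Cons.prems s by (cases b) (auto dest: arg_cong[of _ _ length])
  then show ?case using Cons.prems Cons.IH[of y] s by simp
qed simp

text \<open>A word without cancellable pairs consists of pluses followed by minuses; its prefix sums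
  rise to their maximum exactly at the last plus.\<close>

lemma cancel_pair_fixed:
  assumes "cancel_pair w = w"
  shows "int (length (filter fst w)) = max_prefix w"
    "filter fst w \<noteq> [] \<Longrightarrow> first_peak w = Some (snd (last (filter fst w)))"
proof -
  have "int (length (filter fst w)) = max_prefix w \<and>
      (filter fst w \<noteq> [] \<longrightarrow> first_peak w = Some (snd (last (filter fst w))))"
    using assms
  proof (induction w)
    case (Cons s w)
    obtain b x where s: "s = (b, x)" by fastforce
    show ?case
    proof (cases b)
      case True
      then have "cancel_pair w = w" using Cons.prems s by simp
      note IH = Cons.IH[OF this]
      have "max_prefix w = 0 \<longleftrightarrow> filter fst w = []" using IH by (metis length_0_conv of_nat_eq_0_iff)
      then show ?thesis using True s IH max_prefix_nonneg[of w] by auto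
    next
      case False
      then have no: "filter fst w = []" using cancel_pair_fixed_False Cons.prems s by metis
      have "w = [] \<or> cancel_pair w = w"
      proof (cases w)
        case (Cons s' w')
        then have "\<not> fst s'" using no by auto
        then show ?thesis using Cons.prems s False Cons by (cases s') auto
      qed simp
      then have "max_prefix w = 0" using Cons.IH no by auto
      then show ?thesis using False s no by simp
    qed
  qed simp
  then show "int (length (filter fst w)) = max_prefix w"
    "filter fst w \<noteq> [] \<Longrightarrow> first_peak w = Some (snd (last (filter fst w)))" by auto
qed

lemma plus_cells_props:
  shows "int (crystal_phi n i b) = max_prefix (signature n i b)"
    "plus_cells n i b \<noteq> [] \<Longrightarrow> first_peak (signature n i b) = Some (last (plus_cells n i b))"
proof -
  let ?w = "signature n i b"
  have inv: "max_prefix ((cancel_pair ^^ k) w) = max_prefix w \<and> first_peak ((cancel_pair ^^ k) w) = first_peak w"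
    for k and w :: "(bool \<times> 'x) list"
    by (induction k) (simp_all add: cancel_pair_invariant)
  have fixed: "cancel_pair (cancel_pairs ?w) = cancel_pairs ?w"
    unfolding cancel_pairs_def by (rule cancel_pair_funpow_fixed) simp
  note * = cancel_pair_fixed[OF fixed]
  show "int (crystal_phi n i b) = max_prefix ?w"
    using *(1) inv[of "length ?w" ?w] by (simp add: crystal_phi_def plus_cells_def cancel_pairs_def)
  assume "plus_cells n i b \<noteq> []"
  then have "filter fst (cancel_pairs ?w) \<noteq> []" by (simp add: plus_cells_def)
  then show "first_peak ?w = Some (last (plus_cells n i b))"
    using *(2) inv[of "length ?w" ?w] by (simp add: plus_cells_def cancel_pairs_def last_map)
qed

lemma max_prefix_concat_le_iff:
  "max_prefix (concat ws) \<le> N \<longleftrightarrow> 0 \<le> N \<and> (\<forall>q<length ws. sign_sum (concat (take q ws)) + max_prefix (ws ! q) \<le> N)"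
proof (induction ws arbitrary: N)
  case (Cons u ws)
  have all: "(\<forall>q<length (u # ws). P q) \<longleftrightarrow> P 0 \<and> (\<forall>q<length ws. P (Suc q))" for P :: "nat \<Rightarrow> bool"
    using less_Suc_eq_0_disj by auto
  have "max_prefix (concat (u # ws)) \<le> N \<longleftrightarrow> max_prefix u \<le> N \<and> max_prefix (concat ws) \<le> N - sign_sum u"
    by (auto simp: max_prefix_append)
  also have "\<dots> \<longleftrightarrow> 0 \<le> N \<and> max_prefix u \<le> N \<and> (\<forall>q<length ws. sign_sum (concat (take q ws)) + max_prefix (ws ! q) \<le> N - sign_sum u)"
    unfolding Cons.IH using max_prefix_nonneg[of u] sign_sum_le_max_prefix[of u] by auto
  also have "\<dots> \<longleftrightarrow> 0 \<le> N \<and> (\<forall>q<length (u # ws). sign_sum (concat (take q (u # ws))) + max_prefix ((u # ws) ! q) \<le> N)"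
    unfolding all by (auto simp: algebra_simps)
  finally show ?case .
qed simp

lemma first_peak_concat:
  assumes "q < length ws" "0 < N" "sign_sum (concat (take q ws)) + max_prefix (ws ! q) = N"
    "\<And>r. r < length ws \<Longrightarrow> sign_sum (concat (take r ws)) + max_prefix (ws ! r) \<le> N"
    "\<And>r. r < q \<Longrightarrow> sign_sum (concat (take r ws)) + max_prefix (ws ! r) < N"
  shows "max_prefix (concat ws) = N" "first_peak (concat ws) = first_peak (ws ! q)"
proof -
  let ?u = "concat (take q ws)" and ?w = "concat (drop (Suc q) ws)"
  have eq: "concat ws = ?u @ ws ! q @ ?w"
    using id_take_nth_drop[OF assms(1)] by (metis concat.simps(2) concat_append)
  have le: "max_prefix (concat ws) \<le> N" using assms(2,4) unfolding max_prefix_concat_le_iff by simp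
  have "max_prefix ?u \<le> N - 1"
    unfolding max_prefix_concat_le_iff using assms(1,2,5) by (auto simp: min_def)
  then have 1: "max_prefix ?u < sign_sum ?u + max_prefix (ws ! q @ ?w)"
    using assms(3) by (simp add: max_prefix_append)
  have "sign_sum ?u + max (max_prefix (ws ! q)) (sign_sum (ws ! q) + max_prefix ?w) \<le> N"
    using le unfolding eq max_prefix_append by simp
  then have 2: "\<not> max_prefix (ws ! q) < sign_sum (ws ! q) + max_prefix ?w" using assms(3) by simp
  show "max_prefix (concat ws) = N"
    using 1 2 assms(3) unfolding eq max_prefix_append by simp
  show "first_peak (concat ws) = first_peak (ws ! q)"
    unfolding eq first_peak_append[of ?u] using 1 2 by (simp add: first_peak_append)
qed

section \<open>The word of a single column\<close>

definition signed_letter :: "nat \<Rightarrow> nat \<Rightarrow> int \<Rightarrow> bool" where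
  "signed_letter n i x \<longleftrightarrow> plus_letter n i x \<or> minus_letter n i x"

text \<open>Marks the signs by letters where \<open>cell_word\<close> marks them by cells. Letters
  make sense for columns given as sets and survive sorting.\<close>

definition letter_word :: "nat \<Rightarrow> nat \<Rightarrow> int list \<Rightarrow> (bool \<times> int) list" where
  "letter_word n i C = map (\<lambda>x. (plus_letter n i x, x)) (filter (signed_letter n i) (rev C))"

definition cell_word :: "nat \<Rightarrow> nat \<Rightarrow> nat \<Rightarrow> int list \<Rightarrow> (bool \<times> nat \<times> nat) list" where
  "cell_word n i q C = map (\<lambda>p. (plus_letter n i (C ! p), (q, p))) (filter (\<lambda>p. signed_letter n i (C ! p)) (rev [0..<length C]))"

lemma signature_eq: "signature n i b = concat (map (\<lambda>q. cell_word n i q (b ! q)) [0..<length b])"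
proof -
  have "map f (filter P (concat xss)) = concat (map (\<lambda>xs. map f (filter P xs)) xss)"
    for f :: "nat \<times> nat \<Rightarrow> bool \<times> nat \<times> nat" and P xss
    by (induction xss) auto
  then show ?thesis
    by (simp add: signature_def reading_cells_def cell_word_def signed_letter_def o_def filter_map)
qed

lemma letter_word_eq: "letter_word n i C = map (apsnd (\<lambda>(q, p). C ! p)) (cell_word n i q C)"
proof -
  have "rev C = map ((!) C) (rev [0..<length C])" by (metis map_nth rev_map)
  then have "letter_word n i C = map (\<lambda>x. (plus_letter n i x, x)) (filter (signed_letter n i) (map ((!) C) (rev [0..<length C])))"
    by (simp add: letter_word_def)
  then show ?thesis by (simp add: cell_word_def filter_map o_def)
qed

lemma cell_word_letter_word:
  "max_prefix (cell_word n i q C) = max_prefix (letter_word n i C)"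
  "sign_sum (cell_word n i q C) = sign_sum (letter_word n i C)"
  by (simp_all add: letter_word_eq[of n i C q] max_prefix_map sign_sum_map)

lemma first_peak_cell_word:
  assumes "first_peak (letter_word n i C) = Some x"
  obtains p where "p < length C" "C ! p = x" "first_peak (cell_word n i q C) = Some (q, p)"
proof -
  obtain c where c: "first_peak (cell_word n i q C) = Some c" "(\<lambda>(q, p). C ! p) c = x"
    using assms unfolding letter_word_eq[of n i C q] first_peak_map by auto
  obtain q' p where "c = (q', p)" by fastforce
  moreover have "(True, c) \<in> set (cell_word n i q C)" using first_peak_mem[OF c(1)] .
  ultimately show thesis using c that[of p] by (auto simp: cell_word_def)
qed

lemma letter_word_column:
  assumes S: "S \<subseteq> letters n" and i: "i \<le> n" "1 \<le> n"
  shows "letter_word n i (column_of n S) = map (\<lambda>x. (plus_letter n i x, x)) (filter (\<lambda>x. x \<in> S)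
     (if i = 0 then [- 1, 1] else if i = n then [- int n, int n] else [- int i, - int i - 1, int i + 1, int i]))"
    (is "_ = map _ (filter _ ?L)")
proof -
  let ?xs = "filter (signed_letter n i) (rev (column_of n S))" and ?ys = "filter (\<lambda>x. x \<in> S) ?L"
  note C = column_of_props[OF S]
  have set: "set ?xs = set ?ys"
    using C(1) i by (auto simp: signed_letter_def plus_letter_def minus_letter_def)
  have "sorted_wrt (\<lambda>x y. letter_pos n y < letter_pos n x) ?xs"
    using C(4) by (intro sorted_wrt_filter) (simp add: sorted_wrt_rev)
  then have 1: "sorted_wrt (<) (rev (map (letter_pos n) ?xs))"
    by (simp add: sorted_wrt_rev sorted_wrt_map)
  have "sorted_wrt (\<lambda>x y. letter_pos n y < letter_pos n x) ?L"
    using i by (auto simp: letter_pos_def)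
  then have "sorted_wrt (\<lambda>x y. letter_pos n y < letter_pos n x) ?ys" by (rule sorted_wrt_filter)
  then have 2: "sorted_wrt (<) (rev (map (letter_pos n) ?ys))"
    by (simp add: sorted_wrt_rev sorted_wrt_map)
  have "rev (map (letter_pos n) ?xs) = rev (map (letter_pos n) ?ys)"
  proof (rule sorted_distinct_set_unique)
    show "set (rev (map (letter_pos n) ?xs)) = set (rev (map (letter_pos n) ?ys))"
      using set by (simp del: set_filter)
  qed (use 1 2 strict_sorted_iff in blast)+
  then have "map (letter_pos n) ?xs = map (letter_pos n) ?ys" by simp
  moreover have "set ?xs \<union> set ?ys \<subseteq> letters n" using set S C(1) by auto
  then have "inj_on (letter_pos n) (set ?xs \<union> set ?ys)" using letter_pos_inj inj_on_subset by blast
  ultimately have "?xs = ?ys" by (rule inj_on_map_eq_map[THEN iffD1, rotated])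
  then show ?thesis by (simp add: letter_word_def)
qed

section \<open>The crystal operator on a column\<close>

lemma abs_mem_iff: "\<bar>x\<bar> \<in> abs ` X \<longleftrightarrow> x \<in> X \<or> - x \<in> (X :: int set)"
proof
  assume "\<bar>x\<bar> \<in> abs ` X"
  then obtain y where "y \<in> X" "\<bar>x\<bar> = \<bar>y\<bar>" by blast
  then show "x \<in> X \<or> - x \<in> X" by (metis abs_eq_iff)
qed (metis abs_minus imageI)

lemma split_pair_iff:
  "split_pair n A B \<longleftrightarrow> A \<subseteq> letters n \<and> (\<forall>x\<in>A. - x \<notin> A) \<and> (\<forall>x\<in>B. - x \<notin> B) \<and>
     (\<forall>x. (x \<in> A \<or> - x \<in> A) = (x \<in> B \<or> - x \<in> B)) \<and>
     (\<forall>v\<ge>0. count_above A v \<le> count_above B v \<and> (v \<notin> A \<and> - v \<notin> A \<longrightarrow> count_above A v = count_above B v))"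
proof -
  have 1: "abs ` A = abs ` B \<longleftrightarrow> (\<forall>x. (x \<in> A \<or> - x \<in> A) = (x \<in> B \<or> - x \<in> B))"
  proof
    assume *: "\<forall>x. (x \<in> A \<or> - x \<in> A) = (x \<in> B \<or> - x \<in> B)"
    have "y \<in> abs ` A \<longleftrightarrow> y \<in> abs ` B" for y
    proof (cases "0 \<le> y")
      case True
      then show ?thesis using abs_mem_iff[of y A] abs_mem_iff[of y B] * by simp
    next
      case False
      then show ?thesis by auto
    qed
    then show "abs ` A = abs ` B" by blast
  next
    assume *: "abs ` A = abs ` B"
    show "\<forall>x. (x \<in> A \<or> - x \<in> A) = (x \<in> B \<or> - x \<in> B)"
      unfolding abs_mem_iff[symmetric] * by simp
  qed
  have 2: "v \<notin> abs ` A \<longleftrightarrow> v \<notin> A \<and> - v \<notin> A" if "0 \<le> v" for v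
    using abs_mem_iff[of v A] that by simp
  have 3: "(\<forall>v\<ge>0. P v \<and> (v \<notin> abs ` A \<longrightarrow> Q v)) = (\<forall>v\<ge>0. P v \<and> (v \<notin> A \<and> - v \<notin> A \<longrightarrow> Q v))"
    for P Q using 2 by blast
  show ?thesis unfolding split_pair_def 1 3 by (rule refl)
qed

lemma count_above_pred: "finite X \<Longrightarrow> count_above X (v - 1) = count_above X v + (if v \<in> X then 1 else 0)"
proof -
  assume fin: "finite X"
  have "v - 1 < x \<longleftrightarrow> v < x \<or> x = v" for x by linarith
  then have "{x \<in> X. v - 1 < x} = {x \<in> X. v < x} \<union> (if v \<in> X then {v} else {})" by auto
  then show ?thesis using fin by (auto simp: count_above_def)
qed

text \<open>The effect of one fold in the right half. The counts of B grow by 1 exactly for v from t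
  to z - 1; all these v are absolute values of A, where only an inequality is required.\<close>

lemma split_pair_move:
  assumes sp: "split_pair n A B" and tz: "t \<in> B" "- z \<in> B" "0 < t" "t < z"
    and free: "\<And>v. t < v \<Longrightarrow> v < z \<Longrightarrow> v \<in> A \<or> - v \<in> A"
  shows "split_pair n A ((B - {t, - z}) \<union> {- t, z})"
proof -
  let ?B = "(B - {t, - z}) \<union> {- t, z}"
  have fin: "finite B" using split_pair_finite[OF sp] by blast
  have noB: "x \<in> B \<Longrightarrow> - x \<notin> B" and P: "(x \<in> A \<or> - x \<in> A) = (x \<in> B \<or> - x \<in> B)" for x
    using sp unfolding split_pair_iff by blast+
  have neg: "- t \<notin> B" "z \<notin> B" using noB[of t] noB[of "- z"] tz by auto
  have count: "count_above ?B v = count_above B v + (if t \<le> v \<and> v < z then 1 else 0)" if v: "0 \<le> v" for v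
  proof -
    consider "v < t" | "t \<le> v" "v < z" | "z \<le> v" by linarith
    then show ?thesis
    proof cases
      case 1
      have "{x \<in> ?B. v < x} = insert z ({x \<in> B. v < x} - {t})" using 1 tz v by auto
      moreover have "card (insert z ({x \<in> B. v < x} - {t})) = Suc (card ({x \<in> B. v < x} - {t}))"
        using fin neg by simp
      moreover have "Suc (card ({x \<in> B. v < x} - {t})) = card {x \<in> B. v < x}"
        using fin tz 1 by (intro card_Suc_Diff1) auto
      ultimately show ?thesis using 1 by (simp add: count_above_def)
    next
      case 2
      have "{x \<in> ?B. v < x} = insert z {x \<in> B. v < x}" using 2 tz v by auto
      moreover have "card (insert z {x \<in> B. v < x}) = Suc (card {x \<in> B. v < x})" using fin neg by simp
      ultimately show ?thesis using 2 by (simp add: count_above_def)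
    next
      case 3
      have "{x \<in> ?B. v < x} = {x \<in> B. v < x}" using 3 tz v by auto
      then show ?thesis using 3 by (simp add: count_above_def)
    qed
  qed
  have B_mem: "x \<in> ?B \<longleftrightarrow> x = - t \<or> x = z \<or> (x \<in> B \<and> x \<noteq> t \<and> x \<noteq> - z)" for x by blast
  have P': "(x \<in> ?B \<or> - x \<in> ?B) = (x \<in> B \<or> - x \<in> B)" for x
  proof (cases "x \<in> {t, - t, z, - z}")
    case True
    then show ?thesis unfolding B_mem using tz by auto
  next
    case False
    then have "- x \<notin> {t, - t, z, - z}" by auto
    then show ?thesis unfolding B_mem using False by simp
  qed
  have no: "- x \<notin> ?B" if "x \<in> ?B" for x
  proof (cases "x = - t \<or> x = z")
    case True
    then show ?thesis unfolding B_mem using tz by auto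
  next
    case False
    then have "x \<in> B" "x \<noteq> t" "x \<noteq> - z" using that unfolding B_mem by blast+
    then show ?thesis unfolding B_mem using noB[of x] by auto
  qed
  have spA: "A \<subseteq> letters n" "\<forall>x\<in>A. - x \<notin> A"
    and cnt: "\<And>v. 0 \<le> v \<Longrightarrow> count_above A v \<le> count_above B v"
      "\<And>v. 0 \<le> v \<Longrightarrow> v \<notin> A \<Longrightarrow> - v \<notin> A \<Longrightarrow> count_above A v = count_above B v"
    using sp unfolding split_pair_iff by blast+
  have "count_above A v \<le> count_above ?B v" if "0 \<le> v" for v using cnt(1)[OF that] count[OF that] by simp
  moreover have "count_above A v = count_above ?B v" if "0 \<le> v" "v \<notin> A" "- v \<notin> A" for v
  proof -
    have "v \<noteq> t" using P[of t] tz(1) that by auto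
    then have "\<not> (t \<le> v \<and> v < z)" using free[of v] that by force
    then show ?thesis using cnt(2)[OF that] count[OF that(1)] by simp
  qed
  ultimately show ?thesis unfolding split_pair_iff P' using spA no P by blast
qed

text \<open>The pairing of the sum of the e(a), for a in the column, with the coroot of the simple
  root.\<close>

definition wt :: "nat \<Rightarrow> nat \<Rightarrow> int set \<Rightarrow> int" where
  "wt n p A = (case simple_letters n p of (u, v) \<Rightarrow>
     of_bool (u \<in> A) - of_bool (- u \<in> A) - (if v = - u then 0 else of_bool (v \<in> A) - of_bool (- v \<in> A)))"

lemma count_above_image:
  assumes "\<And>x. s (s x) = x"
  shows "count_above (s ` A) w = card {x \<in> A. w < s x}"
proof -
  have "{y \<in> s ` A. w < y} = s ` {x \<in> A. w < s x}" by auto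
  moreover have "inj_on s X" for X using assms by (metis inj_on_inverseI)
  ultimately show ?thesis by (simp add: count_above_def card_image)
qed

text \<open>
  The crystal operator on a column, read off its splitting: the simple reflection is applied to one
  or both of the two columns.
\<close>

definition column_move :: "nat \<Rightarrow> nat \<Rightarrow> int set \<Rightarrow> int set \<Rightarrow> int set \<Rightarrow> int set \<Rightarrow> bool" where
  "column_move n p A B A' B' \<longleftrightarrow> (let s = signed_reflection (simple_letters n p) in
     (wt n p A = 1 \<and> wt n p B = 1 \<and> A' = s ` A \<and> B' = s ` B) \<or>
     (wt n p A = 2 \<and> wt n p B \<le> 0 \<and> A' = s ` A \<and> B' = B) \<or>
     (0 \<le> wt n p A \<and> wt n p B = 2 \<and> A' = A \<and> B' = s ` B))"

definition opt :: "bool \<Rightarrow> 'a \<Rightarrow> 'a list" where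
  "opt c x = (if c then [x] else [])"

lemma opt_simps [simp]: "opt True x = [x]" "opt False x = []"
  by (simp_all add: opt_def)

text \<open>
  The signs in two columns of the letters p, p-bar, p+1, (p+1)-bar, numbered 1 to 4, and the numbers
  of letters above p+1.
\<close>

lemma short_word:
  fixes a1 a2 a3 a4 b1 b2 b3 b4 :: bool and c d :: nat and u v :: int
  assumes "\<not> (a1 \<and> a2)" "\<not> (a3 \<and> a4)" "\<not> (b1 \<and> b2)" "\<not> (b3 \<and> b4)"
    "(a1 \<or> a2) = (b1 \<or> b2)" "(a3 \<or> a4) = (b3 \<or> b4)"
    "c \<le> d" "c + of_bool a3 \<le> d + of_bool b3" "c + of_bool a3 + of_bool a1 \<le> d + of_bool b3 + of_bool b1"
    "\<not> a1 \<and> \<not> a2 \<longrightarrow> c + of_bool a3 = d + of_bool b3" "\<not> a3 \<and> \<not> a4 \<longrightarrow> c = d"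
  defines "a \<equiv> of_bool a1 - of_bool a2 - (of_bool a3 - of_bool a4) :: int"
    and "b \<equiv> of_bool b1 - of_bool b2 - (of_bool b3 - of_bool b4) :: int"
    and "w \<equiv> opt a2 (False, - u) @ opt a4 (True, - v) @ opt b3 (False, v) @ opt b1 (True, u)"
  shows "2 * sign_sum w = a + b" "max_prefix w \<le> max 0 (max (sgn a) ((a + b) div 2))"
    "a = 1 \<Longrightarrow> b = 1 \<Longrightarrow> c = d \<and> max_prefix w = 1 \<and>
       ((a1 \<and> b1 \<and> \<not> a3 \<and> \<not> a4 \<and> \<not> b3 \<and> \<not> b4 \<and> first_peak w = Some u) \<or>
        (a4 \<and> b4 \<and> \<not> a1 \<and> \<not> a2 \<and> \<not> b1 \<and> \<not> b2 \<and> first_peak w = Some (- v)))"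
    "a = 2 \<Longrightarrow> b \<le> 0 \<Longrightarrow> a1 \<and> a4 \<and> max_prefix w = 1 \<and> first_peak w = Some (- v) \<and> c + 1 \<le> d + of_bool b3"
    "b = 2 \<Longrightarrow> 0 \<le> a \<Longrightarrow> b1 \<and> b4 \<and> max_prefix w = a div 2 + 1 \<and> first_peak w = Some u"
proof -
  \<comment> \<open>Two of the eight truth values are determined by the others, which leaves 64
    cases.\<close>
  have b2: "b2 = ((a1 \<or> a2) \<and> \<not> b1)" and b4: "b4 = ((a3 \<or> a4) \<and> \<not> b3)" using assms(3-6) by blast+
  have "2 * sign_sum w = a + b \<and> max_prefix w \<le> max 0 (max (sgn a) ((a + b) div 2)) \<and>
    (a = 1 \<longrightarrow> b = 1 \<longrightarrow> c = d \<and> max_prefix w = 1 \<and>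
       ((a1 \<and> b1 \<and> \<not> a3 \<and> \<not> a4 \<and> \<not> b3 \<and> \<not> b4 \<and> first_peak w = Some u) \<or>
        (a4 \<and> b4 \<and> \<not> a1 \<and> \<not> a2 \<and> \<not> b1 \<and> \<not> b2 \<and> first_peak w = Some (- v)))) \<and>
    (a = 2 \<longrightarrow> b \<le> 0 \<longrightarrow> a1 \<and> a4 \<and> max_prefix w = 1 \<and> first_peak w = Some (- v) \<and> c + 1 \<le> d + of_bool b3) \<and>
    (b = 2 \<longrightarrow> 0 \<le> a \<longrightarrow> b1 \<and> b4 \<and> max_prefix w = a div 2 + 1 \<and> first_peak w = Some u)"
    using assms(1,2,5-11) unfolding a_def b_def w_def b2 b4
    by (cases a1; cases a2; cases a3; cases a4; cases b1; cases b3) simp_all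
  then show "2 * sign_sum w = a + b" "max_prefix w \<le> max 0 (max (sgn a) ((a + b) div 2))"
    "a = 1 \<Longrightarrow> b = 1 \<Longrightarrow> c = d \<and> max_prefix w = 1 \<and>
       ((a1 \<and> b1 \<and> \<not> a3 \<and> \<not> a4 \<and> \<not> b3 \<and> \<not> b4 \<and> first_peak w = Some u) \<or>
        (a4 \<and> b4 \<and> \<not> a1 \<and> \<not> a2 \<and> \<not> b1 \<and> \<not> b2 \<and> first_peak w = Some (- v)))"
    "a = 2 \<Longrightarrow> b \<le> 0 \<Longrightarrow> a1 \<and> a4 \<and> max_prefix w = 1 \<and> first_peak w = Some (- v) \<and> c + 1 \<le> d + of_bool b3"
    "b = 2 \<Longrightarrow> 0 \<le> a \<Longrightarrow> b1 \<and> b4 \<and> max_prefix w = a div 2 + 1 \<and> first_peak w = Some u" by blast+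
qed

text \<open>The cases p = n and p = 0, where u is the letter with the plus sign, n or 1-bar. The
  barred letter is read first and belongs to the left column; it is the minus for p = n and the plus
  for p = 0, hence the two forms of the word.\<close>

lemma long_word:
  fixes a1 a2 b1 b2 :: bool and u :: int
  assumes "\<not> (a1 \<and> a2)" "\<not> (b1 \<and> b2)" "(a1 \<or> a2) = (b1 \<or> b2)" "a1 \<longrightarrow> b1"
  defines "a \<equiv> of_bool a1 - of_bool a2 :: int" and "b \<equiv> of_bool b1 - of_bool b2 :: int"
  assumes w: "w = opt a2 (False, - u) @ opt b1 (True, u) \<or> w = opt a1 (True, u) @ opt b2 (False, - u)"
  shows "2 * sign_sum w = a + b \<and> max_prefix w \<le> max 0 (max (sgn a) ((a + b) div 2)) \<and>
    (a = 1 \<longrightarrow> b = 1 \<longrightarrow> max_prefix w = 1 \<and> first_peak w = Some u)"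
proof -
  have b2: "b2 = ((a1 \<or> a2) \<and> \<not> b1)" using assms(2,3) by blast
  show ?thesis using w assms(1,3,4) unfolding a_def b_def b2
    by (elim disjE; cases a1; cases a2; cases b1; simp)
qed

context
  fixes n p :: nat and A B :: "int set"
  assumes n: "1 \<le> n" and p: "p \<le> n" and sp: "split_pair n A B"
begin

private lemma facts:
  shows "finite A" "finite B" "A \<subseteq> letters n" "B \<subseteq> letters n"
    "\<And>x. x \<in> A \<Longrightarrow> - x \<notin> A" "\<And>x. x \<in> B \<Longrightarrow> - x \<notin> B"
    "\<And>x. (x \<in> A \<or> - x \<in> A) = (x \<in> B \<or> - x \<in> B)"
    "\<And>v. 0 \<le> v \<Longrightarrow> count_above A v \<le> count_above B v"
    "\<And>v. 0 \<le> v \<Longrightarrow> v \<notin> A \<Longrightarrow> - v \<notin> A \<Longrightarrow> count_above A v = count_above B v"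
  using sp split_pair_finite[OF sp] unfolding split_pair_iff by blast+

private lemma joined_mem: "x \<noteq> 0 \<Longrightarrow> x \<in> joined A B \<longleftrightarrow> (if 0 < x then x \<in> B else x \<in> A)"
  by (auto simp: joined_def)

private lemma short_bounds:
  assumes "1 \<le> p" "p < n"
  defines "u \<equiv> int p"
  shows "count_above A (u + 1) \<le> count_above B (u + 1)"
    "count_above A (u + 1) + of_bool (u + 1 \<in> A) \<le> count_above B (u + 1) + of_bool (u + 1 \<in> B)"
    "count_above A (u + 1) + of_bool (u + 1 \<in> A) + of_bool (u \<in> A) \<le> count_above B (u + 1) + of_bool (u + 1 \<in> B) + of_bool (u \<in> B)"
    "u \<notin> A \<Longrightarrow> - u \<notin> A \<Longrightarrow> count_above A (u + 1) + of_bool (u + 1 \<in> A) = count_above B (u + 1) + of_bool (u + 1 \<in> B)"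
    "u + 1 \<notin> A \<Longrightarrow> - (u + 1) \<notin> A \<Longrightarrow> count_above A (u + 1) = count_above B (u + 1)"
proof -
  have c: "count_above X u = count_above X (u + 1) + of_bool (u + 1 \<in> X)"
      "count_above X (u - 1) = count_above X (u + 1) + of_bool (u + 1 \<in> X) + of_bool (u \<in> X)" if "finite X" for X
    using count_above_pred[OF that, of "u + 1"] count_above_pred[OF that, of u] by simp_all
  show "count_above A (u + 1) \<le> count_above B (u + 1)"
    "count_above A (u + 1) + of_bool (u + 1 \<in> A) \<le> count_above B (u + 1) + of_bool (u + 1 \<in> B)"
    "count_above A (u + 1) + of_bool (u + 1 \<in> A) + of_bool (u \<in> A) \<le> count_above B (u + 1) + of_bool (u + 1 \<in> B) + of_bool (u \<in> B)"
    using facts(8)[of "u + 1"] facts(8)[of u] facts(8)[of "u - 1"] c[OF facts(1)] c[OF facts(2)] assms by simp_all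
  show "u \<notin> A \<Longrightarrow> - u \<notin> A \<Longrightarrow> count_above A (u + 1) + of_bool (u + 1 \<in> A) = count_above B (u + 1) + of_bool (u + 1 \<in> B)"
    "u + 1 \<notin> A \<Longrightarrow> - (u + 1) \<notin> A \<Longrightarrow> count_above A (u + 1) = count_above B (u + 1)"
    using facts(9)[of u] facts(9)[of "u + 1"] c[OF facts(1)] c[OF facts(2)] assms by simp_all
qed

private lemma long_bounds:
  shows "p = n \<Longrightarrow> int n \<in> A \<Longrightarrow> int n \<in> B" "p = 0 \<Longrightarrow> 1 \<in> B \<Longrightarrow> 1 \<in> A"
proof -
  have top: "count_above X (int n) = 0" if "X \<subseteq> letters n" for X
  proof -
    have "{x \<in> X. int n < x} = {}" using that by (auto simp: letter_def subset_eq)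
    then show ?thesis unfolding count_above_def by (simp only: card.empty)
  qed
  show "p = n \<Longrightarrow> int n \<in> A \<Longrightarrow> int n \<in> B"
    using facts(8)[of "int n - 1"] count_above_pred[OF facts(1), of "int n"] count_above_pred[OF facts(2), of "int n"]
      top[OF facts(3)] top[OF facts(4)] n by (auto split: if_splits)
  have "0 \<notin> A" using facts(3) by (auto simp: letter_def)
  then show "p = 0 \<Longrightarrow> 1 \<in> B \<Longrightarrow> 1 \<in> A"
    using facts(8)[of 1] facts(9)[of 0] count_above_pred[OF facts(1), of 1] count_above_pred[OF facts(2), of 1]
    by (auto split: if_splits)
qed

private lemma short_letter_word:
  assumes "1 \<le> p" "p < n"
  shows "letter_word n p (column_of n (joined A B)) =
    opt (- int p \<in> A) (False, - int p) @ opt (- (int p + 1) \<in> A) (True, - (int p + 1)) @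
    opt (int p + 1 \<in> B) (False, int p + 1) @ opt (int p \<in> B) (True, int p)"
  unfolding letter_word_column[OF joined_subset[OF sp] p n] opt_def
  using assms by (simp add: joined_mem plus_letter_def)

private lemma short_wt: "1 \<le> p \<Longrightarrow> p < n \<Longrightarrow> wt n p X = of_bool (int p \<in> X) - of_bool (- int p \<in> X) -
    (of_bool (int p + 1 \<in> X) - of_bool (- (int p + 1) \<in> X))"
  by (simp add: wt_def simple_letters_def)

private lemmas short = short_word[where ?a1.0 = "int p \<in> A" and ?a2.0 = "- int p \<in> A" and ?a3.0 = "int p + 1 \<in> A"
    and ?a4.0 = "- (int p + 1) \<in> A" and ?b1.0 = "int p \<in> B" and ?b2.0 = "- int p \<in> B" and ?b3.0 = "int p + 1 \<in> B"
    and ?b4.0 = "- (int p + 1) \<in> B" and c = "count_above A (int p + 1)" and d = "count_above B (int p + 1)"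
    and u = "int p" and v = "int p + 1"]

private lemma short_hyps:
  shows "\<not> (int p \<in> A \<and> - int p \<in> A)" "\<not> (int p + 1 \<in> A \<and> - (int p + 1) \<in> A)"
    "\<not> (int p \<in> B \<and> - int p \<in> B)" "\<not> (int p + 1 \<in> B \<and> - (int p + 1) \<in> B)"
    "(int p \<in> A \<or> - int p \<in> A) = (int p \<in> B \<or> - int p \<in> B)"
    "(int p + 1 \<in> A \<or> - (int p + 1) \<in> A) = (int p + 1 \<in> B \<or> - (int p + 1) \<in> B)"
  using facts(5-7) by blast+

private lemma short_eqs:
  assumes "1 \<le> p" "p < n"
  shows "int p \<notin> A \<and> - int p \<notin> A \<longrightarrow> count_above A (int p + 1) + of_bool (int p + 1 \<in> A) =
      count_above B (int p + 1) + of_bool (int p + 1 \<in> B)"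
    "int p + 1 \<notin> A \<and> - (int p + 1) \<notin> A \<longrightarrow> count_above A (int p + 1) = count_above B (int p + 1)"
  using short_bounds(4,5)[OF assms] by blast+

private lemma long_facts:
  assumes "p = n \<or> p = 0"
  defines "u \<equiv> (if p = 0 then - 1 else int n)" and "w \<equiv> letter_word n p (column_of n (joined A B))"
  shows "simple_letters n p = (u, - u)" "u \<noteq> 0" "lower_letter n p u = - u"
    "wt n p X = of_bool (u \<in> X) - of_bool (- u \<in> X)"
    "2 * sign_sum w = wt n p A + wt n p B \<and> max_prefix w \<le> max 0 (max (sgn (wt n p A)) ((wt n p A + wt n p B) div 2)) \<and>
     (wt n p A = 1 \<longrightarrow> wt n p B = 1 \<longrightarrow> max_prefix w = 1 \<and> first_peak w = Some u)"
proof -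
  show simple: "simple_letters n p = (u, - u)" "u \<noteq> 0" and "lower_letter n p u = - u"
    using assms(1) n by (auto simp: simple_letters_def lower_letter_def u_def)
  show wt: "wt n p X = of_bool (u \<in> X) - of_bool (- u \<in> X)" for X
    using simple by (simp add: wt_def)
  have w: "w = opt (- u \<in> A) (False, - u) @ opt (u \<in> B) (True, u) \<or> w = opt (u \<in> A) (True, u) @ opt (- u \<in> B) (False, - u)"
  proof (cases "p = 0")
    case True
    then have "w = opt (u \<in> A) (True, u) @ opt (- u \<in> B) (False, - u)"
      unfolding w_def letter_word_column[OF joined_subset[OF sp] p n] opt_def u_def by (simp add: joined_mem plus_letter_def)
    then show ?thesis by blast
  next
    case False
    then have "p = n" using assms(1) by simp
    then have "w = opt (- u \<in> A) (False, - u) @ opt (u \<in> B) (True, u)"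
      unfolding w_def letter_word_column[OF joined_subset[OF sp] p n] opt_def u_def
      using n by (simp add: joined_mem plus_letter_def)
    then show ?thesis by blast
  qed
  have "u \<in> A \<longrightarrow> u \<in> B"
  proof (cases "p = 0")
    case True
    then have "u = - 1" by (simp add: u_def)
    moreover have "- 1 \<in> A \<Longrightarrow> 1 \<notin> A" using facts(5)[of "- 1"] by simp
    ultimately show ?thesis using long_bounds(2)[OF True] facts(7)[of 1] by blast
  next
    case False
    then show ?thesis using long_bounds(1) assms(1) by (simp add: u_def)
  qed
  then show "2 * sign_sum w = wt n p A + wt n p B \<and> max_prefix w \<le> max 0 (max (sgn (wt n p A)) ((wt n p A + wt n p B) div 2)) \<and>
     (wt n p A = 1 \<longrightarrow> wt n p B = 1 \<longrightarrow> max_prefix w = 1 \<and> first_peak w = Some u)"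
    unfolding wt using facts(5-7) by (intro long_word[OF _ _ _ _ w]) blast+
qed

text \<open>The three terms of the bound are the values, relative to the start of the block, that
  the peaks of g take at its start, middle and end.\<close>

lemma letter_word_joined:
  "2 * sign_sum (letter_word n p (column_of n (joined A B))) = wt n p A + wt n p B"
  "max_prefix (letter_word n p (column_of n (joined A B))) \<le> max 0 (max (sgn (wt n p A)) ((wt n p A + wt n p B) div 2))"
proof -
  let ?w = "letter_word n p (column_of n (joined A B))"
  have "2 * sign_sum ?w = wt n p A + wt n p B \<and>
      max_prefix ?w \<le> max 0 (max (sgn (wt n p A)) ((wt n p A + wt n p B) div 2))"
  proof (cases "p = n \<or> p = 0")
    case True
    then show ?thesis using long_facts(5) by blast
  next
    case False
    then have sh: "1 \<le> p" "p < n" using p by auto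
    show ?thesis unfolding short_letter_word[OF sh] short_wt[OF sh] using short(1,2)[OF short_hyps short_bounds(1-3)[OF sh] short_eqs[OF sh]] by blast
  qed
  then show "2 * sign_sum ?w = wt n p A + wt n p B"
    "max_prefix ?w \<le> max 0 (max (sgn (wt n p A)) ((wt n p A + wt n p B) div 2))" by auto
qed

private lemma s_props:
  assumes "1 \<le> p" "p < n"
  defines "s \<equiv> signed_reflection (simple_letters n p)" and "u \<equiv> int p"
  shows "s x = (if x = u then u + 1 else if x = u + 1 then u else if x = - u then - (u + 1) else if x = - (u + 1) then - u else x)"
    "s (s x) = x" "s (- x) = - s x" "x \<in> s ` X \<longleftrightarrow> s x \<in> X"
proof -
  have l: "simple_letters n p = (u, u + 1)" "u \<noteq> 0" "u + 1 \<noteq> 0" "u \<noteq> u + 1"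
    using assms by (auto simp: simple_letters_def)
  show "s x = (if x = u then u + 1 else if x = u + 1 then u else if x = - u then - (u + 1) else if x = - (u + 1) then - u else x)"
    unfolding s_def l(1) signed_reflection_apply[OF l(2-4)] ..
  show inv: "s (s x) = x" for x unfolding s_def l(1) by (rule signed_reflection_invol[OF l(2-4)])
  have "sperm n s" unfolding s_def l(1) using assms by (intro sperm_signed_reflection) (auto simp: letter_def)
  then show "s (- x) = - s x" by (rule sperm_neg)
  show "x \<in> s ` X \<longleftrightarrow> s x \<in> X" using inv by (metis imageE imageI)
qed

private lemma count_above_s:
  assumes "1 \<le> p" "p < n" "finite X" "0 \<le> w"
  shows "count_above (signed_reflection (simple_letters n p) ` X) w =
    (if w = int p then count_above X (int p + 1) + of_bool (int p \<in> X) else count_above X w)"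
proof -
  let ?s = "signed_reflection (simple_letters n p)"
  note s = s_props[OF assms(1,2)]
  have c: "count_above (?s ` X) w = card {x \<in> X. w < ?s x}" by (rule count_above_image[OF s(2)])
  show ?thesis
  proof (cases "w = int p")
    case True
    have "w < ?s x \<longleftrightarrow> int p + 1 < x \<or> x = int p" for x
      unfolding s(1) True using assms(1) by auto
    then have "{x \<in> X. w < ?s x} = {x \<in> X. int p + 1 < x} \<union> (if int p \<in> X then {int p} else {})" by auto
    then show ?thesis using True c assms(3) by (auto simp: count_above_def)
  next
    case False
    have "w < ?s x \<longleftrightarrow> w < x" for x
      unfolding s(1) using assms(1,4) False by auto
    then show ?thesis using c False by (simp add: count_above_def)
  qed
qed

private lemma short_split:
  assumes sh: "1 \<le> p" "p < n"
  defines "s \<equiv> signed_reflection (simple_letters n p)"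
  assumes A': "A' = A \<or> A' = s ` A" and B': "B' = B \<or> B' = s ` B"
    and P: "\<And>x. (x \<in> A' \<or> - x \<in> A') = (x \<in> B' \<or> - x \<in> B')"
    and cu: "count_above A' (int p) \<le> count_above B' (int p)"
      "int p \<notin> A' \<and> - int p \<notin> A' \<longrightarrow> count_above A' (int p) = count_above B' (int p)"
    and cv: "int p + 1 \<notin> A' \<and> - (int p + 1) \<notin> A' \<longrightarrow> count_above A (int p + 1) = count_above B (int p + 1)"
  shows "split_pair n A' B'"
proof -
  note sp' = s_props[OF sh, folded s_def]
  have l: "sperm n s" unfolding s_def using sh by (auto simp: simple_letters_def letter_def intro!: sperm_signed_reflection)
  have "A' \<subseteq> letters n" using A' facts(3) sperm_letter[OF l] by blast
  moreover have "- x \<notin> A'" if "x \<in> A'" for x using A' that facts(5) unfolding sp'(4)[of _ A] by (metis sp'(3,4))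
  moreover have "- x \<notin> B'" if "x \<in> B'" for x using B' that facts(6) by (metis sp'(3,4))
  moreover have "count_above A' v \<le> count_above B' v \<and> (v \<notin> A' \<and> - v \<notin> A' \<longrightarrow> count_above A' v = count_above B' v)"
    if v: "0 \<le> v" for v
  proof (cases "v = int p")
    case True
    then show ?thesis using cu by simp
  next
    case False
    have c: "count_above A' v = count_above A v" "count_above B' v = count_above B v"
      using A' B' count_above_s[OF sh facts(1) v] count_above_s[OF sh facts(2) v] False by (auto simp: s_def)
    show ?thesis
    proof (cases "v = int p + 1")
      case True
      then show ?thesis using c facts(8)[OF v] cv by simp
    next
      case no: False
      have "s v = v" "s (- v) = - v" unfolding sp'(1) using v False no by auto
      then have "v \<in> A' \<longleftrightarrow> v \<in> A" "- v \<in> A' \<longleftrightarrow> - v \<in> A" using A' sp'(4) by metis+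
      then show ?thesis using c facts(8,9)[OF v] by simp
    qed
  qed
  ultimately show ?thesis unfolding split_pair_iff using P by blast
qed

private lemma joined_move:
  assumes sh: "1 \<le> p" "p < n"
  defines "s \<equiv> signed_reflection (simple_letters n p)"
  assumes A': "A' = A \<or> A' = s ` A" and B': "B' = B \<or> B' = s ` B" and y: "y = int p \<or> y = - (int p + 1)"
    and 4: "y = int p \<Longrightarrow> int p \<notin> B' \<and> int p + 1 \<in> B' \<and> (- int p \<in> A' \<longleftrightarrow> - int p \<in> A) \<and> (- (int p + 1) \<in> A' \<longleftrightarrow> - (int p + 1) \<in> A)"
      "y = - (int p + 1) \<Longrightarrow> (int p \<in> B' \<longleftrightarrow> int p \<in> B) \<and> (int p + 1 \<in> B' \<longleftrightarrow> int p + 1 \<in> B) \<and> - int p \<in> A' \<and> - (int p + 1) \<notin> A'"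
  shows "joined A' B' = (joined A B - {y}) \<union> {lower_letter n p y}"
proof (rule set_eqI)
  fix x
  note sp' = s_props[OF sh, folded s_def]
  have low: "lower_letter n p (int p) = int p + 1" "lower_letter n p (- (int p + 1)) = - int p"
    using sh by (auto simp: lower_letter_def)
  have jm: "x \<in> joined X Y \<longleftrightarrow> x \<in> Y" if "0 < x" for X Y using that by (auto simp: joined_def)
  have jm': "x \<in> joined X Y \<longleftrightarrow> x \<in> X" if "x < 0" for X Y using that by (auto simp: joined_def)
  consider "x = int p" | "x = int p + 1" | "x = - int p" | "x = - (int p + 1)"
    | "x \<notin> {int p, int p + 1, - int p, - (int p + 1)}" by blast
  then show "x \<in> joined A' B' \<longleftrightarrow> x \<in> (joined A B - {y}) \<union> {lower_letter n p y}"
  proof cases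
    case 1
    then have "0 < x" "x \<noteq> int p + 1" "x \<noteq> - int p" "x \<noteq> - (int p + 1)" using sh by auto
    then show ?thesis unfolding Un_iff Diff_iff jm[OF \<open>0 < x\<close>] using 1 y 4 low by auto
  next
    case 2
    then have "0 < x" "x \<noteq> int p" "x \<noteq> - int p" "x \<noteq> - (int p + 1)" using sh by auto
    then show ?thesis unfolding Un_iff Diff_iff jm[OF \<open>0 < x\<close>] using 2 y 4 low by auto
  next
    case 3
    then have "x < 0" "x \<noteq> int p" "x \<noteq> int p + 1" "x \<noteq> - (int p + 1)" using sh by auto
    then show ?thesis unfolding Un_iff Diff_iff jm'[OF \<open>x < 0\<close>] using 3 y 4 low by auto
  next
    case 4
    then have "x < 0" "x \<noteq> int p" "x \<noteq> int p + 1" "x \<noteq> - int p" using sh by auto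
    then show ?thesis unfolding Un_iff Diff_iff jm'[OF \<open>x < 0\<close>] using 4 y assms(7,8) low by auto
  next
    case 5
    then have "s x = x" unfolding sp'(1) by auto
    then have "x \<in> A' \<longleftrightarrow> x \<in> A" "x \<in> B' \<longleftrightarrow> x \<in> B" using A' B' sp'(4) by metis+
    moreover have "x \<noteq> y" "x \<noteq> lower_letter n p y" using 5 y low by auto
    ultimately show ?thesis by (simp add: joined_def)
  qed
qed

text \<open>The joined column shows only the barred letters of A and the unbarred ones of B. So
  moving A alone changes only (p+1)-bar to p-bar, and moving B alone only p to p + 1. If both
  weights are 1, the two columns contain the same single plus letter of the pair, and again one
  letter changes. For p = n and p = 0 the weights never reach 2, and only this last case
  arises.\<close>

lemma column_move_crystal:
  assumes move: "column_move n p A B A' B'"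
  shows "split_pair n A' B' \<and>
    max_prefix (letter_word n p (column_of n (joined A B))) = (if wt n p B = 2 then wt n p A div 2 + 1 else 1) \<and>
    (\<exists>y. first_peak (letter_word n p (column_of n (joined A B))) = Some y \<and>
       joined A' B' = (joined A B - {y}) \<union> {lower_letter n p y})"
proof (cases "p = n \<or> p = 0")
  case True
  define u where "u = (if p = 0 then - 1 else int n)"
  note lf = long_facts[OF True, folded u_def]
  note u = lf(1-3) and wt = lf(4)
  let ?s = "signed_reflection (u, - u)"
  have no2: "wt n p X \<noteq> 2" for X unfolding wt by auto
  have w1: "wt n p A = 1" "wt n p B = 1" "A' = ?s ` A" "B' = ?s ` B"
    using move no2 unfolding column_move_def Let_def u(1) by blast+
  have uAB: "u \<in> A" "- u \<notin> A" "u \<in> B" "- u \<notin> B" using w1(1,2) unfolding wt by (auto simp: of_bool_def split: if_splits)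
  have s: "?s x = (if x = u then - u else if x = - u then u else x)" for x
    using u(2) by (simp add: signed_reflection_apply)
  have image: "?s ` X = (X - {u}) \<union> {- u}" if "u \<in> X" "- u \<notin> X" for X
  proof (rule set_eqI)
    fix x
    have "x \<in> ?s ` X \<longleftrightarrow> ?s x \<in> X"
      using signed_reflection_invol[of u "- u"] u(2) by (metis imageE imageI neg_equal_zero equation_minus_iff)
    then show "x \<in> ?s ` X \<longleftrightarrow> x \<in> (X - {u}) \<union> {- u}" unfolding s using that by auto
  qed
  note A' = w1(3)[unfolded image[OF uAB(1,2)]] and B' = w1(4)[unfolded image[OF uAB(3,4)]]
  \<comment> \<open>The change of the count depends on u and v only, so it is the same for A and B
    and every comparison persists.\<close>
  have count: "int (count_above ((X - {u}) \<union> {- u}) v) = int (count_above X v) - of_bool (v < u) + of_bool (v < - u)"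
    if "finite X" "u \<in> X" "- u \<notin> X" "0 \<le> v" for X v
  proof -
    have fin: "finite {x \<in> X. v < x}" using that(1) by simp
    have "{x \<in> (X - {u}) \<union> {- u}. v < x} = ({x \<in> X. v < x} - {u}) \<union> (if v < - u then {- u} else {})" by auto
    moreover have "int (card ({x \<in> X. v < x} - {u})) = int (card {x \<in> X. v < x}) - of_bool (v < u)"
    proof (cases "v < u")
      case True
      then have "Suc (card ({x \<in> X. v < x} - {u})) = card {x \<in> X. v < x}"
        using fin that by (intro card_Suc_Diff1) auto
      then show ?thesis using True by simp
    next
      case False
      then have "{x \<in> X. v < x} - {u} = {x \<in> X. v < x}" by auto
      then show ?thesis using False by simp
    qed
    moreover have "card (({x \<in> X. v < x} - {u}) \<union> (if v < - u then {- u} else {})) =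
        card ({x \<in> X. v < x} - {u}) + of_bool (v < - u)"
      using fin that(3) by auto
    ultimately show ?thesis by (simp add: count_above_def)
  qed
  have P: "(x \<in> (X - {u}) \<union> {- u} \<or> - x \<in> (X - {u}) \<union> {- u}) = (x \<in> X \<or> - x \<in> X)" if "u \<in> X" for X x
    using that by (cases "x = u \<or> x = - u") auto
  have "split_pair n A' B'"
    unfolding split_pair_iff A' B' P[OF uAB(1)] P[OF uAB(3)]
  proof (intro conjI ballI allI impI)
    have "letter n u" using facts(3) uAB by blast
    then show "A - {u} \<union> {- u} \<subseteq> letters n" using facts(3) by auto
    show "- x \<notin> A - {u} \<union> {- u}" if "x \<in> A - {u} \<union> {- u}" for x
      using that facts(5)[of x] uAB u(2) by auto
    show "- x \<notin> B - {u} \<union> {- u}" if "x \<in> B - {u} \<union> {- u}" for x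
      using that facts(6)[of x] uAB u(2) by auto
    show "(x \<in> A \<or> - x \<in> A) = (x \<in> B \<or> - x \<in> B)" for x using facts(7) .
    fix v :: int assume v: "0 \<le> v"
    note c = count[OF facts(1) uAB(1,2) v] count[OF facts(2) uAB(3,4) v]
    show "count_above (A - {u} \<union> {- u}) v \<le> count_above (B - {u} \<union> {- u}) v"
      using c facts(8)[OF v] by linarith
    assume "v \<notin> A - {u} \<union> {- u} \<and> - v \<notin> A - {u} \<union> {- u}"
    then have "v \<notin> A" "- v \<notin> A" using P[OF uAB(1), of v] by blast+
    then show "count_above (A - {u} \<union> {- u}) v = count_above (B - {u} \<union> {- u}) v"
      using c facts(9)[OF v] by linarith
  qed
  moreover have "joined A' B' = (joined A B - {u}) \<union> {- u}"
    unfolding A' B' joined_def using u(2) by (cases "0 < u") auto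
  ultimately show ?thesis using lf(5) w1(1,2) u(3) by auto
next
  case False
  then have sh: "1 \<le> p" "p < n" using p by auto
  let ?s = "signed_reflection (simple_letters n p)" and ?w = "letter_word n p (column_of n (joined A B))"
  note sp' = s_props[OF sh]
  note sw = short(3-5)[OF short_hyps short_bounds(1-3)[OF sh] short_eqs[OF sh],
      folded short_letter_word[OF sh] short_wt[OF sh]]
  note cs = count_above_s[OF sh facts(1), of "int p"] count_above_s[OF sh facts(2), of "int p"]
  note cp = count_above_pred[OF facts(1), of "int p + 1"] count_above_pred[OF facts(2), of "int p + 1"]
  have s4: "?s (int p) = int p + 1" "?s (int p + 1) = int p" "?s (- int p) = - (int p + 1)" "?s (- (int p + 1)) = - int p"
    using sh by (simp_all add: sp'(1))
  consider (both) "wt n p A = 1" "wt n p B = 1" "A' = ?s ` A" "B' = ?s ` B"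
    | (left) "wt n p A = 2" "wt n p B \<le> 0" "A' = ?s ` A" "B' = B"
    | (right) "0 \<le> wt n p A" "wt n p B = 2" "A' = A" "B' = ?s ` B"
    using move unfolding column_move_def Let_def by blast
  then show ?thesis
  proof cases
    case both
    note w = sw(1)[OF both(1,2)]
    obtain y where y: "first_peak ?w = Some y" "(y = int p \<and> int p \<in> A \<and> int p \<in> B \<and> int p + 1 \<notin> A \<and> - (int p + 1) \<notin> A \<and> int p + 1 \<notin> B \<and> - (int p + 1) \<notin> B) \<or>
        (y = - (int p + 1) \<and> - (int p + 1) \<in> A \<and> - (int p + 1) \<in> B \<and> int p \<notin> A \<and> - int p \<notin> A \<and> int p \<notin> B \<and> - int p \<notin> B)"
      using w by blast
    have "split_pair n A' B'"
    proof (rule short_split[OF sh])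
      show "(x \<in> A' \<or> - x \<in> A') = (x \<in> B' \<or> - x \<in> B')" for x
        unfolding both(3,4) sp'(4) sp'(3) using facts(7) .
      have "int p \<in> A \<longleftrightarrow> int p \<in> B" using y(2) by blast
      then show "count_above A' (int p) \<le> count_above B' (int p)"
        "int p \<notin> A' \<and> - int p \<notin> A' \<longrightarrow> count_above A' (int p) = count_above B' (int p)"
        unfolding both(3,4) using cs w by simp_all
      show "int p + 1 \<notin> A' \<and> - (int p + 1) \<notin> A' \<longrightarrow> count_above A (int p + 1) = count_above B (int p + 1)"
        using w by blast
    qed (use both in simp_all)
    moreover have "joined A' B' = (joined A B - {y}) \<union> {lower_letter n p y}"
    proof (rule joined_move[OF sh])
      have mem: "int p \<in> B' \<longleftrightarrow> int p + 1 \<in> B" "int p + 1 \<in> B' \<longleftrightarrow> int p \<in> B"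
        "- int p \<in> A' \<longleftrightarrow> - (int p + 1) \<in> A" "- (int p + 1) \<in> A' \<longleftrightarrow> - int p \<in> A"
        unfolding both(3,4) sp'(4) s4 by (rule refl)+
      have ne: "int p \<noteq> - (int p + 1)" by simp
      have nA: "int p \<in> A \<Longrightarrow> - int p \<notin> A" using facts(5) .
      show "y = int p \<Longrightarrow> int p \<notin> B' \<and> int p + 1 \<in> B' \<and> (- int p \<in> A' \<longleftrightarrow> - int p \<in> A) \<and> (- (int p + 1) \<in> A' \<longleftrightarrow> - (int p + 1) \<in> A)"
        "y = - (int p + 1) \<Longrightarrow> (int p \<in> B' \<longleftrightarrow> int p \<in> B) \<and> (int p + 1 \<in> B' \<longleftrightarrow> int p + 1 \<in> B) \<and> - int p \<in> A' \<and> - (int p + 1) \<notin> A'"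
        using y(2) ne nA facts(6)[of "int p + 1"] unfolding mem by auto
    qed (use both y in blast)+
    ultimately show ?thesis using y(1) w both(2) by auto
  next
    case left
    note w = sw(2)[OF left(1,2)]
    have PA: "int p \<in> A" "- (int p + 1) \<in> A" using w by auto
    have "split_pair n A' B'"
    proof (rule short_split[OF sh])
      show "(x \<in> A' \<or> - x \<in> A') = (x \<in> B' \<or> - x \<in> B')" for x
      proof (cases "x \<in> {int p, int p + 1, - int p, - (int p + 1)}")
        case True
        then consider "x = int p" | "x = int p + 1" | "x = - int p" | "x = - (int p + 1)" by blast
        then have "(?s x \<in> A \<or> - ?s x \<in> A) \<and> (x \<in> A \<or> - x \<in> A)" using PA by cases (simp_all only: s4 minus_minus simp_thms)
        then show ?thesis unfolding left(3,4) sp'(4) sp'(3) using facts(7)[of x] by blast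
      next
        case False
        then have "?s x = x" unfolding sp'(1) by auto
        then show ?thesis unfolding left(3,4) sp'(4) sp'(3) using facts(7)[of x] by simp
      qed
      show "count_above A' (int p) \<le> count_above B' (int p)"
        unfolding left(3,4) using cs cp w PA by auto
      show "int p \<notin> A' \<and> - int p \<notin> A' \<longrightarrow> count_above A' (int p) = count_above B' (int p)"
        unfolding left(3,4) sp'(4) using s4 PA by simp
      show "int p + 1 \<notin> A' \<and> - (int p + 1) \<notin> A' \<longrightarrow> count_above A (int p + 1) = count_above B (int p + 1)"
        unfolding left(3,4) sp'(4) using s4 PA by simp
    qed (use left in simp_all)
    moreover have "joined A' B' = (joined A B - {- (int p + 1)}) \<union> {lower_letter n p (- (int p + 1))}"
    proof (rule joined_move[OF sh])
      have mem: "- int p \<in> A' \<longleftrightarrow> - (int p + 1) \<in> A" "- (int p + 1) \<in> A' \<longleftrightarrow> - int p \<in> A"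
        unfolding left(3) sp'(4) s4 by (rule refl)+
      show "- (int p + 1) = - (int p + 1) \<Longrightarrow> (int p \<in> B' \<longleftrightarrow> int p \<in> B) \<and> (int p + 1 \<in> B' \<longleftrightarrow> int p + 1 \<in> B) \<and> - int p \<in> A' \<and> - (int p + 1) \<notin> A'"
        using PA facts(5)[OF PA(1)] unfolding mem left(4) by blast
      show "- (int p + 1) = int p \<Longrightarrow> int p \<notin> B' \<and> int p + 1 \<in> B' \<and> (- int p \<in> A' \<longleftrightarrow> - int p \<in> A) \<and> (- (int p + 1) \<in> A' \<longleftrightarrow> - (int p + 1) \<in> A)"
        by simp
    qed (use left in blast)+
    ultimately show ?thesis using w left(2) by auto
  next
    case right
    note w = sw(3)[OF right(2,1)]
    have PB: "int p \<in> B" "- (int p + 1) \<in> B" using w by auto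
    then have PA: "int p \<in> A \<or> - int p \<in> A" "int p + 1 \<in> A \<or> - (int p + 1) \<in> A"
      using facts(7)[of "int p"] facts(7)[of "int p + 1"] by blast+
    have nB: "int p + 1 \<notin> B" "- int p \<notin> B" using facts(6)[OF PB(1)] facts(6)[of "int p + 1"] PB(2) by blast+
    have "split_pair n A' B'"
    proof (rule short_split[OF sh])
      show "(x \<in> A' \<or> - x \<in> A') = (x \<in> B' \<or> - x \<in> B')" for x
      proof (cases "x \<in> {int p, int p + 1, - int p, - (int p + 1)}")
        case True
        then consider "x = int p" | "x = int p + 1" | "x = - int p" | "x = - (int p + 1)" by blast
        then have "(?s x \<in> B \<or> - ?s x \<in> B) \<and> (x \<in> B \<or> - x \<in> B)" using PB by cases (simp_all only: s4 minus_minus simp_thms)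
        then show ?thesis unfolding right(3,4) sp'(4) sp'(3) using facts(7)[of x] by blast
      next
        case False
        then have "?s x = x" unfolding sp'(1) by auto
        then show ?thesis unfolding right(3,4) sp'(4) sp'(3) using facts(7)[of x] by simp
      qed
      have "count_above A (int p) \<le> count_above B (int p)" using facts(8) by simp
      then show "count_above A' (int p) \<le> count_above B' (int p)"
        unfolding right(3,4) using cs cp PB nB by auto
      show "int p \<notin> A' \<and> - int p \<notin> A' \<longrightarrow> count_above A' (int p) = count_above B' (int p)"
        "int p + 1 \<notin> A' \<and> - (int p + 1) \<notin> A' \<longrightarrow> count_above A (int p + 1) = count_above B (int p + 1)"
        unfolding right(3) using PA by blast+
    qed (use right in simp_all)
    moreover have "joined A' B' = (joined A B - {int p}) \<union> {lower_letter n p (int p)}"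
    proof (rule joined_move[OF sh])
      have mem: "int p \<in> B' \<longleftrightarrow> int p + 1 \<in> B" "int p + 1 \<in> B' \<longleftrightarrow> int p \<in> B"
        unfolding right(4) sp'(4) s4 by (rule refl)+
      show "int p = int p \<Longrightarrow> int p \<notin> B' \<and> int p + 1 \<in> B' \<and> (- int p \<in> A' \<longleftrightarrow> - int p \<in> A) \<and> (- (int p + 1) \<in> A' \<longleftrightarrow> - (int p + 1) \<in> A)"
        using PB nB unfolding mem right(3) by blast
      show "int p = - (int p + 1) \<Longrightarrow> (int p \<in> B' \<longleftrightarrow> int p \<in> B) \<and> (int p + 1 \<in> B' \<longleftrightarrow> int p + 1 \<in> B) \<and> - int p \<in> A' \<and> - (int p + 1) \<notin> A'"
        by simp
    qed (use right in blast)+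
    ultimately show ?thesis using w right(2) by auto
  qed
qed

end

section \<open>The filling map\<close>

lemma involution_image_iff: "(\<And>x. s (s x) = x) \<Longrightarrow> x \<in> s ` X \<longleftrightarrow> s x \<in> X"
  by (metis imageE imageI)

text \<open>A column of weight zero contains u and v together or not at all, and likewise their
  negatives. This is why the crystal operator leaves columns between the two changed folds as they
  are.\<close>

lemma wt_zero_image:
  assumes "1 \<le> n" "p \<le> n" "wt n p X = 0" "\<And>x. x \<in> X \<Longrightarrow> - x \<notin> X"
  shows "signed_reflection (simple_letters n p) ` X = X"
proof -
  obtain u v where uv: "simple_letters n p = (u, v)" "letter n u" "letter n v" "u \<noteq> v"
    using simple_lettersE[OF assms(1,2)] by metis
  have nz: "u \<noteq> 0" "v \<noteq> 0" using uv letter_nonzero by auto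
  let ?s = "signed_reflection (u, v)"
  have mem: "?s x \<in> X \<longleftrightarrow> x \<in> X" for x
  proof -
    have "u \<in> X \<Longrightarrow> - u \<notin> X" "v \<in> X \<Longrightarrow> - v \<notin> X" using assms(4) by blast+
    then have "(u \<in> X \<longleftrightarrow> v \<in> X) \<and> (- u \<in> X \<longleftrightarrow> - v \<in> X)"
      using assms(3) unfolding wt_def uv(1) case_prod_conv
      by (cases "v = - u"; cases "u \<in> X"; cases "- u \<in> X"; cases "v \<in> X"; cases "- v \<in> X") simp_all
    then show ?thesis unfolding signed_reflection_apply[OF nz uv(4)] by auto
  qed
  have "x \<in> ?s ` X \<longleftrightarrow> ?s x \<in> X" for x
    by (rule involution_image_iff) (rule signed_reflection_invol[OF nz uv(4)])
  then show ?thesis unfolding uv(1) using mem by blast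
qed

lemma nth_concat_pairs:
  "q < length xs \<Longrightarrow> concat (map (\<lambda>x. [f x, g x]) xs) ! (2 * q) = f (xs ! q) \<and>
     concat (map (\<lambda>x. [f x, g x]) xs) ! Suc (2 * q) = g (xs ! q)"
proof (induction xs arbitrary: q)
  case (Cons x xs)
  then show ?case by (cases q) auto
qed simp

lemma sperm_image:
  assumes \<pi>: "sperm n \<pi>" and h: "h \<le> n"
  shows "\<pi> ` {1..int h} \<subseteq> letters n" "x \<in> \<pi> ` {1..int h} \<Longrightarrow> - x \<notin> \<pi> ` {1..int h}"
    "card (\<pi> ` {1..int h}) = h" "y \<in> \<pi> ` {1..int h} \<longleftrightarrow> inv \<pi> y \<in> {1..int h}"
proof -
  show mem: "y \<in> \<pi> ` {1..int h} \<longleftrightarrow> inv \<pi> y \<in> {1..int h}" for y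
  proof
    assume "y \<in> \<pi> ` {1..int h}"
    then show "inv \<pi> y \<in> {1..int h}" using \<pi> by auto
  next
    assume "inv \<pi> y \<in> {1..int h}"
    then have "\<pi> (inv \<pi> y) \<in> \<pi> ` {1..int h}" by (rule imageI)
    then show "y \<in> \<pi> ` {1..int h}" using \<pi> by simp
  qed
  show "\<pi> ` {1..int h} \<subseteq> letters n"
  proof
    fix x assume "x \<in> \<pi> ` {1..int h}"
    then obtain a where a: "x = \<pi> a" "1 \<le> a" "a \<le> int h" by auto
    then have "letter n a" using h by (auto simp: letter_def)
    then show "x \<in> letters n" using a sperm_letter[OF \<pi>] by simp
  qed
  have "inv \<pi> (- x) = - inv \<pi> x" using sperm_neg[OF sperm_inv[OF \<pi>]] .
  then show "x \<in> \<pi> ` {1..int h} \<Longrightarrow> - x \<notin> \<pi> ` {1..int h}" unfolding mem by simp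
  have "inj_on \<pi> {1..int h}" by (rule inj_onI) (simp add: sperm_eq_iff[OF \<pi>])
  then show "card (\<pi> ` {1..int h}) = h" by (simp add: card_image)
qed

context lambda_chain
begin

definition content :: "nat set \<Rightarrow> nat \<Rightarrow> int set" where
  "content J c = W J (start (Suc c)) ` {1..int (col_height c)}"

lemma content_props:
  assumes "c < num_parts"
  shows "content J c \<subseteq> letters n" "\<And>x. x \<in> content J c \<Longrightarrow> - x \<notin> content J c" "card (content J c) = col_height c"
  using sperm_image[OF sperm_W[OF start_le[of "Suc c"]] col_height_le] assms unfolding content_def by auto

lemma col_weight_eq:
  assumes p: "p \<le> n" and c: "c < num_parts"
  shows "col_weight J p c = of_int (wt n p (content J c))"
proof -
  let ?j = "start (Suc c)" and ?h = "col_height c"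
  have j: "?j \<le> chain_length n lam" using start_le[of "Suc c"] c by simp
  note sp = sperm_W[OF j, of J] and spi = sperm_inv[OF sperm_W[OF j, of J]]
  obtain u v where uv: "simple_letters n p = (u, v)" "letter n u" "letter n v" "u \<noteq> v"
    using simple_lettersE[OF n_pos p] by metis
  define x y where "x = inv (W J ?j) u" and "y = inv (W J ?j) v"
  have xy: "letter n x" "letter n y" "x \<noteq> y"
    using uv sperm_letter[OF spi] sperm_eq_iff[OF spi] by (auto simp: x_def y_def)
  have neg: "inv (W J ?j) (- a) = - inv (W J ?j) a" for a using sperm_neg[OF spi] .
  have vu: "v = - u \<longleftrightarrow> y = - x" using sperm_eq_iff[OF spi, of v "- u"] by (simp add: x_def y_def neg)
  have mem: "a \<in> content J c \<longleftrightarrow> 1 \<le> inv (W J ?j) a \<and> inv (W J ?j) a \<le> int ?h" for a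
    using sperm_image(4)[OF sp col_height_le] by (simp add: content_def)
  have co: "coord (omega ?h) (inv (W J ?j) a) = of_bool (a \<in> content J c) - of_bool (- a \<in> content J c)" for a
    unfolding mem neg by (auto simp: coord_omega sgn_if)
  have "pulled J p ?j = root (x, y)"
    using uv p act_root[OF spi] by (simp add: pulled_def simple_root_eq x_def y_def)
  then have "col_weight J p c = (if y = - x then coord (omega ?h) x else coord (omega ?h) x - coord (omega ?h) y)"
    using xy by (simp add: col_weight_def ip_coroot)
  then show ?thesis
    unfolding wt_def uv(1) case_prod_conv vu x_def[of] y_def[of] co by simp
qed

text \<open>Induction along the right half. At its start both columns have the same content, and
  every fold is a move of \<open>split_pair_move\<close> by the description of the edges in
  \<open>qbg_edge_sum_root\<close>.\<close>

lemma split_pair_content: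
  assumes adm: "admissible n lam J" and q: "q < first_part lam"
  shows "split_pair n (content J (2 * q)) (content J (Suc (2 * q)))"
proof -
  let ?c = "Suc (2 * q)" and ?h = "int (col_height (2 * q))"
  have c: "?c < num_parts" using q by simp
  have h: "col_height ?c = col_height (2 * q)" by (simp add: col_height_def)
  have part: "part ?c = Gamma_r (col_height (2 * q))" by (simp add: part_def h)
  have "split_pair n (content J (2 * q)) (W J (start ?c + m) ` {1..?h})" if "m \<le> length (part ?c)" for m
    using that
  proof (induction m)
    case 0
    show ?case
      unfolding split_pair_iff using content_props(1,2)[where c = "2 * q" and J = J] q by (auto simp: content_def)
  next
    case (Suc m)
    then have m: "m < length (part ?c)" by simp
    let ?j = "start ?c + m"
    have j: "?j < chain_length n lam" using start_add_less[OF c m] .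
    note IH = Suc.IH[OF less_imp_le[OF m]]
    show ?case
    proof (cases "?j \<in> J")
      case False
      then show ?thesis using IH by (simp add: W_Suc[OF j])
    next
      case True
      obtain i x where ix: "part ?c ! m = (i, x)" by fastforce
      then have "(i, x) \<in> set (Gamma_r (col_height (2 * q)))" using m part by (metis nth_mem)
      define j' where "j' = - x"
      have ij: "1 \<le> j'" "j' < i" "i \<le> ?h" "i \<le> int n" "x = - j'"
        using \<open>(i, x) \<in> _\<close> col_height_le[of "2 * q"] by (auto simp: set_Gamma_r j'_def)
      let ?\<pi> = "W J ?j"
      have sp: "sperm n ?\<pi>" using sperm_W[of ?j J] j by simp
      have ch: "chain n lam ! ?j = (i, - j')" using chain_nth[OF c m] ix ij(5) by simp
      have "qbg_edge n (act ?\<pi>) (root (i, - j'))"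
        using admissible_edge(2)[OF adm True] by (simp add: chain_root_def ch)
      then obtain t z where tz: "0 < t" "t < z" "(?\<pi> i = t \<and> ?\<pi> j' = - z) \<or> (?\<pi> j' = t \<and> ?\<pi> i = - z)"
        and free: "\<And>y. i < y \<Longrightarrow> y \<le> int n \<Longrightarrow> \<not> (t < \<bar>?\<pi> y\<bar> \<and> \<bar>?\<pi> y\<bar> < z)"
        using qbg_edge_sum_root[OF sp _ ij(1,2,4)] by blast
      let ?B = "?\<pi> ` {1..?h}"
      have neg: "?\<pi> (- a) = - ?\<pi> a" for a using sperm_neg[OF sp] .
      have sr: "signed_reflection (i, - j') a = (if a = i then - j' else if a = - j' then i else if a = - i then j' else if a = j' then - i else a)" for a
        using ij by (subst signed_reflection_apply) auto
      have "signed_reflection (i, - j') ` {1..?h} = ({1..?h} - {i, j'}) \<union> {- i, - j'}"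
      proof (rule set_eqI)
        fix a
        have "i \<noteq> 0" "- j' \<noteq> 0" "i \<noteq> - j'" using ij by auto
        then have "signed_reflection (i, - j') (signed_reflection (i, - j') a) = a" for a
          by (rule signed_reflection_invol)
        then have "a \<in> signed_reflection (i, - j') ` {1..?h} \<longleftrightarrow> signed_reflection (i, - j') a \<in> {1..?h}"
          by (rule involution_image_iff)
        then show "a \<in> signed_reflection (i, - j') ` {1..?h} \<longleftrightarrow> a \<in> ({1..?h} - {i, j'}) \<union> {- i, - j'}"
          unfolding sr using ij by auto
      qed
      moreover have "W J (Suc ?j) = ?\<pi> \<circ> signed_reflection (i, - j')"
        using True W_Suc[OF j, of J] by (simp only: ch if_True)
      then have "W J (Suc ?j) ` {1..?h} = ?\<pi> ` (signed_reflection (i, - j') ` {1..?h})"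
        by (simp only: image_comp)
      ultimately have "W J (Suc ?j) ` {1..?h} = ?\<pi> ` (({1..?h} - {i, j'}) \<union> {- i, - j'})"
        by (simp only:)
      also have "\<dots> = (?B - {?\<pi> i, ?\<pi> j'}) \<union> {- ?\<pi> i, - ?\<pi> j'}"
        using sperm_eq_iff[OF sp] by (auto simp: neg)
      also have "\<dots> = (?B - {t, - z}) \<union> {- t, z}" using tz(3) by auto
      finally have W': "W J (Suc ?j) ` {1..?h} = (?B - {t, - z}) \<union> {- t, z}" .
      have iB: "?\<pi> i \<in> ?B" "?\<pi> j' \<in> ?B" using ij by auto
      have "split_pair n (content J (2 * q)) ((?B - {t, - z}) \<union> {- t, z})"
      proof (rule split_pair_move[OF IH])
        show "t \<in> ?B" "- z \<in> ?B" using tz(3) iB by auto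
        fix v assume v: "t < v" "v < z"
        have "letter n (?\<pi> i)" "letter n (?\<pi> j')" using sperm_letter[OF sp] ij by (auto simp: letter_def)
        then have "z \<le> int n" using tz by (auto simp: letter_def)
        then have "letter n v" using v tz by (auto simp: letter_def)
        then have la: "letter n (inv ?\<pi> v)" using sperm_letter[OF sperm_inv[OF sp]] by blast
        define y where "y = \<bar>inv ?\<pi> v\<bar>"
        have y: "1 \<le> y" "y \<le> int n" using la by (auto simp: y_def letter_def)
        have "?\<pi> (inv ?\<pi> v) = v" using sp by simp
        then have py: "?\<pi> y = v \<or> ?\<pi> y = - v" unfolding y_def by (auto simp: abs_if neg)
        then have "\<bar>?\<pi> y\<bar> = v" using v tz by auto
        \<comment> \<open>A value in the gap cannot sit at a position after i, and positions up to i
          belong to the column.\<close>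
        then have "y \<le> i" using free[of y] y v by force
        then have "?\<pi> y \<in> ?B" using y ij by simp
        then have "v \<in> ?B \<or> - v \<in> ?B" using py by auto
        then show "v \<in> content J (2 * q) \<or> - v \<in> content J (2 * q)"
          using IH unfolding split_pair_iff by blast
      qed (use tz in auto)
      then show ?thesis using W' by simp
    qed
  qed
  from this[of "length (part ?c)"] show ?thesis by (simp add: content_def[of J ?c] start_Suc h)
qed

lemma sfill_columns_eq: "sfill_columns n lam J = map (\<lambda>c. column_of n (content J c)) [0..<num_parts]"
proof -
  have shift: "[1..<Suc num_parts] = map Suc [0..<num_parts]" by (simp add: map_Suc_upt)
  show ?thesis
    unfolding sfill_columns_def shift map_map
  proof (rule map_cong[OF refl])
    fix c assume "c \<in> set [0..<num_parts]"
    then have c: "Suc c \<le> num_parts" by simp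
    note sp = sperm_W[OF start_le[OF c], of J]
    have h: "conj_part lam ((Suc c + 1) div 2) = col_height c" by (simp add: col_height_def)
    have "inj_on (W J (start (Suc c))) X" for X by (rule inj_onI) (simp add: sperm_eq_iff[OF sp])
    then show "((\<lambda>q. sort_column n (map (signed_perm n lam J q) [1..int (conj_part lam ((q + 1) div 2))])) \<circ> Suc) c =
        column_of n (content J c)"
      using sort_column_eq[of "map (W J (start (Suc c))) [1..int (col_height c)]" n] content_props(1)[where c = c and J = J] c
      unfolding o_apply h signed_perm_eq[OF c] by (simp add: distinct_map content_def)
  qed
qed

text \<open>Resolves the definite description: the joined columns split as required, and a KN column
  is determined by its splitting. The assumption is the splitting criterion, because the lemma is
  applied to f_p(J) too, where the criterion comes from \<open>column_move_crystal\<close>.\<close>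

lemma sfill_eq:
  assumes "\<And>q. q < first_part lam \<Longrightarrow> split_pair n (content J (2 * q)) (content J (Suc (2 * q)))"
  shows "sfill n lam J = map (\<lambda>q. column_of n (joined (content J (2 * q)) (content J (Suc (2 * q))))) [0..<first_part lam]"
    (is "_ = ?b")
  unfolding sfill_def
proof (rule the_equality)
  have KN: "KN_column n (?b ! q)" "left_column n (?b ! q) = column_of n (content J (2 * q))"
      "right_column n (?b ! q) = column_of n (content J (Suc (2 * q)))" "length (?b ! q) = conj_part lam (q + 1)"
    if "q < first_part lam" for q
    using split_of_joined[OF assms[OF that]] content_props(3)[where c = "2 * q" and J = J] that by (simp_all add: col_height_def)
  have nth: "length (split_tensor n b) = 2 * length b \<and> (\<forall>q<length b. split_tensor n b ! (2 * q) = left_column n (b ! q) \<and>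
      split_tensor n b ! Suc (2 * q) = right_column n (b ! q))" for b
    unfolding split_tensor_def using nth_concat_pairs[where xs = b and f = "left_column n" and g = "right_column n"]
    by (simp add: length_concat o_def sum_list_triv)
  have "split_tensor n ?b = sfill_columns n lam J"
  proof (rule nth_equalityI)
    show "length (split_tensor n ?b) = length (sfill_columns n lam J)" using nth by (simp add: sfill_columns_eq)
    fix c assume "c < length (split_tensor n ?b)"
    then have c: "c < num_parts" using nth[of ?b] by simp
    obtain q where "c = 2 * q \<or> c = Suc (2 * q)" by (metis oddE evenE Suc_eq_plus1)
    then show "split_tensor n ?b ! c = sfill_columns n lam J ! c"
      using nth[of ?b] KN[of q] c by (auto simp: sfill_columns_eq)
  qed
  then show "?b \<in> KN_tensor n lam \<and> split_tensor n ?b = sfill_columns n lam J"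
    using KN by (simp add: KN_tensor_def)
  fix b assume b: "b \<in> KN_tensor n lam \<and> split_tensor n b = sfill_columns n lam J"
  then have len: "length b = first_part lam" by (simp add: KN_tensor_def)
  show "b = ?b"
  proof (rule nth_equalityI)
    fix q assume "q < length b"
    then have q: "q < first_part lam" using len by simp
    show "b ! q = ?b ! q"
    proof (rule KN_split_inj)
      show "KN_column n (b ! q)" using b q by (simp add: KN_tensor_def)
      show "KN_column n (?b ! q)" using KN(1)[OF q] .
      show "left_column n (b ! q) = left_column n (?b ! q)" "right_column n (b ! q) = right_column n (?b ! q)"
        using nth[of b] b q len KN(2,3)[OF q] by (auto simp: sfill_columns_eq)
    qed
  qed (simp add: len)
qed

text \<open>Hence the minimal index with maximal level, which defines m in the crystal operator, is
  the first element of \<open>hits_inf\<close> whose peak is maximal.\<close>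

lemma level_peak:
  assumes p: "p \<le> n" and j: "j \<in> hits_inf J p"
  shows "rsgn n (simple_root n p) * level n lam J (simple_root n p) j = peak J p j"
proof (cases "j \<in> hits J p")
  case True
  then have "j < chain_length n lam" "hit J p j" by (auto simp: hits_def)
  then obtain c m where cm: "c < num_parts" "m < length (part c)" "j = start c + m" by (elim chain_positionE)
  then show ?thesis using level_hit[OF p cm(1,2)] peak_hit[OF p cm(1,2)] \<open>hit J p j\<close> by simp
next
  case False
  then have "j = chain_length n lam" using j by (simp add: hits_inf_def)
  moreover have "peak J p (start num_parts) = level_at J p num_parts" using peak_even[OF p, of "first_part lam" J] by simp
  ultimately show ?thesis using level_infinity[of "simple_root n p" J]
    by (simp add: level_at_def start_num_parts)
qed

lemma alcove_f_eq:
  fixes J :: "nat set"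
  assumes p: "p \<le> n"
  defines "M \<equiv> g_max n lam J (simple_root n p)"
  shows "alcove_f n lam p J = (if (if p = 0 then 1 else 0) < M then
     (let m = Min {i \<in> hits_inf J p. peak J p i = M}; k = Max {i \<in> hits_inf J p. i < m} in Some ((J - {m}) \<union> {k})) else None)"
proof -
  have "{i \<in> hits_inf J p. rsgn n (simple_root n p) * level n lam J (simple_root n p) i = M} = {i \<in> hits_inf J p. peak J p i = M}"
    using level_peak[OF p] by auto
  then show ?thesis by (simp only: alcove_f_def Let_def I_hat_eq[OF p] M_def[symmetric])
qed

end

section \<open>Dual Demazure arrows\<close>

lemma sgn_of_int: "sgn (of_int k :: 'a :: linordered_idom) = of_int (sgn k)"
  by (simp add: sgn_if)

context lambda_chain
begin

context
  fixes J :: "nat set" and p :: nat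
  assumes adm: "admissible n lam J" and p: "p \<le> n"
begin

private abbreviation "left_content q \<equiv> content J (2 * q)"
private abbreviation "right_content q \<equiv> content J (Suc (2 * q))"
private abbreviation "col q \<equiv> column_of n (joined (left_content q) (right_content q))"
private abbreviation "word q \<equiv> cell_word n p q (col q)"
private abbreviation "words \<equiv> map word [0..<first_part lam]"
private abbreviation "M \<equiv> g_max n lam J (simple_root n p)"

private lemma sfill_J: "sfill n lam J = map col [0..<first_part lam]"
  using sfill_eq[OF split_pair_content[OF adm]] by simp

private lemma word_props:
  assumes q: "q < first_part lam"
  shows "2 * sign_sum (word q) = wt n p (left_content q) + wt n p (right_content q)"
    "max_prefix (word q) \<le> max 0 (max (sgn (wt n p (left_content q))) (sign_sum (word q)))"
  using letter_word_joined[OF n_pos p split_pair_content[OF adm q]]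
  unfolding cell_word_letter_word by (auto simp: mult.commute)

text \<open>Each half of a block adds half the weight of its column, and the mean of the two weights
  is the sign sum of the unsplit column.\<close>

private lemma level_at_sum: "q \<le> first_part lam \<Longrightarrow> level_at J p (2 * q) = of_int (sign_sum (concat (take q words)))"
proof (induction q)
  case 0
  then show ?case by (simp add: level_at_0)
next
  case (Suc q)
  then have q: "q < first_part lam" by simp
  have c: "2 * q < num_parts" "Suc (2 * q) < num_parts" using q by simp_all
  have "level_at J p (2 * Suc q) = level_at J p (2 * q) + of_int (wt n p (left_content q) + wt n p (right_content q)) / 2"
    using level_at_Suc[OF p c(1), of J] level_at_Suc[OF p c(2), of J] col_weight_eq[OF p c(1), of J] col_weight_eq[OF p c(2), of J]
    by (simp add: add_divide_distrib)
  also have "\<dots> = level_at J p (2 * q) + of_int (sign_sum (word q))"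
    unfolding word_props(1)[OF q, symmetric] by simp
  finally show ?case using Suc q by (simp add: take_Suc_conv_app_nth)
qed

private lemma level_at_next:
  assumes q: "q < first_part lam"
  shows "level_at J p (2 * q) + of_int (sign_sum (word q)) = level_at J p (2 * Suc q)"
  using level_at_sum[of q] level_at_sum[of "Suc q"] q by (simp add: take_Suc_conv_app_nth)

private lemma word_peak:
  assumes q: "q < first_part lam"
  obtains c where "c \<in> {2 * q, Suc (2 * q), Suc (Suc (2 * q))}"
    "level_at J p (2 * q) + of_int (max_prefix (word q)) \<le> peak J p (start c)"
proof -
  have c: "2 * q < num_parts" "Suc (2 * q) \<le> num_parts" "2 * Suc q \<le> num_parts" using q by simp_all
  have peaks: "peak J p (start (2 * q)) = level_at J p (2 * q)"
    "peak J p (start (Suc (2 * q))) = level_at J p (2 * q) + of_int (sgn (wt n p (left_content q)))"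
    "peak J p (start (Suc (Suc (2 * q)))) = level_at J p (2 * q) + of_int (sign_sum (word q))"
    using peak_even[OF p, of q J] peak_even[OF p c(3), of J] peak_odd[OF p c(2), of J] c
      level_at_next[OF q] col_weight_eq[OF p c(1), of J] by (simp_all add: sgn_of_int)
  consider "max_prefix (word q) \<le> 0" | "max_prefix (word q) \<le> sgn (wt n p (left_content q))"
    | "max_prefix (word q) \<le> sign_sum (word q)"
    using word_props(2)[OF q] by (auto simp: max_def split: if_splits)
  then show thesis
  proof cases
    case 1
    then have "real_of_int (max_prefix (word q)) \<le> 0" by simp
    then show thesis using peaks(1) that[of "2 * q"] by simp
  next
    case 2
    then have "real_of_int (max_prefix (word q)) \<le> of_int (sgn (wt n p (left_content q)))" by (simp only: of_int_le_iff)
    then show thesis using peaks(2) that[of "Suc (2 * q)"] by simp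
  next
    case 3
    then have "real_of_int (max_prefix (word q)) \<le> of_int (sign_sum (word q))" by (simp only: of_int_le_iff)
    then show thesis using peaks(3) that[of "Suc (Suc (2 * q))"] by simp
  qed
qed

private lemma word_le_max:
  assumes q: "q < first_part lam"
  shows "level_at J p (2 * q) + of_int (max_prefix (word q)) \<le> M"
proof (rule word_peak[OF q])
  fix c assume c: "c \<in> {2 * q, Suc (2 * q), Suc (Suc (2 * q))}"
    "level_at J p (2 * q) + of_int (max_prefix (word q)) \<le> peak J p (start c)"
  then have "start c \<le> chain_length n lam" using q by (intro start_le) auto
  then show ?thesis using c(2) peak_le_max[OF adm p] order_trans by blast
qed

private lemma signature_J: "signature n p (sfill n lam J) = concat words"
proof -
  have "map (\<lambda>q. cell_word n p q (sfill n lam J ! q)) [0..<length (sfill n lam J)] = words"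
    unfolding sfill_J by (intro map_cong) simp_all
  then show ?thesis by (simp add: signature_eq)
qed

private lemma phi_le:
  assumes "M \<le> of_int N" "0 \<le> N"
  shows "int (crystal_phi n p (sfill n lam J)) \<le> N"
proof -
  have "sign_sum (concat (take q words)) + max_prefix (words ! q) \<le> N" if "q < length words" for q
  proof -
    have q: "q < first_part lam" using that by simp
    have "real_of_int (sign_sum (concat (take q words)) + max_prefix (word q)) \<le> of_int N"
      using word_le_max[OF q] level_at_sum[of q] q assms(1) by simp
    then show ?thesis using q by (simp only: of_int_le_iff) simp
  qed
  then show ?thesis unfolding plus_cells_props(1) signature_J max_prefix_concat_le_iff using assms(2) by blast
qed

text \<open>The block containing k is moved by the simple reflection, all other columns are fixed by it.\<close>

private lemma crystal_move:
  assumes big: "(if p = 0 then 1 else 0) < M"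
  defines "m \<equiv> Min {i \<in> hits_inf J p. peak J p i = M}"
  defines "k \<equiv> Max {i \<in> hits_inf J p. i < m}"
  defines "J' \<equiv> (J - {m}) \<union> {k}"
  obtains q where "q < first_part lam"
    "column_move n p (left_content q) (right_content q) (content J' (2 * q)) (content J' (Suc (2 * q)))"
    "\<And>r. r < first_part lam \<Longrightarrow> r \<noteq> q \<Longrightarrow> content J' (2 * r) = left_content r \<and> content J' (Suc (2 * r)) = right_content r"
    "level_at J p (2 * q) + (if wt n p (right_content q) = 2 then of_int (wt n p (left_content q) div 2 + 1) else 1) = M"
    "\<And>r. r < q \<Longrightarrow> level_at J p (2 * r) + of_int (max_prefix (word r)) < M"
proof -
  let ?s = "signed_reflection (simple_letters n p)" and ?L = "chain_length n lam"
  note step = crystal_step[OF adm p big, folded m_def k_def]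
  have mL: "m \<le> ?L" and km: "k < m" and kL: "k < ?L" and kh: "hit J p k"
    using step(1-3) by (auto simp: hits_def)
  have W': "W J' j = (if k < j \<and> j \<le> m then ?s \<circ> W J j else W J j)" if "j \<le> ?L" for j
    unfolding J'_def using W_crystal[OF p step(3,4,1,5) that] .
  define inside where "inside c \<longleftrightarrow> k < start (Suc c) \<and> start (Suc c) \<le> m" for c
  have content': "content J' c = (if inside c then ?s ` content J c else content J c)" if "c < num_parts" for c
    using W'[OF start_le[of "Suc c"]] that unfolding content_def inside_def by (simp add: image_comp)
  obtain c0 m0 where c0: "c0 < num_parts" "m0 < length (part c0)" "k = start c0 + m0"
    using chain_positionE[OF kL] by metis
  have k_part: "start c0 \<le> k" "k < start (Suc c0)" using c0 by (simp_all add: start_Suc)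
  have not_before: "\<not> inside c" if "c < c0" for c
    using start_mono[of "Suc c" c0] that k_part by (auto simp: inside_def)
  have after: "k < start c" if "c0 < c" for c
    using start_mono[of "Suc c0" c] that k_part by simp
  have peak_k: "level_at J p c0 = M - 1"
    using peak_hit[OF p c0(1,2), of J] kh step(6) c0(3) by simp
  \<comment> \<open>If m is not infinity it is a hit, so the level of its part equals its peak. The
    part of k has level M - 1, hence m lies in a later part.\<close>
  have peak_m: "level_at J p c = M" if "c < num_parts" "start c \<le> m" "m < start (Suc c)" for c
  proof -
    have "m < ?L" using that(1,3) start_le[of "Suc c"] by simp
    then have h: "hit J p m" using step(5) by (auto simp: hits_def)
    define i where "i = m - start c"
    have "m = start c + i" using that(2) by (simp add: i_def)
    moreover from this have "i < length (part c)" using that(3) by (simp add: start_Suc)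
    ultimately show ?thesis using peak_hit[OF p that(1), of i J] h step(7)[OF km] by simp
  qed
  have m_part: "start (Suc c0) \<le> m"
  proof (rule ccontr)
    assume "\<not> start (Suc c0) \<le> m"
    then have "level_at J p c0 = M" using peak_m[OF c0(1)] k_part km by simp
    then show False using peak_k by simp
  qed
  have in0: "inside c0" using m_part k_part by (simp add: inside_def)
  have wt: "col_weight J p c = of_int (wt n p (content J c))" if "c < num_parts" for c using col_weight_eq[OF p that] .
  have next_level: "level_at J p (Suc c) = level_at J p c + of_int (wt n p (content J c)) / 2" if "c < num_parts" for c
    using level_at_Suc[OF p that] wt[OF that] by simp
  have peakM: "peak J p (start c) = M" if "c0 < c" "start c \<le> m" for c using step(7)[OF after[OF that(1)] that(2)] .
  have fixed: "?s ` content J c = content J c" if "c < num_parts" "wt n p (content J c) = 0" for c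
    using wt_zero_image[OF n_pos p that(2)] content_props(2)[OF that(1)] by blast
  define q where "q = c0 div 2"
  have q: "q < first_part lam" using c0(1) by (simp add: q_def)
  \<comment> \<open>In a later block up to m, the peaks at the start, middle and end of the columns
    concerned are all M. This forces the weights there to be zero, and such columns are fixed by the
    simple reflection.\<close>
  have others: "content J' c = content J c" if c: "c < num_parts" "c div 2 \<noteq> q" for c
  proof (cases "inside c")
    case True
    then have cc: "c0 < c" using not_before[of c] c(2) by (metis linorder_neqE_nat q_def)
    have s: "start (Suc c) \<le> m" "start c \<le> m" using True start_mono[of c "Suc c"] by (auto simp: inside_def)
    have "wt n p (content J c) = 0"
    proof (cases "even c")
      case True
      then obtain r where r: "c = 2 * r" by blast
      have "level_at J p c = M" using peakM[OF cc s(2)] peak_even[OF p, of r J] r c(1) by simp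
      moreover have "level_at J p c + sgn (col_weight J p c) = M"
        using peakM[of "Suc c"] cc s(1) peak_odd[OF p, of r J] r c(1) by simp
      ultimately show ?thesis using wt[OF c(1)] by (simp add: sgn_0_0)
    next
      case False
      then obtain r where r: "c = Suc (2 * r)" by (metis oddE Suc_eq_plus1)
      have r0: "c0 < 2 * r" using cc c(2) r by (auto simp: q_def)
      have c': "2 * r < num_parts" using r c(1) by simp
      have "start (2 * r) \<le> m" using s(2) start_mono[of "2 * r" c] r by simp
      then have "level_at J p (2 * r) = M" using peakM[OF r0] peak_even[OF p, of r J] c' by simp
      moreover have "level_at J p (2 * r) + sgn (col_weight J p (2 * r)) = M"
        using peakM[of c] cc s(2) peak_odd[OF p, of r J] r c(1) by simp
      ultimately have "col_weight J p (2 * r) = 0" by (simp add: sgn_0_0)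
      then have "level_at J p c = M" using level_at_Suc[OF p c', of J] r \<open>level_at J p (2 * r) = M\<close> by simp
      moreover have "level_at J p (Suc c) = M"
        using peakM[of "Suc c"] cc s(1) peak_even[OF p, of "Suc r" J] r c(1) by simp
      ultimately show ?thesis using next_level[OF c(1)] by simp
    qed
    then show ?thesis using content'[OF c(1)] fixed[OF c(1)] by simp
  qed (use content'[OF c(1)] in simp)
  have before: "level_at J p (2 * r) + of_int (max_prefix (word r)) < M" if r: "r < q" for r
  proof -
    have "r < first_part lam" using r q by simp
    then show ?thesis
    proof (rule word_peak)
      fix c assume c: "c \<in> {2 * r, Suc (2 * r), Suc (Suc (2 * r))}"
        "level_at J p (2 * r) + of_int (max_prefix (word r)) \<le> peak J p (start c)"
      have "c \<le> c0" using c(1) r by (auto simp: q_def)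
      then have "start c \<le> k" using start_mono[of c c0] k_part by simp
      then show ?thesis using step(9)[of "start c"] c(2) by linarith
    qed
  qed
  have q2: "2 * q < num_parts" "Suc (2 * q) < num_parts" "2 * Suc q \<le> num_parts" using q by simp_all
  let ?a = "wt n p (left_content q)" and ?b = "wt n p (right_content q)"
  have lv: "level_at J p (Suc (2 * q)) = level_at J p (2 * q) + of_int ?a / 2"
    "level_at J p (2 * Suc q) = level_at J p (2 * q) + of_int ?a / 2 + of_int ?b / 2"
    using next_level[OF q2(1)] next_level[OF q2(2)] by simp_all
  have a_cases: "?a \<in> {- 2, - 1, 0, 1, 2}"
    unfolding wt_def of_bool_def by (split prod.split) simp
  have end_le: "level_at J p (2 * Suc q) \<le> M"
    using peak_le_max[OF adm p start_le[OF q2(3)]] peak_even[OF p q2(3), of J] by simp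
  have "column_move n p (left_content q) (right_content q) (content J' (2 * q)) (content J' (Suc (2 * q))) \<and>
     level_at J p (2 * q) + (if ?b = 2 then of_int (?a div 2 + 1) else 1) = M"
  proof (cases "even c0")
    case True
    then have c0q: "c0 = 2 * q" by (simp add: q_def)
    have left: "content J' (2 * q) = ?s ` left_content q" using content'[OF q2(1)] in0 c0q by simp
    have "peak J p (start (Suc (2 * q))) = M" using peakM[of "Suc (2 * q)"] m_part c0q by simp
    then have "sgn (col_weight J p (2 * q)) = 1" using peak_odd[OF p, of q J] q2 peak_k c0q by simp
    then have a: "?a = 1 \<or> ?a = 2" using wt[OF q2(1)] a_cases by auto
    show ?thesis
    proof (cases "start (Suc (Suc (2 * q))) \<le> m")
      case True
      then have "inside (Suc (2 * q))" using after[of "Suc (Suc (2 * q))"] c0q by (simp add: inside_def)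
      then have right: "content J' (Suc (2 * q)) = ?s ` right_content q" using content'[OF q2(2)] by simp
      have "level_at J p (2 * Suc q) = M"
        using peakM[of "Suc (Suc (2 * q))"] True c0q peak_even[OF p q2(3), of J] by simp
      then have "real_of_int (?a + ?b) = of_int 2" using lv(2) peak_k c0q by simp
      then have ab: "?a + ?b = 2" by (simp only: of_int_eq_iff)
      show ?thesis
      proof (cases "?a = 1")
        case True
        then show ?thesis using ab left right peak_k c0q by (simp add: column_move_def Let_def)
      next
        case False
        \<comment> \<open>The right column is formally moved too, but a column of weight zero is
          fixed, so the second alternative of \<open>column_move\<close> applies.\<close>
        then have "?a = 2" "?b = 0" using a ab by auto
        then show ?thesis using left right fixed[OF q2(2)] peak_k c0q by (simp add: column_move_def Let_def)
      qed
    next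
      case False
      then have right: "content J' (Suc (2 * q)) = right_content q" using content'[OF q2(2)] by (simp add: inside_def)
      have "level_at J p (Suc (2 * q)) = M" using peak_m[OF q2(2)] False m_part c0q by simp
      then have a2: "?a = 2" using lv(1) peak_k c0q a by auto
      then have "?b \<le> 0" using end_le lv(2) peak_k c0q by simp
      then show ?thesis using a2 left right peak_k c0q by (simp add: column_move_def Let_def)
    qed
  next
    case False
    then have c0q: "c0 = Suc (2 * q)" unfolding q_def by presburger
    have left: "content J' (2 * q) = left_content q" using content'[OF q2(1)] not_before[of "2 * q"] c0q by simp
    have right: "content J' (Suc (2 * q)) = ?s ` right_content q" using content'[OF q2(2)] in0 c0q by simp
    have "level_at J p (2 * Suc q) = M"
      using peakM[of "Suc (Suc (2 * q))"] m_part c0q peak_even[OF p q2(3), of J] by simp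
    then have b2: "?b = 2" using lv peak_k c0q by simp
    \<comment> \<open>With k in the right half the left weight a is found by integrality: the level
      at the start of the block and M are integers, so a is even, and since no peak up to k reaches
      M it is not negative.\<close>
    obtain z where z: "level_at J p (2 * q) = of_int z" using level_at_sum[of q] q by simp
    obtain y where y: "M = of_int y" using peak_int[of J p m] step(7)[OF km] by auto
    have "peak J p (start (2 * q)) < M"
      using step(9)[of "start (2 * q)"] start_mono[of "2 * q" c0] c0q k_part by simp
    then have "z < y" using peak_even[OF p, of q J] q2 z y by simp
    have "real_of_int (2 * z + ?a) = of_int (2 * y - 2)"
      using peak_k lv(1) c0q z y by simp
    then have "2 * z + ?a = 2 * y - 2" by (simp only: of_int_eq_iff)
    moreover have "a = 2 * (y - z - 1)" if "2 * z + a = 2 * y - 2" for a :: int using that by arith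
    ultimately have a2: "?a = 2 * (y - z - 1)" by blast
    then have a: "0 \<le> ?a" using \<open>z < y\<close> by simp
    have "z + (?a div 2 + 1) = y" using a2 by simp
    then have "level_at J p (2 * q) + of_int (?a div 2 + 1) = M" unfolding z y of_int_add[symmetric] by simp
    then show ?thesis using a(1) b2 left right by (simp add: column_move_def Let_def)
  qed
  moreover have "content J' (2 * r) = left_content r \<and> content J' (Suc (2 * r)) = right_content r"
    if "r < first_part lam" "r \<noteq> q" for r
    using others[of "2 * r"] others[of "Suc (2 * r)"] that by simp
  ultimately show thesis using that[OF q] before by blast
qed

text \<open>Above the threshold, M equals the number of surviving pluses, so for p = 0 the condition
  M > 1 becomes that this number is at least 2. Below it, the number is only bounded by the
  threshold, which already excludes a dual Demazure arrow; M itself may then be half an integer, as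
  g starts at 1/2 for p = 0.\<close>

lemma dual_demazure_iff_alcove:
  shows "(dual_demazure_arrow n p (sfill n lam J) \<longleftrightarrow> alcove_f n lam p J \<noteq> None) \<and>
    (\<forall>J'. alcove_f n lam p J = Some J' \<longrightarrow> crystal_f n p (sfill n lam J) = Some (sfill n lam J'))"
proof (cases "(if p = 0 then 1 else 0) < M")
  case False
  define N :: int where "N = (if p = 0 then 1 else 0)"
  have "int (crystal_phi n p (sfill n lam J)) \<le> N"
    using False by (intro phi_le) (auto simp: N_def split: if_splits)
  then have "\<not> dual_demazure_arrow n p (sfill n lam J)"
    by (auto simp: dual_demazure_arrow_def crystal_f_def crystal_phi_def N_def split: if_splits)
  moreover have "alcove_f n lam p J = None" using False alcove_f_eq[OF p] by simp
  ultimately show ?thesis by simp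
next
  case True
  define m where "m = Min {i \<in> hits_inf J p. peak J p i = M}"
  define k where "k = Max {i \<in> hits_inf J p. i < m}"
  define J' where "J' = (J - {m}) \<union> {k}"
  have alcove: "alcove_f n lam p J = Some J'"
    using True unfolding alcove_f_eq[OF p] by (simp add: Let_def m_def k_def J'_def)
  obtain q where q: "q < first_part lam"
    and move: "column_move n p (left_content q) (right_content q) (content J' (2 * q)) (content J' (Suc (2 * q)))"
    and others: "\<And>r. r < first_part lam \<Longrightarrow> r \<noteq> q \<Longrightarrow> content J' (2 * r) = left_content r \<and> content J' (Suc (2 * r)) = right_content r"
    and top: "level_at J p (2 * q) + (if wt n p (right_content q) = 2 then of_int (wt n p (left_content q) div 2 + 1) else 1) = M"
    and before: "\<And>r. r < q \<Longrightarrow> level_at J p (2 * r) + of_int (max_prefix (word r)) < M"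
    by (rule crystal_move[OF True, folded m_def, folded k_def, folded J'_def]) (rule that)
  note cm = column_move_crystal[OF n_pos p split_pair_content[OF adm q] move]
  obtain y where y: "first_peak (letter_word n p (col q)) = Some y"
      "joined (content J' (2 * q)) (content J' (Suc (2 * q))) = (joined (left_content q) (right_content q) - {y}) \<union> {lower_letter n p y}"
    using cm by blast
  have mp: "max_prefix (word q) = (if wt n p (right_content q) = 2 then wt n p (left_content q) div 2 + 1 else 1)"
    using cm by (simp add: cell_word_letter_word)
  obtain pos where pos: "pos < length (col q)" "col q ! pos = y" "first_peak (word q) = Some (q, pos)"
    using first_peak_cell_word[OF y(1)] by metis
  define N where "N = sign_sum (concat (take q words)) + max_prefix (word q)"
  have N: "of_int N = M" using top level_at_sum[of q] q mp
    by (cases "wt n p (right_content q) = 2") (simp_all add: N_def)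
  have Nge: "(if p = 0 then 2 else 1) \<le> N"
  proof -
    have "real_of_int (if p = 0 then 1 else 0) < of_int N" using True N by (auto split: if_splits)
    then have "(if p = 0 then 1 else 0) < N" by (simp only: of_int_less_iff)
    then show ?thesis by (auto split: if_splits)
  qed
  have le: "sign_sum (concat (take r words)) + max_prefix (words ! r) \<le> N" if "r < length words" for r
  proof -
    have r: "r < first_part lam" using that by simp
    have "real_of_int (sign_sum (concat (take r words)) + max_prefix (word r)) \<le> of_int N"
      using word_le_max[OF r] level_at_sum[of r] r N by simp
    then show ?thesis using r by (simp only: of_int_le_iff) simp
  qed
  have less: "sign_sum (concat (take r words)) + max_prefix (words ! r) < N" if "r < q" for r
  proof -
    have r: "r < first_part lam" using that q by simp
    have "real_of_int (sign_sum (concat (take r words)) + max_prefix (word r)) < of_int N"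
      using before[OF that] level_at_sum[of r] r N by simp
    then show ?thesis using r by (simp only: of_int_less_iff) simp
  qed
  have Npos: "0 < N" using Nge by (auto split: if_splits)
  have peak: "max_prefix (concat words) = N" "first_peak (concat words) = Some (q, pos)"
    using first_peak_concat[of q words N] q Npos le less pos(3) by (simp_all add: N_def)
  have phi: "int (crystal_phi n p (sfill n lam J)) = N"
    unfolding plus_cells_props(1) signature_J by (rule peak(1))
  then have ne: "plus_cells n p (sfill n lam J) \<noteq> []" using Npos by (auto simp: crystal_phi_def)
  then have last: "last (plus_cells n p (sfill n lam J)) = (q, pos)"
    using plus_cells_props(2)[OF ne] peak(2) unfolding signature_J by simp
  have sp': "split_pair n (content J' (2 * r)) (content J' (Suc (2 * r)))" if "r < first_part lam" for r
    using cm others[OF that] split_pair_content[OF adm that] by (cases "r = q") auto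
  note sfill' = sfill_eq[OF sp']
  let ?S = "joined (left_content q) (right_content q)" and ?S' = "joined (content J' (2 * q)) (content J' (Suc (2 * q)))"
  have c: "2 * q < num_parts" using q by simp
  have lS: "?S \<subseteq> letters n" "?S' \<subseteq> letters n"
    using joined_subset[OF split_pair_content[OF adm q]] joined_subset[OF sp'[OF q]] by blast+
  have card: "length (col q) = card ?S'"
  proof -
    have "length (col q) = card (left_content q)" by (rule split_of_joined(4)[OF split_pair_content[OF adm q]])
    also have "\<dots> = card (content J' (2 * q))" using content_props(3)[OF c] by simp
    also have "\<dots> = length (column_of n ?S')" by (rule split_of_joined(4)[OF sp'[OF q], symmetric])
    also have "\<dots> = card ?S'" by (rule column_of_props(3)[OF lS(2)])
    finally show ?thesis .
  qed
  \<comment> \<open>The letter changed by the crystal operator is the one at the first peak of the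
    word of column q. Sets and lengths agree, so sorting gives the column of the new
    filling.\<close>
  have set': "set ((col q)[pos := lower_letter n p y]) = ?S'"
    using set_update_distinct[OF column_of_props(2)[OF lS(1)] pos(1)] column_of_props(1)[OF lS(1)] pos(2) y(2) by simp
  moreover have "distinct ((col q)[pos := lower_letter n p y])"
    by (rule card_distinct) (simp add: set' card)
  ultimately have new: "sort_column n ((col q)[pos := lower_letter n p y]) = column_of n ?S'"
    using sort_column_eq[of "(col q)[pos := lower_letter n p y]" n] lS(2) by simp
  have "crystal_f n p (sfill n lam J) = Some ((sfill n lam J)[q := column_of n ?S'])"
    using ne last q pos(2) new by (simp add: crystal_f_def sfill_J)
  also have "(sfill n lam J)[q := column_of n ?S'] = sfill n lam J'"
  proof (rule nth_equalityI)
    fix r assume "r < length ((sfill n lam J)[q := column_of n ?S'])"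
    then have r: "r < first_part lam" by (simp add: sfill_J)
    then show "(sfill n lam J)[q := column_of n ?S'] ! r = sfill n lam J' ! r"
      using others[OF r] by (cases "r = q") (simp_all add: sfill_J sfill')
  qed (simp add: sfill_J sfill')
  finally have f: "crystal_f n p (sfill n lam J) = Some (sfill n lam J')" .
  have "p \<noteq> 0 \<or> 2 \<le> crystal_phi n p (sfill n lam J)" using phi Nge by (auto split: if_splits)
  then have "dual_demazure_arrow n p (sfill n lam J)" using f by (cases "p = 0") (simp_all add: dual_demazure_arrow_def)
  then show ?thesis using alcove f by simp
qed

end

end

theorem theorem4p20:
  fixes n i :: nat and lam :: "nat list" and J :: "nat set" and b :: "int list list"
  assumes "n \<ge> 1"
    and "is_partition lam" and "length lam \<le> n"
    and "admissible n lam J"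
    and "b = sfill n lam J"
    and "i \<le> n"
  shows "(dual_demazure_arrow n i b \<longleftrightarrow> alcove_f n lam i J \<noteq> None) \<and>
         (\<forall>J'. alcove_f n lam i J = Some J' \<longrightarrow> crystal_f n i b = Some (sfill n lam J'))"
proof -
  interpret lambda_chain n lam using assms(1-3) by unfold_locales
  show ?thesis unfolding assms(5) by (rule dual_demazure_iff_alcove[OF assms(4,6)])
qed

end
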